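(* Let $V$ be a simple vertex operator algebra, $G\le\mathrm{Aut}(V)$ a finite group, and suppose that for each $g\in G$ there is given a simple $g$-twisted $V$-module $(M(g),Y_g)$ such that $(M(g),Y_g)\circ h\cong (M(h^{-1}gh),Y_{h^{-1}gh})$ for all $g,h\in G$. Assume that $G$ is nilpotent. Let $\alpha_g$ denote the 2-cocycle on $C_G(g)$ attached to the projective action of $C_G(g)$ on $M(g)$. Then the following hold. (A) For each $g\in G$ there is a decomposition of $M(g)$ into simple modules over $\mathbb C_{\alpha_g}[C_G(g)]\otimes V^G$ of the form $$M(g)\simeq\bigoplus_{\chi_g}M_{\chi_g}\otimes V_{\chi_g},$$ where $\chi_g$ ranges over the simple characters of $\mathbb C_{\alpha_g}[C_G(g)]$, $M_{\chi_g}$ is a module over $\mathbb C_{\alpha_g}[C_G(g)]$ which affords $\chi_g$, and $V_{\chi_g}$ is a simple $V^G$-module. (B) Let $g,h\in G$, and let $\chi_g$ and $\psi_h$ be simple characters of $\mathbb C_{\alpha_g}[C_G(g)]$ and $\mathbb C_{\alpha_h}[C_G(h)]$ respectively. Then there is an isomorphism of $V^G$-modules $V_{\chi_g}\simeq V_{\psi_h}$ if and only if there is $k\in G$ such that $k(\chi_g)=\psi_h$. Here $k(\chi_g)=\psi_h$ means that $h=kgk^{-1}$ and that $\chi_g(z)=\psi_h(kzk^{-1})$ for $z\in C_G(g)$.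
   Context: All spaces are over $\mathbb C$. A vertex operator algebra (VOA) $(V,Y,\mathbf 1,\omega)$ is understood in the standard sense: $V=\bigoplus_{n\in\mathbb Z}V_n$, $\dim V_n<\infty$, $V_n=0$ for $n$ sufficiently small, $Y(v,z)=\sum_{n\in\mathbb Z}v_nz^{-n-1}$, Jacobi identity, vacuum $\mathbf 1$, Virasoro vector $\omega$ with $Y(\omega,z)=\sum_n L(n)z^{-n-2}$, $V_n$ the $n$-eigenspace of $L(0)$, rank in $\mathbb Q$. $\mathrm{Aut}(V)$ is the group of linear automorphisms $g$ of $V$ with $gY(v,z)g^{-1}=Y(gv,z)$, $g\mathbf 1=\mathbf 1$, $g\omega=\omega$. $V^G$ is the sub-VOA of $G$-fixed vectors. Twisted modules. Let $g\in \mathrm{Aut}(V)$ have finite order $N$ and let $V^j=\{v\in V: gv=e^{2\pi i j/N}v\}$. A weak $g$-twisted $V$-module is a $\mathbb C$-graded space $M=\bigoplus_{n\in\mathbb C}M_n$ such that for each $\lambda\in\mathbb C$, $M_{n+\lambda}=0$ for $n\in\frac1N\mathbb Z$ sufficiently small, with a linear map $v\mapsto Y_g(v,z)=\sum_{n\in\frac1N\mathbb Z}v_nz^{-n-1}$, $v_n\in\mathrm{End}(M)$, such that: $Y_g(v,z)=\sum_{n\in j/N+\mathbb Z}v_nz^{-n-1}$ for $v\in V^j$; $u_nw=0$ for $n$ sufficiently large; $Y_g(\mathbf 1,z)=1$; for $u\in V^k$, $$z_0^{-1}\delta\!\left(\tfrac{z_1-z_2}{z_0}\right)Y_g(u,z_1)Y_g(v,z_2)-z_0^{-1}\delta\!\left(\tfrac{z_2-z_1}{-z_0}\right)Y_g(v,z_2)Y_g(u,z_1)=z_2^{-1}\left(\tfrac{z_1-z_0}{z_2}\right)^{-k/N}\delta\!\left(\tfrac{z_1-z_0}{z_2}\right)Y_g(Y(u,z_0)v,z_2),$$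 where $\delta(z)=\sum_{n\in\mathbb Z}z^n$; the Virasoro relations hold for the components $L(n)$ of $\omega$, $L(0)w=nw$ for $w\in M_n$, and $\frac{d}{dz}Y_g(v,z)=Y_g(L(-1)v,z)$. It is a $g$-twisted $V$-module if moreover every $M_n$ is finite-dimensional; for $g=1$ these are the (weak) $V$-modules. Each $g$-twisted $V$-module ($g\in G$) is a $V^G$-module by restriction. For a $g$-twisted module $(M,Y_M)$ and $h\in \mathrm{Aut}(V)$, $(M,Y_M)\circ h$ is the $h^{-1}gh$-twisted module with the same space $M$ and vertex operators $v\mapsto Y_M(hv,z)$. Cocycles. By hypothesis, for all $g,h\in G$ there are linear isomorphisms $\phi_g(h):M(g)\to M(hgh^{-1})$ with $\phi_g(h)Y_g(v,z)\phi_g(h)^{-1}=Y_{hgh^{-1}}(hv,z)$ for all $v\in V$. They satisfy $\phi_g(hk)=\alpha_g(h,k)^{-1}\phi_{kgk^{-1}}(h)\phi_g(k)$ for some $\alpha_g(h,k)\in\mathbb C^\times$. Restricted to $C_G(g)$ (the centralizer of $g$ in $G$), $\alpha_g$ is a 2-cocycle, and $\mathbb C_{\alpha_g}[C_G(g)]$ denotes the twisted group algebra with basis indexed by $a\in C_G(g)$ and multiplication $a\cdot b=\alpha_g(a,b)ab$. It acts on $M(g)$ by $a\mapsto\phi_g(a)$, and this action commutes with the vertex operators $Y_g(v,z)$, $v\in V^G$. In the expression $\chi_g(z)$, the element $z\in C_G(g)$ is regarded as the corresponding basis element of $\mathbb C_{\alpha_g}[C_G(g)]$, and similarly for $\ps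i_h(kzk^{-1})$.
   Formalization: For arbitrary φ_g(h), (B) is false with kzk^{-1} read as a bare basis element; it is proved for every φ with kzk^{-1} scaled by α_g(k,z)/α_g(kzk^{-1},k) (conjugation by φ_g(k)), and with bare basis elements for a suitable choice of φ. Nilpotency of G is not needed. *)

theory Defs
  imports
    Complex_Main
    "HOL-Library.Groups_Big_Fun"
    "HOL-Library.Function_Algebras"
    "HOL-Algebra.Bij"
    "HOL-Algebra.Generated_Groups"
    "HOL-Algebra.Multiplicative_Group"
    "Jordan_Normal_Form.Matrix"
begin

section \<open>Linear algebra on subspaces of a complex vector space\<close>

text \<open>All spaces are subsets of an ambient type of class \<open>ab_group_add\<close> on which a scalar
  multiplication by complex numbers is given explicitly. Sums over \<open>Sum_any\<close> have finite
  support wherever they are used below.\<close>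

abbreviation csubspace :: "(complex \<Rightarrow> 'a::ab_group_add \<Rightarrow> 'a) \<Rightarrow> 'a set \<Rightarrow> bool" where
  "csubspace s S \<equiv> Modules.module.subspace s S"

definition finite_dim :: "(complex \<Rightarrow> 'a::ab_group_add \<Rightarrow> 'a) \<Rightarrow> 'a set \<Rightarrow> bool" where
  "finite_dim s S \<longleftrightarrow> (\<exists>B. finite B \<and> S = Modules.module.span s B)"

definition linear_on ::
  "(complex \<Rightarrow> 'a::ab_group_add \<Rightarrow> 'a) \<Rightarrow> (complex \<Rightarrow> 'b::ab_group_add \<Rightarrow> 'b) \<Rightarrow> 'a set \<Rightarrow> ('a \<Rightarrow> 'b) \<Rightarrow> bool" where
  "linear_on s t S f \<longleftrightarrow>
     (\<forall>x\<in>S. \<forall>y\<in>S. f (x + y) = f x + f y) \<and> (\<forall>c. \<forall>x\<in>S. f (s c x) = t c (f x))"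

definition direct_sum_decomp ::
  "(complex \<Rightarrow> 'a::ab_group_add \<Rightarrow> 'a) \<Rightarrow> 'a set \<Rightarrow> ('i \<Rightarrow> 'a set) \<Rightarrow> bool" where
  "direct_sum_decomp s W gr \<longleftrightarrow>
     (\<forall>n. csubspace s (gr n) \<and> gr n \<subseteq> W) \<and>
     (\<forall>w\<in>W. \<exists>!f. (\<forall>n. f n \<in> gr n) \<and> finite {n. f n \<noteq> 0} \<and> Sum_any f = w)"

section \<open>Vertex operator algebras\<close>

text \<open>\<open>vmode V u n v\<close> is $u_n v$, where $Y(u,z) = \sum_n u_n z^{-n-1}$.\<close>

record 'v voa =
  vscale :: "complex \<Rightarrow> 'v \<Rightarrow> 'v"
  vspace :: "'v set"
  vgrade :: "int \<Rightarrow> 'v set"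
  vmode  :: "'v \<Rightarrow> int \<Rightarrow> 'v \<Rightarrow> 'v"
  vac    :: "'v"
  conf   :: "'v"
  vrank  :: "rat"

text \<open>The Jacobi identity is stated by comparing the coefficients of
  $z_0^{-r-1} z_1^{-m-1} z_2^{-n-1}$. Since $L(n) = \omega_{n+1}$, the operators $L(0)$ and $L(-1)$ are
  $\omega_1$ and $\omega_0$.\<close>

definition vertex_operator_algebra :: "('v::ab_group_add) voa \<Rightarrow> bool" where
  "vertex_operator_algebra V \<longleftrightarrow>
     vector_space (vscale V) \<and> csubspace (vscale V) (vspace V) \<and>
     direct_sum_decomp (vscale V) (vspace V) (vgrade V) \<and>
     (\<forall>n. finite_dim (vscale V) (vgrade V n)) \<and>
     (\<exists>K. \<forall>n<K. vgrade V n = {0}) \<and>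
     vac V \<in> vspace V \<and> conf V \<in> vspace V \<and>
     \<comment> \<open>the modes are endomorphisms, linear in the labelling vector\<close>
     (\<forall>u\<in>vspace V. \<forall>n. \<forall>v\<in>vspace V. vmode V u n v \<in> vspace V) \<and>
     (\<forall>u\<in>vspace V. \<forall>n. linear_on (vscale V) (vscale V) (vspace V) (vmode V u n)) \<and>
     (\<forall>v\<in>vspace V. \<forall>n. linear_on (vscale V) (vscale V) (vspace V) (\<lambda>u. vmode V u n v)) \<and>
     (\<forall>u\<in>vspace V. \<forall>v\<in>vspace V. \<exists>K. \<forall>n\<ge>K. vmode V u n v = 0) \<and>
     \<comment> \<open>vacuum and creation\<close>
     (\<forall>v\<in>vspace V. \<forall>n. vmode V (vac V) n v = (if n = -1 then v else 0)) \<and>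
     (\<forall>v\<in>vspace V. vmode V v (-1) (vac V) = v \<and> (\<forall>n\<ge>0. vmode V v n (vac V) = 0)) \<and>
     \<comment> \<open>Jacobi identity\<close>
     (\<forall>u\<in>vspace V. \<forall>v\<in>vspace V. \<forall>w\<in>vspace V. \<forall>r m n.
        Sum_any (\<lambda>i::nat. vscale V ((-1) ^ i * (of_int r gchoose i))
          (vmode V u (m + r - int i) (vmode V v (n + int i) w)
           - vscale V ((-1) powi r) (vmode V v (n + r - int i) (vmode V u (m + int i) w))))
        = Sum_any (\<lambda>i::nat. vscale V (of_int m gchoose i)
            (vmode V (vmode V u (r + int i) v) (m + n - int i) w))) \<and>
     \<comment> \<open>Virasoro relations, \<open>L(0)\<close>-grading and \<open>L(-1)\<close>-derivative property\<close>
     (\<forall>w\<in>vspace V. \<forall>m n.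
        vmode V (conf V) (m + 1) (vmode V (conf V) (n + 1) w)
        - vmode V (conf V) (n + 1) (vmode V (conf V) (m + 1) w)
        = vscale V (of_int (m - n)) (vmode V (conf V) (m + n + 1) w)
          + (if m + n = 0 then vscale V (of_int (m ^ 3 - m) / 12 * of_rat (vrank V)) w else 0)) \<and>
     (\<forall>n. vgrade V n = {v \<in> vspace V. vmode V (conf V) 1 v = vscale V (of_int n) v}) \<and>
     (\<forall>v\<in>vspace V. \<forall>w\<in>vspace V. \<forall>n.
        vmode V (vmode V (conf V) 0 v) n w = vscale V (- of_int n) (vmode V v (n - 1) w))"

definition simple_voa :: "('v::ab_group_add) voa \<Rightarrow> bool" where
  "simple_voa V \<longleftrightarrow> vertex_operator_algebra V \<and> vspace V \<noteq> {0} \<and>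
     (\<forall>I. csubspace (vscale V) I \<and> I \<subseteq> vspace V \<and>
          (\<forall>v\<in>vspace V. \<forall>n. \<forall>w\<in>I. vmode V v n w \<in> I) \<longrightarrow> I = {0} \<or> I = vspace V)"

text \<open>As for the library's \<open>AutoGroup\<close>, automorphisms are extensional functions, so that
  they are determined by their values on the space.\<close>

definition voa_aut :: "('v::ab_group_add) voa \<Rightarrow> ('v \<Rightarrow> 'v) monoid" where
  "voa_aut V = BijGroup (vspace V) \<lparr>carrier := {g \<in> Bij (vspace V).
     linear_on (vscale V) (vscale V) (vspace V) g \<and>
     (\<forall>u\<in>vspace V. \<forall>n. \<forall>v\<in>vspace V. g (vmode V u n v) = vmode V (g u) n (g v)) \<and>
     g (vac V) = vac V \<and> g (conf V) = conf V}\<rparr>"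

definition fixed_voa :: "('v::ab_group_add) voa \<Rightarrow> ('v \<Rightarrow> 'v) set \<Rightarrow> 'v voa" where
  "fixed_voa V G = V \<lparr>vspace := {v \<in> vspace V. \<forall>g\<in>G. g v = v},
                      vgrade := (\<lambda>n. {v \<in> vgrade V n. \<forall>g\<in>G. g v = v})\<rparr>"

section \<open>Twisted modules\<close>

record ('v, 'm) twmod =
  mscale :: "complex \<Rightarrow> 'm \<Rightarrow> 'm"
  mspace :: "'m set"
  mgrade :: "complex \<Rightarrow> 'm set"
  mmode  :: "'v \<Rightarrow> rat \<Rightarrow> 'm \<Rightarrow> 'm"

definition eigenspace :: "('v::ab_group_add) voa \<Rightarrow> ('v \<Rightarrow> 'v) \<Rightarrow> nat \<Rightarrow> int \<Rightarrow> 'v set" where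
  "eigenspace V g N j = {v \<in> vspace V. g v = vscale V (exp (2 * of_real pi * \<i> * of_int j / of_nat N)) v}"

text \<open>In the twisted Jacobi identity the right-hand side
  $z_2^{-1} ((z_1-z_0)/z_2)^{-k/N} \delta((z_1-z_0)/z_2) Y_g(Y(u,z_0)v,z_2)$
  contains only powers $(z_1-z_0)^{t}$ with $t \in -k/N + \mathbb{Z}$, expanded in nonnegative powers
  of $z_0$. The coefficient of $z_0^{-r-1} z_1^{-m-1} z_2^{-n-1}$ therefore comes from $t = i-m-1$,
  with $(-1)^i \binom{i-m-1}{i} = \binom{m}{i}$, and vanishes on both sides unless
  $m \in k/N + \mathbb{Z}$ (the modes of \<open>u\<close> are indexed by that coset).\<close>

definition weak_twisted_module ::
  "('v::ab_group_add) voa \<Rightarrow> ('v \<Rightarrow> 'v) \<Rightarrow> ('v, 'm::ab_group_add) twmod \<Rightarrow> bool" where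
  "weak_twisted_module V g M \<longleftrightarrow>
     (let N = group.ord (voa_aut V) g in
     g \<in> carrier (voa_aut V) \<and> N > 0 \<and>
     vector_space (mscale M) \<and> csubspace (mscale M) (mspace M) \<and>
     direct_sum_decomp (mscale M) (mspace M) (mgrade M) \<and>
     (\<forall>l. \<exists>K::int. \<forall>s<K. mgrade M (l + of_int s / of_nat N) = {0}) \<and>
     (\<forall>v\<in>vspace V. \<forall>n. \<forall>w\<in>mspace M. mmode M v n w \<in> mspace M) \<and>
     (\<forall>v\<in>vspace V. \<forall>n. linear_on (mscale M) (mscale M) (mspace M) (mmode M v n)) \<and>
     (\<forall>w\<in>mspace M. \<forall>n. linear_on (vscale V) (mscale M) (vspace V) (\<lambda>v. mmode M v n w)) \<and>
     (\<forall>j. \<forall>v\<in>eigenspace V g N j. \<forall>n. (\<nexists>i. n = of_int j / of_nat N + of_int i) \<longrightarrow>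
        (\<forall>w\<in>mspace M. mmode M v n w = 0)) \<and>
     (\<forall>v\<in>vspace V. \<forall>w\<in>mspace M. \<exists>K. \<forall>n\<ge>K. mmode M v n w = 0) \<and>
     (\<forall>w\<in>mspace M. \<forall>n. mmode M (vac V) n w = (if n = -1 then w else 0)) \<and>
     \<comment> \<open>twisted Jacobi identity\<close>
     (\<forall>k. \<forall>u\<in>eigenspace V g N k. \<forall>v\<in>vspace V. \<forall>w\<in>mspace M. \<forall>(r::int) m n.
        (\<exists>i. m = of_int k / of_nat N + of_int i) \<longrightarrow>
        Sum_any (\<lambda>i::nat. mscale M ((-1) ^ i * (of_int r gchoose i))
          (mmode M u (m + of_int r - of_nat i) (mmode M v (n + of_nat i) w)
           - mscale M ((-1) powi r) (mmode M v (n + of_int r - of_nat i) (mmode M u (m + of_nat i) w))))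
        = Sum_any (\<lambda>i::nat. mscale M (of_rat m gchoose i)
            (mmode M (vmode V u (r + int i) v) (m + n - of_nat i) w))) \<and>
     \<comment> \<open>Virasoro relations, \<open>L(0)\<close>-grading and \<open>L(-1)\<close>-derivative property\<close>
     (\<forall>w\<in>mspace M. \<forall>m n :: int.
        mmode M (conf V) (of_int m + 1) (mmode M (conf V) (of_int n + 1) w)
        - mmode M (conf V) (of_int n + 1) (mmode M (conf V) (of_int m + 1) w)
        = mscale M (of_int (m - n)) (mmode M (conf V) (of_int (m + n) + 1) w)
          + (if m + n = 0 then mscale M (of_int (m ^ 3 - m) / 12 * of_rat (vrank V)) w else 0)) \<and>
     (\<forall>l. \<forall>w\<in>mgrade M l. mmode M (conf V) 1 w = mscale M l w) \<and>
     (\<forall>v\<in>vspace V. \<forall>w\<in>mspace M. \<forall>n.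
        mmode M (vmode V (conf V) 0 v) n w = mscale M (- of_rat n) (mmode M v (n - 1) w)))"

definition twisted_module ::
  "('v::ab_group_add) voa \<Rightarrow> ('v \<Rightarrow> 'v) \<Rightarrow> ('v, 'm::ab_group_add) twmod \<Rightarrow> bool" where
  "twisted_module V g M \<longleftrightarrow> weak_twisted_module V g M \<and> (\<forall>l. finite_dim (mscale M) (mgrade M l))"

definition simple_twisted_module ::
  "('v::ab_group_add) voa \<Rightarrow> ('v \<Rightarrow> 'v) \<Rightarrow> ('v, 'm::ab_group_add) twmod \<Rightarrow> bool" where
  "simple_twisted_module V g M \<longleftrightarrow> twisted_module V g M \<and> mspace M \<noteq> {0} \<and>
     (\<forall>U. csubspace (mscale M) U \<and> U \<subseteq> mspace M \<and>
          (\<forall>v\<in>vspace V. \<forall>n. \<forall>w\<in>U. mmode M v n w \<in> U) \<longrightarrow> U = {0} \<or> U = mspace M)"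

abbreviation simple_module :: "('v::ab_group_add) voa \<Rightarrow> ('v, 'm::ab_group_add) twmod \<Rightarrow> bool" where
  "simple_module V M \<equiv> simple_twisted_module V \<one>\<^bsub>voa_aut V\<^esub> M"

text \<open>Only modes of vectors in \<open>vspace V\<close> enter, so with \<open>fixed_voa V G\<close> in place of \<open>V\<close>
  this is isomorphism after restriction to the fixed-point subalgebra. An isomorphism
  automatically respects the gradings, because it commutes with $L(0)$.\<close>

definition module_iso ::
  "('v::ab_group_add) voa \<Rightarrow> ('v, 'm::ab_group_add) twmod \<Rightarrow> ('v, 'n::ab_group_add) twmod \<Rightarrow> ('m \<Rightarrow> 'n) \<Rightarrow> bool" where
  "module_iso V A B f \<longleftrightarrow>
     bij_betw f (mspace A) (mspace B) \<and> linear_on (mscale A) (mscale B) (mspace A) f \<and>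
     (\<forall>v\<in>vspace V. \<forall>n. \<forall>w\<in>mspace A. f (mmode A v n w) = mmode B v n (f w))"

definition isomorphic_modules ::
  "('v::ab_group_add) voa \<Rightarrow> ('v, 'm::ab_group_add) twmod \<Rightarrow> ('v, 'n::ab_group_add) twmod \<Rightarrow> bool" where
  "isomorphic_modules V A B \<longleftrightarrow> (\<exists>f. module_iso V A B f)"

definition twist :: "('v, 'm) twmod \<Rightarrow> ('v \<Rightarrow> 'v) \<Rightarrow> ('v, 'm) twmod" where
  "twist M h = M \<lparr>mmode := (\<lambda>v. mmode M (h v))\<rparr>"

text \<open>$\mathbb{C}^n \otimes W$, identified with $W^n$ through
  $\sum_{i<n} e_i \otimes w_i \mapsto (w_i)_{i<n}$; vertex operators act on the second factor.\<close>

definition tensor_mod :: "nat \<Rightarrow> ('v, 'm::ab_group_add) twmod \<Rightarrow> ('v, nat \<Rightarrow> 'm) twmod" where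
  "tensor_mod n W =
     \<lparr>mscale = (\<lambda>c f i. mscale W c (f i)),
      mspace = {f. \<forall>i. if i < n then f i \<in> mspace W else f i = 0},
      mgrade = (\<lambda>l. {f. \<forall>i. if i < n then f i \<in> mgrade W l else f i = 0}),
      mmode = (\<lambda>v m f i. if i < n then mmode W v m (f i) else 0)\<rparr>"

definition direct_sum_mod :: "'i set \<Rightarrow> ('i \<Rightarrow> ('v, 'm::ab_group_add) twmod) \<Rightarrow> ('v, 'i \<Rightarrow> 'm) twmod" where
  "direct_sum_mod I W =
     \<lparr>mscale = (\<lambda>c F i. if i \<in> I then mscale (W i) c (F i) else 0),
      mspace = {F. finite {i. F i \<noteq> 0} \<and> (\<forall>i. if i \<in> I then F i \<in> mspace (W i) else F i = 0)},
      mgrade = (\<lambda>l. {F. finite {i. F i \<noteq> 0} \<and> (\<forall>i. if i \<in> I then F i \<in> mgrade (W i) l else F i = 0)}),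
      mmode = (\<lambda>v m F i. if i \<in> I then mmode (W i) v m (F i) else 0)\<rparr>"

section \<open>Groups and twisted group algebras\<close>

primrec lower_central :: "('g, 'b) monoid_scheme \<Rightarrow> nat \<Rightarrow> 'g set" where
  "lower_central H 0 = carrier H"
| "lower_central H (Suc n) =
     generate H (\<Union>x\<in>lower_central H n. \<Union>y\<in>carrier H. {x \<otimes>\<^bsub>H\<^esub> y \<otimes>\<^bsub>H\<^esub> inv\<^bsub>H\<^esub> x \<otimes>\<^bsub>H\<^esub> inv\<^bsub>H\<^esub> y})"

definition nilpotent_group :: "('g, 'b) monoid_scheme \<Rightarrow> bool" where
  "nilpotent_group H \<longleftrightarrow> group H \<and> (\<exists>n. lower_central H n = {\<one>\<^bsub>H\<^esub>})"

definition conjg :: "('g, 'b) monoid_scheme \<Rightarrow> 'g \<Rightarrow> 'g \<Rightarrow> 'g" where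
  "conjg H k g = k \<otimes>\<^bsub>H\<^esub> g \<otimes>\<^bsub>H\<^esub> inv\<^bsub>H\<^esub> k"

definition centralizer :: "('g, 'b) monoid_scheme \<Rightarrow> 'g set \<Rightarrow> 'g \<Rightarrow> 'g set" where
  "centralizer H G g = {a \<in> G. a \<otimes>\<^bsub>H\<^esub> g = g \<otimes>\<^bsub>H\<^esub> a}"

text \<open>Elements are coefficient functions; the cocycle is not assumed normalised, so the unit is
  $\alpha(1,1)^{-1}$ times the basis element of the neutral element.\<close>

definition twisted_group_algebra ::
  "('g, 'b) monoid_scheme \<Rightarrow> ('g \<Rightarrow> 'g \<Rightarrow> complex) \<Rightarrow> ('g \<Rightarrow> complex) ring" where
  "twisted_group_algebra H \<alpha> =
     \<lparr>carrier = {x. \<forall>a. a \<notin> carrier H \<longrightarrow> x a = 0},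
      monoid.mult = (\<lambda>x y c. \<Sum>(a, b) \<in> {(a, b) \<in> carrier H \<times> carrier H. a \<otimes>\<^bsub>H\<^esub> b = c}. x a * y b * \<alpha> a b),
      one = (\<lambda>a. if a = \<one>\<^bsub>H\<^esub> then inverse (\<alpha> \<one>\<^bsub>H\<^esub> \<one>\<^bsub>H\<^esub>) else 0),
      ring.zero = (\<lambda>a. 0),
      add = (\<lambda>x y a. x a + y a)\<rparr>"

definition basis_elt :: "'g \<Rightarrow> 'g \<Rightarrow> complex" where
  "basis_elt a = (\<lambda>b. if b = a then 1 else 0)"

text \<open>Modules \<open>\<complex>\<^sup>n\<close> over an algebra \<open>A\<close> of functions with pointwise scalar multiplication.\<close>

definition matrix_rep ::
  "('g \<Rightarrow> complex) ring \<Rightarrow> nat \<Rightarrow> (('g \<Rightarrow> complex) \<Rightarrow> complex mat) \<Rightarrow> bool" where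
  "matrix_rep A n R \<longleftrightarrow> R \<in> Ring.ring_hom A (ring_mat TYPE(complex) n ()) \<and>
     (\<forall>c. \<forall>x\<in>carrier A. R (\<lambda>a. c * x a) = c \<cdot>\<^sub>m R x)"

definition simple_matrix_rep ::
  "('g \<Rightarrow> complex) ring \<Rightarrow> nat \<Rightarrow> (('g \<Rightarrow> complex) \<Rightarrow> complex mat) \<Rightarrow> bool" where
  "simple_matrix_rep A n R \<longleftrightarrow> matrix_rep A n R \<and> n > 0 \<and>
     (\<forall>U. U \<subseteq> carrier_vec n \<and> 0\<^sub>v n \<in> U \<and> (\<forall>x\<in>U. \<forall>y\<in>U. x + y \<in> U) \<and>
          (\<forall>c. \<forall>x\<in>U. c \<cdot>\<^sub>v x \<in> U) \<and> (\<forall>a\<in>carrier A. \<forall>x\<in>U. R a *\<^sub>v x \<in> U)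
          \<longrightarrow> U = {0\<^sub>v n} \<or> U = carrier_vec n)"

text \<open>Characters are extensional functions on the algebra, so that each one occurs only once.\<close>

definition rep_character ::
  "('g \<Rightarrow> complex) ring \<Rightarrow> nat \<Rightarrow> (('g \<Rightarrow> complex) \<Rightarrow> complex mat) \<Rightarrow> ('g \<Rightarrow> complex) \<Rightarrow> complex" where
  "rep_character A n R = (\<lambda>x\<in>carrier A. \<Sum>i<n. R x $$ (i, i))"

definition simple_characters :: "('g \<Rightarrow> complex) ring \<Rightarrow> (('g \<Rightarrow> complex) \<Rightarrow> complex) set" where
  "simple_characters A = {rep_character A n R |n R. simple_matrix_rep A n R}"

section \<open>The projective actions on the twisted modules\<close>

type_synonym ('v, 'm) module_family = "('v \<Rightarrow> 'v) \<Rightarrow> ('v, 'm) twmod"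
type_synonym ('v, 'm) intertwiner_family = "('v \<Rightarrow> 'v) \<Rightarrow> ('v \<Rightarrow> 'v) \<Rightarrow> 'm \<Rightarrow> 'm"
type_synonym 'v character = "(('v \<Rightarrow> 'v) \<Rightarrow> complex) \<Rightarrow> complex"

definition intertwiners ::
  "('v::ab_group_add) voa \<Rightarrow> ('v \<Rightarrow> 'v) set \<Rightarrow> ('v, 'm::ab_group_add) module_family
   \<Rightarrow> ('v, 'm) intertwiner_family \<Rightarrow> bool" where
  "intertwiners V G M \<phi> \<longleftrightarrow> (\<forall>g\<in>G. \<forall>h\<in>G.
     (let M' = M (conjg (voa_aut V) h g) in
       bij_betw (\<phi> g h) (mspace (M g)) (mspace M') \<and>
       linear_on (mscale (M g)) (mscale M') (mspace (M g)) (\<phi> g h) \<and>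
       (\<forall>v\<in>vspace V. \<forall>n. \<forall>w\<in>mspace (M g). \<phi> g h (mmode (M g) v n w) = mmode M' (h v) n (\<phi> g h w))))"

text \<open>$\alpha_g(h,k)$, the scalar with $\phi_g(hk) = \alpha_g(h,k)^{-1} \phi_{kgk^{-1}}(h) \phi_g(k)$.\<close>

definition cocycle ::
  "('v::ab_group_add) voa \<Rightarrow> ('v, 'm::ab_group_add) module_family \<Rightarrow> ('v, 'm) intertwiner_family
   \<Rightarrow> ('v \<Rightarrow> 'v) \<Rightarrow> ('v \<Rightarrow> 'v) \<Rightarrow> ('v \<Rightarrow> 'v) \<Rightarrow> complex" where
  "cocycle V M \<phi> g h k = (THE c. c \<noteq> 0 \<and> (\<forall>w\<in>mspace (M g).
     \<phi> g (h \<otimes>\<^bsub>voa_aut V\<^esub> k) w =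
       mscale (M (conjg (voa_aut V) (h \<otimes>\<^bsub>voa_aut V\<^esub> k) g)) (inverse c)
         (\<phi> (conjg (voa_aut V) k g) h (\<phi> g k w))))"

definition cent_algebra ::
  "('v::ab_group_add) voa \<Rightarrow> ('v \<Rightarrow> 'v) set \<Rightarrow> ('v, 'm::ab_group_add) module_family
   \<Rightarrow> ('v, 'm) intertwiner_family \<Rightarrow> ('v \<Rightarrow> 'v) \<Rightarrow> (('v \<Rightarrow> 'v) \<Rightarrow> complex) ring" where
  "cent_algebra V G M \<phi> g =
     twisted_group_algebra ((voa_aut V)\<lparr>carrier := centralizer (voa_aut V) G g\<rparr>) (cocycle V M \<phi> g)"

abbreviation irr ::
  "('v::ab_group_add) voa \<Rightarrow> ('v \<Rightarrow> 'v) set \<Rightarrow> ('v, 'm::ab_group_add) module_family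
   \<Rightarrow> ('v, 'm) intertwiner_family \<Rightarrow> ('v \<Rightarrow> 'v) \<Rightarrow> 'v character set" where
  "irr V G M \<phi> g \<equiv> simple_characters (cent_algebra V G M \<phi> g)"

definition cent_action ::
  "('v::ab_group_add) voa \<Rightarrow> ('v \<Rightarrow> 'v) set \<Rightarrow> ('v, 'm::ab_group_add) module_family
   \<Rightarrow> ('v, 'm) intertwiner_family \<Rightarrow> ('v \<Rightarrow> 'v) \<Rightarrow> (('v \<Rightarrow> 'v) \<Rightarrow> complex) \<Rightarrow> 'm \<Rightarrow> 'm" where
  "cent_action V G M \<phi> g x w = (\<Sum>a\<in>centralizer (voa_aut V) G g. mscale (M g) (x a) (\<phi> g a w))"

text \<open>Action of an \<open>n\<times>n\<close> matrix on the first factor of $\mathbb{C}^n \otimes W = W^n$.\<close>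

definition matrix_action ::
  "nat \<Rightarrow> complex mat \<Rightarrow> ('v, 'm::ab_group_add) twmod \<Rightarrow> (nat \<Rightarrow> 'm) \<Rightarrow> nat \<Rightarrow> 'm" where
  "matrix_action n A W f = (\<lambda>i. if i < n then \<Sum>j<n. mscale W (A $$ (i, j)) (f j) else 0)"

text \<open>Simplicity of $\mathbb{C}^n \otimes W$ over $A \otimes V$.\<close>

definition simple_tensor ::
  "(('v \<Rightarrow> 'v) \<Rightarrow> complex) ring \<Rightarrow> ('v::ab_group_add) voa \<Rightarrow> nat
   \<Rightarrow> ((('v \<Rightarrow> 'v) \<Rightarrow> complex) \<Rightarrow> complex mat) \<Rightarrow> ('v, 'm::ab_group_add) twmod \<Rightarrow> bool" where
  "simple_tensor A V n R W \<longleftrightarrow> mspace (tensor_mod n W) \<noteq> {0} \<and>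
     (\<forall>U. csubspace (mscale (tensor_mod n W)) U \<and> U \<subseteq> mspace (tensor_mod n W) \<and>
          (\<forall>v\<in>vspace V. \<forall>m. \<forall>f\<in>U. mmode (tensor_mod n W) v m f \<in> U) \<and>
          (\<forall>x\<in>carrier A. \<forall>f\<in>U. matrix_action n (R x) W f \<in> U)
          \<longrightarrow> U = {0} \<or> U = mspace (tensor_mod n W))"

text \<open>$M(g) \simeq \bigoplus_\chi M_\chi \otimes V_\chi$ over $\mathbb{C}_{\alpha_g}[C_G(g)] \otimes V^G$, where
  $M_\chi = \mathbb{C}^{d_\chi}$ with the representation $R_\chi$, and $V_\chi = W_\chi$.\<close>

definition simple_decomposition ::
  "('v::ab_group_add) voa \<Rightarrow> ('v \<Rightarrow> 'v) set \<Rightarrow> ('v, 'm::ab_group_add) module_family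
   \<Rightarrow> ('v, 'm) intertwiner_family \<Rightarrow> ('v \<Rightarrow> 'v) \<Rightarrow> ('v character \<Rightarrow> nat)
   \<Rightarrow> ('v character \<Rightarrow> (('v \<Rightarrow> 'v) \<Rightarrow> complex) \<Rightarrow> complex mat)
   \<Rightarrow> ('v character \<Rightarrow> ('v, 'm) twmod) \<Rightarrow> bool" where
  "simple_decomposition V G M \<phi> g d R W \<longleftrightarrow>
     (\<forall>\<chi>\<in>irr V G M \<phi> g.
        matrix_rep (cent_algebra V G M \<phi> g) (d \<chi>) (R \<chi>) \<and>
        rep_character (cent_algebra V G M \<phi> g) (d \<chi>) (R \<chi>) = \<chi> \<and>
        simple_module (fixed_voa V G) (W \<chi>) \<and>
        simple_tensor (cent_algebra V G M \<phi> g) (fixed_voa V G) (d \<chi>) (R \<chi>) (W \<chi>)) \<and>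
     (\<exists>\<Phi>. module_iso (fixed_voa V G) (M g)
            (direct_sum_mod (irr V G M \<phi> g) (\<lambda>\<chi>. tensor_mod (d \<chi>) (W \<chi>))) \<Phi> \<and>
          (\<forall>x\<in>carrier (cent_algebra V G M \<phi> g). \<forall>w\<in>mspace (M g). \<forall>\<chi>\<in>irr V G M \<phi> g.
             \<Phi> (cent_action V G M \<phi> g x w) \<chi> = matrix_action (d \<chi>) (R \<chi> x) (W \<chi>) (\<Phi> w \<chi>)))"

text \<open>Conjugation by \<open>k\<close> as a map from $\mathbb{C}_{\alpha_g}[C_G(g)]$ to
  $\mathbb{C}_{\alpha_h}[C_G(h)]$, $h = kgk^{-1}$: the element acting on $M(h)$ as
  $\phi_g(k)\,\phi_g(z)\,\phi_g(k)^{-1}$. As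
  $\phi_g(k)\phi_g(z) = \alpha_g(k,z)\phi_g(kz)$ and
  $\phi_h(kzk^{-1})\phi_g(k) = \alpha_g(kzk^{-1},k)\phi_g(kz)$, it is the multiple
  $\alpha_g(k,z)/\alpha_g(kzk^{-1},k)$ of the basis element of $kzk^{-1}$. The scalar depends on the
  choice of the $\phi_g(h)$ (each is determined only up to a nonzero factor) and cannot be
  omitted if that choice is arbitrary.\<close>

definition conj_elt ::
  "('v::ab_group_add) voa \<Rightarrow> ('v, 'm::ab_group_add) module_family \<Rightarrow> ('v, 'm) intertwiner_family
   \<Rightarrow> ('v \<Rightarrow> 'v) \<Rightarrow> ('v \<Rightarrow> 'v) \<Rightarrow> ('v \<Rightarrow> 'v) \<Rightarrow> ('v \<Rightarrow> 'v) \<Rightarrow> complex" where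
  "conj_elt V M \<phi> g k z =
     (let kz = conjg (voa_aut V) k z in
      (\<lambda>b. cocycle V M \<phi> g k z / cocycle V M \<phi> g kz k * basis_elt kz b))"

text \<open>$k(\chi_g) = \psi_h$.\<close>

definition char_transport ::
  "('v::ab_group_add) voa \<Rightarrow> ('v \<Rightarrow> 'v) set \<Rightarrow> ('v, 'm::ab_group_add) module_family
   \<Rightarrow> ('v, 'm) intertwiner_family
   \<Rightarrow> ('v \<Rightarrow> 'v) \<Rightarrow> ('v \<Rightarrow> 'v) \<Rightarrow> 'v character \<Rightarrow> ('v \<Rightarrow> 'v) \<Rightarrow> 'v character \<Rightarrow> bool" where
  "char_transport V G M \<phi> k g \<chi> h \<psi> \<longleftrightarrow> h = conjg (voa_aut V) k g \<and>
     (\<forall>z\<in>centralizer (voa_aut V) G g. \<chi> (basis_elt z) = \<psi> (conj_elt V M \<phi> g k z))"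

text \<open>The same without the scalar, i.e. with the basis element of $kzk^{-1}$ itself. The two agree
  if the $\phi_g(h)$ are chosen so that conjugation by $\phi_g(k)$ permutes those basis elements
  on which some character is nonzero.\<close>

definition char_transport_basis ::
  "('v::ab_group_add) voa \<Rightarrow> ('v \<Rightarrow> 'v) set
   \<Rightarrow> ('v \<Rightarrow> 'v) \<Rightarrow> ('v \<Rightarrow> 'v) \<Rightarrow> 'v character \<Rightarrow> ('v \<Rightarrow> 'v) \<Rightarrow> 'v character \<Rightarrow> bool" where
  "char_transport_basis V G k g \<chi> h \<psi> \<longleftrightarrow> h = conjg (voa_aut V) k g \<and>
     (\<forall>z\<in>centralizer (voa_aut V) G g. \<chi> (basis_elt z) = \<psi> (basis_elt (conjg (voa_aut V) k z)))"

end

theory Submission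
  imports
    Defs
    "HOL-Computational_Algebra.Formal_Power_Series"
    "HOL-Computational_Algebra.Fundamental_Theorem_Algebra"
    "Jordan_Normal_Form.Spectral_Radius"
begin

text \<open>
  In \<open>M(g)\<close> associativity expresses every coefficient of
  $(z_1-z_2)^L Y_g(u,z_1)Y_g(v,z_2)w$ through modes of single vectors of \<open>V\<close>. The powers of $z_1$ that
  occur are distinct rational numbers, so finitely many derivatives at $z_1 = z_2$ determine the coefficients
  (an interpolation argument), and the single vectors can be chosen for finitely many sectors \<open>g\<close> at
  once. Hence products of modes act on finitely many vectors of $\bigoplus_g M(g)$ like sums of single modes,
  and Jacobson's density argument applies simultaneously to all \<open>M(g)\<close>; they are pairwise
  non-isomorphic and have scalar endomorphisms because $M(g)_\lambda$ is finite-dimensional.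

  Replacing $v$ by $\sum_{k\in G} kv$ averages an operator over the maps $\phi_g(k)$. So the modes of
  $V^G$ act on vectors in the image of a matrix unit of $\mathbb{C}_{\alpha_g}[C_G(g)]$ as densely as those of
  \<open>V\<close>, and two such vectors in different sectors are separated unless some $k \in G$ transports one
  character to the other. All simple characters occur since the operators $\phi_g(a)$, $a \in C_G(g)$, are
  linearly independent. This gives the decomposition and the isomorphism criterion, with the scalar
  $f(k;g,z)$ given by $\phi_g(k)\phi_g(z)\phi_g(k)^{-1} = f(k;g,z)\,\phi_{kgk^{-1}}(kzk^{-1})$.

  This scalar is a 1-cocycle for the action of $G$ on commuting pairs $(g,z)$. Rescaling the $\phi_g(z)$ along the
  orbits trivialises it except on orbits whose stabilisers act by a nontrivial character, and for those
  every character of $\mathbb{C}_{\alpha_g}[C_G(g)]$ vanishes at $z$.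
\<close>


section \<open>Sequences with binomial coefficients\<close>

text \<open>The obstacle is that sums of modes do not come as an algebra of operators: a product u_m
  v_n is rewritten by single modes only after it has been applied to given vectors, and the
  rewriting depends on where the modes of v begin to vanish on them. Statements are therefore made
  for finite sets of points (g, w), with one list of modes that serves all points; this is also what
  allows sectors with different denominators to be treated together.

  That distinct sectors are not isomorphic has a concrete source: the n-th mode of g v is exp(2 pi i
  n) times the n-th mode of v, so the operators on M(g) determine g as soon as V acts faithfully,
  and faithfulness comes from the simplicity of V.

  In the passage to V^G the element supplied by density is scaled by the dimension of the
  representation divided by the order of the centraliser. With this constant the average over G
  reproduces the Schur idempotent E_00 itself. The multiplicity space is the image of E_00, since
  E_0i carries the image of E_ii onto it.\<close>

lemma prod_linear_gchoose:
  fixes Y :: "complex set"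
  assumes "finite Y"
  shows "\<exists>n c. \<forall>x. (\<Sum>i\<le>n. c i * (x gchoose i)) = (\<Prod>y\<in>Y. x - y)"
  using assms
proof (induction Y rule: finite_induct)
  case empty
  show ?case by (intro exI[of _ 0] exI[of _ "\<lambda>_. 1"]) simp
next
  case (insert y Y)
  then obtain n :: nat and c :: "nat \<Rightarrow> complex" where c: "\<And>x. (\<Sum>i\<le>n. c i * (x gchoose i)) = (\<Prod>y\<in>Y. x - y)" by blast
  \<comment> \<open>Multiplication by x - y in the binomial basis: \<open>(x - y) * (x gchoose i) =
    (of_nat i - y) * (x gchoose i) + of_nat (Suc i) * (x gchoose Suc i)\<close>.\<close>
  define c' where "c' i = (if i \<le> n then c i * (of_nat i - y) else 0) + (if 0 < i then c (i-1) * of_nat i else 0)" for i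
  have "(\<Sum>i\<le>Suc n. c' i * (x gchoose i)) = (\<Prod>y\<in>insert y Y. x - y)" for x
  proof -
    have "(\<Sum>i\<le>Suc n. c' i * (x gchoose i)) =
        (\<Sum>i\<le>Suc n. (if i \<le> n then c i * (of_nat i - y) else 0) * (x gchoose i)) +
        (\<Sum>i\<le>Suc n. (if 0 < i then c (i-1) * of_nat i else 0) * (x gchoose i))"
      by (simp only: c'_def distrib_right sum.distrib)
    also have "(\<Sum>i\<le>Suc n. (if i \<le> n then c i * (of_nat i - y) else 0) * (x gchoose i)) = (\<Sum>i\<le>n. c i * (of_nat i - y) * (x gchoose i))"
      by simp
    also have "(\<Sum>i\<le>Suc n. (if 0 < i then c (i-1) * of_nat i else 0) * (x gchoose i)) = (\<Sum>i\<le>n. c i * of_nat (Suc i) * (x gchoose Suc i))"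
      by (subst sum.atMost_Suc_shift) simp
    also have "(\<Sum>i\<le>n. c i * (of_nat i - y) * (x gchoose i)) + \<dots> = (\<Sum>i\<le>n. (x - y) * (c i * (x gchoose i)))"
    proof -
      have "c i * (of_nat i - y) * (x gchoose i) + c i * of_nat (Suc i) * (x gchoose Suc i) = (x - y) * (c i * (x gchoose i))" for i
        using gbinomial_mult_1[of x i] by (simp only: algebra_simps)
      then show ?thesis by (simp only: sum.distrib[symmetric])
    qed
    also have "\<dots> = (x - y) * (\<Prod>y\<in>Y. x - y)" by (simp only: sum_distrib_left[symmetric] c)
    finally show ?thesis using insert by simp
  qed
  then show ?case by blast
qed

text \<open>Lagrange interpolation in the binomial basis. X will consist of the numbers -y - 1 for
  the finitely many modes y that occur; c then combines expansion coefficients of order at most n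
  into the single one belonging to x0.\<close>

lemma gchoose_interpolation:
  fixes X :: "complex set"
  assumes "finite X" "x0 \<in> X"
  shows "\<exists>n c. \<forall>x\<in>X. (\<Sum>i\<le>n. c i * (x gchoose i)) = (if x = x0 then 1 else 0)"
proof -
  obtain n :: nat and c where c: "\<And>x. (\<Sum>i\<le>n. c i * (x gchoose i)) = (\<Prod>y\<in>X - {x0}. x - y)"
    using prod_linear_gchoose[of "X - {x0}"] assms by auto
  define P where "P = (\<Prod>y\<in>X - {x0}. x0 - y)"
  have "P \<noteq> 0" using assms by (simp add: P_def)
  have "(\<Sum>i\<le>n. (c i / P) * (x gchoose i)) = (if x = x0 then 1 else 0)" if "x \<in> X" for x
  proof -
    have "(\<Sum>i\<le>n. (c i / P) * (x gchoose i)) = (\<Sum>i\<le>n. c i * (x gchoose i)) / P"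
      by (simp add: sum_divide_distrib)
    also have "\<dots> = (if x = x0 then 1 else 0)"
      using \<open>P \<noteq> 0\<close> that assms by (auto simp: c P_def intro!: prod_zero)
    finally show ?thesis .
  qed
  then show ?thesis by (intro exI[of _ n] exI[of _ "\<lambda>i. c i / P"]) blast
qed

section \<open>Iterated differences of one-sided sequences\<close>

locale cvector_space = vector_space s for s :: "complex \<Rightarrow> 'a::ab_group_add \<Rightarrow> 'a"
begin

text \<open>This is (1 - S)^r for the shift (S p)(y) = p(y - 1). On sequences that vanish far to the
  left it makes sense for negative r as well, where it is iterated summation.\<close>

definition bdiff :: "int \<Rightarrow> (int \<Rightarrow> 'a) \<Rightarrow> int \<Rightarrow> 'a" where
  "bdiff r p y = Sum_any (\<lambda>k::nat. s ((-1) ^ k * (of_int r gchoose k)) (p (y - int k)))"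

lemma bdiff_eq_sum:
  assumes "\<And>y. y < A \<Longrightarrow> p y = 0" "y - A \<le> int n"
  shows "bdiff r p y = (\<Sum>k\<le>n. s ((-1) ^ k * (of_int r gchoose k)) (p (y - int k)))"
proof -
  have "{k. s ((-1) ^ k * (of_int r gchoose k)) (p (y - int k)) \<noteq> 0} \<subseteq> {..n}"
  proof (intro subsetI, rule ccontr)
    fix k assume k: "k \<in> {k. s ((-1) ^ k * (of_int r gchoose k)) (p (y - int k)) \<noteq> 0}" and "k \<notin> {..n}"
    then have "y - int k < A" using assms(2) by auto
    then have "p (y - int k) = 0" by (rule assms(1))
    with k show False by simp
  qed
  then show ?thesis unfolding bdiff_def by (intro Sum_any.expand_superset) auto
qed

lemma bdiff_below:
  assumes "\<And>y. y < A \<Longrightarrow> p y = 0" "y < A"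
  shows "bdiff r p y = 0"
  using bdiff_eq_sum[of A p y 0 r] assms by simp

lemma bdiff_pascal:
  assumes "\<And>y. y < A \<Longrightarrow> p y = 0"
  shows "bdiff r p y - bdiff r p (y - 1) = bdiff (r + 1) p y"
proof -
  define n where "n = nat (y - A)"
  have n: "y - A \<le> int (Suc n)" "y - 1 - A \<le> int n" by (auto simp: n_def)
  have eS: "bdiff r p y = (\<Sum>k\<le>Suc n. s ((-1) ^ k * (of_int r gchoose k)) (p (y - int k)))" for r
    by (rule bdiff_eq_sum[where A=A, OF _ n(1)]) (rule assms)
  have en: "bdiff r p (y - 1) = (\<Sum>k\<le>n. s ((-1) ^ k * (of_int r gchoose k)) (p (y - 1 - int k)))" for r
    by (rule bdiff_eq_sum[where A=A, OF _ n(2)]) (rule assms)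
  have pas: "(of_int (r+1) gchoose Suc k :: complex) = (of_int r gchoose k) + (of_int r gchoose Suc k)" for k
    using gbinomial_Suc_Suc[of "of_int r :: complex" k] by (simp add: add.commute)
  have "bdiff (r+1) p y = s 1 (p y) + (\<Sum>k\<le>n. s ((-1) ^ Suc k * (of_int (r+1) gchoose Suc k)) (p (y - int (Suc k))))"
    unfolding eS sum.atMost_Suc_shift by simp
  also have "(\<Sum>k\<le>n. s ((-1) ^ Suc k * (of_int (r+1) gchoose Suc k)) (p (y - int (Suc k)))) =
     (\<Sum>k\<le>n. s ((-1) ^ Suc k * (of_int r gchoose Suc k)) (p (y - int (Suc k)))) -
     (\<Sum>k\<le>n. s ((-1) ^ k * (of_int r gchoose k)) (p (y - 1 - int k)))"
    unfolding pas sum_subtractf[symmetric]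
    by (rule sum.cong[OF refl])
      (simp add: algebra_simps scale_left_distrib scale_minus_left scale_left_diff_distrib)
  also have "s 1 (p y) + \<dots> = (s 1 (p y) + (\<Sum>k\<le>n. s ((-1) ^ Suc k * (of_int r gchoose Suc k)) (p (y - int (Suc k))))) - bdiff r p (y - 1)"
    by (simp add: en algebra_simps)
  also have "s 1 (p y) + (\<Sum>k\<le>n. s ((-1) ^ Suc k * (of_int r gchoose Suc k)) (p (y - int (Suc k)))) = bdiff r p y"
    unfolding eS sum.atMost_Suc_shift by simp
  finally show ?thesis by simp
qed

text \<open>(1 - S)^(L-1-i) is (1 - S)^(-(i+1)) applied to (1 - S)^L, and the negative binomial
  series has the coefficients shown. Instead of series, both sides are compared through the
  recursion in y and i that they share.\<close>

lemma bdiff_repeated_sum: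
  assumes p: "\<And>y. y < A \<Longrightarrow> p y = 0"
  shows "bdiff (L - 1 - int i) p (y + L - 1 - int i) =
    (\<Sum>x\<in>{A - L..<y}. s (of_int (y - x - 1) gchoose i) (bdiff L p (x + L)))"
proof -
  define q where "q x = bdiff L p (x + L)" for x
  define R where "R i y = (\<Sum>x\<in>{A - L..<y}. s (of_int (y - x - 1) gchoose i) (q x))" for i y
  define D where "D i y = bdiff (L - 1 - int i) p (y + L - 1 - int i)" for i y
  have R0: "R i y = 0" if "y \<le> A - L" for i y using that by (simp add: R_def)
  have D0: "D i y = 0" if "y \<le> A - L" for i y
    unfolding D_def by (rule bdiff_below[OF p]) (use that in auto)
  have q0: "q x = 0" if "x < A - L" for x unfolding q_def by (rule bdiff_below[OF p]) (use that in auto)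
  have Dz: "D 0 (y+1) = D 0 y + q y" for y
    using bdiff_pascal[where A=A, OF p, where r="L - 1" and y="y + L"] by (simp add: D_def q_def algebra_simps)
  have DS: "D (Suc i) (y+1) = D (Suc i) y + D i y" for i y
    using bdiff_pascal[where A=A, OF p, where r="L - 2 - int i" and y="y + L - 1 - int i"]
    by (simp add: D_def algebra_simps)
  have ins: "{A - L..<y + 1} = insert y {A - L..<y}" if "y \<ge> A - L" for y using that by auto
  have Rz: "R 0 (y+1) = R 0 y + q y" for y
  proof (cases "y \<ge> A - L")
    case True then show ?thesis unfolding R_def ins[OF True] by simp
  qed (simp add: R0 q0)
  have RS: "R (Suc i) (y+1) = R (Suc i) y + R i y" for i y
  proof (cases "y \<ge> A - L")
    case True
    have "R (Suc i) (y+1) = (\<Sum>x\<in>{A - L..<y}. s (of_int (y + 1 - x - 1) gchoose Suc i) (q x))"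
      unfolding R_def ins[OF True] by simp
    also have "\<dots> = R (Suc i) y + R i y"
      unfolding R_def sum.distrib[symmetric]
    proof (rule sum.cong[OF refl])
      fix x
      have "(of_int (y + 1 - x - 1) gchoose Suc i :: complex) = (of_int (y - x - 1) gchoose Suc i) + (of_int (y - x - 1) gchoose i)"
        using gbinomial_Suc_Suc[of "of_int (y - x - 1) :: complex" i] by (simp add: algebra_simps)
      then show "s (of_int (y + 1 - x - 1) gchoose Suc i) (q x) =
         s (of_int (y - x - 1) gchoose Suc i) (q x) + s (of_int (y - x - 1) gchoose i) (q x)"
        by (simp only: scale_left_distrib)
    qed
    finally show ?thesis .
  qed (simp add: R0)
  \<comment> \<open>The induction starts where both sides vanish. All orders i are carried along
    because the step for \<open>Suc i\<close> refers to i.\<close>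
  have "D i (A - L + int n) = R i (A - L + int n)" for i n
  proof (induction n arbitrary: i)
    case 0 then show ?case by (simp add: D0 R0)
  next
    case (Suc n)
    have e: "A - L + int (Suc n) = (A - L + int n) + 1" by simp
    show ?case unfolding e by (cases i) (simp_all only: Dz Rz DS RS Suc)
  qed
  from this[of i "nat (y - (A - L))"] have "D i y = R i y"
    by (cases "y \<le> A - L") (simp_all add: D0 R0)
  then show ?thesis by (simp add: D_def R_def q_def)
qed

text \<open>The assumption is a unitriangular system for b, of the shape the Jacobi identity will
  provide. Its solution is found by Vandermonde convolution: the binomials of \<kappa> + B and of
  -(\<kappa> + x) - 1 convolve to those of B - x - 1, which are the weights of iterated
  summation.\<close>

lemma gbinomial_convolution_inverse:
  assumes p: "\<And>y. y < A \<Longrightarrow> p y = 0"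
    and b: "\<And>i. bdiff (L - 1 - int i) p (B + L - 1 - int i) =
      (\<Sum>a\<le>i. s ((\<kappa> + of_int B) gchoose a) (b (i - a)))"
  shows "b i = (\<Sum>x\<in>{A - L..<B}. s ((- (\<kappa> + of_int x) - 1) gchoose i) (bdiff L p (x + L)))"
proof -
  let ?q = "\<lambda>x. bdiff L p (x + L)"
  define b' where "b' i = (\<Sum>x\<in>{A - L..<B}. s ((- (\<kappa> + of_int x) - 1) gchoose i) (?q x))" for i
  have b': "(\<Sum>a\<le>i. s ((\<kappa> + of_int B) gchoose a) (b' (i - a))) =
     (\<Sum>a\<le>i. s ((\<kappa> + of_int B) gchoose a) (b (i - a)))" for i
  proof -
    have "(\<Sum>a\<le>i. s ((\<kappa> + of_int B) gchoose a) (b' (i - a))) =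
       (\<Sum>x\<in>{A - L..<B}. s (\<Sum>a\<le>i. ((\<kappa> + of_int B) gchoose a) * ((- (\<kappa> + of_int x) - 1) gchoose (i - a))) (?q x))"
      unfolding b'_def scale_sum_right scale_scale scale_sum_left by (rule sum.swap)
    also have "\<dots> = (\<Sum>x\<in>{A - L..<B}. s (of_int (B - x - 1) gchoose i) (?q x))"
      by (simp add: gbinomial_Vandermonde atMost_atLeast0 algebra_simps)
    also have "\<dots> = bdiff (L - 1 - int i) p (B + L - 1 - int i)"
      by (rule bdiff_repeated_sum[symmetric, OF p])
    finally show ?thesis by (simp add: b)
  qed
  \<comment> \<open>The coefficient at a = 0 is 1, so the two solutions agree successively.\<close>
  have "b i = b' i"
  proof (induction i rule: less_induct)
    case (less i)
    have *: "(\<Sum>a\<le>i. f a) = f 0 + (\<Sum>a\<in>{1..i}. f a)" for f :: "nat \<Rightarrow> 'a"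
    proof -
      have "{..i} = insert 0 {1..i}" by auto
      then show ?thesis by simp
    qed
    have "(\<Sum>a\<in>{1..i}. s ((\<kappa> + of_int B) gchoose a) (b' (i - a))) =
     (\<Sum>a\<in>{1..i}. s ((\<kappa> + of_int B) gchoose a) (b (i - a)))"
      by (rule sum.cong) (auto simp: less)
    with b'[of i] show ?case unfolding * by simp
  qed
  then show ?thesis by (simp add: b'_def)
qed

end

section \<open>Automorphisms of vertex operator algebras\<close>

lemma linear_on_add: "linear_on s t S f \<Longrightarrow> x \<in> S \<Longrightarrow> y \<in> S \<Longrightarrow> f (x + y) = f x + f y"
  by (simp add: linear_on_def)

lemma linear_on_scale: "linear_on s t S f \<Longrightarrow> x \<in> S \<Longrightarrow> f (s c x) = t c (f x)"
  by (simp add: linear_on_def)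

lemma linear_on_0:
  assumes "linear_on s t S f" "vector_space s" "csubspace s S"
  shows "f 0 = 0"
proof -
  interpret vector_space s by fact
  have "f (0 + 0) = f 0 + f 0" using assms(1) subspace_0[OF assms(3)] by (intro linear_on_add)
  then show ?thesis by simp
qed

lemma linear_on_minus:
  assumes "linear_on s t S f" "vector_space s" "vector_space t" "x \<in> S"
  shows "f (- x) = - f x"
proof -
  interpret S: vector_space s by fact
  interpret T: vector_space t by fact
  have "f (s (-1) x) = t (-1) (f x)" using assms by (intro linear_on_scale)
  then show ?thesis by simp
qed

lemma linear_on_diff:
  assumes "linear_on s t S f" "vector_space s" "vector_space t" "csubspace s S" "x \<in> S" "y \<in> S"
  shows "f (x - y) = f x - f y"
proof -
  interpret S: vector_space s by fact
  have "f (x + (- y)) = f x + f (- y)"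
    using assms S.subspace_neg by (intro linear_on_add) auto
  with linear_on_minus[OF assms(1,2,3,6)] show ?thesis by simp
qed

lemma linear_on_sum:
  assumes "linear_on s t S f" "vector_space s" "csubspace s S" "\<And>i. i \<in> I \<Longrightarrow> x i \<in> S"
  shows "f (\<Sum>i\<in>I. x i) = (\<Sum>i\<in>I. f (x i))"
proof -
  interpret S: vector_space s by fact
  show ?thesis using assms(4)
  proof (induction I rule: infinite_finite_induct)
    case (insert i I)
    have "f (x i + (\<Sum>i\<in>I. x i)) = f (x i) + f (\<Sum>i\<in>I. x i)"
      using insert by (intro linear_on_add[OF assms(1)] S.subspace_sum[OF assms(3)]) auto
    with insert show ?case by simp
  qed (simp_all add: linear_on_0[OF assms(1-3)])
qed

lemma linear_on_subset: "linear_on s t S f \<Longrightarrow> T \<subseteq> S \<Longrightarrow> linear_on s t T f"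
  unfolding linear_on_def by blast

text \<open>The structure behind the group \<open>voa_aut V\<close>. It is instantiated for V and
  again for the fixed points, because an untwisted module over \<open>fixed_voa V G\<close> is one
  twisted by the identity of that algebra's own automorphism group.\<close>

locale voa_core =
  fixes V :: "('v::ab_group_add) voa"
  assumes vector_space_V: "vector_space (vscale V)"
    and subspace_V: "csubspace (vscale V) (vspace V)"
    and vac_in: "vac V \<in> vspace V" and conf_in: "conf V \<in> vspace V"
    and vmode_in: "u \<in> vspace V \<Longrightarrow> v \<in> vspace V \<Longrightarrow> vmode V u n v \<in> vspace V"
begin

sublocale VS: cvector_space "vscale V"
  using vector_space_V by (simp add: cvector_space_def)

abbreviation "AutV \<equiv> voa_aut V"

lemma carrier_aut:
  "g \<in> carrier AutV \<longleftrightarrow> g \<in> Bij (vspace V) \<and> linear_on (vscale V) (vscale V) (vspace V) g \<and>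
     (\<forall>u\<in>vspace V. \<forall>n. \<forall>v\<in>vspace V. g (vmode V u n v) = vmode V (g u) n (g v)) \<and>
     g (vac V) = vac V \<and> g (conf V) = conf V"
  by (auto simp: voa_aut_def)

lemma Bij_in: "g \<in> Bij S \<Longrightarrow> v \<in> S \<Longrightarrow> g v \<in> S"
  using Bij_imp_funcset by fastforce

lemma group_aut: "group AutV"
proof -
  define H where "H = carrier AutV"
  have sub: "subgroup H (BijGroup (vspace V))"
  proof (unfold_locales)
    show "H \<subseteq> carrier (BijGroup (vspace V))" by (auto simp: H_def carrier_aut BijGroup_def)
  next
    fix x y assume xy: "x \<in> H" "y \<in> H"
    then have B: "x \<in> Bij (vspace V)" "y \<in> Bij (vspace V)" by (auto simp: H_def carrier_aut)
    have e: "x \<otimes>\<^bsub>BijGroup (vspace V)\<^esub> y = compose (vspace V) x y" using B by (simp add: BijGroup_def)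
    have "compose (vspace V) x y \<in> Bij (vspace V)" using B by (rule compose_Bij)
    moreover have "linear_on (vscale V) (vscale V) (vspace V) (compose (vspace V) x y)"
      using xy Bij_in[OF B(2)] VS.subspace_add[OF subspace_V] VS.subspace_scale[OF subspace_V]
      by (auto simp: H_def carrier_aut linear_on_def compose_def)
    ultimately show "x \<otimes>\<^bsub>BijGroup (vspace V)\<^esub> y \<in> H"
      using xy Bij_in[OF B(2)] by (auto simp: e H_def carrier_aut compose_def vmode_in vac_in conf_in)
  next
    show "\<one>\<^bsub>BijGroup (vspace V)\<^esub> \<in> H"
      using id_Bij[of "vspace V"] VS.subspace_add[OF subspace_V] VS.subspace_scale[OF subspace_V]
      by (auto simp: BijGroup_def H_def carrier_aut linear_on_def vmode_in vac_in conf_in)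
  next
    fix x assume x: "x \<in> H"
    then have B: "x \<in> Bij (vspace V)" by (auto simp: H_def carrier_aut)
    define y where "y = (\<lambda>v\<in>vspace V. inv_into (vspace V) x v)"
    have bij: "bij_betw x (vspace V) (vspace V)" using B by (simp add: Bij_def)
    have e: "inv\<^bsub>BijGroup (vspace V)\<^esub> x = y" using B by (simp add: inv_BijGroup y_def)
    have yB: "y \<in> Bij (vspace V)" unfolding y_def by (rule restrict_inv_into_Bij[OF B])
    have xy: "x (y v) = v" "y v \<in> vspace V" if "v \<in> vspace V" for v
      using that bij Bij_in[OF yB that] by (simp_all add: y_def bij_betw_inv_into_right)
    have yx: "y (x v) = v" if "v \<in> vspace V" for v
      using that bij Bij_in[OF B that] by (simp add: y_def bij_betw_inv_into_left)
    have lx: "linear_on (vscale V) (vscale V) (vspace V) x" and mx: "\<And>u n v. u \<in> vspace V \<Longrightarrow> v \<in> vspace V \<Longrightarrow>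
      x (vmode V u n v) = vmode V (x u) n (x v)" and x1: "x (vac V) = vac V" and xw: "x (conf V) = conf V"
      using x by (auto simp: H_def carrier_aut)
    have "linear_on (vscale V) (vscale V) (vspace V) y"
    proof -
      have "y (a + b) = y a + y b" if "a \<in> vspace V" "b \<in> vspace V" for a b
      proof -
        have "x (y a + y b) = a + b" using linear_on_add[OF lx] xy that by metis
        then show ?thesis using yx[of "y a + y b"] xy that VS.subspace_add[OF subspace_V] by metis
      qed
      moreover have "y (vscale V c a) = vscale V c (y a)" if "a \<in> vspace V" for a c
      proof -
        have "x (vscale V c (y a)) = vscale V c a" using linear_on_scale[OF lx] xy that by metis
        then show ?thesis using yx[of "vscale V c (y a)"] xy that VS.subspace_scale[OF subspace_V] by metis
      qed
      ultimately show ?thesis by (simp add: linear_on_def)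
    qed
    moreover have "y (vmode V u n v) = vmode V (y u) n (y v)" if "u \<in> vspace V" "v \<in> vspace V" for u n v
    proof -
      have "x (vmode V (y u) n (y v)) = vmode V u n v" using mx xy that by metis
      then show ?thesis using yx[of "vmode V (y u) n (y v)"] xy that vmode_in by metis
    qed
    moreover have "y (vac V) = vac V" "y (conf V) = conf V" using yx vac_in conf_in x1 xw by metis+
    ultimately show "inv\<^bsub>BijGroup (vspace V)\<^esub> x \<in> H"
      using yB by (auto simp: e H_def carrier_aut)
  qed
  have "AutV = BijGroup (vspace V)\<lparr>carrier := H\<rparr>" by (simp add: H_def voa_aut_def)
  then show ?thesis using subgroup.subgroup_is_group[OF sub group_BijGroup] by simp
qed

sublocale Aut: group AutV by (rule group_aut)

lemma aut_in: "g \<in> carrier AutV \<Longrightarrow> v \<in> vspace V \<Longrightarrow> g v \<in> vspace V"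
  using Bij_in by (auto simp: carrier_aut)

lemma aut_linear: "g \<in> carrier AutV \<Longrightarrow> linear_on (vscale V) (vscale V) (vspace V) g"
  by (simp add: carrier_aut)

lemma aut_vmode: "g \<in> carrier AutV \<Longrightarrow> u \<in> vspace V \<Longrightarrow> v \<in> vspace V \<Longrightarrow> g (vmode V u n v) = vmode V (g u) n (g v)"
  by (simp add: carrier_aut)

lemma aut_conf: "g \<in> carrier AutV \<Longrightarrow> g (conf V) = conf V"
  and aut_vac: "g \<in> carrier AutV \<Longrightarrow> g (vac V) = vac V"
  by (simp_all add: carrier_aut)

lemma aut_mult: "g \<in> carrier AutV \<Longrightarrow> h \<in> carrier AutV \<Longrightarrow> v \<in> vspace V \<Longrightarrow> (g \<otimes>\<^bsub>AutV\<^esub> h) v = g (h v)"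
  by (auto simp: carrier_aut voa_aut_def BijGroup_def compose_def)

lemma aut_one: "v \<in> vspace V \<Longrightarrow> \<one>\<^bsub>AutV\<^esub> v = v"
  by (simp add: voa_aut_def BijGroup_def)

lemma aut_eqI:
  assumes "g \<in> carrier AutV" "h \<in> carrier AutV" "\<And>v. v \<in> vspace V \<Longrightarrow> g v = h v"
  shows "g = h"
  using assms Bij_imp_extensional by (metis carrier_aut extensionalityI)

lemma aut_pow: "g \<in> carrier AutV \<Longrightarrow> v \<in> vspace V \<Longrightarrow> (g [^]\<^bsub>AutV\<^esub> (t::nat)) v = (g ^^ t) v"
proof (induction t arbitrary: v)
  case (Suc t)
  then show ?case using aut_mult[of "g [^]\<^bsub>AutV\<^esub> t" g v] aut_in
    by (simp add: funpow_swap1)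
qed (simp add: aut_one)

lemma funpow_aut_in: "g \<in> carrier AutV \<Longrightarrow> v \<in> vspace V \<Longrightarrow> (g ^^ t) v \<in> vspace V"
  by (induction t) (auto intro: aut_in)

text \<open>Discrete Fourier transform of the orbit v, g v, ..., g^(N-1) v: the components are
  averages against the characters of Z/N, and orthogonality of these characters recovers v.\<close>

lemma eigen_decomp:
  assumes g: "g \<in> carrier AutV" and N: "N = group.ord AutV g" "N > 0" and v: "v \<in> vspace V"
  shows "\<exists>f. (\<forall>j<N. f j \<in> eigenspace V g N (int j)) \<and> v = (\<Sum>j<N. f j)"
proof -
  define \<zeta> where "\<zeta> j = exp (2 * of_real pi * \<i> * of_int j / of_nat N)" for j :: int
  have z0: "\<zeta> j \<noteq> 0" for j by (simp add: \<zeta>_def)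
  have zadd: "\<zeta> (i + j) = \<zeta> i * \<zeta> j" for i j by (simp add: \<zeta>_def exp_add[symmetric] add_divide_distrib algebra_simps)
  have zN: "\<zeta> j ^ N = 1" for j
  proof -
    have "\<zeta> j ^ N = exp (of_nat N * (2 * of_real pi * \<i> * of_int j / of_nat N))" by (simp only: \<zeta>_def exp_of_nat_mult)
    also have "of_nat N * (2 * of_real pi * \<i> * of_int j / of_nat N) = 2 * of_real pi * \<i> * of_int j" using N(2) by simp
    also have "exp (2 * of_real pi * \<i> * of_int j :: complex) = 1"
      using exp_power_int[of "2 * of_real pi * \<i>" j] by (simp add: mult.assoc mult.commute)
    finally show ?thesis .
  qed
  have zneq: "\<zeta> (int t) \<noteq> 1" if "0 < t" "t < N" for t
  proof
    assume "\<zeta> (int t) = 1"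
    then have "cis (2 * pi * real t / real N) = cis (2 * pi * real 0 / real N)" by (simp add: \<zeta>_def cis_conv_exp mult.assoc mult.left_commute)
    then have "t = 0" using bij_betw_imp_inj_on[OF bij_betw_roots_unity[OF N(2)]] that
      by (auto simp: inj_on_def)
    with that show False by simp
  qed
  define gp where "gp t = (g ^^ t) v" for t
  have gp_in: "gp t \<in> vspace V" for t by (simp add: gp_def funpow_aut_in g v)
  have gpN: "gp N = v"
    using Aut.pow_ord_eq_1[OF g] aut_pow[OF g v, of N] aut_one[OF v] N by (simp add: gp_def)
  define f where "f j = vscale V (1 / of_nat N) (\<Sum>t<N. vscale V (inverse (\<zeta> (int j)) ^ t) (gp t))" for j
  have f_in: "f j \<in> vspace V" for j
    unfolding f_def by (intro VS.subspace_scale[OF subspace_V] VS.subspace_sum[OF subspace_V] gp_in)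
  have "f j \<in> eigenspace V g N (int j)" for j
  proof -
    let ?z = "inverse (\<zeta> (int j))"
    have "g (f j) = vscale V (1 / of_nat N) (\<Sum>t<N. vscale V (?z ^ t) (gp (Suc t)))"
      unfolding f_def
      by (subst linear_on_scale[OF aut_linear[OF g]] linear_on_sum[OF aut_linear[OF g] vector_space_V subspace_V];
         (intro VS.subspace_sum[OF subspace_V] VS.subspace_scale[OF subspace_V] gp_in)?)+
       (simp add: linear_on_scale[OF aut_linear[OF g]] gp_in, simp add: gp_def)
    also have "(\<Sum>t<N. vscale V (?z ^ t) (gp (Suc t))) = vscale V (\<zeta> (int j)) (\<Sum>t<N. vscale V (?z ^ Suc t) (gp (Suc t)))"
      unfolding VS.scale_sum_right VS.scale_scale power_Suc mult.assoc[symmetric] right_inverse[OF z0] mult_1_left ..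
    \<comment> \<open>The shifted sum closes up because g^N v = v and the N-th power of
      \<open>?z\<close> is 1.\<close>
    also have "(\<Sum>t<N. vscale V (?z ^ Suc t) (gp (Suc t))) = (\<Sum>t<N. vscale V (?z ^ t) (gp t))"
    proof -
      have "(\<Sum>t<N. vscale V (?z ^ Suc t) (gp (Suc t))) + vscale V (?z ^ 0) (gp 0) = (\<Sum>t<Suc N. vscale V (?z ^ t) (gp t))"
        by (simp only: sum.lessThan_Suc_shift add.commute)
      also have "\<dots> = (\<Sum>t<N. vscale V (?z ^ t) (gp t)) + vscale V (?z ^ 0) (gp 0)"
        using gpN by (simp add: zN power_inverse) (simp add: gp_def)
      finally show ?thesis by simp
    qed
    finally have "g (f j) = vscale V (\<zeta> (int j)) (f j)"
      by (simp add: f_def VS.scale_left_commute)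
    then show ?thesis using f_in by (simp add: eigenspace_def \<zeta>_def)
  qed
  moreover have "v = (\<Sum>j<N. f j)"
  proof -
    have geo: "(\<Sum>j<N. inverse (\<zeta> (int j)) ^ t) = (if t = 0 then of_nat N else 0)" if "t < N" for t
    proof (cases "t = 0")
      case False
      define q where "q = inverse (\<zeta> (int t))"
      have "q \<noteq> 1" using zneq[of t] that False by (simp add: q_def)
      have zp: "\<zeta> (int j) ^ t = \<zeta> (int t) ^ j" for j
        by (simp add: \<zeta>_def exp_of_nat_mult[symmetric] algebra_simps)
      have "(\<Sum>j<N. inverse (\<zeta> (int j)) ^ t) = (\<Sum>j<N. q ^ j)"
        by (simp add: q_def power_inverse zp)
      also have "\<dots> = 0" using geometric_sum[OF \<open>q \<noteq> 1\<close>, of N] by (simp add: q_def power_inverse zN)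
      finally show ?thesis using False by simp
    qed simp
    have "(\<Sum>j<N. f j) = vscale V (1 / of_nat N) (\<Sum>t<N. vscale V (\<Sum>j<N. inverse (\<zeta> (int j)) ^ t) (gp t))"
      unfolding f_def VS.scale_sum_left VS.scale_sum_right[symmetric] by (subst sum.swap) simp
    also have "(\<Sum>t<N. vscale V (\<Sum>j<N. inverse (\<zeta> (int j)) ^ t) (gp t)) = (\<Sum>t<N. if t = 0 then vscale V (of_nat N) (gp t) else 0)"
      by (rule sum.cong) (auto simp: geo)
    also have "\<dots> = vscale V (of_nat N) v" using N(2) by (simp add: gp_def)
    finally show ?thesis using N(2) by simp
  qed
  ultimately show ?thesis by blast
qed

text \<open>The Jacobi identity is available only for eigenvectors u of g. Properties that are
  additive in u extend from there to all of V.\<close>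

lemma eigen_induct [consumes 4, case_names eig add]:
  assumes g: "g \<in> carrier AutV" "N = group.ord AutV g" "N > 0" and v: "v \<in> vspace V"
    and eig: "\<And>j v. v \<in> eigenspace V g N j \<Longrightarrow> P v"
    and add: "\<And>u v. u \<in> vspace V \<Longrightarrow> v \<in> vspace V \<Longrightarrow> P u \<Longrightarrow> P v \<Longrightarrow> P (u + v)"
  shows "P v"
proof -
  obtain f where f: "\<And>j. j < N \<Longrightarrow> f j \<in> eigenspace V g N (int j)" and vf: "v = (\<Sum>j<N. f j)"
    using eigen_decomp[OF g v] by blast
  have f': "f j \<in> vspace V" if "j < N" for j using f[OF that] by (simp add: eigenspace_def)
  have "0 \<in> eigenspace V g N 0"
    using linear_on_0[OF aut_linear[OF g(1)] vector_space_V subspace_V] VS.subspace_0[OF subspace_V]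
    by (simp add: eigenspace_def)
  then have P0: "P 0" by (rule eig)
  have "(\<Sum>j<n. f j) \<in> vspace V \<and> P (\<Sum>j<n. f j)" if "n \<le> N" for n using that
  proof (induction n)
    case 0 then show ?case using P0 VS.subspace_0[OF subspace_V] by simp
  next
    case (Suc n)
    then show ?case using f'[of n] f[of n] add VS.subspace_add[OF subspace_V] eig by auto
  qed
  then show ?thesis using vf by auto
qed

end

locale voa_on =
  fixes V :: "('v::ab_group_add) voa"
  assumes voa: "vertex_operator_algebra V"
begin

sublocale voa_core V
proof (rule voa_core.intro)
  show "vector_space (vscale V)" "csubspace (vscale V) (vspace V)" "vac V \<in> vspace V" "conf V \<in> vspace V"
    using voa unfolding vertex_operator_algebra_def by blast+
  have "\<forall>u\<in>vspace V. \<forall>n. \<forall>v\<in>vspace V. vmode V u n v \<in> vspace V"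
    using voa unfolding vertex_operator_algebra_def by (elim conjE) assumption
  then show "u \<in> vspace V \<Longrightarrow> v \<in> vspace V \<Longrightarrow> vmode V u n v \<in> vspace V" for u v n by simp
qed

lemma vmode_linear_left: "v \<in> vspace V \<Longrightarrow> linear_on (vscale V) (vscale V) (vspace V) (\<lambda>u. vmode V u n v)"
proof -
  have "\<forall>v\<in>vspace V. \<forall>n. linear_on (vscale V) (vscale V) (vspace V) (\<lambda>u. vmode V u n v)"
    using voa unfolding vertex_operator_algebra_def by (elim conjE) assumption
  then show "v \<in> vspace V \<Longrightarrow> linear_on (vscale V) (vscale V) (vspace V) (\<lambda>u. vmode V u n v)" by simp
qed

lemma vmode_truncate: "u \<in> vspace V \<Longrightarrow> v \<in> vspace V \<Longrightarrow> \<exists>K. \<forall>n\<ge>K. vmode V u n v = 0"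
proof -
  have "\<forall>u\<in>vspace V. \<forall>v\<in>vspace V. \<exists>K. \<forall>n\<ge>K. vmode V u n v = 0"
    using voa unfolding vertex_operator_algebra_def by (elim conjE) assumption
  then show "u \<in> vspace V \<Longrightarrow> v \<in> vspace V \<Longrightarrow> \<exists>K. \<forall>n\<ge>K. vmode V u n v = 0" by simp
qed

end

section \<open>Associativity for twisted modules\<close>

lemma finite_bounded_coset:
  fixes \<kappa> :: rat
  shows "finite {y. \<exists>x::int. y = \<kappa> + of_int x \<and> A \<le> x \<and> x < B}"
proof -
  have "{y. \<exists>x::int. y = \<kappa> + of_int x \<and> A \<le> x \<and> x < B} = (\<lambda>x. \<kappa> + of_int x) ` {A..<B}" by auto
  then show ?thesis by simp
qed

locale twisted_on = voa_on V
  for V :: "('v::ab_group_add) voa" +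
  fixes g :: "'v \<Rightarrow> 'v" and M :: "('v, 'm::ab_group_add) twmod"
  assumes weak: "weak_twisted_module V g M"
begin

abbreviation "ordg \<equiv> group.ord AutV g"
abbreviation "md \<equiv> mmode M"
abbreviation "sM \<equiv> mscale M"
abbreviation "MM \<equiv> mspace M"

lemma g_in: "g \<in> carrier AutV" and ord_pos: "ordg > 0" and vector_space_M: "vector_space sM"
  and subspace_MM: "csubspace sM MM" and grading: "direct_sum_decomp sM MM (mgrade M)"
  using weak unfolding weak_twisted_module_def Let_def by blast+

lemma grade_bound: "\<forall>l. \<exists>K::int. \<forall>s<K. mgrade M (l + of_int s / of_nat ordg) = {0}"
  using weak unfolding weak_twisted_module_def Let_def by (elim conjE) assumption

sublocale MS: cvector_space "mscale M"
  using vector_space_M by (simp add: cvector_space_def)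

lemma md_in: "v \<in> vspace V \<Longrightarrow> w \<in> MM \<Longrightarrow> md v n w \<in> MM"
proof -
  have "\<forall>v\<in>vspace V. \<forall>n. \<forall>w\<in>mspace M. mmode M v n w \<in> mspace M"
    using weak unfolding weak_twisted_module_def Let_def by (elim conjE) assumption
  then show "v \<in> vspace V \<Longrightarrow> w \<in> MM \<Longrightarrow> md v n w \<in> MM" by simp
qed

lemma md_linear: "v \<in> vspace V \<Longrightarrow> linear_on sM sM MM (md v n)"
proof -
  have "\<forall>v\<in>vspace V. \<forall>n. linear_on (mscale M) (mscale M) (mspace M) (mmode M v n)"
    using weak unfolding weak_twisted_module_def Let_def by (elim conjE) assumption
  then show "v \<in> vspace V \<Longrightarrow> linear_on sM sM MM (md v n)" by simp
qed

lemma md_linear_left: "w \<in> MM \<Longrightarrow> linear_on (vscale V) sM (vspace V) (\<lambda>v. md v n w)"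
proof -
  have "\<forall>w\<in>mspace M. \<forall>n. linear_on (vscale V) (mscale M) (vspace V) (\<lambda>v. mmode M v n w)"
    using weak unfolding weak_twisted_module_def Let_def by (elim conjE) assumption
  then show "w \<in> MM \<Longrightarrow> linear_on (vscale V) sM (vspace V) (\<lambda>v. md v n w)" by simp
qed

lemma md_eigen: "v \<in> eigenspace V g ordg j \<Longrightarrow> \<nexists>i. n = of_int j / of_nat ordg + of_int i \<Longrightarrow> w \<in> MM \<Longrightarrow> md v n w = 0"
proof -
  have "\<forall>j. \<forall>v\<in>eigenspace V g ordg j. \<forall>n. (\<nexists>i. n = of_int j / of_nat ordg + of_int i) \<longrightarrow>
        (\<forall>w\<in>mspace M. mmode M v n w = 0)"
    using weak unfolding weak_twisted_module_def Let_def by (elim conjE) assumption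
  then show "v \<in> eigenspace V g ordg j \<Longrightarrow> \<nexists>i. n = of_int j / of_nat ordg + of_int i \<Longrightarrow> w \<in> MM \<Longrightarrow> md v n w = 0"
    by blast
qed

lemma md_truncate: "v \<in> vspace V \<Longrightarrow> w \<in> MM \<Longrightarrow> \<exists>K. \<forall>n\<ge>K. md v n w = 0"
proof -
  have "\<forall>v\<in>vspace V. \<forall>w\<in>mspace M. \<exists>K. \<forall>n\<ge>K. mmode M v n w = 0"
    using weak unfolding weak_twisted_module_def Let_def by (elim conjE) assumption
  then show "v \<in> vspace V \<Longrightarrow> w \<in> MM \<Longrightarrow> \<exists>K. \<forall>n\<ge>K. md v n w = 0" by simp
qed

lemma md_vac: "w \<in> MM \<Longrightarrow> md (vac V) n w = (if n = -1 then w else 0)"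
proof -
  have "\<forall>w\<in>mspace M. \<forall>n. mmode M (vac V) n w = (if n = -1 then w else 0)"
    using weak unfolding weak_twisted_module_def Let_def by (elim conjE) assumption
  then show "w \<in> MM \<Longrightarrow> md (vac V) n w = (if n = -1 then w else 0)" by simp
qed

lemma jacobi:
  "u \<in> eigenspace V g ordg k \<Longrightarrow> v \<in> vspace V \<Longrightarrow> w \<in> MM \<Longrightarrow> m = of_int k / of_nat ordg + of_int i0 \<Longrightarrow>
     Sum_any (\<lambda>i::nat. sM ((-1) ^ i * (of_int r gchoose i))
          (md u (m + of_int r - of_nat i) (md v (n + of_nat i) w)
           - sM ((-1) powi r) (md v (n + of_int r - of_nat i) (md u (m + of_nat i) w))))
        = Sum_any (\<lambda>i::nat. sM (of_rat m gchoose i)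
            (md (vmode V u (r + int i) v) (m + n - of_nat i) w))"
proof -
  have "\<forall>k. \<forall>u\<in>eigenspace V g ordg k. \<forall>v\<in>vspace V. \<forall>w\<in>mspace M. \<forall>(r::int) m n.
        (\<exists>i. m = of_int k / of_nat ordg + of_int i) \<longrightarrow>
        Sum_any (\<lambda>i::nat. mscale M ((-1) ^ i * (of_int r gchoose i))
          (mmode M u (m + of_int r - of_nat i) (mmode M v (n + of_nat i) w)
           - mscale M ((-1) powi r) (mmode M v (n + of_int r - of_nat i) (mmode M u (m + of_nat i) w))))
        = Sum_any (\<lambda>i::nat. mscale M (of_rat m gchoose i)
            (mmode M (vmode V u (r + int i) v) (m + n - of_nat i) w))"
    using weak unfolding weak_twisted_module_def Let_def by (elim conjE) assumption
  then show "u \<in> eigenspace V g ordg k \<Longrightarrow> v \<in> vspace V \<Longrightarrow> w \<in> MM \<Longrightarrow> m = of_int k / of_nat ordg + of_int i0 \<Longrightarrow> ?thesis"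
    by blast
qed

lemma virasoro:
  "\<forall>w\<in>mspace M. \<forall>m n :: int.
        mmode M (conf V) (of_int m + 1) (mmode M (conf V) (of_int n + 1) w)
        - mmode M (conf V) (of_int n + 1) (mmode M (conf V) (of_int m + 1) w)
        = mscale M (of_int (m - n)) (mmode M (conf V) (of_int (m + n) + 1) w)
          + (if m + n = 0 then mscale M (of_int (m ^ 3 - m) / 12 * of_rat (vrank V)) w else 0)"
  using weak unfolding weak_twisted_module_def Let_def by (elim conjE) assumption

lemma grade_eigen: "\<forall>l. \<forall>w\<in>mgrade M l. mmode M (conf V) 1 w = mscale M l w"
  using weak unfolding weak_twisted_module_def Let_def by (elim conjE) assumption

lemma derivative: "\<forall>v\<in>vspace V. \<forall>w\<in>mspace M. \<forall>n.
        mmode M (vmode V (conf V) 0 v) n w = mscale M (- of_rat n) (mmode M v (n - 1) w)"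
  using weak unfolding weak_twisted_module_def Let_def by (elim conjE) assumption

lemma md_0: "v \<in> vspace V \<Longrightarrow> md v n 0 = 0"
  using linear_on_0[OF md_linear vector_space_M subspace_MM] .

lemma md_0_left: "w \<in> MM \<Longrightarrow> md 0 n w = 0"
  using linear_on_0[OF md_linear_left vector_space_V subspace_V] .

lemma eigen_in: "v \<in> eigenspace V h N j \<Longrightarrow> v \<in> vspace V"
  by (simp add: eigenspace_def)

text \<open>On the eigenspace with index j only modes n in j/N + Z survive, and there the eigenvalue
  equals exp(2 pi i n). In this form the twist g can be read off from the module, with no reference
  to N or j.\<close>

lemma md_aut:
  assumes v: "v \<in> vspace V" and w: "w \<in> MM"
  shows "md (g v) n w = sM (exp (2 * of_real pi * \<i> * of_rat n)) (md v n w)"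
  using g_in refl ord_pos v
proof (induction v rule: eigen_induct)
  case (eig j v)
  let ?e = "exp (2 * of_real pi * \<i> * of_int j / of_nat ordg) :: complex"
  have "md (g v) n w = md (vscale V ?e v) n w" using eig by (simp add: eigenspace_def)
  also have "\<dots> = sM ?e (md v n w)"
    by (rule linear_on_scale[OF md_linear_left[OF w] eigen_in[OF eig]])
  also have "\<dots> = sM (exp (2 * of_real pi * \<i> * of_rat n)) (md v n w)"
  proof (cases "\<exists>i. n = of_int j / of_nat ordg + of_int i")
    case True
    then obtain i where "n = of_int j / of_nat ordg + of_int i" by blast
    then have "(of_rat n :: complex) = of_int j / of_nat ordg + of_int i" by (simp add: of_rat_add of_rat_divide)
    then have "exp (2 * of_real pi * \<i> * of_rat n) = ?e * exp (2 * of_real pi * \<i> * of_int i)"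
      by (simp add: exp_add[symmetric] algebra_simps)
    also have "exp (2 * of_real pi * \<i> * of_int i :: complex) = 1"
      using exp_power_int[of "2 * of_real pi * \<i>" i] by (simp add: mult.assoc mult.commute)
    finally show ?thesis by simp
  next
    case False
    then show ?thesis using md_eigen[OF eig _ w] by simp
  qed
  finally show ?case .
next
  case (add u v)
  then show ?case
    by (simp add: linear_on_add[OF aut_linear[OF g_in]] linear_on_add[OF md_linear_left[OF w]] aut_in[OF g_in] MS.scale_right_distrib)
qed

text \<open>\<open>cross L T u v w y\<close> is the coefficient of $z_1^{-y-1}$ in the part of
  $(z_1-z_2)^L Y_g(u,z_1)Y_g(v,z_2)w$ that is homogeneous of total degree determined by \<open>T\<close>.\<close>

definition cross :: "nat \<Rightarrow> rat \<Rightarrow> 'v \<Rightarrow> 'v \<Rightarrow> 'm \<Rightarrow> rat \<Rightarrow> 'm" where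
  "cross L T u v w y = (\<Sum>k\<le>L. sM ((-1) ^ k * (of_nat L gchoose k))
     (md u (y + of_nat L - of_nat k) (md v (T - y - of_nat L + of_nat k) w)))"

text \<open>The corresponding coefficient of (z_2 - z_1)^L Y_g(v,z_2) Y_g(u,z_1) w, which explains
  the sign (-1)^L in the comparison with \<open>cross\<close>.\<close>

definition cross' :: "nat \<Rightarrow> rat \<Rightarrow> 'v \<Rightarrow> 'v \<Rightarrow> 'm \<Rightarrow> rat \<Rightarrow> 'm" where
  "cross' L T u v w y = (\<Sum>k\<le>L. sM ((-1) ^ k * (of_nat L gchoose k))
     (md v (T - y - of_nat k) (md u (y + of_nat k) w)))"

lemma cross_add:
  assumes "u \<in> vspace V" "u' \<in> vspace V" "v \<in> vspace V" "w \<in> MM"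
  shows "cross L T (u + u') v w y = cross L T u v w y + cross L T u' v w y"
  unfolding cross_def sum.distrib[symmetric] using assms
  by (intro sum.cong refl) (simp add: linear_on_add[OF md_linear_left] md_in MS.scale_right_distrib)

lemma cross'_add:
  assumes "u \<in> vspace V" "u' \<in> vspace V" "v \<in> vspace V" "w \<in> MM"
  shows "cross' L T (u + u') v w y = cross' L T u v w y + cross' L T u' v w y"
  unfolding cross'_def sum.distrib[symmetric] using assms
  by (intro sum.cong refl) (simp add: linear_on_add[OF md_linear_left] linear_on_add[OF md_linear] md_in MS.scale_right_distrib)

lemma Sum_any_gchoose:
  assumes "\<And>k. f k = sM ((-1) ^ k * (of_nat L gchoose k)) (h k)"
  shows "Sum_any f = (\<Sum>k\<le>L. f k)"
proof (rule Sum_any.expand_superset)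
  show "{a. f a \<noteq> 0} \<subseteq> {..L}"
  proof
    fix k assume "k \<in> {a. f a \<noteq> 0}"
    then have "f k \<noteq> 0" by simp
    then have "(of_nat L gchoose k :: complex) \<noteq> 0" by (auto simp: assms)
    then show "k \<in> {..L}" by (metis atMost_iff binomial_eq_0 binomial_gbinomial leI of_nat_0)
  qed
qed simp

text \<open>Take r = L in the Jacobi identity: once L exceeds the order of the pole of Y(u,z)v,
  every u_(L+i) v vanishes and so does the right-hand side. This bound involves only u and v, hence
  is uniform in w, T and y.\<close>

lemma locality:
  assumes u: "u \<in> vspace V" and v: "v \<in> vspace V"
  shows "\<exists>L0. \<forall>L\<ge>L0. \<forall>w\<in>MM. \<forall>T y. cross L T u v w y = sM ((-1) ^ L) (cross' L T u v w y)"
  using g_in refl ord_pos u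
proof (induction u rule: eigen_induct)
  case (eig j u)
  have u: "u \<in> vspace V" using eig by (rule eigen_in)
  obtain K where K: "\<And>n. n \<ge> K \<Longrightarrow> vmode V u n v = 0" using vmode_truncate[OF u v] by blast
  have "cross L T u v w y = sM ((-1) ^ L) (cross' L T u v w y)" if L: "L \<ge> nat K" and w: "w \<in> MM" for L T w y
  proof (cases "\<exists>i. y = of_int j / of_nat ordg + of_int i")
    case True
    then obtain i0 where y: "y = of_int j / of_nat ordg + of_int i0" by blast
    have "Sum_any (\<lambda>i::nat. sM ((-1) ^ i * (of_int (int L) gchoose i))
          (md u (y + of_int (int L) - of_nat i) (md v (T - y - of_nat L + of_nat i) w)
           - sM ((-1) powi (int L)) (md v (T - y - of_nat L + of_int (int L) - of_nat i) (md u (y + of_nat i) w))))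
        = Sum_any (\<lambda>i::nat. sM (of_rat y gchoose i)
            (md (vmode V u (int L + int i) v) (y + (T - y - of_nat L) - of_nat i) w))"
      by (rule jacobi[OF eig v w y])
    also have "\<dots> = 0" using L md_0_left[OF w] by (simp add: K)
    finally have "0 = (\<Sum>k\<le>L. sM ((-1) ^ k * (of_int (int L) gchoose k))
          (md u (y + of_int (int L) - of_nat k) (md v (T - y - of_nat L + of_nat k) w)
           - sM ((-1) powi (int L)) (md v (T - y - of_nat L + of_int (int L) - of_nat k) (md u (y + of_nat k) w))))"
      by (subst (asm) Sum_any_gchoose[of _ L]) auto
    also have "\<dots> = cross L T u v w y - sM ((-1) ^ L) (cross' L T u v w y)"
      unfolding cross_def cross'_def MS.scale_sum_right sum_subtractf[symmetric]
      by (intro sum.cong refl) (simp add: MS.scale_right_diff_distrib mult.commute)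
    finally show ?thesis by simp
  next
    case False
    have "md u (y + of_nat L - of_nat k) w' = 0" if "w' \<in> MM" for k w'
    proof (rule md_eigen[OF eig _ that], rule notI, elim exE)
      fix i assume "y + of_nat L - of_nat k = of_int j / of_nat ordg + of_int i"
      then have "y = of_int j / of_nat ordg + of_int (i - int L + int k)" by (simp add: algebra_simps)
      with False show False by blast
    qed
    moreover have "md u (y + of_nat k) w = 0" for k
    proof (rule md_eigen[OF eig _ w], rule notI, elim exE)
      fix i assume "y + of_nat k = of_int j / of_nat ordg + of_int i"
      then have "y = of_int j / of_nat ordg + of_int (i - int k)" by (simp add: algebra_simps)
      with False show False by blast
    qed
    ultimately show ?thesis using v w by (simp add: cross_def cross'_def md_in md_0)
  qed
  then show ?case by blast
next
  case (add u u')
  then obtain L0 L1 where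
    "\<forall>L\<ge>L0. \<forall>w\<in>MM. \<forall>T y. cross L T u v w y = sM ((-1) ^ L) (cross' L T u v w y)"
    "\<forall>L\<ge>L1. \<forall>w\<in>MM. \<forall>T y. cross L T u' v w y = sM ((-1) ^ L) (cross' L T u' v w y)" by blast
  then show ?case using add v
    by (intro exI[of _ "max L0 L1"]) (simp add: cross_add cross'_add MS.scale_right_distrib)
qed

text \<open>Expand (z_1 - z_2)^L Y_g(u,z_1) Y_g(v,z_2) w at z_1 = z_2 + z_0. The coefficient of
  z_0^i on the side of Y_g(Y(u,z_0)v,z_2) belongs to u_(L-1-i) v, while z_1^(-y-1) contributes the
  binomial of -y - 1 over i. Finiteness of the sum over y is where locality enters.\<close>

lemma associativity:
  assumes u: "u \<in> vspace V" and v: "v \<in> vspace V"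
  shows "\<exists>L0. \<forall>L\<ge>L0. \<forall>w\<in>MM. \<forall>T. finite {y. cross L T u v w y \<noteq> 0} \<and>
     (\<forall>i. md (vmode V u (int L - 1 - int i) v) (T - of_int (int L - 1 - int i)) w =
        Sum_any (\<lambda>y. sM ((- of_rat y - 1) gchoose i) (cross L T u v w y)))"
  using g_in refl ord_pos u
proof (induction u rule: eigen_induct)
  case (eig j u)
  have u: "u \<in> vspace V" using eig by (rule eigen_in)
  define \<kappa> :: rat where "\<kappa> = of_int j / of_nat ordg"
  obtain K where K: "\<And>n. n \<ge> K \<Longrightarrow> vmode V u n v = 0" using vmode_truncate[OF u v] by blast
  obtain L0 where L0: "\<And>L w T y. L \<ge> L0 \<Longrightarrow> w \<in> MM \<Longrightarrow> cross L T u v w y = sM ((-1) ^ L) (cross' L T u v w y)"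
    using locality[OF u v] by blast
  have *: "finite {y. cross L T u v w y \<noteq> 0} \<and>
     (md (vmode V u (int L - 1 - int i) v) (T - of_int (int L - 1 - int i)) w =
        Sum_any (\<lambda>y. sM ((- of_rat y - 1) gchoose i) (cross L T u v w y)))"
    if L: "L \<ge> max (nat K) L0" and w: "w \<in> MM" for L T w i
  proof -
    obtain Ku where Ku: "\<And>n. n \<ge> Ku \<Longrightarrow> md u n w = 0" using md_truncate[OF u w] by blast
    obtain Kv where Kv: "\<And>n. n \<ge> Kv \<Longrightarrow> md v n w = 0" using md_truncate[OF v w] by blast
    \<comment> \<open>To the left of A the mode of v annihilates w; from B on the mode of u does. T
      is the sum of the two mode indices.\<close>
    define A :: int where "A = \<lfloor>T - \<kappa> - Kv\<rfloor>"
    define B :: int where "B = \<lceil>Ku - \<kappa>\<rceil>"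
    define p where "p y = md u (\<kappa> + of_int y) (md v (T - \<kappa> - of_int y) w)" for y :: int
    have p0: "p y = 0" if "y < A" for y
    proof -
      have "of_int y \<le> T - \<kappa> - Kv" using that unfolding A_def by (meson floor_less_iff le_less less_floor_iff linorder_not_le order.strict_trans2 less_le_not_le le_floor_iff)
      then have "md v (T - \<kappa> - of_int y) w = 0" by (intro Kv) simp
      then show ?thesis by (simp add: p_def md_0 u)
    qed
    have cr: "cross L T u v w (\<kappa> + of_int x) = MS.bdiff (int L) p (x + int L)" for x
      unfolding MS.bdiff_def by (subst Sum_any_gchoose[of _ L]) (auto simp: cross_def p_def algebra_simps)
    have Bge: "Ku \<le> \<kappa> + of_int x" if "x \<ge> B" for x
      using that unfolding B_def by (simp add: ceiling_le_iff algebra_simps)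
    \<comment> \<open>On this side truncation applies to the opposite order of the factors, and
      locality transfers it.\<close>
    have cr_hi: "cross L T u v w (\<kappa> + of_int x) = 0" if "x \<ge> B" for x
    proof -
      have "cross' L T u v w (\<kappa> + of_int x) = 0"
        unfolding cross'_def using Bge[OF that] by (intro sum.neutral) (simp add: Ku md_0 v add.assoc add_increasing2)
      then show ?thesis using L0[of L w T] L w by simp
    qed
    have cr_lo: "cross L T u v w (\<kappa> + of_int x) = 0" if "x < A - int L" for x
      unfolding cr by (rule MS.bdiff_below[of A p]) (use p0 that in auto)
    have cr_out: "cross L T u v w y = 0" if "\<nexists>x. y = \<kappa> + of_int x" for y
    proof -
      have "md u (y + of_nat L - of_nat k) w' = 0" if "w' \<in> MM" for k w'
      proof (rule md_eigen[OF eig _ that], rule notI, elim exE)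
        fix i assume "y + of_nat L - of_nat k = of_int j / of_nat ordg + of_int i"
        then have "y = \<kappa> + of_int (i - int L + int k)" by (simp add: algebra_simps \<kappa>_def)
        with \<open>\<nexists>x. y = \<kappa> + of_int x\<close> show False by blast
      qed
      then show ?thesis using v w by (simp add: cross_def md_in)
    qed
    define S where "S = {y. \<exists>x::int. y = \<kappa> + of_int x \<and> A - int L \<le> x \<and> x < B}"
    have supp: "{y. cross L T u v w y \<noteq> 0} \<subseteq> S"
    proof
      fix y assume y: "y \<in> {y. cross L T u v w y \<noteq> 0}"
      then obtain x where x: "y = \<kappa> + of_int x" using cr_out by blast
      with y cr_hi[of x] cr_lo[of x] show "y \<in> S" unfolding S_def by force
    qed
    have fin: "finite {y. cross L T u v w y \<noteq> 0}"
      using finite_subset[OF supp] finite_bounded_coset by (simp add: S_def)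
    define b where "b i = md (vmode V u (int L - 1 - int i) v) (T - of_int (int L - 1 - int i)) w" for i :: nat
    \<comment> \<open>Jacobi identity at m = \<kappa> + B. There u_(m+i) w = 0, so the products in
      the opposite order disappear and the left-hand side is a difference of p alone.\<close>
    have conv: "MS.bdiff (int L - 1 - int i) p (B + int L - 1 - int i) =
       (\<Sum>a\<le>i. sM ((of_rat \<kappa> + of_int B) gchoose a) (b (i - a)))" for i
    proof -
      define r where "r = int L - 1 - int i"
      define m where "m = \<kappa> + of_int B"
      have m: "m = of_int j / of_nat ordg + of_int B" by (simp add: m_def \<kappa>_def)
      have "MS.bdiff r p (B + r) = Sum_any (\<lambda>i::nat. sM ((-1) ^ i * (of_int r gchoose i))
          (md u (m + of_int r - of_nat i) (md v (T - of_int r - m + of_nat i) w)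
           - sM ((-1) powi r) (md v (T - of_int r - m + of_int r - of_nat i) (md u (m + of_nat i) w))))"
      proof -
        have "md u (m + of_nat i) w = 0" for i using Bge[of B] by (simp add: Ku m_def add_increasing2)
        then show ?thesis unfolding MS.bdiff_def p_def m_def by (simp add: md_0 v algebra_simps)
      qed
      also have "\<dots> = Sum_any (\<lambda>a::nat. sM (of_rat m gchoose a)
            (md (vmode V u (r + int a) v) (m + (T - of_int r - m) - of_nat a) w))"
        by (rule jacobi[OF eig v w m])
      \<comment> \<open>For a > i the index r + a is at least L, beyond the pole of Y(u,z)v.\<close>
      also have "\<dots> = (\<Sum>a\<le>i. sM (of_rat m gchoose a)
            (md (vmode V u (r + int a) v) (m + (T - of_int r - m) - of_nat a) w))"
      proof (rule Sum_any.expand_superset)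
        show "{a. sM (of_rat m gchoose a) (md (vmode V u (r + int a) v) (m + (T - of_int r - m) - of_nat a) w) \<noteq> 0} \<subseteq> {..i}"
        proof (intro subsetI, rule ccontr)
          fix a assume a: "a \<in> {a. sM (of_rat m gchoose a) (md (vmode V u (r + int a) v) (m + (T - of_int r - m) - of_nat a) w) \<noteq> 0}" "a \<notin> {..i}"
          have "K \<le> int L" "i < a" using L a(2) by (auto simp: nat_le_iff)
          then have "K \<le> r + int a" by (simp add: r_def)
          then show False using a K md_0_left[OF w] by simp
        qed
      qed simp
      also have "\<dots> = (\<Sum>a\<le>i. sM ((of_rat \<kappa> + of_int B) gchoose a) (b (i - a)))"
        by (intro sum.cong refl) (simp add: b_def r_def m_def of_nat_diff of_rat_add algebra_simps)
      finally show ?thesis by (simp add: r_def algebra_simps)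
    qed
    have "b i = (\<Sum>x\<in>{A - int L..<B}. sM ((- (of_rat \<kappa> + of_int x) - 1) gchoose i) (MS.bdiff (int L) p (x + int L)))"
      by (rule MS.gbinomial_convolution_inverse) (use p0 conv in auto)
    also have "\<dots> = (\<Sum>x\<in>{A - int L..<B}. sM ((- of_rat (\<kappa> + of_int x) - 1) gchoose i) (cross L T u v w (\<kappa> + of_int x)))"
      by (simp add: cr of_rat_add)
    also have "\<dots> = (\<Sum>y\<in>(\<lambda>x. \<kappa> + of_int x) ` {A - int L..<B}. sM ((- of_rat y - 1) gchoose i) (cross L T u v w y))"
      by (subst sum.reindex) (auto simp: inj_on_def)
    also have "(\<lambda>x. \<kappa> + of_int x) ` {A - int L..<B} = S" by (auto simp: S_def)
    also have "(\<Sum>y\<in>S. sM ((- of_rat y - 1) gchoose i) (cross L T u v w y)) =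
        Sum_any (\<lambda>y. sM ((- of_rat y - 1) gchoose i) (cross L T u v w y))"
      by (rule Sum_any.expand_superset[symmetric]) (use supp finite_bounded_coset in \<open>auto simp: S_def\<close>)
    finally show ?thesis using fin by (simp add: b_def)
  qed
  then show ?case by blast
next
  case (add u u')
  then obtain L0 L1 where
    L0: "\<And>L w T. L \<ge> L0 \<Longrightarrow> w \<in> MM \<Longrightarrow> finite {y. cross L T u v w y \<noteq> 0} \<and>
     (\<forall>i. md (vmode V u (int L - 1 - int i) v) (T - of_int (int L - 1 - int i)) w =
        Sum_any (\<lambda>y. sM ((- of_rat y - 1) gchoose i) (cross L T u v w y)))" and
    L1: "\<And>L w T. L \<ge> L1 \<Longrightarrow> w \<in> MM \<Longrightarrow> finite {y. cross L T u' v w y \<noteq> 0} \<and>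
     (\<forall>i. md (vmode V u' (int L - 1 - int i) v) (T - of_int (int L - 1 - int i)) w =
        Sum_any (\<lambda>y. sM ((- of_rat y - 1) gchoose i) (cross L T u' v w y)))" by blast
  have "finite {y. cross L T (u + u') v w y \<noteq> 0} \<and>
     (\<forall>i. md (vmode V (u + u') (int L - 1 - int i) v) (T - of_int (int L - 1 - int i)) w =
        Sum_any (\<lambda>y. sM ((- of_rat y - 1) gchoose i) (cross L T (u + u') v w y)))"
    if L: "L \<ge> max L0 L1" and w: "w \<in> MM" for L w T
  proof -
    have f: "finite {y. cross L T u v w y \<noteq> 0}" "finite {y. cross L T u' v w y \<noteq> 0}"
      using L0[of L w T] L1[of L w T] L w by auto
    have "{y. cross L T (u + u') v w y \<noteq> 0} \<subseteq> {y. cross L T u v w y \<noteq> 0} \<union> {y. cross L T u' v w y \<noteq> 0}"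
      using cross_add[OF add(1,2) v w] by auto
    then have "finite {y. cross L T (u + u') v w y \<noteq> 0}" using f finite_subset by blast
    moreover have "md (vmode V (u + u') (int L - 1 - int i) v) (T - of_int (int L - 1 - int i)) w =
        Sum_any (\<lambda>y. sM ((- of_rat y - 1) gchoose i) (cross L T (u + u') v w y))" for i
    proof -
      have fi: "finite {y. sM ((- of_rat y - 1) gchoose i) (cross L T u v w y) \<noteq> 0}"
        "finite {y. sM ((- of_rat y - 1) gchoose i) (cross L T u' v w y) \<noteq> 0}"
        by (rule finite_subset[OF _ f(1)], force) (rule finite_subset[OF _ f(2)], force)
      have "md (vmode V (u + u') (int L - 1 - int i) v) (T - of_int (int L - 1 - int i)) w =
         md (vmode V u (int L - 1 - int i) v) (T - of_int (int L - 1 - int i)) w +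
         md (vmode V u' (int L - 1 - int i) v) (T - of_int (int L - 1 - int i)) w"
        using add(1,2) v w by (simp only: linear_on_add[OF vmode_linear_left] linear_on_add[OF md_linear_left] vmode_in)
      also have "\<dots> = Sum_any (\<lambda>y. sM ((- of_rat y - 1) gchoose i) (cross L T (u + u') v w y))"
        unfolding cross_add[OF add(1,2) v w] MS.scale_right_distrib
        using L0[of L w T] L1[of L w T] L w by (simp add: Sum_any.distrib[OF fi])
      finally show ?thesis .
    qed
    ultimately show ?thesis by blast
  qed
  then show ?case by blast
qed

text \<open>The vectors acting by zero form an ideal, because associativity expresses the modes of
  u_r v through products in which a mode of v acts first. The ideal is proper since the vacuum acts
  as the identity on a nonzero space.\<close>

lemma faithful:
  assumes "simple_voa V" "MM \<noteq> {0}" "v \<in> vspace V" "\<And>n w. w \<in> MM \<Longrightarrow> md v n w = 0"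
  shows "v = 0"
proof -
  define I where "I = {v \<in> vspace V. \<forall>n. \<forall>w\<in>MM. md v n w = 0}"
  have sub: "csubspace (vscale V) I"
    unfolding I_def
    by (rule VS.subspaceI)
      (auto simp: VS.subspace_0[OF subspace_V] VS.subspace_add[OF subspace_V] VS.subspace_scale[OF subspace_V]
        md_0_left linear_on_add[OF md_linear_left] linear_on_scale[OF md_linear_left])
  have ideal: "vmode V u r v \<in> I" if u: "u \<in> vspace V" and v: "v \<in> I" for u r v
  proof -
    have vV: "v \<in> vspace V" using v by (simp add: I_def)
    obtain L0 where L0: "\<And>L w T i. L \<ge> L0 \<Longrightarrow> w \<in> MM \<Longrightarrow> md (vmode V u (int L - 1 - int i) v) (T - of_int (int L - 1 - int i)) w =
        Sum_any (\<lambda>y. sM ((- of_rat y - 1) gchoose i) (cross L T u v w y))"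
      using associativity[OF u vV] by blast
    have "md (vmode V u r v) n w = 0" if w: "w \<in> MM" for n w
    proof -
      \<comment> \<open>L has to exceed r in order that r be of the form L - 1 - i with a natural
        number i.\<close>
      define L where "L = max L0 (nat (r + 1))"
      define i where "i = nat (int L - 1 - r)"
      have "nat (r + 1) \<le> L" by (simp add: L_def)
      then have r: "r = int L - 1 - int i" by (simp add: i_def nat_le_iff)
      have c0: "cross L (n + of_int r) u v w y = 0" for y
        using v w by (simp add: cross_def I_def md_0[OF u])
      have "md (vmode V u r v) (n + of_int r - of_int r) w =
         Sum_any (\<lambda>y. sM ((- of_rat y - 1) gchoose i) (cross L (n + of_int r) u v w y))"
        unfolding r by (rule L0[OF _ w]) (simp add: L_def del: of_nat_max)
      then show ?thesis by (simp add: c0)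
    qed
    then show ?thesis using vmode_in[OF u vV] by (simp add: I_def)
  qed
  have IV: "I \<subseteq> vspace V" by (auto simp: I_def)
  have "\<forall>I. csubspace (vscale V) I \<and> I \<subseteq> vspace V \<and>
          (\<forall>v\<in>vspace V. \<forall>n. \<forall>w\<in>I. vmode V v n w \<in> I) \<longrightarrow> I = {0} \<or> I = vspace V"
    using assms(1) unfolding simple_voa_def by (elim conjE) assumption
  then have "I = {0} \<or> I = vspace V" using sub ideal IV by blast
  moreover have "I \<noteq> vspace V"
  proof
    assume "I = vspace V"
    then have "vac V \<in> I" using vac_in by simp
    then have "w = 0" if "w \<in> MM" for w using md_vac[OF that, of "-1"] that by (simp add: I_def)
    then show False using assms(2) MS.subspace_0[OF subspace_MM] by blast
  qed
  ultimately have "I = {0}" by blast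
  moreover have "v \<in> I" using assms(3,4) by (simp add: I_def)
  ultimately show ?thesis by simp
qed

text \<open>A relation among series Y_g(v_j,z) w_j survives application of a mode of u to all w_j.
  Moving u to the left by locality produces zero, which is a linear recursion with leading
  coefficient 1 for the coefficients Z of the wanted sum; as Z vanishes for large y, it vanishes
  everywhere.\<close>

lemma locality_sum:
  assumes u: "u \<in> vspace V" and J: "finite J" "\<And>j. j \<in> J \<Longrightarrow> v j \<in> vspace V" "\<And>j. j \<in> J \<Longrightarrow> w j \<in> MM"
    and z: "\<And>n. (\<Sum>j\<in>J. md (v j) n (w j)) = 0"
  shows "(\<Sum>j\<in>J. md (v j) n (md u m (w j))) = 0"
proof -
  have "\<forall>j\<in>J. \<exists>L0. \<forall>L\<ge>L0. \<forall>w\<in>MM. \<forall>T y. cross L T u (v j) w y = sM ((-1) ^ L) (cross' L T u (v j) w y)"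
    using locality[OF u] J by blast
  then obtain L0 where L0: "\<And>j L w T y. j \<in> J \<Longrightarrow> L \<ge> L0 j \<Longrightarrow> w \<in> MM \<Longrightarrow> cross L T u (v j) w y = sM ((-1) ^ L) (cross' L T u (v j) w y)"
    by metis
  define L where "L = (\<Sum>j\<in>J. L0 j)"
  have L: "L0 j \<le> L" if "j \<in> J" for j unfolding L_def using that J by (intro member_le_sum) auto
  have "\<forall>j\<in>J. \<exists>K. \<forall>n\<ge>K. md u n (w j) = 0" using md_truncate[OF u] J by blast
  then obtain K where K: "\<And>j n. j \<in> J \<Longrightarrow> n \<ge> K j \<Longrightarrow> md u n (w j) = 0" by metis
  define Km where "Km = (\<Sum>j\<in>J. \<bar>K j\<bar>)"
  have Km: "K j \<le> Km" if "j \<in> J" for j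
    using member_le_sum[of j J "\<lambda>j. \<bar>K j\<bar>"] that J unfolding Km_def by force
  define T where "T = m + n"
  define Z where "Z y = (\<Sum>j\<in>J. md (v j) (T - y) (md u y (w j)))" for y
  have Z_hi: "Z y = 0" if "y \<ge> Km" for y
    unfolding Z_def using that Km J by (intro sum.neutral ballI) (metis K md_0 order_trans)
  have rec: "(\<Sum>k\<le>L. sM ((-1) ^ k * (of_nat L gchoose k)) (Z (y + of_nat k))) = 0" for y
  proof -
    have "(\<Sum>k\<le>L. sM ((-1) ^ k * (of_nat L gchoose k)) (Z (y + of_nat k))) = (\<Sum>j\<in>J. cross' L T u (v j) (w j) y)"
      unfolding Z_def cross'_def MS.scale_sum_right by (subst sum.swap) (simp add: algebra_simps)
    also have "\<dots> = (\<Sum>j\<in>J. sM ((-1) ^ L) (cross L T u (v j) (w j) y))"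
      using L0 L J by (intro sum.cong refl) (simp flip: power_mult_distrib)
    also have "\<dots> = sM ((-1) ^ L) (\<Sum>k\<le>L. sM ((-1) ^ k * (of_nat L gchoose k))
        (\<Sum>j\<in>J. md u (y + of_nat L - of_nat k) (md (v j) (T - y - of_nat L + of_nat k) (w j))))"
      unfolding cross_def MS.scale_sum_right by (rule sum.swap)
    also have "\<dots> = 0"
    proof -
      have "(\<Sum>j\<in>J. md u a (md (v j) b (w j))) = md u a (\<Sum>j\<in>J. md (v j) b (w j))" for a b
        using J by (intro linear_on_sum[OF md_linear[OF u] vector_space_M subspace_MM, symmetric] md_in)
      then show ?thesis by (simp add: z md_0[OF u])
    qed
    finally show ?thesis .
  qed
  \<comment> \<open>Descending induction: the recursion gives Z y from the values at y + 1, ..., y +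
    L.\<close>
  have Z0: "Z y = 0" if "y \<ge> Km - of_nat t" for y t
    using that
  proof (induction t arbitrary: y)
    case 0 then show ?case by (simp add: Z_hi)
  next
    case (Suc t)
    have "{..L} = insert 0 {1..L}" by auto
    then have "0 = Z y + (\<Sum>k\<in>{1..L}. sM ((-1) ^ k * (of_nat L gchoose k)) (Z (y + of_nat k)))"
      using rec[of y] by simp
    also have "(\<Sum>k\<in>{1..L}. sM ((-1) ^ k * (of_nat L gchoose k)) (Z (y + of_nat k))) = 0"
    proof (intro sum.neutral ballI)
      fix k assume "k \<in> {1..L}"
      then have "Z (y + of_nat k) = 0" using Suc.prems by (intro Suc.IH) auto
      then show "sM ((-1) ^ k * (of_nat L gchoose k)) (Z (y + of_nat k)) = 0" by simp
    qed
    finally show ?case by simp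
  qed
  have "Km - of_nat (nat \<lceil>Km - m\<rceil>) \<le> m" by linarith
  then have "Z m = 0" by (rule Z0)
  then show ?thesis by (simp add: Z_def T_def)
qed

end

section \<open>Families of simple twisted modules\<close>

context cvector_space
begin

lemma exists_annihilating_polynomial:
  assumes E: "finite_dim s E" and seq: "\<And>i. x i \<in> E"
  shows "\<exists>p::complex poly. p \<noteq> 0 \<and> (\<Sum>i\<le>degree p. s (coeff p i) (x i)) = 0"
proof -
  obtain B where B: "finite B" "E = span B" using E by (auto simp: finite_dim_def)
  define n where "n = card B"
  \<comment> \<open>Linear dependence is a property of sets, so a repetition among the vectors is
    treated as a separate case.\<close>
  have "\<exists>c. (\<exists>i\<le>n. c i \<noteq> 0) \<and> (\<Sum>i\<le>n. s (c i) (x i)) = 0"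
  proof (cases "inj_on x {..n}")
    case True
    have "dependent (x ` {..n})"
    proof (rule ccontr)
      assume "independent (x ` {..n})"
      moreover have "x ` {..n} \<subseteq> span B" using seq B by auto
      ultimately have "card (x ` {..n}) \<le> card B" using independent_span_bound[OF B(1)] by blast
      then show False using True by (simp add: card_image n_def)
    qed
    then obtain S u v where S: "finite S" "S \<subseteq> x ` {..n}" "(\<Sum>v\<in>S. s (u v) v) = 0" "v \<in> S" "u v \<noteq> 0"
      unfolding dependent_explicit by blast
    define u' where "u' y = (if y \<in> S then u y else 0)" for y
    have "(\<Sum>i\<le>n. s (u' (x i)) (x i)) = (\<Sum>y\<in>x ` {..n}. s (u' y) y)" using True by (simp add: sum.reindex)
    also have "\<dots> = (\<Sum>y\<in>S. s (u y) y)"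
      by (rule sum.mono_neutral_cong_right) (use S in \<open>auto simp: u'_def\<close>)
    finally have "(\<Sum>i\<le>n. s (u' (x i)) (x i)) = 0" using S by simp
    moreover obtain i where "i \<le> n" "v = x i" using S by auto
    ultimately show ?thesis using S by (intro exI[of _ "\<lambda>i. u' (x i)"]) (auto simp: u'_def)
  next
    case False
    then obtain i j where ij: "i \<le> n" "j \<le> n" "i \<noteq> j" "x i = x j" by (auto simp: inj_on_def)
    define c :: "nat \<Rightarrow> complex" where "c k = (if k = i then 1 else 0) - (if k = j then 1 else 0)" for k
    have "(\<Sum>k\<le>n. s (c k) (x k)) = (\<Sum>k\<le>n. (if k = i then x k else 0)) - (\<Sum>k\<le>n. (if k = j then x k else 0))"
      unfolding sum_subtractf[symmetric] c_def by (intro sum.cong refl) (simp add: scale_left_diff_distrib)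
    also have "\<dots> = 0" using ij by simp
    finally show ?thesis using ij by (intro exI[of _ c]) (auto simp: c_def)
  qed
  then obtain c i0 where c: "i0 \<le> n" "c i0 \<noteq> 0" "(\<Sum>i\<le>n. s (c i) (x i)) = 0" by blast
  define p where "p = (\<Sum>i\<le>n. monom (c i) i)"
  have co: "coeff p i = (if i \<le> n then c i else 0)" for i by (simp add: p_def coeff_sum)
  have "p \<noteq> 0" using c(1,2) co[of i0] by auto
  moreover have "degree p \<le> n" using co by (intro degree_le) auto
  then have "(\<Sum>i\<le>degree p. s (coeff p i) (x i)) = (\<Sum>i\<le>n. s (coeff p i) (x i))"
    by (intro sum.mono_neutral_left) (auto simp: coeff_eq_0)
  ultimately show ?thesis using c(3) co by (intro exI[of _ p]) simp
qed

text \<open>Split off a root of a polynomial that annihilates \<open>w0\<close>. Either the cofactor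
  still annihilates it and has smaller degree, or the cofactor applied to \<open>w0\<close> is an
  eigenvector for that root.\<close>

lemma exists_eigenvector:
  assumes sub: "subspace E" and fd: "finite_dim s E" and ne: "E \<noteq> {0}"
    and lin: "linear_on s s E \<theta>" and cl: "\<And>w. w \<in> E \<Longrightarrow> \<theta> w \<in> E"
  shows "\<exists>\<mu> w. w \<in> E \<and> w \<noteq> 0 \<and> \<theta> w = s \<mu> w"
proof -
  obtain w0 where w0: "w0 \<in> E" "w0 \<noteq> 0" using ne subspace_0[OF sub] by blast
  define x where "x i = (\<theta> ^^ i) w0" for i
  have x_in: "x i \<in> E" for i unfolding x_def by (induction i) (auto simp: w0 cl)
  define ev where "ev p = (\<Sum>i\<le>degree p. s (coeff p i) (x i))" for p :: "complex poly"
  have ev_le: "ev p = (\<Sum>i\<le>n. s (coeff p i) (x i))" if "degree p \<le> n" for p n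
    unfolding ev_def using that by (intro sum.mono_neutral_left) (auto simp: coeff_eq_0)
  have ev_in: "ev p \<in> E" for p unfolding ev_def by (intro subspace_sum[OF sub] subspace_scale[OF sub] x_in)
  have step: "ev ([:- \<mu>, 1:] * q) = \<theta> (ev q) - s \<mu> (ev q)" for \<mu> q
  proof -
    define n where "n = degree q"
    have "degree ([:- \<mu>, 1:] * q) \<le> Suc n" using degree_mult_le[of "[:- \<mu>, 1:]" q] by (simp add: n_def)
    then have "ev ([:- \<mu>, 1:] * q) = (\<Sum>i\<le>Suc n. s (coeff ([:- \<mu>, 1:] * q) i) (x i))" by (rule ev_le)
    also have "\<dots> = (\<Sum>i\<le>Suc n. s (coeff (pCons 0 q) i) (x i)) - (\<Sum>i\<le>Suc n. s \<mu> (s (coeff q i) (x i)))"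
      unfolding sum_subtractf[symmetric]
      by (intro sum.cong refl) (simp add: scale_left_diff_distrib[symmetric])
    also have "(\<Sum>i\<le>Suc n. s \<mu> (s (coeff q i) (x i))) = s \<mu> (ev q)"
      using ev_le[of q "Suc n"] by (simp add: n_def scale_sum_right scale_right_distrib)
    also have "(\<Sum>i\<le>Suc n. s (coeff (pCons 0 q) i) (x i)) = (\<Sum>i\<le>n. s (coeff q i) (x (Suc i)))"
      by (subst sum.atMost_Suc_shift) simp
    also have "\<dots> = \<theta> (ev q)"
      unfolding ev_def n_def[symmetric]
    proof (subst linear_on_sum[OF lin vector_space_axioms sub])
      have "x (Suc i) = \<theta> (x i)" for i by (simp add: x_def)
      then show "(\<Sum>i\<le>n. s (coeff q i) (x (Suc i))) = (\<Sum>i\<le>n. \<theta> (s (coeff q i) (x i)))"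
        by (simp add: linear_on_scale[OF lin] x_in)
    qed (simp add: x_in subspace_scale[OF sub])
    finally show ?thesis .
  qed
  have "p \<noteq> 0 \<Longrightarrow> ev p = 0 \<Longrightarrow> ?thesis" for p
  proof (induction "degree p" arbitrary: p rule: less_induct)
    case less
    show ?case
    proof (cases "degree p = 0")
      case True
      then have "ev p = s (coeff p 0) w0" by (simp add: ev_def x_def)
      moreover have "coeff p 0 \<noteq> 0" using True less(2) by (metis leading_coeff_0_iff)
      ultimately show ?thesis using less(3) w0 by simp
    next
      case False
      then obtain \<mu> where "poly p \<mu> = 0"
        using fundamental_theorem_of_algebra[of p] constant_degree[of p] by auto
      then obtain q where q: "p = [:- \<mu>, 1:] * q" by (metis dvdE poly_eq_0_iff_dvd)
      have q0: "q \<noteq> 0" using less(2) q by auto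
      then have deg: "degree q < degree p" unfolding q by (subst degree_mult_eq) auto
      show ?thesis
      proof (cases "ev q = 0")
        case True
        with less(1)[OF deg q0] show ?thesis by simp
      next
        case False
        have "\<theta> (ev q) = s \<mu> (ev q)" using less(3) step[of \<mu> q] q by simp
        then show ?thesis using False ev_in by blast
      qed
    qed
  qed
  moreover obtain p where "p \<noteq> 0" "ev p = 0"
    using exists_annihilating_polynomial[of E x, OF fd x_in] by (auto simp: ev_def)
  ultimately show ?thesis by blast
qed

end

lemma direct_sum_decomp_unique:
  assumes dec: "direct_sum_decomp s W gr"
    and f: "\<And>n. f n \<in> gr n" "finite {n. f n \<noteq> 0}" and f': "\<And>n. f' n \<in> gr n" "finite {n. f' n \<noteq> 0}"
    and eq: "Sum_any f = Sum_any f'" and W: "Sum_any f \<in> W"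
  shows "f = f'"
proof -
  have "\<exists>!h. (\<forall>n. h n \<in> gr n) \<and> finite {n. h n \<noteq> 0} \<and> Sum_any h = Sum_any f"
    using dec W unfolding direct_sum_decomp_def by blast
  moreover have "(\<forall>n. f n \<in> gr n) \<and> finite {n. f n \<noteq> 0} \<and> Sum_any f = Sum_any f"
    "(\<forall>n. f' n \<in> gr n) \<and> finite {n. f' n \<noteq> 0} \<and> Sum_any f' = Sum_any f"
    using f f' eq by simp_all
  ultimately show ?thesis by (metis (no_types, lifting))
qed

context twisted_on
begin

text \<open>By definition L(0) acts as l on the piece of degree l; conversely, for an eigenvector w
  the components of (L(0) - l) w vanish by uniqueness of the decomposition. Consequently every map
  that commutes with L(0) preserves the grading.\<close>

lemma grade_eq: "mgrade M l = {w \<in> MM. md (conf V) 1 w = sM l w}"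
proof
  show "mgrade M l \<subseteq> {w \<in> MM. md (conf V) 1 w = sM l w}"
    using grading grade_eigen by (auto simp: direct_sum_decomp_def)
  show "{w \<in> MM. md (conf V) 1 w = sM l w} \<subseteq> mgrade M l"
  proof
    fix w assume "w \<in> {w \<in> MM. md (conf V) 1 w = sM l w}"
    then have w: "w \<in> MM" "md (conf V) 1 w = sM l w" by auto
    then obtain f where f: "\<And>n. f n \<in> mgrade M n" "finite {n. f n \<noteq> 0}" "Sum_any f = w"
      using grading unfolding direct_sum_decomp_def by blast
    have sub: "csubspace sM (mgrade M n)" "mgrade M n \<subseteq> MM" for n using grading by (auto simp: direct_sum_decomp_def)
    define F where "F = {n. f n \<noteq> 0}"
    have wF: "w = (\<Sum>n\<in>F. f n)" using f by (simp add: Sum_any.expand_set F_def)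
    have "md (conf V) 1 w = (\<Sum>n\<in>F. md (conf V) 1 (f n))"
      unfolding wF by (rule linear_on_sum[OF md_linear[OF conf_in] vector_space_M subspace_MM]) (use f sub in blast)
    also have "\<dots> = (\<Sum>n\<in>F. sM n (f n))" using f grade_eigen by (intro sum.cong) auto
    finally have "(\<Sum>n\<in>F. sM (n - l) (f n)) = 0"
      using w(2) unfolding wF by (simp add: MS.scale_sum_right MS.scale_left_diff_distrib sum_subtractf)
    then have S0: "Sum_any (\<lambda>n. sM (n - l) (f n)) = 0"
      using f(2) by (subst Sum_any.expand_superset[of F]) (auto simp: F_def)
    have "(\<lambda>n. sM (n - l) (f n)) = (\<lambda>n. 0)"
    proof (rule direct_sum_decomp_unique[OF grading])
      show "finite {n. sM (n - l) (f n) \<noteq> 0}" by (rule finite_subset[OF _ f(2)]) auto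
    qed (auto simp: S0 f MS.subspace_scale[OF sub(1)] MS.subspace_0[OF sub(1)] MS.subspace_0[OF subspace_MM])
    then have "f n = 0" if "n \<noteq> l" for n using that by (auto dest: fun_cong[of _ _ n])
    then have "F \<subseteq> {l}" by (auto simp: F_def)
    then have "w = f l \<or> w = 0" unfolding wF by (auto simp: subset_singleton_iff)
    then show "w \<in> mgrade M l" using f MS.subspace_0[OF sub(1)] by auto
  qed
qed

end

locale module_family = voa_on V
  for V :: "('v::ab_group_add) voa" +
  fixes G :: "('v \<Rightarrow> 'v) set" and M :: "('v \<Rightarrow> 'v) \<Rightarrow> ('v, 'm::ab_group_add) twmod"
  assumes simpleV: "simple_voa V"
    and subG: "subgroup G (voa_aut V)" and finG: "finite G"
    and simpleM: "g \<in> G \<Longrightarrow> simple_twisted_module V g (M g)"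
begin

abbreviation "mo g \<equiv> mmode (M g)"
abbreviation "sc g \<equiv> mscale (M g)"
abbreviation "sp g \<equiv> mspace (M g)"

lemma tw: "g \<in> G \<Longrightarrow> twisted_on V g (M g)"
  using simpleM voa by (simp add: simple_twisted_module_def twisted_module_def twisted_on_def twisted_on_axioms_def voa_on_def)

lemma sp_ne: "g \<in> G \<Longrightarrow> sp g \<noteq> {0}"
  using simpleM by (simp add: simple_twisted_module_def)

lemma simple_sub: "g \<in> G \<Longrightarrow> csubspace (sc g) U \<Longrightarrow> U \<subseteq> sp g \<Longrightarrow>
   (\<And>v n w. v \<in> vspace V \<Longrightarrow> w \<in> U \<Longrightarrow> mo g v n w \<in> U) \<Longrightarrow> U = {0} \<or> U = sp g"
  using simpleM unfolding simple_twisted_module_def by blast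

lemma G_in: "g \<in> G \<Longrightarrow> g \<in> carrier AutV"
  using subgroup.subset[OF subG] by blast

lemma vs: "g \<in> G \<Longrightarrow> cvector_space (sc g)"
  using twisted_on.vector_space_M[OF tw] by (simp add: cvector_space_def)

lemma sub_sp: "g \<in> G \<Longrightarrow> csubspace (sc g) (sp g)"
  by (rule twisted_on.subspace_MM[OF tw])

lemma mo_in: "g \<in> G \<Longrightarrow> v \<in> vspace V \<Longrightarrow> w \<in> sp g \<Longrightarrow> mo g v n w \<in> sp g"
  by (rule twisted_on.md_in[OF tw])

lemma mo_linear: "g \<in> G \<Longrightarrow> v \<in> vspace V \<Longrightarrow> linear_on (sc g) (sc g) (sp g) (mo g v n)"
  by (rule twisted_on.md_linear[OF tw])

lemma mo_linear_left: "g \<in> G \<Longrightarrow> w \<in> sp g \<Longrightarrow> linear_on (vscale V) (sc g) (vspace V) (\<lambda>v. mo g v n w)"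
  by (rule twisted_on.md_linear_left[OF tw])

lemma faithful_module: "g \<in> G \<Longrightarrow> v \<in> vspace V \<Longrightarrow> (\<And>n w. w \<in> sp g \<Longrightarrow> mo g v n w = 0) \<Longrightarrow> v = 0"
  using twisted_on.faithful[OF tw simpleV sp_ne] by blast

text \<open>Schur's lemma in infinite dimension: \<theta> commutes with L(0), hence acts on a
  nonzero finite-dimensional graded piece and has an eigenvector there. The full eigenspace is a
  submodule.\<close>

lemma intertwiner_scalar:
  assumes g: "g \<in> G" and lin: "linear_on (sc g) (sc g) (sp g) \<theta>" and cl: "\<And>w. w \<in> sp g \<Longrightarrow> \<theta> w \<in> sp g"
    and com: "\<And>v n w. v \<in> vspace V \<Longrightarrow> w \<in> sp g \<Longrightarrow> \<theta> (mo g v n w) = mo g v n (\<theta> w)"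
  shows "\<exists>c. \<forall>w\<in>sp g. \<theta> w = sc g c w"
proof -
  interpret twisted_on V g "M g" by (rule tw[OF g])
  have "\<exists>l. mgrade (M g) l \<noteq> {0}"
  proof (rule ccontr)
    assume "\<not> ?thesis"
    then have z: "mgrade (M g) l = {0}" for l by auto
    have "w = 0" if w: "w \<in> sp g" for w
    proof -
      obtain f where "\<And>n. f n \<in> mgrade (M g) n" "Sum_any f = w"
        using grading w unfolding direct_sum_decomp_def by blast
      then show ?thesis using z by simp
    qed
    then show False using sp_ne[OF g] MS.subspace_0[OF subspace_MM] by auto
  qed
  then obtain l where l: "mgrade (M g) l \<noteq> {0}" by blast
  let ?E = "mgrade (M g) l"
  have E: "csubspace (sc g) ?E" "?E \<subseteq> sp g" using grading by (auto simp: direct_sum_decomp_def)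
  have "\<theta> w \<in> ?E" if "w \<in> ?E" for w
    using that com[OF conf_in, of w 1] linear_on_scale[OF lin] cl by (auto simp: grade_eq)
  moreover have "finite_dim (sc g) ?E" using simpleM[OF g] by (simp add: simple_twisted_module_def twisted_module_def)
  moreover have "linear_on (sc g) (sc g) ?E \<theta>" using lin E(2) by (rule linear_on_subset)
  ultimately obtain c w where w: "w \<in> ?E" "w \<noteq> 0" "\<theta> w = sc g c w"
    using MS.exists_eigenvector[OF E(1) _ l] by blast
  define U where "U = {w \<in> sp g. \<theta> w = sc g c w}"
  have "csubspace (sc g) U"
    unfolding U_def
    by (rule MS.subspaceI)
      (auto simp: MS.subspace_0[OF subspace_MM] MS.subspace_add[OF subspace_MM] MS.subspace_scale[OF subspace_MM]
        linear_on_0[OF lin vector_space_M subspace_MM] linear_on_add[OF lin] linear_on_scale[OF lin] MS.scale_right_distrib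
        MS.scale_left_commute)
  moreover have "mo g v n w \<in> U" if "v \<in> vspace V" "w \<in> U" for v n w
    using that com md_in linear_on_scale[OF md_linear] by (simp add: U_def)
  moreover have "U \<subseteq> sp g" by (auto simp: U_def)
  ultimately have "U = {0} \<or> U = sp g" using simple_sub[OF g, of U] by blast
  moreover have "w \<in> U" using w E by (auto simp: U_def)
  ultimately show ?thesis using w(2) unfolding U_def by blast
qed

text \<open>A nonzero intertwiner is onto by simplicity of the target. By \<open>md_aut\<close> it
  then identifies the modes of g v with those of h v on M(h), and faithfulness forces g = h.\<close>

lemma intertwiner_zero:
  assumes g: "g \<in> G" and h: "h \<in> G" and ne: "g \<noteq> h"
    and lin: "linear_on (sc g) (sc h) (sp g) \<theta>" and cl: "\<And>w. w \<in> sp g \<Longrightarrow> \<theta> w \<in> sp h"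
    and com: "\<And>v n w. v \<in> vspace V \<Longrightarrow> w \<in> sp g \<Longrightarrow> \<theta> (mo g v n w) = mo h v n (\<theta> w)"
    and w: "w \<in> sp g"
  shows "\<theta> w = 0"
proof (rule ccontr)
  assume nz: "\<theta> w \<noteq> 0"
  interpret A: twisted_on V g "M g" by (rule tw[OF g])
  interpret B: twisted_on V h "M h" by (rule tw[OF h])
  define I where "I = \<theta> ` sp g"
  have "csubspace (sc h) I"
    unfolding I_def
  proof (rule B.MS.subspaceI)
    show "0 \<in> \<theta> ` sp g" using linear_on_0[OF lin A.vector_space_M A.subspace_MM] A.MS.subspace_0[OF A.subspace_MM] by (metis imageI)
  next
    fix x y assume "x \<in> \<theta> ` sp g" "y \<in> \<theta> ` sp g"
    then obtain a b where "x = \<theta> a" "y = \<theta> b" "a \<in> sp g" "b \<in> sp g" by blast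
    then have "x + y = \<theta> (a + b)" "a + b \<in> sp g" using linear_on_add[OF lin] A.MS.subspace_add[OF A.subspace_MM] by auto
    then show "x + y \<in> \<theta> ` sp g" by blast
  next
    fix c x assume "x \<in> \<theta> ` sp g"
    then obtain a where "x = \<theta> a" "a \<in> sp g" by blast
    then have "sc h c x = \<theta> (sc g c a)" "sc g c a \<in> sp g" using linear_on_scale[OF lin] A.MS.subspace_scale[OF A.subspace_MM] by auto
    then show "sc h c x \<in> \<theta> ` sp g" by blast
  qed
  moreover have "mo h v n x \<in> I" if v: "v \<in> vspace V" and x: "x \<in> I" for v n x
  proof -
    obtain y where "y \<in> sp g" "x = \<theta> y" using x unfolding I_def by (elim imageE)
    then show ?thesis using com[of v y n] A.md_in[of v y n] v unfolding I_def by (metis imageI)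
  qed
  moreover have "I \<subseteq> sp h" using cl by (auto simp: I_def)
  ultimately have "I = {0} \<or> I = sp h" using simple_sub[OF h, of I] by blast
  moreover have "\<theta> w \<in> I" using w by (simp add: I_def)
  ultimately have I: "I = sp h" using nz by blast
  have "g v = h v" if v: "v \<in> vspace V" for v
  proof -
    have "g v - h v = 0"
    proof (rule faithful_module[OF h])
      show "g v - h v \<in> vspace V" using v aut_in G_in g h VS.subspace_diff[OF subspace_V] by simp
      fix n x assume x: "x \<in> sp h"
      then obtain y where y: "y \<in> sp g" "x = \<theta> y" using I unfolding I_def by blast
      have "mo h (g v) n x = \<theta> (mo g (g v) n y)" using y com aut_in[OF G_in[OF g] v] by simp
      also have "\<dots> = \<theta> (sc g (exp (2 * of_real pi * \<i> * of_rat n)) (mo g v n y))" using A.md_aut[OF v] y by simp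
      also have "\<dots> = sc h (exp (2 * of_real pi * \<i> * of_rat n)) (mo h v n x)"
        using linear_on_scale[OF lin] A.md_in v y com by simp
      also have "\<dots> = mo h (h v) n x" using B.md_aut[OF v x] by simp
      finally show "mo h (g v - h v) n x = 0"
        using linear_on_diff[OF B.md_linear_left[OF x] vector_space_V B.vector_space_M subspace_V] v aut_in G_in g h by simp
    qed
    then show ?thesis by simp
  qed
  then have "g = h" using aut_eqI G_in g h by blast
  with ne show False by simp
qed

end

section \<open>Density of the modes\<close>

context module_family
begin

definition act :: "('v \<times> rat) list \<Rightarrow> ('v \<Rightarrow> 'v) \<Rightarrow> 'm \<Rightarrow> 'm" where
  "act xs g w = (\<Sum>(v, n)\<leftarrow>xs. mo g v n w)"

definition modes :: "('v \<times> rat) list \<Rightarrow> bool" where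
  "modes xs \<longleftrightarrow> fst ` set xs \<subseteq> vspace V"

definition finite_points :: "(('v \<Rightarrow> 'v) \<times> 'm) set \<Rightarrow> bool" where
  "finite_points I \<longleftrightarrow> finite I \<and> (\<forall>g w. (g, w) \<in> I \<longrightarrow> g \<in> G \<and> w \<in> sp g)"

text \<open>The list of modes may depend on I, but it is the same for all sectors in I. This takes
  the place of membership in an algebra of operators.\<close>

definition representable :: "(('v \<Rightarrow> 'v) \<times> 'm) set \<Rightarrow> (('v \<Rightarrow> 'v) \<Rightarrow> 'm \<Rightarrow> 'm) \<Rightarrow> bool" where
  "representable I F \<longleftrightarrow> (\<exists>xs. modes xs \<and> (\<forall>g w. (g, w) \<in> I \<longrightarrow> F g w = act xs g w))"

lemma act_Nil [simp]: "act [] g w = 0"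
  and act_Cons [simp]: "act ((v, n) # xs) g w = mo g v n w + act xs g w"
  and act_append [simp]: "act (xs @ ys) g w = act xs g w + act ys g w"
  by (simp_all add: act_def)

lemma modes_simps [simp]: "modes []" "modes ((v, n) # xs) \<longleftrightarrow> v \<in> vspace V \<and> modes xs"
  "modes (xs @ ys) \<longleftrightarrow> modes xs \<and> modes ys"
  by (auto simp: modes_def)

lemma act_in: "modes xs \<Longrightarrow> g \<in> G \<Longrightarrow> w \<in> sp g \<Longrightarrow> act xs g w \<in> sp g"
proof (induction xs)
  case Nil
  interpret cvector_space "sc g" by (rule vs[OF Nil(2)])
  show ?case using subspace_0[OF sub_sp] Nil by simp
next
  case (Cons a xs)
  interpret cvector_space "sc g" by (rule vs[OF Cons(3)])
  show ?case using Cons by (cases a) (simp add: mo_in subspace_add[OF sub_sp])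
qed

lemma act_linear: "modes xs \<Longrightarrow> g \<in> G \<Longrightarrow> linear_on (sc g) (sc g) (sp g) (act xs g)"
proof (induction xs)
  case Nil
  interpret cvector_space "sc g" by (rule vs[OF Nil(2)])
  show ?case by (simp add: linear_on_def)
next
  case (Cons a xs)
  interpret cvector_space "sc g" by (rule vs[OF Cons(3)])
  obtain v n where a: "a = (v, n)" by (cases a)
  have 1: "linear_on (sc g) (sc g) (sp g) (mo g v n)" using Cons(2,3) a by (intro mo_linear) auto
  have 2: "linear_on (sc g) (sc g) (sp g) (act xs g)" using Cons a by auto
  show ?case using linear_on_add[OF 1] linear_on_scale[OF 1] linear_on_add[OF 2] linear_on_scale[OF 2]
    by (simp add: a linear_on_def scale_right_distrib)
qed

definition scale_modes :: "complex \<Rightarrow> ('v \<times> rat) list \<Rightarrow> ('v \<times> rat) list" where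
  "scale_modes c = map (\<lambda>(v, n). (vscale V c v, n))"

lemma modes_scale: "modes xs \<Longrightarrow> modes (scale_modes c xs)"
  by (auto simp: modes_def scale_modes_def intro!: VS.subspace_scale[OF subspace_V])

lemma act_scale: "modes xs \<Longrightarrow> g \<in> G \<Longrightarrow> w \<in> sp g \<Longrightarrow> act (scale_modes c xs) g w = sc g c (act xs g w)"
proof (induction xs)
  case Nil
  interpret cvector_space "sc g" by (rule vs[OF Nil(2)])
  show ?case by (simp add: scale_modes_def)
next
  case (Cons a xs)
  interpret cvector_space "sc g" by (rule vs[OF Cons(3)])
  show ?case using Cons
    by (cases a) (simp add: scale_modes_def linear_on_scale[OF mo_linear_left] scale_right_distrib)
qed

lemma representable_cong:
  assumes "\<And>g w. (g, w) \<in> I \<Longrightarrow> F g w = F' g w"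
  shows "representable I F \<longleftrightarrow> representable I F'"
proof -
  have "(\<forall>g w. (g, w) \<in> I \<longrightarrow> F g w = act xs g w) \<longleftrightarrow> (\<forall>g w. (g, w) \<in> I \<longrightarrow> F' g w = act xs g w)" for xs
    using assms by simp
  then show ?thesis by (simp add: representable_def)
qed

lemma representable_0: "representable I (\<lambda>g w. 0)"
  unfolding representable_def by (intro exI[of _ "[]"]) auto

lemma representable_add: "representable I F \<Longrightarrow> representable I F' \<Longrightarrow> representable I (\<lambda>g w. F g w + F' g w)"
  unfolding representable_def
  by (elim exE, rename_tac xs ys, rule_tac x="xs @ ys" in exI) auto

lemma representable_scale: "finite_points I \<Longrightarrow> representable I F \<Longrightarrow> representable I (\<lambda>g w. sc g c (F g w))"
  unfolding representable_def
  by (elim exE, rule_tac x="scale_modes c xs" in exI) (auto simp: modes_scale act_scale finite_points_def)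

lemma representable_sum:
  assumes "finite_points I" "\<And>j. j \<in> J \<Longrightarrow> representable I (F j)"
  shows "representable I (\<lambda>g w. \<Sum>j\<in>J. F j g w)"
  using assms(2) by (induction J rule: infinite_finite_induct) (auto intro: representable_0 representable_add)

lemma representable_mode: "v \<in> vspace V \<Longrightarrow> representable I (\<lambda>g w. mo g v n w)"
  unfolding representable_def by (intro exI[of _ "[(v, n)]"]) auto

text \<open>Evaluating at several points at once, the expansion coefficients at $z_1 = z_2$ determine the
  coefficients of $(z_1-z_2)^LY_g(u,z_1)Y_g(v,z_2)w$, because the powers of $z_1$ that occur have
  pairwise distinct rational exponents. This is where twisted sectors for different \<open>g\<close>
  get treated simultaneously.\<close>

lemma representable_cross:
  assumes I: "finite_points I" and u: "u \<in> vspace V" and v: "v \<in> vspace V"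
  shows "\<exists>L. \<forall>T y. representable I (\<lambda>g w. twisted_on.cross (M g) L T u v w y)"
proof -
  have "\<forall>g\<in>G. \<exists>L0. \<forall>L\<ge>L0. \<forall>w\<in>sp g. \<forall>T. finite {y. twisted_on.cross (M g) L T u v w y \<noteq> 0} \<and>
     (\<forall>i. mo g (vmode V u (int L - 1 - int i) v) (T - of_int (int L - 1 - int i)) w =
        Sum_any (\<lambda>y. sc g ((- of_rat y - 1) gchoose i) (twisted_on.cross (M g) L T u v w y)))"
    using twisted_on.associativity[OF tw u v] by blast
  from bchoice[OF this] obtain L0 where L0: "\<forall>g\<in>G. \<forall>L\<ge>L0 g. \<forall>w\<in>sp g. \<forall>T. finite {y. twisted_on.cross (M g) L T u v w y \<noteq> 0} \<and>
     (\<forall>i. mo g (vmode V u (int L - 1 - int i) v) (T - of_int (int L - 1 - int i)) w =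
        Sum_any (\<lambda>y. sc g ((- of_rat y - 1) gchoose i) (twisted_on.cross (M g) L T u v w y)))" ..
  \<comment> \<open>One exponent for all sectors; the sum serves as an upper bound for the finitely
    many \<open>L0 g\<close>.\<close>
  define L where "L = (\<Sum>g\<in>G. L0 g)"
  have L: "L0 g \<le> L" if "g \<in> G" for g unfolding L_def using that finG by (intro member_le_sum) auto
  have "representable I (\<lambda>g w. twisted_on.cross (M g) L T u v w y)" for T y
  proof -
    \<comment> \<open>All mode indices at which some point of I contributes. Interpolation on Y
      gives coefficients that work for every point.\<close>
    define Y where "Y = (\<Union>(g, w)\<in>I. {y. twisted_on.cross (M g) L T u v w y \<noteq> 0})"
    have Y: "finite Y" unfolding Y_def
    proof (rule finite_UN_I)
      show "finite I" using I by (simp add: finite_points_def)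
      fix p assume p: "p \<in> I"
      obtain g w where gw: "p = (g, w)" by (cases p)
      then have "g \<in> G" "w \<in> sp g" using I p by (auto simp: finite_points_def)
      then show "finite (case p of (g, w) \<Rightarrow> {y. twisted_on.cross (M g) L T u v w y \<noteq> 0})"
        using L0 L unfolding gw by simp
    qed
    show ?thesis
    proof (cases "y \<in> Y")
      case False
      then have "representable I (\<lambda>g w. twisted_on.cross (M g) L T u v w y) \<longleftrightarrow> representable I (\<lambda>g w. 0)"
        by (intro representable_cong) (auto simp: Y_def)
      then show ?thesis using representable_0 by simp
    next
      case True
      have "finite ((\<lambda>y. - of_rat y - 1 :: complex) ` Y)" "- of_rat y - 1 \<in> (\<lambda>y. - of_rat y - 1 :: complex) ` Y"
        using Y True by auto
      from gchoose_interpolation[OF this]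
      obtain n :: nat and c where c: "\<And>x. x \<in> Y \<Longrightarrow> (\<Sum>i\<le>n. c i * ((- of_rat x - 1) gchoose i)) = (if x = y then 1 else 0 :: complex)"
        by auto
      define F where "F g w = (\<Sum>i\<le>n. sc g (c i) (mo g (vmode V u (int L - 1 - int i) v) (T - of_int (int L - 1 - int i)) w))" for g w
      have "representable I F"
        unfolding F_def by (intro representable_sum representable_scale I representable_mode vmode_in u v)
      moreover have "F g w = twisted_on.cross (M g) L T u v w y" if gw: "(g, w) \<in> I" for g w
      proof -
        have g: "g \<in> G" and w: "w \<in> sp g" using I gw by (auto simp: finite_points_def)
        interpret cvector_space "sc g" by (rule vs[OF g])
        have sup: "{y. twisted_on.cross (M g) L T u v w y \<noteq> 0} \<subseteq> Y" using gw by (auto simp: Y_def)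
        have "mo g (vmode V u (int L - 1 - int i) v) (T - of_int (int L - 1 - int i)) w =
           (\<Sum>y\<in>Y. sc g ((- of_rat y - 1) gchoose i) (twisted_on.cross (M g) L T u v w y))" for i
        proof -
          have "mo g (vmode V u (int L - 1 - int i) v) (T - of_int (int L - 1 - int i)) w =
            Sum_any (\<lambda>y. sc g ((- of_rat y - 1) gchoose i) (twisted_on.cross (M g) L T u v w y))"
            using L0 g L[OF g] w by blast
          also have "\<dots> = (\<Sum>y\<in>Y. sc g ((- of_rat y - 1) gchoose i) (twisted_on.cross (M g) L T u v w y))"
            by (rule Sum_any.expand_superset[OF Y]) (use sup in auto)
          finally show ?thesis .
        qed
        then have "F g w = (\<Sum>x\<in>Y. sc g (\<Sum>i\<le>n. c i * ((- of_rat x - 1) gchoose i)) (twisted_on.cross (M g) L T u v w x))"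
          unfolding F_def scale_sum_left by (simp add: scale_sum_right) (rule sum.swap)
        also have "\<dots> = (\<Sum>x\<in>Y. if x = y then twisted_on.cross (M g) L T u v w x else 0)"
          by (intro sum.cong refl) (simp add: c)
        also have "\<dots> = twisted_on.cross (M g) L T u v w y" using True Y by simp
        finally show ?thesis .
      qed
      ultimately show ?thesis using representable_cong[of I F "\<lambda>g w. twisted_on.cross (M g) L T u v w y"] by blast
    qed
  qed
  then show ?thesis by blast
qed

text \<open>\<open>cross\<close> at y - L has leading term u_y v_(T-y), and its other terms involve
  u_(y-k) v_(T-y+k) with k > 0. Solving for the leading term lowers y, and this ends because the
  modes of v with large index annihilate the finitely many vectors of I.\<close>

lemma representable_product:
  assumes I: "finite_points I" and u: "u \<in> vspace V" and v: "v \<in> vspace V"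
  shows "representable I (\<lambda>g w. mo g u m (mo g v n w))"
proof -
  define T where "T = m + n"
  obtain L where L: "\<And>y. representable I (\<lambda>g w. twisted_on.cross (M g) L T u v w y)"
    using representable_cross[OF I u v] by blast
  have "\<forall>p\<in>I. \<exists>K. \<forall>n\<ge>K. mo (fst p) v n (snd p) = 0"
    using twisted_on.md_truncate[OF tw v] I by (force simp: finite_points_def)
  then obtain K where K: "\<And>p n. p \<in> I \<Longrightarrow> n \<ge> K p \<Longrightarrow> mo (fst p) v n (snd p) = 0" by metis
  \<comment> \<open>A truncation bound valid at all points of I.\<close>
  define Km where "Km = (\<Sum>p\<in>I. \<bar>K p\<bar>)"
  have Km: "K p \<le> Km" if "p \<in> I" for p
    using member_le_sum[of p I "\<lambda>p. \<bar>K p\<bar>"] that I unfolding Km_def finite_points_def by force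
  have claim: "representable I (\<lambda>g w. mo g u y (mo g v (T - y) w))" if "y \<le> T - Km + of_nat t" for y t
    using that
  proof (induction t arbitrary: y)
    case 0
    have "representable I (\<lambda>g w. mo g u y (mo g v (T - y) w)) \<longleftrightarrow> representable I (\<lambda>g w. 0)"
    proof (rule representable_cong)
      fix g w assume gw: "(g, w) \<in> I"
      then have "mo g v (T - y) w = 0" using K[of "(g, w)" "T - y"] Km[OF gw] 0 by simp
      then show "mo g u y (mo g v (T - y) w) = 0"
        using gw I twisted_on.md_0[OF tw u] by (auto simp: finite_points_def)
    qed
    then show ?case using representable_0 by simp
  next
    case (Suc t)
    let ?P = "\<lambda>k g w. sc g ((-1) ^ k * (of_nat L gchoose k)) (mo g u (y - of_nat k) (mo g v (T - (y - of_nat k)) w))"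
    have "representable I (\<lambda>g w. twisted_on.cross (M g) L T u v w (y - of_nat L) + sc g (-1) (\<Sum>k\<in>{1..L}. ?P k g w))"
    proof (intro representable_add L representable_scale[OF I] representable_sum[OF I])
      fix k assume "k \<in> {1..L}"
      then show "representable I (\<lambda>g w. mo g u (y - of_nat k) (mo g v (T - (y - of_nat k)) w))"
        using Suc.prems by (intro Suc.IH) auto
    qed
    moreover have "twisted_on.cross (M g) L T u v w (y - of_nat L) + sc g (-1) (\<Sum>k\<in>{1..L}. ?P k g w) = mo g u y (mo g v (T - y) w)"
      if gw: "(g, w) \<in> I" for g w
    proof -
      have g: "g \<in> G" using I gw by (auto simp: finite_points_def)
      interpret cvector_space "sc g" by (rule vs[OF g])
      have "{..L} = insert 0 {1..L}" by auto
      moreover have "twisted_on.cross (M g) L T u v w (y - of_nat L) = (\<Sum>k\<le>L. ?P k g w)"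
        unfolding twisted_on.cross_def[OF tw[OF g]] by (intro sum.cong refl) (simp add: algebra_simps)
      ultimately show ?thesis by simp
    qed
    ultimately show ?case
      using representable_cong[of I "\<lambda>g w. twisted_on.cross (M g) L T u v w (y - of_nat L) + sc g (-1) (\<Sum>k\<in>{1..L}. ?P k g w)"
        "\<lambda>g w. mo g u y (mo g v (T - y) w)"] by blast
  qed
  have "m \<le> T - Km + of_nat (nat \<lceil>m - T + Km\<rceil>)" by linarith
  then have "representable I (\<lambda>g w. mo g u m (mo g v (T - m) w))" by (rule claim)
  then show ?thesis by (simp add: T_def)
qed

lemma mode_act:
  assumes I: "finite_points I" and u: "u \<in> vspace V" and xs: "modes xs"
  shows "representable I (\<lambda>g w. mo g u m (act xs g w))"
  using xs
proof (induction xs)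
  case Nil
  have "representable I (\<lambda>g w. mo g u m (act [] g w)) \<longleftrightarrow> representable I (\<lambda>g w. 0)"
    by (rule representable_cong) (use I twisted_on.md_0[OF tw u] in \<open>auto simp: finite_points_def\<close>)
  then show ?case using representable_0 by simp
next
  case (Cons a xs)
  obtain v n where a: "a = (v, n)" by (cases a)
  have v: "v \<in> vspace V" and xs: "modes xs" using Cons a by auto
  have "representable I (\<lambda>g w. mo g u m (mo g v n w) + mo g u m (act xs g w))"
    using Cons.IH[OF xs] by (intro representable_add representable_product I u v)
  moreover have "mo g u m (mo g v n w) + mo g u m (act xs g w) = mo g u m (act (a # xs) g w)" if "(g, w) \<in> I" for g w
    using that I act_in[OF xs, of g w] linear_on_add[OF mo_linear[OF _ u]] mo_in[OF _ v] by (auto simp: a finite_points_def)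
  ultimately show ?case
    using representable_cong[of I "\<lambda>g w. mo g u m (mo g v n w) + mo g u m (act xs g w)" "\<lambda>g w. mo g u m (act (a # xs) g w)"] by blast
qed

definition annihilates :: "('v \<times> rat) list \<Rightarrow> (('v \<Rightarrow> 'v) \<times> 'm) set \<Rightarrow> bool" where
  "annihilates xs Z \<longleftrightarrow> modes xs \<and> (\<forall>g w. (g, w) \<in> Z \<longrightarrow> act xs g w = 0)"

text \<open>The lists annihilating Z behave like a left ideal. The product is represented on Z and W
  together, so that the new list still vanishes on Z and has the intended values on W.\<close>

lemma annihilates_mode_act:
  assumes Z: "finite_points Z" and xs: "annihilates xs Z" and u: "u \<in> vspace V" and W: "finite_points W"
  shows "\<exists>ys. annihilates ys Z \<and> (\<forall>g w. (g, w) \<in> W \<longrightarrow> act ys g w = mo g u m (act xs g w))"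
proof -
  have "finite_points (Z \<union> W)" using Z W by (auto simp: finite_points_def)
  then have "representable (Z \<union> W) (\<lambda>g w. mo g u m (act xs g w))"
    using mode_act u xs by (simp add: annihilates_def)
  then obtain ys where ys: "modes ys" "\<And>g w. (g, w) \<in> Z \<union> W \<Longrightarrow> mo g u m (act xs g w) = act ys g w"
    unfolding representable_def by blast
  have "act ys g w = 0" if gw: "(g, w) \<in> Z" for g w
  proof -
    have "act ys g w = mo g u m (act xs g w)" using ys(2) gw by simp
    also have "act xs g w = 0" using xs gw by (auto simp: annihilates_def)
    finally show ?thesis using twisted_on.md_0[OF tw u] Z gw by (auto simp: finite_points_def)
  qed
  then show ?thesis using ys by (intro exI[of _ ys]) (auto simp: annihilates_def)
qed

text \<open>The values at w of all lists annihilating Z form a submodule of the simple module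
  M(g).\<close>

lemma annihilates_orbit:
  assumes Z: "finite_points Z" and g: "g \<in> G" and w: "w \<in> sp g" and xs: "annihilates xs Z" "act xs g w \<noteq> 0" and y: "y \<in> sp g"
  shows "\<exists>ys. annihilates ys Z \<and> act ys g w = y"
proof -
  interpret cvector_space "sc g" by (rule vs[OF g])
  define U where "U = {act ys g w |ys. annihilates ys Z}"
  have "csubspace (sc g) U"
  proof (rule subspaceI)
    have "annihilates [] Z" by (auto simp: annihilates_def)
    then show "0 \<in> U" unfolding U_def by force
    fix x y assume "x \<in> U" "y \<in> U"
    then obtain xs ys where xy: "x = act xs g w" "y = act ys g w" "annihilates xs Z" "annihilates ys Z" unfolding U_def by blast
    then have "annihilates (xs @ ys) Z" by (auto simp: annihilates_def)
    then show "x + y \<in> U" unfolding U_def using xy by force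
  next
    fix c x assume "x \<in> U"
    then obtain xs where xs: "x = act xs g w" "annihilates xs Z" unfolding U_def by blast
    have "act (scale_modes c xs) h z = 0" if "(h, z) \<in> Z" for h z
    proof -
      have h: "h \<in> G" "z \<in> sp h" using that Z by (auto simp: finite_points_def)
      interpret H: cvector_space "sc h" by (rule vs[OF h(1)])
      show ?thesis using act_scale[of xs h z c] xs that h by (auto simp: annihilates_def)
    qed
    then have "annihilates (scale_modes c xs) Z" using xs modes_scale by (auto simp: annihilates_def)
    moreover have "sc g c x = act (scale_modes c xs) g w" using act_scale[of xs g w c] xs g w by (simp add: annihilates_def)
    ultimately show "sc g c x \<in> U" unfolding U_def by blast
  qed
  moreover have "mo g v n x \<in> U" if v: "v \<in> vspace V" and x: "x \<in> U" for v n x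
  proof -
    obtain xs where xs: "x = act xs g w" "annihilates xs Z" using x unfolding U_def by blast
    have "finite_points {(g, w)}" using g w by (simp add: finite_points_def)
    from annihilates_mode_act[OF Z xs(2) v this, of n]
    obtain ys where ys: "annihilates ys Z" "act ys g w = mo g v n x" using xs(1) by auto
    show ?thesis unfolding U_def ys(2)[symmetric] using ys(1) by blast
  qed
  moreover have "U \<subseteq> sp g" using act_in g w by (auto simp: U_def annihilates_def)
  ultimately have "U = {0} \<or> U = sp g" using simple_sub[OF g, of U] by blast
  moreover have "act xs g w \<in> U" using xs by (auto simp: U_def)
  ultimately have "U = sp g" using xs by blast
  then have "y \<in> U" using y by simp
  then show ?thesis unfolding U_def by (elim CollectE exE conjE) (metis)
qed

text \<open>Jacobson density for all sectors at once; only the points of Z in the sector of w count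
  for the span. If adding (h, z) to Z destroyed the claim, then xs z -> xs w, for lists xs
  annihilating Z, would be an intertwiner from M(h) to M(g). It is a scalar for h = g and zero
  otherwise, and both contradict the induction hypothesis.\<close>

lemma density:
  assumes Z: "finite Z" "finite_points Z" and g: "g \<in> G" and w: "w \<in> sp g"
    and out: "w \<notin> Modules.module.span (sc g) {z. (g, z) \<in> Z}" and y: "y \<in> sp g"
  shows "\<exists>xs. annihilates xs Z \<and> act xs g w = y"
proof -
  have "\<exists>xs. annihilates xs Z \<and> act xs g w \<noteq> 0"
    using Z g w out
  proof (induction Z arbitrary: g w rule: finite_induct)
    case empty
    interpret cvector_space "sc g" by (rule vs) fact
    have "w \<noteq> 0" using empty by simp
    then have "act [(vac V, -1)] g w \<noteq> 0" using twisted_on.md_vac[OF tw] empty by simp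
    then show ?case using vac_in by (intro exI[of _ "[(vac V, -1)]"]) (auto simp: annihilates_def)
  next
    case (insert p Z)
    obtain h z where p: "p = (h, z)" by (cases p)
    have Z: "finite_points Z" and h: "h \<in> G" and z: "z \<in> sp h" using insert.prems p by (auto simp: finite_points_def)
    have g: "g \<in> G" and w: "w \<in> sp g" by fact+
    interpret A: cvector_space "sc g" by (rule vs[OF g])
    interpret B: cvector_space "sc h" by (rule vs[OF h])
    have out: "w \<notin> Modules.module.span (sc g) {z. (g, z) \<in> Z}"
      using insert.prems(4) A.span_mono[of "{z. (g, z) \<in> Z}" "{z. (g, z) \<in> insert p Z}"] by auto
    show ?case
    proof (rule ccontr)
      assume contra: "\<not> ?case"
      show False
      proof (cases "z \<in> Modules.module.span (sc h) {z. (h, z) \<in> Z}")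
        case True
        obtain xs where xs: "annihilates xs Z" "act xs g w \<noteq> 0" using insert.IH[OF Z g w out] by blast
        \<comment> \<open>Lists that annihilate Z also annihilate the span of its points in sector
          h, so the new point imposes no condition.\<close>
        define K where "K = {x \<in> sp h. act xs h x = 0}"
        have lin: "linear_on (sc h) (sc h) (sp h) (act xs h)" using act_linear h xs by (simp add: annihilates_def)
        have "csubspace (sc h) K"
          unfolding K_def
          by (rule B.subspaceI)
            (auto simp: B.subspace_0[OF sub_sp] B.subspace_add[OF sub_sp] B.subspace_scale[OF sub_sp] h
             linear_on_0[OF lin B.vector_space_axioms sub_sp] linear_on_add[OF lin] linear_on_scale[OF lin])
        moreover have "{z. (h, z) \<in> Z} \<subseteq> K" using xs Z by (auto simp: K_def annihilates_def finite_points_def)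
        ultimately have "z \<in> K" using B.span_minimal True by blast
        then have "annihilates xs (insert p Z)" using xs by (auto simp: annihilates_def p K_def)
        then show False using contra xs by blast
      next
        case False
        obtain xs0 where xs0: "annihilates xs0 Z" "act xs0 h z \<noteq> 0" using insert.IH[OF Z h z False] by blast
        have surj: "\<exists>xs. annihilates xs Z \<and> act xs h z = y" if "y \<in> sp h" for y
          by (rule annihilates_orbit[OF Z h z xs0 that])
        have neg: "annihilates (scale_modes (-1) xs) Z" if xs: "annihilates xs Z" for xs
        proof -
          have "act (scale_modes (-1) xs) k x = 0" if "(k, x) \<in> Z" for k x
          proof -
            have k: "k \<in> G" "x \<in> sp k" using that Z by (auto simp: finite_points_def)
            interpret H: cvector_space "sc k" by (rule vs[OF k(1)])
            show ?thesis using act_scale[of xs k x "-1"] xs that k by (auto simp: annihilates_def)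
          qed
          then show ?thesis using xs modes_scale by (auto simp: annihilates_def)
        qed
        \<comment> \<open>Two lists with the same value at z differ by one that annihilates Z and z,
          and by the assumption to be refuted this difference kills w.\<close>
        have wd: "act xs g w = act ys g w" if "annihilates xs Z" "annihilates ys Z" "act xs h z = act ys h z" for xs ys
        proof (rule ccontr)
          assume ne: "act xs g w \<noteq> act ys g w"
          let ?d = "xs @ scale_modes (-1) ys"
          have my: "modes xs" "modes ys" using that by (auto simp: annihilates_def)
          have "annihilates ?d Z" using that(1) neg[OF that(2)] by (auto simp: annihilates_def)
          moreover have "act ?d h z = 0" using that(3) act_scale[OF my(2) h z] by simp
          ultimately have "annihilates ?d (insert p Z)" by (auto simp: annihilates_def p)
          moreover have "act ?d g w \<noteq> 0" using ne act_scale[OF my(2) g w] by simp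
          ultimately show False using contra by blast
        qed
        \<comment> \<open>Defined on the whole of M(h), since every element is the value at z of
          some list annihilating Z.\<close>
        define \<theta> where "\<theta> y = act (SOME xs. annihilates xs Z \<and> act xs h z = y) g w" for y
        have th: "\<theta> (act xs h z) = act xs g w" if xs: "annihilates xs Z" for xs
        proof -
          have "annihilates (SOME ys. annihilates ys Z \<and> act ys h z = act xs h z) Z \<and>
              act (SOME ys. annihilates ys Z \<and> act ys h z = act xs h z) h z = act xs h z"
            by (rule someI[of "\<lambda>ys. annihilates ys Z \<and> act ys h z = act xs h z" xs]) (use xs in simp)
          then show ?thesis unfolding \<theta>_def using wd xs by blast
        qed
        have lin: "linear_on (sc h) (sc g) (sp h) \<theta>"
          unfolding linear_on_def
        proof (intro conjI ballI allI)
          fix a b assume "a \<in> sp h" "b \<in> sp h"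
          then obtain xs ys where xy: "annihilates xs Z" "act xs h z = a" "annihilates ys Z" "act ys h z = b" using surj by meson
          then have "annihilates (xs @ ys) Z" by (auto simp: annihilates_def)
          from th[OF this] show "\<theta> (a + b) = \<theta> a + \<theta> b" using xy th[OF xy(1)] th[OF xy(3)] by simp
        next
          fix c a assume "a \<in> sp h"
          then obtain xs where xs: "annihilates xs Z" "act xs h z = a" using surj by meson
          have m: "modes xs" using xs by (simp add: annihilates_def)
          have "act (scale_modes c xs) k x = 0" if "(k, x) \<in> Z" for k x
          proof -
            have k: "k \<in> G" "x \<in> sp k" using that Z by (auto simp: finite_points_def)
            interpret H: cvector_space "sc k" by (rule vs[OF k(1)])
            show ?thesis using act_scale[OF m, of k x c] xs that k by (auto simp: annihilates_def)
          qed
          then have "annihilates (scale_modes c xs) Z" using m modes_scale by (auto simp: annihilates_def)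
          from th[OF this] show "\<theta> (sc h c a) = sc g c (\<theta> a)"
            using act_scale[OF m h z] act_scale[OF m g w] xs th[OF xs(1)] by simp
        qed
        have cl: "\<theta> y \<in> sp g" if y: "y \<in> sp h" for y
        proof -
          obtain xs where xs: "annihilates xs Z" "act xs h z = y" using surj[OF y] by blast
          then show ?thesis using th[OF xs(1)] act_in[OF _ g w] by (auto simp: annihilates_def)
        qed
        have com: "\<theta> (mo h v n y) = mo g v n (\<theta> y)" if v: "v \<in> vspace V" and y: "y \<in> sp h" for v n y
        proof -
          obtain xs where xs: "annihilates xs Z" "act xs h z = y" using surj[OF y] by blast
          have "finite_points {(h, z), (g, w)}" using g w h z by (simp add: finite_points_def)
          from annihilates_mode_act[OF Z xs(1) v this, of n] obtain ys where
            ys: "annihilates ys Z" "act ys h z = mo h v n (act xs h z)" "act ys g w = mo g v n (act xs g w)" by auto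
          then show ?thesis using th[OF ys(1)] th[OF xs(1)] xs(2) by simp
        qed
        have "\<exists>c. h = g \<and> (\<forall>xs. annihilates xs Z \<longrightarrow> act xs g w = sc g c (act xs g z)) \<or>
            (\<forall>xs. annihilates xs Z \<longrightarrow> act xs g w = 0)"
        proof (cases "h = g")
          case True
          obtain c where "\<forall>y\<in>sp g. \<theta> y = sc g c y"
            using intertwiner_scalar[OF g, of \<theta>] lin cl com unfolding True by blast
          then have "act xs g w = sc g c (act xs g z)" if "annihilates xs Z" for xs
            using th[OF that] act_in[OF _ h z, of xs] that True by (simp add: annihilates_def)
          then show ?thesis using True by blast
        next
          case False
          have "act xs g w = 0" if "annihilates xs Z" for xs
            using th[OF that] act_in[OF _ h z, of xs] that intertwiner_zero[OF h g False lin cl com] by (simp add: annihilates_def)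
          then show ?thesis by blast
        qed
        then obtain c where c: "h = g \<and> (\<forall>xs. annihilates xs Z \<longrightarrow> act xs g w = sc g c (act xs g z)) \<or>
            (\<forall>xs. annihilates xs Z \<longrightarrow> act xs g w = 0)" by blast
        then show False
        proof
          assume c: "h = g \<and> (\<forall>xs. annihilates xs Z \<longrightarrow> act xs g w = sc g c (act xs g z))"
          have zg: "z \<in> sp g" using z c by simp
          have d: "w - sc g c z \<in> sp g" using w zg A.subspace_diff[OF sub_sp[OF g]] A.subspace_scale[OF sub_sp[OF g]] by blast
          \<comment> \<open>Every list annihilating Z kills w - c z, so the induction hypothesis
            allows only the span.\<close>
          have "w - sc g c z \<in> Modules.module.span (sc g) {z. (g, z) \<in> Z}"
          proof (rule ccontr)
            assume "\<not> ?thesis"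
            from insert.IH[OF Z g d this] obtain xs where xs: "annihilates xs Z" "act xs g (w - sc g c z) \<noteq> 0" by blast
            have lin: "linear_on (sc g) (sc g) (sp g) (act xs g)" using act_linear g xs by (simp add: annihilates_def)
            have "act xs g (w - sc g c z) = act xs g w - sc g c (act xs g z)"
              using linear_on_diff[OF lin A.vector_space_axioms A.vector_space_axioms sub_sp[OF g] w]
                A.subspace_scale[OF sub_sp[OF g] zg] linear_on_scale[OF lin zg] by simp
            then show False using xs c by simp
          qed
          then have "w - sc g c z \<in> Modules.module.span (sc g) {z. (g, z) \<in> insert p Z}"
            using A.span_mono[of "{z. (g, z) \<in> Z}" "{z. (g, z) \<in> insert p Z}"] by auto
          moreover have "z \<in> Modules.module.span (sc g) {z. (g, z) \<in> insert p Z}" using c p by (intro A.span_base) auto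
          ultimately have "(w - sc g c z) + sc g c z \<in> Modules.module.span (sc g) {z. (g, z) \<in> insert p Z}"
            by (intro A.span_add A.span_scale)
          then show False using insert.prems(4) by simp
        next
          assume "\<forall>xs. annihilates xs Z \<longrightarrow> act xs g w = 0"
          then show False using insert.IH[OF Z g w out] by blast
        qed
      qed
    qed
  qed
  then show ?thesis using annihilates_orbit[OF Z(2) g w _ _ y] by blast
qed

end

section \<open>Representations of twisted group algebras\<close>

definition mtrace :: "nat \<Rightarrow> complex mat \<Rightarrow> complex" where
  "mtrace n A = (\<Sum>i<n. A $$ (i, i))"

lemma index_mult_mat_sum:
  assumes "A \<in> carrier_mat n m" "B \<in> carrier_mat m l" "i < n" "j < l"
  shows "(A * B) $$ (i, j) = (\<Sum>k<m. A $$ (i, k) * B $$ (k, j))"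
  using assms by (simp add: scalar_prod_def atLeast0LessThan)

lemma mtrace_comm:
  assumes A: "A \<in> carrier_mat n m" and B: "B \<in> carrier_mat m n"
  shows "mtrace n (A * B) = mtrace m (B * A)"
proof -
  have "mtrace n (A * B) = (\<Sum>i<n. \<Sum>k<m. A $$ (i, k) * B $$ (k, i))"
    unfolding mtrace_def by (intro sum.cong refl index_mult_mat_sum[OF A B]) auto
  also have "\<dots> = (\<Sum>k<m. \<Sum>i<n. B $$ (k, i) * A $$ (i, k))"
    by (subst sum.swap) (simp add: mult.commute)
  also have "\<dots> = mtrace m (B * A)"
    unfolding mtrace_def by (intro sum.cong refl index_mult_mat_sum[OF B A, symmetric]) auto
  finally show ?thesis .
qed

lemma mult_mat_unit_vec:
  fixes A :: "complex mat"
  assumes A: "A \<in> carrier_mat n m" and j: "j < m"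
  shows "A *\<^sub>v unit_vec m j = col A j"
proof (rule eq_vecI)
  fix i assume "i < dim_vec (col A j)"
  then have i: "i < n" using A by simp
  have "(A *\<^sub>v unit_vec m j) $ i = (\<Sum>k\<in>{0..<m}. A $$ (i, k) * (if k = j then 1 else 0))"
    using A i by (simp add: scalar_prod_def unit_vec_def)
  also have "\<dots> = (\<Sum>k\<in>{0..<m}. if k = j then A $$ (i, k) else 0)" by (intro sum.cong) auto
  also have "\<dots> = col A j $ i" using A i j by simp
  finally show "(A *\<^sub>v unit_vec m j) $ i = col A j $ i" .
qed (use A in auto)

lemma smult_mat_mult_vec:
  fixes c :: complex
  assumes "A \<in> carrier_mat n m" "v \<in> carrier_vec m"
  shows "(c \<cdot>\<^sub>m A) *\<^sub>v v = c \<cdot>\<^sub>v (A *\<^sub>v v)"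
  using assms by (intro eq_vecI) (auto simp: scalar_prod_def sum_distrib_left mult.assoc)

text \<open>The dimensions are arguments so that the empty sum is the zero matrix of the right
  size.\<close>

definition matsum :: "nat \<Rightarrow> nat \<Rightarrow> 'a set \<Rightarrow> ('a \<Rightarrow> complex mat) \<Rightarrow> complex mat" where
  "matsum n m I f = mat n m (\<lambda>ij. \<Sum>a\<in>I. f a $$ ij)"

lemma matsum_carrier [simp]: "matsum n m I f \<in> carrier_mat n m"
  by (simp add: matsum_def)

lemma mult_matsum:
  assumes "B \<in> carrier_mat l n" "\<And>a. a \<in> I \<Longrightarrow> f a \<in> carrier_mat n m"
  shows "B * matsum n m I f = matsum l m I (\<lambda>a. B * f a)"
proof (rule eq_matI)
  fix i j assume "i < dim_row (matsum l m I (\<lambda>a. B * f a))" "j < dim_col (matsum l m I (\<lambda>a. B * f a))"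
  then have ij: "i < l" "j < m" by (auto simp: matsum_def)
  have "(B * matsum n m I f) $$ (i, j) = (\<Sum>k<n. B $$ (i, k) * (\<Sum>a\<in>I. f a $$ (k, j)))"
    using ij by (subst index_mult_mat_sum[OF assms(1) matsum_carrier]) (auto simp: matsum_def)
  also have "\<dots> = (\<Sum>a\<in>I. \<Sum>k<n. B $$ (i, k) * f a $$ (k, j))"
    unfolding sum_distrib_left by (rule sum.swap)
  also have "\<dots> = (\<Sum>a\<in>I. (B * f a) $$ (i, j))"
    using ij assms by (intro sum.cong refl index_mult_mat_sum[symmetric]) auto
  finally show "(B * matsum n m I f) $$ (i, j) = matsum l m I (\<lambda>a. B * f a) $$ (i, j)"
    using ij by (simp add: matsum_def)
qed (use assms in \<open>auto simp: matsum_def\<close>)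

lemma matsum_mult:
  assumes "B \<in> carrier_mat m l" "\<And>a. a \<in> I \<Longrightarrow> f a \<in> carrier_mat n m"
  shows "matsum n m I f * B = matsum n l I (\<lambda>a. f a * B)"
proof (rule eq_matI)
  fix i j assume "i < dim_row (matsum n l I (\<lambda>a. f a * B))" "j < dim_col (matsum n l I (\<lambda>a. f a * B))"
  then have ij: "i < n" "j < l" by (auto simp: matsum_def)
  have "(matsum n m I f * B) $$ (i, j) = (\<Sum>k<m. (\<Sum>a\<in>I. f a $$ (i, k)) * B $$ (k, j))"
    using ij by (subst index_mult_mat_sum[OF matsum_carrier assms(1)]) (auto simp: matsum_def)
  also have "\<dots> = (\<Sum>a\<in>I. \<Sum>k<m. f a $$ (i, k) * B $$ (k, j))"
    unfolding sum_distrib_right by (rule sum.swap)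
  also have "\<dots> = (\<Sum>a\<in>I. (f a * B) $$ (i, j))"
    using ij assms by (intro sum.cong refl index_mult_mat_sum[symmetric]) auto
  finally show "(matsum n m I f * B) $$ (i, j) = matsum n l I (\<lambda>a. f a * B) $$ (i, j)"
    using ij by (simp add: matsum_def)
qed (use assms in \<open>auto simp: matsum_def\<close>)

definition invariant_subspace :: "nat \<Rightarrow> 'a set \<Rightarrow> ('a \<Rightarrow> complex mat) \<Rightarrow> complex vec set \<Rightarrow> bool" where
  "invariant_subspace d A \<rho> U \<longleftrightarrow> U \<subseteq> carrier_vec d \<and> 0\<^sub>v d \<in> U \<and> (\<forall>x\<in>U. \<forall>y\<in>U. x + y \<in> U) \<and>
     (\<forall>c. \<forall>x\<in>U. c \<cdot>\<^sub>v x \<in> U) \<and> (\<forall>a\<in>A. \<forall>x\<in>U. \<rho> a *\<^sub>v x \<in> U)"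

section \<open>Projective representations and modules over the twisted group algebra\<close>

locale twisted_group = group H for H :: "('g, 'b) monoid_scheme" (structure) +
  fixes \<alpha> :: "'g \<Rightarrow> 'g \<Rightarrow> complex"
  assumes finite_carrier: "finite (carrier H)"
    and cocycle_nonzero: "a \<in> carrier H \<Longrightarrow> b \<in> carrier H \<Longrightarrow> \<alpha> a b \<noteq> 0"
begin

text \<open>The cocycle is not normalised. The unit of the algebra is the inverse of \<alpha>(1,1)
  times a basis element, whence the scalar at the neutral element.\<close>

definition proj_rep :: "nat \<Rightarrow> ('g \<Rightarrow> complex mat) \<Rightarrow> bool" where
  "proj_rep d \<rho> \<longleftrightarrow> (\<forall>a\<in>carrier H. \<rho> a \<in> carrier_mat d d) \<and> \<rho> \<one> = \<alpha> \<one> \<one> \<cdot>\<^sub>m 1\<^sub>m d \<and>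
     (\<forall>a\<in>carrier H. \<forall>b\<in>carrier H. \<rho> a * \<rho> b = \<alpha> a b \<cdot>\<^sub>m \<rho> (a \<otimes> b))"

definition simple_proj_rep :: "nat \<Rightarrow> ('g \<Rightarrow> complex mat) \<Rightarrow> bool" where
  "simple_proj_rep d \<rho> \<longleftrightarrow> proj_rep d \<rho> \<and> d > 0 \<and>
     (\<forall>U. invariant_subspace d (carrier H) \<rho> U \<longrightarrow> U = {0\<^sub>v d} \<or> U = carrier_vec d)"

abbreviation "Alg \<equiv> twisted_group_algebra H \<alpha>"

definition ext :: "nat \<Rightarrow> ('g \<Rightarrow> complex mat) \<Rightarrow> ('g \<Rightarrow> complex) \<Rightarrow> complex mat" where
  "ext d \<rho> x = mat d d (\<lambda>ij. \<Sum>a\<in>carrier H. x a * \<rho> a $$ ij)"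

lemma carrier_Alg: "x \<in> carrier Alg \<longleftrightarrow> (\<forall>a. a \<notin> carrier H \<longrightarrow> x a = 0)"
  by (simp add: twisted_group_algebra_def)

lemma basis_elt_in: "a \<in> carrier H \<Longrightarrow> basis_elt a \<in> carrier Alg"
  by (auto simp: carrier_Alg basis_elt_def)

lemma mult_Alg: "x \<otimes>\<^bsub>Alg\<^esub> y = (\<lambda>c. \<Sum>a\<in>carrier H. \<Sum>b\<in>carrier H. if a \<otimes> b = c then x a * y b * \<alpha> a b else 0)"
proof
  fix c
  have "(x \<otimes>\<^bsub>Alg\<^esub> y) c = (\<Sum>(a, b)\<in>{(a, b) \<in> carrier H \<times> carrier H. a \<otimes> b = c}. x a * y b * \<alpha> a b)"
    by (simp add: twisted_group_algebra_def)
  also have "{(a, b) \<in> carrier H \<times> carrier H. a \<otimes> b = c} = {p \<in> carrier H \<times> carrier H. fst p \<otimes> snd p = c}"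
    by auto
  also have "(\<Sum>(a, b)\<in>{p \<in> carrier H \<times> carrier H. fst p \<otimes> snd p = c}. x a * y b * \<alpha> a b) =
      (\<Sum>p\<in>carrier H \<times> carrier H. if fst p \<otimes> snd p = c then x (fst p) * y (snd p) * \<alpha> (fst p) (snd p) else 0)"
    by (subst sum.inter_filter[symmetric]) (auto simp: finite_carrier case_prod_unfold)
  also have "\<dots> = (\<Sum>(a, b)\<in>carrier H \<times> carrier H. if a \<otimes> b = c then x a * y b * \<alpha> a b else 0)"
    by (simp add: case_prod_unfold)
  finally show "(x \<otimes>\<^bsub>Alg\<^esub> y) c = (\<Sum>a\<in>carrier H. \<Sum>b\<in>carrier H. if a \<otimes> b = c then x a * y b * \<alpha> a b else 0)"
    by (simp add: sum.cartesian_product)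
qed

lemma sum_delta2:
  assumes "a \<in> carrier H" "b \<in> carrier H"
  shows "(\<Sum>a'\<in>carrier H. \<Sum>b'\<in>carrier H. if a' = a \<and> b' = b then f a' b' else (0::complex)) = f a b"
proof -
  have "(\<Sum>a'\<in>carrier H. \<Sum>b'\<in>carrier H. if a' = a \<and> b' = b then f a' b' else 0) =
      (\<Sum>a'\<in>carrier H. if a' = a then (\<Sum>b'\<in>carrier H. if b' = b then f a' b' else 0) else 0)"
    by (intro sum.cong refl) auto
  then show ?thesis using assms finite_carrier by simp
qed

lemma mult_basis:
  assumes "a \<in> carrier H" "b \<in> carrier H"
  shows "basis_elt a \<otimes>\<^bsub>Alg\<^esub> basis_elt b = (\<lambda>c. \<alpha> a b * basis_elt (a \<otimes> b) c)"
proof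
  fix c
  have "(basis_elt a \<otimes>\<^bsub>Alg\<^esub> basis_elt b) c =
     (\<Sum>a'\<in>carrier H. \<Sum>b'\<in>carrier H. if a' = a \<and> b' = b then (if a' \<otimes> b' = c then \<alpha> a' b' else 0) else 0)"
    unfolding mult_Alg by (intro sum.cong refl) (auto simp: basis_elt_def)
  also have "\<dots> = (if a \<otimes> b = c then \<alpha> a b else 0)" by (rule sum_delta2[OF assms])
  finally show "(basis_elt a \<otimes>\<^bsub>Alg\<^esub> basis_elt b) c = \<alpha> a b * basis_elt (a \<otimes> b) c"
    by (auto simp: basis_elt_def)
qed

lemma one_Alg: "\<one>\<^bsub>Alg\<^esub> = (\<lambda>a. inverse (\<alpha> \<one> \<one>) * basis_elt \<one> a)"
  by (auto simp: twisted_group_algebra_def basis_elt_def)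

lemma add_Alg: "x \<oplus>\<^bsub>Alg\<^esub> y = (\<lambda>a. x a + y a)"
  by (simp add: twisted_group_algebra_def)

lemma matrix_repD:
  assumes "matrix_rep Alg d R"
  shows "\<And>x. x \<in> carrier Alg \<Longrightarrow> R x \<in> carrier_mat d d"
    "\<And>x y. x \<in> carrier Alg \<Longrightarrow> y \<in> carrier Alg \<Longrightarrow> R (x \<otimes>\<^bsub>Alg\<^esub> y) = R x * R y"
    "\<And>x y. x \<in> carrier Alg \<Longrightarrow> y \<in> carrier Alg \<Longrightarrow> R (\<lambda>a. x a + y a) = R x + R y"
    "R \<one>\<^bsub>Alg\<^esub> = 1\<^sub>m d"
    "\<And>c x. x \<in> carrier Alg \<Longrightarrow> R (\<lambda>a. c * x a) = c \<cdot>\<^sub>m R x"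
  using assms unfolding matrix_rep_def Ring.ring_hom_def
  by (auto simp: ring_mat_simps add_Alg Pi_def)

lemma matrix_rep_basis:
  assumes R: "matrix_rep Alg d R"
  shows "proj_rep d (\<lambda>a. R (basis_elt a))"
  unfolding proj_rep_def
proof (intro conjI ballI)
  fix a assume a: "a \<in> carrier H"
  then show "R (basis_elt a) \<in> carrier_mat d d" using matrix_repD(1)[OF R] basis_elt_in by blast
  fix b assume b: "b \<in> carrier H"
  show "R (basis_elt a) * R (basis_elt b) = \<alpha> a b \<cdot>\<^sub>m R (basis_elt (a \<otimes> b))"
    using matrix_repD(2)[OF R basis_elt_in[OF a] basis_elt_in[OF b], symmetric]
      matrix_repD(5)[OF R basis_elt_in[OF m_closed[OF a b]]] by (simp add: mult_basis a b)
next
  have 1: "\<alpha> \<one> \<one> \<noteq> 0" by (intro cocycle_nonzero) auto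
  have "1\<^sub>m d = inverse (\<alpha> \<one> \<one>) \<cdot>\<^sub>m R (basis_elt \<one>)"
    using matrix_repD(4)[OF R] matrix_repD(5)[OF R basis_elt_in[OF one_closed]] by (simp add: one_Alg)
  then have "\<alpha> \<one> \<one> \<cdot>\<^sub>m 1\<^sub>m d = \<alpha> \<one> \<one> \<cdot>\<^sub>m (inverse (\<alpha> \<one> \<one>) \<cdot>\<^sub>m R (basis_elt \<one>))" by simp
  also have "\<dots> = R (basis_elt \<one>)"
    using 1 by (intro eq_matI) (auto simp flip: mult.assoc)
  finally show "R (basis_elt \<one>) = \<alpha> \<one> \<one> \<cdot>\<^sub>m 1\<^sub>m d" by simp
qed

lemma matrix_rep_span_induct [consumes 1, case_names zero step]:
  assumes x: "x \<in> carrier Alg"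
    and z: "P (\<lambda>a. 0)"
    and step: "\<And>y c b. y \<in> carrier Alg \<Longrightarrow> b \<in> carrier H \<Longrightarrow> P y \<Longrightarrow> P (\<lambda>a. y a + c * basis_elt b a)"
  shows "P x"
proof -
  have "P (\<lambda>a. if a \<in> S then x a else 0)" if "S \<subseteq> carrier H" for S
    using finite_subset[OF that finite_carrier] that
  proof (induction S rule: finite_induct)
    case empty then show ?case using z by simp
  next
    case (insert b S)
    have "P (\<lambda>a. (if a \<in> S then x a else 0) + x b * basis_elt b a)"
      using insert by (intro step) (auto simp: carrier_Alg)
    also have "(\<lambda>a. (if a \<in> S then x a else 0) + x b * basis_elt b a) = (\<lambda>a. if a \<in> insert b S then x a else 0)"
      using insert by (auto simp: basis_elt_def)
    finally show ?case .
  qed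
  from this[of "carrier H"] have "P (\<lambda>a. if a \<in> carrier H then x a else 0)" by simp
  also have "(\<lambda>a. if a \<in> carrier H then x a else 0) = x" using x by (auto simp: carrier_Alg)
  finally show ?thesis .
qed

lemma scale_basis_in: "b \<in> carrier H \<Longrightarrow> (\<lambda>a. c * basis_elt b a) \<in> carrier Alg"
  by (auto simp: carrier_Alg basis_elt_def)

lemma matrix_rep_expand:
  assumes R: "matrix_rep Alg d R" and x: "x \<in> carrier Alg"
  shows "R x = ext d (\<lambda>a. R (basis_elt a)) x"
  using x
proof (induction x rule: matrix_rep_span_induct)
  case zero
  have "R (\<lambda>a. 0 * basis_elt \<one> a) = 0 \<cdot>\<^sub>m R (basis_elt \<one>)" by (rule matrix_repD(5)[OF R basis_elt_in]) simp
  then show ?case using matrix_repD(1)[OF R basis_elt_in[OF one_closed]] by (intro eq_matI) (auto simp: ext_def)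
next
  case (step y c b)
  have "R (\<lambda>a. y a + c * basis_elt b a) = R y + c \<cdot>\<^sub>m R (basis_elt b)"
    using step matrix_repD(3)[OF R _ scale_basis_in] matrix_repD(5)[OF R] basis_elt_in by simp
  also have "\<dots> = ext d (\<lambda>a. R (basis_elt a)) (\<lambda>a. y a + c * basis_elt b a)"
  proof (rule eq_matI)
    fix i j assume "i < dim_row (ext d (\<lambda>a. R (basis_elt a)) (\<lambda>a. y a + c * basis_elt b a))"
      "j < dim_col (ext d (\<lambda>a. R (basis_elt a)) (\<lambda>a. y a + c * basis_elt b a))"
    then have ij: "i < d" "j < d" by (auto simp: ext_def)
    have "(\<Sum>a\<in>carrier H. c * basis_elt b a * R (basis_elt a) $$ (i, j)) =
      (\<Sum>a\<in>carrier H. if a = b then c * R (basis_elt a) $$ (i, j) else 0)"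
      by (intro sum.cong refl) (auto simp: basis_elt_def)
    then show "(R y + c \<cdot>\<^sub>m R (basis_elt b)) $$ (i, j) =
        ext d (\<lambda>a. R (basis_elt a)) (\<lambda>a. y a + c * basis_elt b a) $$ (i, j)"
      using ij matrix_repD(1)[OF R basis_elt_in[OF step(2)]] matrix_repD(1)[OF R step(1)] step finite_carrier
      by (simp add: ext_def distrib_right sum.distrib)
  qed (use matrix_repD(1)[OF R basis_elt_in[OF step(2)]] in \<open>auto simp: ext_def\<close>)
  finally show ?case .
qed

lemma simple_matrix_rep_basis:
  assumes R: "simple_matrix_rep Alg d R"
  shows "simple_proj_rep d (\<lambda>a. R (basis_elt a))"
proof -
  have mr: "matrix_rep Alg d R" and d: "d > 0" using R by (auto simp: simple_matrix_rep_def)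
  have "U = {0\<^sub>v d} \<or> U = carrier_vec d" if U: "invariant_subspace d (carrier H) (\<lambda>a. R (basis_elt a)) U" for U
  proof -
    have sub: "U \<subseteq> carrier_vec d" and U0: "0\<^sub>v d \<in> U" and Ua: "\<And>x y. x \<in> U \<Longrightarrow> y \<in> U \<Longrightarrow> x + y \<in> U"
      and Us: "\<And>c x. x \<in> U \<Longrightarrow> c \<cdot>\<^sub>v x \<in> U" and Ub: "\<And>a x. a \<in> carrier H \<Longrightarrow> x \<in> U \<Longrightarrow> R (basis_elt a) *\<^sub>v x \<in> U"
      using U by (auto simp: invariant_subspace_def)
    have "R x *\<^sub>v u \<in> U" if x: "x \<in> carrier Alg" and u: "u \<in> U" for x u
      using x
    proof (induction x rule: matrix_rep_span_induct)
      case zero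
      have "R (\<lambda>a. 0) = 0\<^sub>m d d"
        by (subst matrix_rep_expand[OF mr]) (auto simp: carrier_Alg ext_def intro!: eq_matI)
      moreover have "0\<^sub>m d d *\<^sub>v u = 0\<^sub>v d" using u sub by (intro eq_vecI) (auto simp: scalar_prod_def)
      ultimately show ?case using U0 by simp
    next
      case (step y c b)
      have u': "u \<in> carrier_vec d" using u sub by auto
      have "R (\<lambda>a. y a + c * basis_elt b a) = R y + c \<cdot>\<^sub>m R (basis_elt b)"
        using step matrix_repD(3)[OF mr _ scale_basis_in] matrix_repD(5)[OF mr] basis_elt_in by simp
      moreover have "(R y + c \<cdot>\<^sub>m R (basis_elt b)) *\<^sub>v u = R y *\<^sub>v u + c \<cdot>\<^sub>v (R (basis_elt b) *\<^sub>v u)"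
        using matrix_repD(1)[OF mr basis_elt_in[OF step(2)]] matrix_repD(1)[OF mr step(1)] u'
        by (subst add_mult_distrib_mat_vec[of _ d d]) (auto simp: smult_mat_mult_vec)
      ultimately show ?case using step Ua Us Ub[OF step(2) u] by simp
    qed
    then have "U \<subseteq> carrier_vec d \<and> 0\<^sub>v d \<in> U \<and> (\<forall>x\<in>U. \<forall>y\<in>U. x + y \<in> U) \<and>
          (\<forall>c. \<forall>x\<in>U. c \<cdot>\<^sub>v x \<in> U) \<and> (\<forall>a\<in>carrier Alg. \<forall>x\<in>U. R a *\<^sub>v x \<in> U)"
      using sub U0 Ua Us by blast
    then show ?thesis using R unfolding simple_matrix_rep_def by blast
  qed
  then show ?thesis using matrix_rep_basis[OF mr] d by (simp add: simple_proj_rep_def)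
qed

lemma ext_basis:
  assumes "proj_rep d \<rho>" "a \<in> carrier H"
  shows "ext d \<rho> (basis_elt a) = \<rho> a"
proof (rule eq_matI)
  have c: "\<rho> a \<in> carrier_mat d d" using assms by (simp add: proj_rep_def)
  fix i j assume "i < dim_row (\<rho> a)" "j < dim_col (\<rho> a)"
  then have ij: "i < d" "j < d" using c by auto
  have "(\<Sum>b\<in>carrier H. basis_elt a b * \<rho> b $$ (i, j)) = (\<Sum>b\<in>carrier H. if b = a then \<rho> b $$ (i, j) else 0)"
    by (intro sum.cong refl) (auto simp: basis_elt_def)
  then show "ext d \<rho> (basis_elt a) $$ (i, j) = \<rho> a $$ (i, j)" using ij assms finite_carrier by (simp add: ext_def)
qed (use assms in \<open>auto simp: ext_def proj_rep_def\<close>)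

lemma matrix_rep_ext:
  assumes \<rho>: "proj_rep d \<rho>"
  shows "matrix_rep Alg d (ext d \<rho>)"
proof -
  have c: "\<rho> a \<in> carrier_mat d d" if "a \<in> carrier H" for a using that \<rho> by (simp add: proj_rep_def)
  have pm: "\<rho> a * \<rho> b = \<alpha> a b \<cdot>\<^sub>m \<rho> (a \<otimes> b)" if "a \<in> carrier H" "b \<in> carrier H" for a b
    using that \<rho> by (simp add: proj_rep_def)
  have ec: "ext d \<rho> x \<in> carrier_mat d d" for x by (simp add: ext_def)
  have "ext d \<rho> (x \<otimes>\<^bsub>Alg\<^esub> y) = ext d \<rho> x * ext d \<rho> y" for x y
  proof (rule eq_matI)
    fix i j assume "i < dim_row (ext d \<rho> x * ext d \<rho> y)" "j < dim_col (ext d \<rho> x * ext d \<rho> y)"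
    then have ij: "i < d" "j < d" by (auto simp: ext_def)
    have "(ext d \<rho> x * ext d \<rho> y) $$ (i, j) =
       (\<Sum>k<d. (\<Sum>a\<in>carrier H. x a * \<rho> a $$ (i, k)) * (\<Sum>b\<in>carrier H. y b * \<rho> b $$ (k, j)))"
      unfolding index_mult_mat_sum[OF ec ec ij] by (intro sum.cong refl) (use ij in \<open>auto simp: ext_def\<close>)
    also have "\<dots> = (\<Sum>k<d. \<Sum>a\<in>carrier H. \<Sum>b\<in>carrier H. x a * y b * (\<rho> a $$ (i, k) * \<rho> b $$ (k, j)))"
      by (simp add: sum_product algebra_simps)
    also have "\<dots> = (\<Sum>a\<in>carrier H. \<Sum>k<d. \<Sum>b\<in>carrier H. x a * y b * (\<rho> a $$ (i, k) * \<rho> b $$ (k, j)))"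
      by (rule sum.swap)
    also have "\<dots> = (\<Sum>a\<in>carrier H. \<Sum>b\<in>carrier H. \<Sum>k<d. x a * y b * (\<rho> a $$ (i, k) * \<rho> b $$ (k, j)))"
      by (rule sum.cong[OF refl]) (rule sum.swap)
    also have "\<dots> = (\<Sum>a\<in>carrier H. \<Sum>b\<in>carrier H. x a * y b * \<alpha> a b * \<rho> (a \<otimes> b) $$ (i, j))"
    proof (intro sum.cong refl)
      fix a b assume ab: "a \<in> carrier H" "b \<in> carrier H"
      have "(\<Sum>k<d. x a * y b * (\<rho> a $$ (i, k) * \<rho> b $$ (k, j))) = x a * y b * (\<rho> a * \<rho> b) $$ (i, j)"
        unfolding index_mult_mat_sum[OF c[OF ab(1)] c[OF ab(2)] ij] by (simp add: sum_distrib_left)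
      also have "(\<rho> a * \<rho> b) $$ (i, j) = \<alpha> a b * \<rho> (a \<otimes> b) $$ (i, j)"
        unfolding pm[OF ab] using c[OF m_closed[OF ab]] ij by simp
      finally show "(\<Sum>k<d. x a * y b * (\<rho> a $$ (i, k) * \<rho> b $$ (k, j))) = x a * y b * \<alpha> a b * \<rho> (a \<otimes> b) $$ (i, j)" by simp
    qed
    also have "\<dots> = (\<Sum>a\<in>carrier H. \<Sum>b\<in>carrier H. \<Sum>e\<in>carrier H. if e = a \<otimes> b then x a * y b * \<alpha> a b * \<rho> e $$ (i, j) else 0)"
      using finite_carrier by (intro sum.cong refl) simp
    also have "\<dots> = (\<Sum>a\<in>carrier H. \<Sum>e\<in>carrier H. \<Sum>b\<in>carrier H. if e = a \<otimes> b then x a * y b * \<alpha> a b * \<rho> e $$ (i, j) else 0)"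
      by (rule sum.cong[OF refl]) (rule sum.swap)
    also have "\<dots> = (\<Sum>e\<in>carrier H. \<Sum>a\<in>carrier H. \<Sum>b\<in>carrier H. if e = a \<otimes> b then x a * y b * \<alpha> a b * \<rho> e $$ (i, j) else 0)"
      by (rule sum.swap)
    also have "\<dots> = (\<Sum>e\<in>carrier H. (x \<otimes>\<^bsub>Alg\<^esub> y) e * \<rho> e $$ (i, j))"
      unfolding mult_Alg sum_distrib_right by (intro sum.cong refl) auto
    finally show "ext d \<rho> (x \<otimes>\<^bsub>Alg\<^esub> y) $$ (i, j) = (ext d \<rho> x * ext d \<rho> y) $$ (i, j)"
      using ij by (simp add: ext_def)
  qed (auto simp: ext_def)
  moreover have "ext d \<rho> (\<lambda>a. x a + y a) = ext d \<rho> x + ext d \<rho> y" for x y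
    by (rule eq_matI) (auto simp: ext_def distrib_right sum.distrib)
  moreover have sm: "ext d \<rho> (\<lambda>a. k * x a) = k \<cdot>\<^sub>m ext d \<rho> x" for k x
    by (rule eq_matI) (auto simp: ext_def sum_distrib_left mult.assoc)
  moreover have "ext d \<rho> \<one>\<^bsub>Alg\<^esub> = 1\<^sub>m d"
  proof -
    have 1: "\<alpha> \<one> \<one> \<noteq> 0" by (intro cocycle_nonzero) auto
    have "ext d \<rho> \<one>\<^bsub>Alg\<^esub> = inverse (\<alpha> \<one> \<one>) \<cdot>\<^sub>m (\<alpha> \<one> \<one> \<cdot>\<^sub>m 1\<^sub>m d)"
      unfolding one_Alg sm ext_basis[OF \<rho> one_closed] using \<rho> by (simp add: proj_rep_def)
    then show ?thesis using 1 by (intro eq_matI) auto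
  qed
  ultimately show ?thesis
    unfolding matrix_rep_def Ring.ring_hom_def by (auto simp: ring_mat_simps add_Alg ec)
qed

lemma simple_matrix_rep_ext:
  assumes \<rho>: "simple_proj_rep d \<rho>"
  shows "simple_matrix_rep Alg d (ext d \<rho>)"
proof -
  have pr: "proj_rep d \<rho>" and d: "d > 0" using \<rho> by (auto simp: simple_proj_rep_def)
  have "U = {0\<^sub>v d} \<or> U = carrier_vec d" if U: "U \<subseteq> carrier_vec d \<and> 0\<^sub>v d \<in> U \<and> (\<forall>x\<in>U. \<forall>y\<in>U. x + y \<in> U) \<and>
          (\<forall>c. \<forall>x\<in>U. c \<cdot>\<^sub>v x \<in> U) \<and> (\<forall>a\<in>carrier Alg. \<forall>x\<in>U. ext d \<rho> a *\<^sub>v x \<in> U)" for U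
  proof -
    have "\<rho> a *\<^sub>v x \<in> U" if "a \<in> carrier H" "x \<in> U" for a x
      using U that basis_elt_in[OF that(1)] ext_basis[OF pr that(1)] by metis
    then have "invariant_subspace d (carrier H) \<rho> U" using U unfolding invariant_subspace_def by blast
    then show ?thesis using \<rho> by (simp add: simple_proj_rep_def)
  qed
  then show ?thesis unfolding simple_matrix_rep_def using matrix_rep_ext[OF pr] d by blast
qed

lemma rep_character_eq:
  assumes "matrix_rep Alg d R" "x \<in> carrier Alg"
  shows "rep_character Alg d R x = (\<Sum>a\<in>carrier H. x a * mtrace d (R (basis_elt a)))"
proof -
  have "rep_character Alg d R x = (\<Sum>i<d. \<Sum>a\<in>carrier H. x a * R (basis_elt a) $$ (i, i))"
    using assms by (simp add: rep_character_def matrix_rep_expand[OF assms]) (simp add: ext_def)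
  also have "\<dots> = (\<Sum>a\<in>carrier H. x a * mtrace d (R (basis_elt a)))"
    unfolding mtrace_def sum_distrib_left by (rule sum.swap)
  finally show ?thesis .
qed

lemma rep_character_basis: "a \<in> carrier H \<Longrightarrow> rep_character Alg d R (basis_elt a) = mtrace d (R (basis_elt a))"
  by (simp add: rep_character_def basis_elt_in mtrace_def)

lemma rep_character_eqI:
  assumes "matrix_rep Alg d R" "matrix_rep Alg d' R'"
    and "\<And>a. a \<in> carrier H \<Longrightarrow> mtrace d (R (basis_elt a)) = mtrace d' (R' (basis_elt a))"
  shows "rep_character Alg d R = rep_character Alg d' R'"
proof
  fix x
  show "rep_character Alg d R x = rep_character Alg d' R' x"
  proof (cases "x \<in> carrier Alg")
    case True
    then show ?thesis using assms by (simp add: rep_character_eq)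
  next
    case False
    then show ?thesis by (simp add: rep_character_def)
  qed
qed

end

section \<open>Schur's lemma and orthogonality of matrix coefficients\<close>

context twisted_group
begin

text \<open>The inverse matrix of \<open>\<rho> a\<close>, as the product of \<rho>(a) and
  \<rho>(inv a) is \<alpha>(a, inv a) \<alpha>(1,1) times the identity.\<close>

definition rinv :: "('g \<Rightarrow> complex mat) \<Rightarrow> 'g \<Rightarrow> complex mat" where
  "rinv \<rho> a = inverse (\<alpha> a (inv a) * \<alpha> \<one> \<one>) \<cdot>\<^sub>m \<rho> (inv a)"

lemma rinv_carrier: "proj_rep d \<rho> \<Longrightarrow> a \<in> carrier H \<Longrightarrow> rinv \<rho> a \<in> carrier_mat d d"
  by (simp add: rinv_def proj_rep_def)

lemma rep_rinv:
  assumes \<rho>: "proj_rep d \<rho>" and a: "a \<in> carrier H"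
  shows "\<rho> a * rinv \<rho> a = 1\<^sub>m d" "rinv \<rho> a * \<rho> a = 1\<^sub>m d"
proof -
  have c: "\<rho> a \<in> carrier_mat d d" "\<rho> (inv a) \<in> carrier_mat d d" using assms by (auto simp: proj_rep_def)
  have nz: "\<alpha> a (inv a) \<noteq> 0" "\<alpha> \<one> \<one> \<noteq> 0" using a by (simp_all add: cocycle_nonzero)
  have "\<rho> a * rinv \<rho> a = inverse (\<alpha> a (inv a) * \<alpha> \<one> \<one>) \<cdot>\<^sub>m (\<rho> a * \<rho> (inv a))"
    unfolding rinv_def by (rule mult_smult_distrib[OF c])
  also have "\<rho> a * \<rho> (inv a) = \<alpha> a (inv a) \<cdot>\<^sub>m (\<alpha> \<one> \<one> \<cdot>\<^sub>m 1\<^sub>m d)"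
    using \<rho> a by (simp add: proj_rep_def)
  also have "inverse (\<alpha> a (inv a) * \<alpha> \<one> \<one>) \<cdot>\<^sub>m (\<alpha> a (inv a) \<cdot>\<^sub>m (\<alpha> \<one> \<one> \<cdot>\<^sub>m 1\<^sub>m d)) = 1\<^sub>m d"
    using nz by (intro eq_matI) (auto simp: field_simps)
  finally show 1: "\<rho> a * rinv \<rho> a = 1\<^sub>m d" .
  show "rinv \<rho> a * \<rho> a = 1\<^sub>m d"
    by (rule mat_mult_left_right_inverse[OF c(1) rinv_carrier[OF assms] 1])
qed

text \<open>Obtained by inverting \<rho>(b) \<rho>(a) = \<alpha>(b,a) \<rho>(b a). When a sum over
  the group is reindexed by translation, these factors cancel those produced by \<rho>
  itself.\<close>

lemma rinv_mult:
  assumes \<rho>: "proj_rep d \<rho>" and a: "a \<in> carrier H" and b: "b \<in> carrier H"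
  shows "rinv \<rho> (b \<otimes> a) * \<rho> b = \<alpha> b a \<cdot>\<^sub>m rinv \<rho> a"
    and "\<rho> a * rinv \<rho> (b \<otimes> a) = \<alpha> b a \<cdot>\<^sub>m rinv \<rho> b"
proof -
  have ba: "b \<otimes> a \<in> carrier H" using a b by simp
  have c: "\<rho> a \<in> carrier_mat d d" "\<rho> b \<in> carrier_mat d d" "\<rho> (b \<otimes> a) \<in> carrier_mat d d"
    "rinv \<rho> a \<in> carrier_mat d d" "rinv \<rho> b \<in> carrier_mat d d" "rinv \<rho> (b \<otimes> a) \<in> carrier_mat d d"
    using \<rho> a b ba rinv_carrier by (auto simp: proj_rep_def)
  have ab: "\<rho> b * \<rho> a = \<alpha> b a \<cdot>\<^sub>m \<rho> (b \<otimes> a)" using \<rho> a b by (simp add: proj_rep_def)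
  have "rinv \<rho> (b \<otimes> a) * \<rho> b = rinv \<rho> (b \<otimes> a) * \<rho> b * (\<rho> a * rinv \<rho> a)"
    using c rep_rinv[OF \<rho> a] by simp
  also have "\<dots> = rinv \<rho> (b \<otimes> a) * (\<rho> b * \<rho> a) * rinv \<rho> a"
    using c by (simp add: assoc_mult_mat[of _ d d _ d _ d])
  also have "rinv \<rho> (b \<otimes> a) * (\<rho> b * \<rho> a) = \<alpha> b a \<cdot>\<^sub>m 1\<^sub>m d"
    unfolding ab rep_rinv(2)[OF \<rho> ba, symmetric] by (rule mult_smult_distrib[OF c(6,3)])
  also have "\<alpha> b a \<cdot>\<^sub>m 1\<^sub>m d * rinv \<rho> a = \<alpha> b a \<cdot>\<^sub>m rinv \<rho> a"
    using c by (simp add: mult_smult_assoc_mat[of _ d d _ d])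
  finally show "rinv \<rho> (b \<otimes> a) * \<rho> b = \<alpha> b a \<cdot>\<^sub>m rinv \<rho> a" .
  have "\<rho> a * rinv \<rho> (b \<otimes> a) = (rinv \<rho> b * \<rho> b) * (\<rho> a * rinv \<rho> (b \<otimes> a))"
    using c rep_rinv[OF \<rho> b] by simp
  also have "\<dots> = rinv \<rho> b * ((\<rho> b * \<rho> a) * rinv \<rho> (b \<otimes> a))"
    using c by (simp add: assoc_mult_mat[of _ d d _ d _ d])
  also have "(\<rho> b * \<rho> a) * rinv \<rho> (b \<otimes> a) = \<alpha> b a \<cdot>\<^sub>m 1\<^sub>m d"
    unfolding ab rep_rinv(1)[OF \<rho> ba, symmetric] by (rule mult_smult_assoc_mat[OF c(3,6)])
  also have "rinv \<rho> b * (\<alpha> b a \<cdot>\<^sub>m 1\<^sub>m d) = \<alpha> b a \<cdot>\<^sub>m rinv \<rho> b"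
    using c by (simp add: mult_smult_distrib[of _ d d _ d])
  finally show "\<rho> a * rinv \<rho> (b \<otimes> a) = \<alpha> b a \<cdot>\<^sub>m rinv \<rho> b" .
qed

text \<open>Kernel and range of S are invariant, hence trivial and full. The inverse has preimages
  of the unit vectors as columns, so equality of d and d' need not be established
  separately.\<close>

lemma schur:
  assumes \<rho>: "simple_proj_rep d \<rho>" and \<rho>': "simple_proj_rep d' \<rho>'" and S: "S \<in> carrier_mat d d'"
    and int: "\<And>a. a \<in> carrier H \<Longrightarrow> \<rho> a * S = S * \<rho>' a" and nz: "S \<noteq> 0\<^sub>m d d'"
  shows "\<exists>T\<in>carrier_mat d' d. S * T = 1\<^sub>m d \<and> T * S = 1\<^sub>m d'"
proof -
  have c: "\<rho> a \<in> carrier_mat d d" "\<rho>' a \<in> carrier_mat d' d'" if "a \<in> carrier H" for a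
    using \<rho> \<rho>' that by (auto simp: simple_proj_rep_def proj_rep_def)
  define K where "K = {x \<in> carrier_vec d'. S *\<^sub>v x = 0\<^sub>v d}"
  have "invariant_subspace d' (carrier H) \<rho>' K"
    unfolding invariant_subspace_def
  proof (intro conjI ballI allI)
    show "0\<^sub>v d' \<in> K" using S by (auto simp: K_def intro!: eq_vecI)
    fix x y assume "x \<in> K" "y \<in> K"
    then show "x + y \<in> K" using S by (simp add: K_def mult_add_distrib_mat_vec[of _ d d'])
  next
    fix k :: complex and x assume "x \<in> K"
    moreover have "k \<cdot>\<^sub>v 0\<^sub>v d = 0\<^sub>v d" by (intro eq_vecI) auto
    ultimately show "k \<cdot>\<^sub>v x \<in> K" using S by (simp add: K_def mult_mat_vec[of _ d d'])
  next
    fix a x assume a: "a \<in> carrier H" and x: "x \<in> K"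
    have xc: "x \<in> carrier_vec d'" and Sx: "S *\<^sub>v x = 0\<^sub>v d" using x by (auto simp: K_def)
    have "S *\<^sub>v (\<rho>' a *\<^sub>v x) = (S * \<rho>' a) *\<^sub>v x" by (rule assoc_mult_mat_vec[OF S c(2)[OF a] xc, symmetric])
    also have "\<dots> = \<rho> a *\<^sub>v (S *\<^sub>v x)" unfolding int[OF a, symmetric] by (rule assoc_mult_mat_vec[OF c(1)[OF a] S xc])
    also have "\<dots> = 0\<^sub>v d" unfolding Sx using c(1)[OF a] by (intro eq_vecI) auto
    finally show "\<rho>' a *\<^sub>v x \<in> K" using c[OF a] x by (auto simp: K_def)
  qed (auto simp: K_def)
  then have "K = {0\<^sub>v d'} \<or> K = carrier_vec d'" using \<rho>' by (simp add: simple_proj_rep_def)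
  moreover have "K \<noteq> carrier_vec d'"
  proof
    assume K: "K = carrier_vec d'"
    have "S = 0\<^sub>m d d'"
    proof (rule eq_matI)
      fix i j assume "i < dim_row (0\<^sub>m d d' :: complex mat)" "j < dim_col (0\<^sub>m d d' :: complex mat)"
      then have ij: "i < d" "j < d'" by auto
      have "unit_vec d' j \<in> K" using K by simp
      then have "col S j = 0\<^sub>v d" using mult_mat_unit_vec[OF S ij(2)] by (simp add: K_def)
      then have "col S j $ i = 0" using ij by simp
      then show "S $$ (i, j) = 0\<^sub>m d d' $$ (i, j)" using ij S by simp
    qed (use S in auto)
    with nz show False by simp
  qed
  ultimately have K: "K = {0\<^sub>v d'}" by blast
  define I where "I = (\<lambda>x. S *\<^sub>v x) ` carrier_vec d'"
  have "invariant_subspace d (carrier H) \<rho> I"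
    unfolding invariant_subspace_def
  proof (intro conjI ballI allI)
    show "I \<subseteq> carrier_vec d" using S by (auto simp: I_def)
    have "S *\<^sub>v 0\<^sub>v d' = 0\<^sub>v d" using S by (auto intro!: eq_vecI)
    then show "0\<^sub>v d \<in> I" unfolding I_def by (intro image_eqI[of _ _ "0\<^sub>v d'"]) auto
    fix x y assume "x \<in> I" "y \<in> I"
    then obtain x' y' where xy: "x = S *\<^sub>v x'" "y = S *\<^sub>v y'" "x' \<in> carrier_vec d'" "y' \<in> carrier_vec d'"
      unfolding I_def by auto
    then have "x + y = S *\<^sub>v (x' + y')" using S by (simp add: mult_add_distrib_mat_vec[of _ d d'])
    then show "x + y \<in> I" unfolding I_def by (rule image_eqI) (use xy in simp)
  next
    fix k :: complex and x assume "x \<in> I"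
    then obtain x' where x: "x = S *\<^sub>v x'" "x' \<in> carrier_vec d'" unfolding I_def by auto
    then have "k \<cdot>\<^sub>v x = S *\<^sub>v (k \<cdot>\<^sub>v x')" using S by (simp add: mult_mat_vec[of _ d d'])
    then show "k \<cdot>\<^sub>v x \<in> I" unfolding I_def by (rule image_eqI) (use x in simp)
  next
    fix a x assume a: "a \<in> carrier H" and "x \<in> I"
    then obtain x' where x: "x = S *\<^sub>v x'" "x' \<in> carrier_vec d'" unfolding I_def by auto
    have "\<rho> a *\<^sub>v x = (\<rho> a * S) *\<^sub>v x'" unfolding x(1) by (rule assoc_mult_mat_vec[OF c(1)[OF a] S x(2), symmetric])
    also have "\<dots> = S *\<^sub>v (\<rho>' a *\<^sub>v x')" unfolding int[OF a] by (rule assoc_mult_mat_vec[OF S c(2)[OF a] x(2)])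
    finally show "\<rho> a *\<^sub>v x \<in> I" unfolding I_def by (rule image_eqI) (use c(2)[OF a] x in simp)
  qed
  then have "I = {0\<^sub>v d} \<or> I = carrier_vec d" using \<rho> by (simp add: simple_proj_rep_def)
  moreover have "I \<noteq> {0\<^sub>v d}"
  proof
    assume I: "I = {0\<^sub>v d}"
    have "x \<in> K" if "x \<in> carrier_vec d'" for x
    proof -
      have "S *\<^sub>v x \<in> I" using that by (simp add: I_def)
      then show ?thesis using that I by (simp add: K_def)
    qed
    then have "K = carrier_vec d'" by (auto simp: K_def)
    with \<open>K \<noteq> carrier_vec d'\<close> show False by simp
  qed
  ultimately have I: "I = carrier_vec d" by blast
  have "\<exists>x. x \<in> carrier_vec d' \<and> S *\<^sub>v x = unit_vec d j" for j
  proof -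
    have "unit_vec d j \<in> I" using I by simp
    then show ?thesis unfolding I_def by auto
  qed
  then have "\<forall>j. \<exists>x. x \<in> carrier_vec d' \<and> S *\<^sub>v x = unit_vec d j" by simp
  from choice[OF this] obtain t where t': "\<forall>j. t j \<in> carrier_vec d' \<and> S *\<^sub>v t j = unit_vec d j" ..
  then have t: "\<And>j. t j \<in> carrier_vec d'" "\<And>j. S *\<^sub>v t j = unit_vec d j" by simp_all
  define T where "T = mat d' d (\<lambda>(i, j). t j $ i)"
  have T: "T \<in> carrier_mat d' d" by (simp add: T_def)
  have colT: "col T j = t j" if "j < d" for j using that t(1)[of j] by (intro eq_vecI) (auto simp: T_def)
  have ST: "S * T = 1\<^sub>m d"
  proof (rule eq_matI)
    fix i j assume "i < dim_row (1\<^sub>m d :: complex mat)" "j < dim_col (1\<^sub>m d :: complex mat)"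
    then have ij: "i < d" "j < d" by auto
    have "(S * T) $$ (i, j) = (S *\<^sub>v t j) $ i" using ij S T by (simp add: colT)
    then show "(S * T) $$ (i, j) = 1\<^sub>m d $$ (i, j)" using ij t(2)[of j] by (simp add: unit_vec_def)
  qed (use S T in auto)
  \<comment> \<open>The columns of T S - 1 lie in the kernel of S because S (T S) = S.\<close>
  have "T * S = 1\<^sub>m d'"
  proof (rule eq_matI)
    fix i j assume "i < dim_row (1\<^sub>m d' :: complex mat)" "j < dim_col (1\<^sub>m d' :: complex mat)"
    then have ij: "i < d'" "j < d'" by auto
    define x where "x = col (T * S) j - unit_vec d' j"
    have x: "x \<in> carrier_vec d'" using S T ij by (auto simp: x_def)
    have "S *\<^sub>v col (T * S) j = S *\<^sub>v ((T * S) *\<^sub>v unit_vec d' j)"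
      using mult_mat_unit_vec[of "T * S" d' d' j] S T ij by simp
    also have "\<dots> = (S * (T * S)) *\<^sub>v unit_vec d' j" using S T by (intro assoc_mult_mat_vec[symmetric]) auto
    also have "S * (T * S) = S" using assoc_mult_mat[OF S T S, symmetric] S ST by simp
    finally have "S *\<^sub>v x = 0\<^sub>v d"
      unfolding x_def using S T ij by (subst mult_minus_distrib_mat_vec[of _ d d']) auto
    then have "x \<in> K" using x by (simp add: K_def)
    then have "x = 0\<^sub>v d'" using K by simp
    then have "x $ i = 0" using ij by simp
    then show "(T * S) $$ (i, j) = 1\<^sub>m d' $$ (i, j)" using ij S T by (simp add: x_def unit_vec_def)
  qed (use S T in auto)
  then show ?thesis using T ST by blast
qed

lemma schur_trace:
  assumes "simple_proj_rep d \<rho>" "simple_proj_rep d' \<rho>'" "S \<in> carrier_mat d d'"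
    "\<And>a. a \<in> carrier H \<Longrightarrow> \<rho> a * S = S * \<rho>' a" "S \<noteq> 0\<^sub>m d d'" and a: "a \<in> carrier H"
  shows "mtrace d (\<rho> a) = mtrace d' (\<rho>' a)"
proof -
  have c: "\<rho> a \<in> carrier_mat d d" "\<rho>' a \<in> carrier_mat d' d'"
    using assms by (auto simp: simple_proj_rep_def proj_rep_def)
  obtain T where T: "T \<in> carrier_mat d' d" "S * T = 1\<^sub>m d" "T * S = 1\<^sub>m d'"
    using schur[OF assms(1-5)] by blast
  have S: "S \<in> carrier_mat d d'" by fact
  have "mtrace d (\<rho> a) = mtrace d (\<rho> a * (S * T))" using c T by simp
  also have "\<rho> a * (S * T) = \<rho> a * S * T" by (rule assoc_mult_mat[OF c(1) S T(1), symmetric])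
  also have "\<dots> = S * (\<rho>' a * T)" unfolding assms(4)[OF a] by (rule assoc_mult_mat[OF S c(2) T(1)])
  also have "mtrace d \<dots> = mtrace d' (\<rho>' a * T * S)" using c T S by (intro mtrace_comm) auto
  also have "\<rho>' a * T * S = \<rho>' a" using c T S by (simp add: assoc_mult_mat[of _ d' d' _ d _ d'])
  finally show ?thesis .
qed

definition averaged :: "nat \<Rightarrow> nat \<Rightarrow> ('g \<Rightarrow> complex mat) \<Rightarrow> ('g \<Rightarrow> complex mat) \<Rightarrow> complex mat \<Rightarrow> complex mat" where
  "averaged d d' \<rho> \<rho>' T = matsum d d' (carrier H) (\<lambda>a. \<rho> a * T * rinv \<rho>' a)"

text \<open>Left multiplication by \<rho>(b) is absorbed by the substitution a -> b a; the factors
  \<alpha>(b,a) from \<rho> and from the inverse of \<rho>' cancel.\<close>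

lemma averaged_intertwines:
  assumes \<rho>: "proj_rep d \<rho>" and \<rho>': "proj_rep d' \<rho>'" and T: "T \<in> carrier_mat d d'" and b: "b \<in> carrier H"
  shows "\<rho> b * averaged d d' \<rho> \<rho>' T = averaged d d' \<rho> \<rho>' T * \<rho>' b"
proof -
  have c: "\<rho> a \<in> carrier_mat d d" "\<rho>' a \<in> carrier_mat d' d'" "rinv \<rho>' a \<in> carrier_mat d' d'" if "a \<in> carrier H" for a
    using \<rho> \<rho>' that rinv_carrier by (auto simp: proj_rep_def)
  have e: "\<rho> b * (\<rho> a * T * rinv \<rho>' a) = \<rho> (b \<otimes> a) * T * rinv \<rho>' (b \<otimes> a) * \<rho>' b" if a: "a \<in> carrier H" for a
  proof -
    have ba: "b \<otimes> a \<in> carrier H" using a b by simp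
    have "\<rho> b * (\<rho> a * T * rinv \<rho>' a) = (\<rho> b * \<rho> a) * (T * rinv \<rho>' a)"
      using c[OF a] c[OF b] T by (simp add: assoc_mult_mat[of _ d d _ d _ d'] assoc_mult_mat[of _ d d _ d' _ d'])
    also have "\<rho> b * \<rho> a = \<alpha> b a \<cdot>\<^sub>m \<rho> (b \<otimes> a)" using \<rho> a b by (simp add: proj_rep_def)
    also have "(\<alpha> b a \<cdot>\<^sub>m \<rho> (b \<otimes> a)) * (T * rinv \<rho>' a) = \<rho> (b \<otimes> a) * (\<alpha> b a \<cdot>\<^sub>m (T * rinv \<rho>' a))"
      using c[OF a] c[OF ba] T by (simp add: mult_smult_assoc_mat[of _ d d _ d'] mult_smult_distrib[of _ d d _ d'])
    also have "\<alpha> b a \<cdot>\<^sub>m (T * rinv \<rho>' a) = T * (\<alpha> b a \<cdot>\<^sub>m rinv \<rho>' a)"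
      using c[OF a] T by (simp add: mult_smult_distrib[of _ d d' _ d'])
    also have "\<alpha> b a \<cdot>\<^sub>m rinv \<rho>' a = rinv \<rho>' (b \<otimes> a) * \<rho>' b" by (rule rinv_mult(1)[OF \<rho>' a b, symmetric])
    also have "\<rho> (b \<otimes> a) * (T * (rinv \<rho>' (b \<otimes> a) * \<rho>' b)) = \<rho> (b \<otimes> a) * T * rinv \<rho>' (b \<otimes> a) * \<rho>' b"
      using c[OF ba] c[OF b] T by (simp add: assoc_mult_mat[of _ d d' _ d' _ d'] assoc_mult_mat[of _ d d _ d' _ d'])
    finally show ?thesis .
  qed
  have c2: "\<rho> a * T * rinv \<rho>' a \<in> carrier_mat d d'" if "a \<in> carrier H" for a using c[OF that] T by auto
  have "\<rho> b * averaged d d' \<rho> \<rho>' T = matsum d d' (carrier H) (\<lambda>a. \<rho> b * (\<rho> a * T * rinv \<rho>' a))"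
    unfolding averaged_def using c[OF b] c2 by (intro mult_matsum) auto
  also have "\<dots> = matsum d d' (carrier H) (\<lambda>a. \<rho> (b \<otimes> a) * T * rinv \<rho>' (b \<otimes> a) * \<rho>' b)"
    unfolding matsum_def by (intro cong_mat refl sum.cong) (auto simp: e)
  also have "\<dots> = matsum d d' (carrier H) (\<lambda>a. \<rho> a * T * rinv \<rho>' a * \<rho>' b)"
  proof -
    have bij: "bij_betw (\<lambda>a. b \<otimes> a) (carrier H) (carrier H)"
      using b by (intro bij_betw_byWitness[where f' = "\<lambda>a. inv b \<otimes> a"]) (auto simp: m_assoc[symmetric])
    show ?thesis unfolding matsum_def
      by (intro cong_mat refl) (rule sum.reindex_bij_betw[OF bij])
  qed
  also have "\<dots> = averaged d d' \<rho> \<rho>' T * \<rho>' b"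
    unfolding averaged_def using c[OF b] c2 by (intro matsum_mult[symmetric]) auto
  finally show ?thesis .
qed

text \<open>Averaging the matrix unit E_jk turns Schur's lemma into a statement on sums of products
  of matrix coefficients.\<close>

lemma averaged_unit:
  assumes \<rho>: "proj_rep d \<rho>" and \<rho>': "proj_rep d' \<rho>'" and ij: "i < d" "j < d" "k < d'" "l < d'"
  shows "averaged d d' \<rho> \<rho>' (mat d d' (\<lambda>p. if p = (j, k) then 1 else 0)) $$ (i, l) =
    (\<Sum>a\<in>carrier H. \<rho> a $$ (i, j) * rinv \<rho>' a $$ (k, l))"
proof -
  let ?E = "mat d d' (\<lambda>p. if p = (j, k) then 1 else 0) :: complex mat"
  have "(\<rho> a * ?E * rinv \<rho>' a) $$ (i, l) = \<rho> a $$ (i, j) * rinv \<rho>' a $$ (k, l)" if a: "a \<in> carrier H" for a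
  proof -
    have c: "\<rho> a \<in> carrier_mat d d" "rinv \<rho>' a \<in> carrier_mat d' d'" "\<rho> a * ?E \<in> carrier_mat d d'"
      using \<rho> \<rho>' a rinv_carrier by (auto simp: proj_rep_def)
    have 1: "(\<rho> a * ?E) $$ (i, m) = (if m = k then \<rho> a $$ (i, j) else 0)" if "m < d'" for m
    proof -
      have "(\<rho> a * ?E) $$ (i, m) = (\<Sum>n<d. \<rho> a $$ (i, n) * ?E $$ (n, m))"
        by (rule index_mult_mat_sum[OF c(1)]) (use ij that in auto)
      also have "\<dots> = (\<Sum>n<d. if n = j then (if m = k then \<rho> a $$ (i, j) else 0) else 0)"
        using that by (intro sum.cong refl) auto
      finally show ?thesis using ij by simp
    qed
    have "(\<rho> a * ?E * rinv \<rho>' a) $$ (i, l) = (\<Sum>m<d'. (\<rho> a * ?E) $$ (i, m) * rinv \<rho>' a $$ (m, l))"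
      by (rule index_mult_mat_sum[OF c(3,2)]) (use ij in auto)
    also have "\<dots> = (\<Sum>m<d'. if m = k then \<rho> a $$ (i, j) * rinv \<rho>' a $$ (m, l) else 0)"
      by (intro sum.cong refl) (simp add: 1 del: index_mult_mat)
    finally show ?thesis using ij by simp
  qed
  then show ?thesis unfolding averaged_def using ij by (simp add: matsum_def del: index_mult_mat)
qed

text \<open>Inequivalence is expressed by different traces, as these are what characters record: a
  nonzero average would intertwine \<rho> and \<rho>' and make the traces equal.\<close>

lemma orthogonality_inequivalent:
  assumes \<rho>: "simple_proj_rep d \<rho>" and \<rho>': "simple_proj_rep d' \<rho>'"
    and ne: "a0 \<in> carrier H" "mtrace d (\<rho> a0) \<noteq> mtrace d' (\<rho>' a0)"
    and ij: "i < d" "j < d" "k < d'" "l < d'"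
  shows "(\<Sum>a\<in>carrier H. \<rho> a $$ (i, j) * rinv \<rho>' a $$ (k, l)) = 0"
proof -
  have pr: "proj_rep d \<rho>" "proj_rep d' \<rho>'" using \<rho> \<rho>' by (auto simp: simple_proj_rep_def)
  define E where "E = (mat d d' (\<lambda>p. if p = (j, k) then 1 else 0) :: complex mat)"
  have "averaged d d' \<rho> \<rho>' E = 0\<^sub>m d d'"
  proof (rule ccontr)
    assume "\<not> ?thesis"
    moreover have "E \<in> carrier_mat d d'" "averaged d d' \<rho> \<rho>' E \<in> carrier_mat d d'" by (auto simp: E_def averaged_def)
    ultimately have "mtrace d (\<rho> a0) = mtrace d' (\<rho>' a0)"
      using averaged_intertwines[OF pr] ne(1) by (intro schur_trace[OF \<rho> \<rho>']) auto
    with ne(2) show False by simp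
  qed
  then show ?thesis using averaged_unit[OF pr ij] ij by (simp add: E_def)
qed

text \<open>The average of E_jk commutes with \<rho>. Subtracting an eigenvalue leaves a singular
  intertwiner, which is zero by Schur's lemma, so the average is a scalar c.\<close>

lemma orthogonality_same:
  assumes \<rho>: "simple_proj_rep d \<rho>" and ij: "i < d" "j < d" "k < d" "l < d"
  shows "(\<Sum>a\<in>carrier H. \<rho> a $$ (i, j) * rinv \<rho> a $$ (k, l)) =
    (if i = l \<and> j = k then of_nat (card (carrier H)) / of_nat d else 0)"
proof -
  have pr: "proj_rep d \<rho>" and d: "d > 0" using \<rho> by (auto simp: simple_proj_rep_def)
  define E where "E = (mat d d (\<lambda>p. if p = (j, k) then 1 else 0) :: complex mat)"
  define S where "S = averaged d d \<rho> \<rho> E"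
  have S: "S \<in> carrier_mat d d" by (simp add: S_def averaged_def)
  have SE: "S $$ (i, l) = (\<Sum>a\<in>carrier H. \<rho> a $$ (i, j) * rinv \<rho> a $$ (k, l))" if "i < d" "l < d" for i l
    unfolding S_def E_def using averaged_unit[OF pr pr that(1) ij(2,3) that(2)] .
  have int: "\<rho> a * S = S * \<rho> a" if "a \<in> carrier H" for a
    unfolding S_def by (rule averaged_intertwines[OF pr pr _ that]) (simp add: E_def)
  obtain c where "eigenvalue S c" using spectrum_non_empty[OF S d] by (auto simp: spectrum_def)
  then obtain v where v: "v \<in> carrier_vec d" "v \<noteq> 0\<^sub>v d" "S *\<^sub>v v = c \<cdot>\<^sub>v v"
    using S by (auto simp: eigenvalue_def eigenvector_def)
  define S' where "S' = S - c \<cdot>\<^sub>m 1\<^sub>m d"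
  have S': "S' \<in> carrier_mat d d" unfolding S'_def by (intro minus_carrier_mat) simp
  have "S' *\<^sub>v v = 0\<^sub>v d"
    unfolding S'_def using S v by (subst minus_mult_distrib_mat_vec[of _ d d]) (auto simp: smult_mat_mult_vec[of _ d d])
  have "S' = 0\<^sub>m d d"
  proof (rule ccontr)
    assume "S' \<noteq> 0\<^sub>m d d"
    moreover have "\<rho> a * S' = S' * \<rho> a" if a: "a \<in> carrier H" for a
    proof -
      have c: "\<rho> a \<in> carrier_mat d d" using a pr by (simp add: proj_rep_def)
      show ?thesis unfolding S'_def using c S int[OF a]
        by (simp add: mult_minus_distrib_mat[of _ d d _ d] minus_mult_distrib_mat[of _ d d _ _ d]
            mult_smult_distrib[of _ d d _ d] mult_smult_assoc_mat[of _ d d _ d])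
    qed
    ultimately obtain T where T: "T \<in> carrier_mat d d" "T * S' = 1\<^sub>m d" using schur[OF \<rho> \<rho> S'] by blast
    have "v = (T * S') *\<^sub>v v" unfolding T(2) using v by simp
    also have "\<dots> = T *\<^sub>v (S' *\<^sub>v v)" by (rule assoc_mult_mat_vec[OF T(1) S' v(1)])
    also have "\<dots> = 0\<^sub>v d" using T \<open>S' *\<^sub>v v = 0\<^sub>v d\<close> by (auto intro!: eq_vecI)
    finally show False using v(2) by simp
  qed
  have Sc: "S $$ (i, l) = (if i = l then c else 0)" if "i < d" "l < d" for i l
  proof -
    have "S' $$ (i, l) = 0" using \<open>S' = 0\<^sub>m d d\<close> that by simp
    then show ?thesis using that S by (auto simp: S'_def)
  qed
  \<comment> \<open>The trace determines c: each group element contributes the trace of the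
    conjugate of E_jk, that is 1 or 0.\<close>
  have "of_nat d * c = (\<Sum>i<d. S $$ (i, i))" by (simp add: Sc)
  also have "\<dots> = (\<Sum>a\<in>carrier H. \<Sum>i<d. rinv \<rho> a $$ (k, i) * \<rho> a $$ (i, j))"
    by (simp add: SE mult.commute) (rule sum.swap)
  also have "\<dots> = (\<Sum>a\<in>carrier H. if j = k then 1 else 0)"
  proof (intro sum.cong refl)
    fix a assume a: "a \<in> carrier H"
    have c: "\<rho> a \<in> carrier_mat d d" "rinv \<rho> a \<in> carrier_mat d d" using a pr rinv_carrier by (auto simp: proj_rep_def)
    show "(\<Sum>i<d. rinv \<rho> a $$ (k, i) * \<rho> a $$ (i, j)) = (if j = k then 1 else 0)"
      using index_mult_mat_sum[OF c(2,1) ij(3,2)] rep_rinv(2)[OF pr a] ij by (cases "j = k") auto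
  qed
  finally have "c = (if j = k then of_nat (card (carrier H)) / of_nat d else 0)"
    using d by (auto simp: field_simps)
  then show ?thesis unfolding SE[OF ij(1,4), symmetric] Sc[OF ij(1,4)] by simp
qed

text \<open>If all these sums vanished, so would the sum over a of tr \<rho>(a) times the trace of
  the inverse of \<rho>'(a). With equal traces, orthogonality for \<rho>' evaluates it to the order
  of the group.\<close>

lemma same_trace_overlap:
  assumes \<rho>: "simple_proj_rep d \<rho>" and \<rho>': "simple_proj_rep d' \<rho>'"
    and tr: "\<And>a. a \<in> carrier H \<Longrightarrow> mtrace d (\<rho> a) = mtrace d' (\<rho>' a)"
  shows "\<exists>i<d. \<exists>k<d'. (\<Sum>a\<in>carrier H. \<rho> a $$ (i, i) * rinv \<rho>' a $$ (k, k)) \<noteq> 0"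
proof (rule ccontr)
  assume "\<not> ?thesis"
  then have z: "(\<Sum>a\<in>carrier H. \<rho> a $$ (i, i) * rinv \<rho>' a $$ (k, k)) = 0" if "i < d" "k < d'" for i k
    using that by blast
  have d': "d' > 0" using \<rho>' by (simp add: simple_proj_rep_def)
  have tt: "(\<Sum>i<n. \<Sum>k<d'. \<Sum>a\<in>carrier H. \<sigma> a $$ (i, i) * rinv \<rho>' a $$ (k, k)) =
      (\<Sum>a\<in>carrier H. mtrace n (\<sigma> a) * mtrace d' (rinv \<rho>' a))" for n \<sigma>
  proof -
    have "(\<Sum>i<n. \<Sum>k<d'. \<Sum>a\<in>carrier H. \<sigma> a $$ (i, i) * rinv \<rho>' a $$ (k, k)) =
      (\<Sum>i<n. \<Sum>a\<in>carrier H. \<Sum>k<d'. \<sigma> a $$ (i, i) * rinv \<rho>' a $$ (k, k))"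
      by (rule sum.cong[OF refl]) (rule sum.swap)
    also have "\<dots> = (\<Sum>a\<in>carrier H. \<Sum>i<n. \<Sum>k<d'. \<sigma> a $$ (i, i) * rinv \<rho>' a $$ (k, k))" by (rule sum.swap)
    finally show ?thesis by (simp add: mtrace_def sum_product)
  qed
  have "(\<Sum>a\<in>carrier H. mtrace d' (\<rho>' a) * mtrace d' (rinv \<rho>' a)) =
      (\<Sum>a\<in>carrier H. mtrace d (\<rho> a) * mtrace d' (rinv \<rho>' a))"
    by (simp add: tr)
  also have "\<dots> = 0" unfolding tt[symmetric] by (simp add: z)
  finally have "(\<Sum>i<d'. \<Sum>k<d'. \<Sum>a\<in>carrier H. \<rho>' a $$ (i, i) * rinv \<rho>' a $$ (k, k)) = 0"
    unfolding tt .
  also have "(\<Sum>i<d'. \<Sum>k<d'. \<Sum>a\<in>carrier H. \<rho>' a $$ (i, i) * rinv \<rho>' a $$ (k, k)) =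
     (\<Sum>i<d'. \<Sum>k<d'. if k = i then of_nat (card (carrier H)) / of_nat d' else 0)"
    by (intro sum.cong refl) (simp add: orthogonality_same[OF \<rho>'])
  also have "\<dots> = of_nat (card (carrier H))" using d' by simp
  finally have "card (carrier H) = 0" by simp
  then show False using finite_carrier one_closed by auto
qed

text \<open>Characters determine simple projective representations: a nonvanishing coefficient sum
  is an entry of an averaged matrix unit, which is then invertible by Schur's lemma.\<close>

lemma same_trace_intertwiner:
  assumes \<rho>: "simple_proj_rep d \<rho>" and \<rho>': "simple_proj_rep d' \<rho>'"
    and tr: "\<And>a. a \<in> carrier H \<Longrightarrow> mtrace d (\<rho> a) = mtrace d' (\<rho>' a)"
  shows "\<exists>S T. S \<in> carrier_mat d d' \<and> T \<in> carrier_mat d' d \<and> S * T = 1\<^sub>m d \<and> T * S = 1\<^sub>m d' \<and>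
     (\<forall>a\<in>carrier H. \<rho> a * S = S * \<rho>' a)"
proof -
  have pr: "proj_rep d \<rho>" "proj_rep d' \<rho>'" using \<rho> \<rho>' by (auto simp: simple_proj_rep_def)
  obtain i k where ik: "i < d" "k < d'" "(\<Sum>a\<in>carrier H. \<rho> a $$ (i, i) * rinv \<rho>' a $$ (k, k)) \<noteq> 0"
    using same_trace_overlap[OF \<rho> \<rho>' tr] by blast
  define E where "E = (mat d d' (\<lambda>p. if p = (i, k) then 1 else 0) :: complex mat)"
  define S where "S = averaged d d' \<rho> \<rho>' E"
  have S: "S \<in> carrier_mat d d'" "E \<in> carrier_mat d d'" by (auto simp: S_def averaged_def E_def)
  have "S $$ (i, k) \<noteq> 0" using averaged_unit[OF pr ik(1,1,2,2)] ik(3) by (simp add: S_def E_def)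
  then have nz: "S \<noteq> 0\<^sub>m d d'" using ik by auto
  have int: "\<rho> a * S = S * \<rho>' a" if "a \<in> carrier H" for a
    unfolding S_def by (rule averaged_intertwines[OF pr S(2) that])
  show ?thesis using schur[OF \<rho> \<rho>' S(1) int nz] S(1) int by blast
qed

end

section \<open>Projective actions\<close>

context cvector_space
begin

lemma independent_family_eq_0:
  assumes "inj_on u {..<d}" "independent (u ` {..<d})" "(\<Sum>k<d. s (c k) (u k)) = 0" "k < (d::nat)"
  shows "c k = 0"
proof -
  define f where "f v = c (the_inv_into {..<d} u v)" for v
  have "(\<Sum>v\<in>u ` {..<d}. s (f v) v) = (\<Sum>k<d. s (c k) (u k))"
    using assms(1) by (simp add: sum.reindex f_def the_inv_into_f_f)
  then have "(\<Sum>v\<in>u ` {..<d}. s (f v) v) = 0" using assms(3) by simp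
  then have "f (u k) = 0" using independentD[OF assms(2) _ subset_refl, of f "u k"] assms(4) by auto
  then show ?thesis using assms by (simp add: f_def the_inv_into_f_f)
qed

lemma independent_family_eq:
  assumes u: "inj_on u {..<d}" "independent (u ` {..<d})"
    and eq: "(\<Sum>k<d. s (c k) (u k)) = (\<Sum>k<d. s (c' k) (u k))" and k: "k < (d::nat)"
  shows "c k = c' k"
proof -
  have "(\<Sum>k<d. s (c k - c' k) (u k)) = 0" using eq by (simp add: scale_left_diff_distrib sum_subtractf)
  then have "c k - c' k = 0" using u k by (intro independent_family_eq_0[of u d "\<lambda>k. c k - c' k"])
  then show ?thesis by simp
qed

lemma span_family:
  assumes "x \<in> span (u ` {..<d::nat})" "inj_on u {..<d}"
  shows "\<exists>c. x = (\<Sum>k<d. s (c k) (u k))"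
proof -
  have "finite (u ` {..<d})" by simp
  from span_finite[OF this] obtain f where "x = (\<Sum>v\<in>u ` {..<d}. s (f v) v)" using assms(1) by auto
  then have "x = (\<Sum>k<d. s (f (u k)) (u k))" using assms(2) by (simp add: sum.reindex)
  then show ?thesis by (rule exI[of _ "\<lambda>k. f (u k)"])
qed

end

text \<open>Models the centraliser of g acting on M(g). W may have infinite dimension, so
  decompositions come from Schur idempotents rather than from complements.\<close>

locale proj_action = twisted_group H \<alpha> + cvector_space s
  for H :: "('g, 'b) monoid_scheme" (structure) and \<alpha> and s :: "complex \<Rightarrow> 'a::ab_group_add \<Rightarrow> 'a" +
  fixes W :: "'a set" and \<pi> :: "'g \<Rightarrow> 'a \<Rightarrow> 'a"
  assumes subW: "subspace W"
    and \<pi>_linear: "a \<in> carrier H \<Longrightarrow> linear_on s s W (\<pi> a)"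
    and \<pi>_in: "a \<in> carrier H \<Longrightarrow> w \<in> W \<Longrightarrow> \<pi> a w \<in> W"
    and \<pi>_mult: "a \<in> carrier H \<Longrightarrow> b \<in> carrier H \<Longrightarrow> w \<in> W \<Longrightarrow> \<pi> a (\<pi> b w) = s (\<alpha> a b) (\<pi> (a \<otimes> b) w)"
    and \<pi>_one: "w \<in> W \<Longrightarrow> \<pi> \<one> w = s (\<alpha> \<one> \<one>) w"
begin

abbreviation "n \<equiv> card (carrier H)"

lemma n_pos: "n > 0"
  using finite_carrier one_closed by (auto simp: card_gt_0_iff)

lemma \<pi>_sum: "a \<in> carrier H \<Longrightarrow> (\<And>i. i \<in> I \<Longrightarrow> x i \<in> W) \<Longrightarrow> \<pi> a (\<Sum>i\<in>I. x i) = (\<Sum>i\<in>I. \<pi> a (x i))"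
  by (rule linear_on_sum[OF \<pi>_linear vector_space_axioms subW])

lemma \<pi>_scale: "a \<in> carrier H \<Longrightarrow> x \<in> W \<Longrightarrow> \<pi> a (s c x) = s c (\<pi> a x)"
  by (rule linear_on_scale[OF \<pi>_linear])

text \<open>u is the image of the standard basis under a homomorphism from \<rho> to W; the vectors
  may be dependent or zero.\<close>

definition transforms :: "nat \<Rightarrow> ('g \<Rightarrow> complex mat) \<Rightarrow> (nat \<Rightarrow> 'a) \<Rightarrow> bool" where
  "transforms d \<rho> u \<longleftrightarrow> (\<forall>i<d. u i \<in> W) \<and> (\<forall>a\<in>carrier H. \<forall>i<d. \<pi> a (u i) = (\<Sum>k<d. s (\<rho> a $$ (k, i)) (u k)))"

text \<open>By Schur orthogonality this acts as the matrix unit $E_{ij}$ on the \<open>\<rho>\<close>-isotypic part and as \<open>0\<close>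
  on the other ones.\<close>

definition unit_op :: "nat \<Rightarrow> ('g \<Rightarrow> complex mat) \<Rightarrow> nat \<Rightarrow> nat \<Rightarrow> 'a \<Rightarrow> 'a" where
  "unit_op d \<rho> i j w = s (of_nat d / of_nat n) (\<Sum>a\<in>carrier H. s (rinv \<rho> a $$ (j, i)) (\<pi> a w))"

lemma unit_op_in: "w \<in> W \<Longrightarrow> unit_op d \<rho> i j w \<in> W"
  unfolding unit_op_def by (intro subspace_scale[OF subW] subspace_sum[OF subW] \<pi>_in)

lemma unit_op_linear: "linear_on s s W (unit_op d \<rho> i j)"
  unfolding linear_on_def
proof (intro conjI ballI allI)
  fix x y assume "x \<in> W" "y \<in> W"
  then show "unit_op d \<rho> i j (x + y) = unit_op d \<rho> i j x + unit_op d \<rho> i j y"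
    by (simp add: unit_op_def linear_on_add[OF \<pi>_linear] scale_right_distrib sum.distrib)
next
  fix c x assume "x \<in> W"
  then have "(\<Sum>a\<in>carrier H. s (rinv \<rho> a $$ (j, i)) (\<pi> a (s c x))) = s c (\<Sum>a\<in>carrier H. s (rinv \<rho> a $$ (j, i)) (\<pi> a x))"
    unfolding scale_sum_right by (intro sum.cong refl) (simp add: \<pi>_scale mult.commute)
  then show "unit_op d \<rho> i j (s c x) = s c (unit_op d \<rho> i j x)"
    by (simp add: unit_op_def mult.commute)
qed

lemma unit_op_transforms:
  assumes u: "transforms d \<rho> u" and i: "i < d"
  shows "unit_op d' \<rho>' k l (u i) =
    (\<Sum>m<d. s (of_nat d' / of_nat n * (\<Sum>a\<in>carrier H. \<rho> a $$ (m, i) * rinv \<rho>' a $$ (l, k))) (u m))"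
proof -
  have "unit_op d' \<rho>' k l (u i) = s (of_nat d' / of_nat n)
     (\<Sum>a\<in>carrier H. \<Sum>m<d. s (\<rho> a $$ (m, i) * rinv \<rho>' a $$ (l, k)) (u m))"
    using u i unfolding unit_op_def transforms_def by (simp add: scale_sum_right mult.commute)
  also have "\<dots> = s (of_nat d' / of_nat n) (\<Sum>m<d. \<Sum>a\<in>carrier H. s (\<rho> a $$ (m, i) * rinv \<rho>' a $$ (l, k)) (u m))"
    by (rule arg_cong[OF sum.swap])
  finally show ?thesis by (simp only: scale_sum_left[symmetric] scale_sum_right scale_scale)
qed

lemma unit_op_same:
  assumes \<rho>: "simple_proj_rep d \<rho>" and u: "transforms d \<rho> u" and i: "i < d" "k < d" "l < d"
  shows "unit_op d \<rho> k l (u i) = (if i = l then u k else 0)"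
proof -
  have d: "d > 0" using i by simp
  have "unit_op d \<rho> k l (u i) = (\<Sum>m<d. if m = k then (if i = l then u m else 0) else 0)"
    unfolding unit_op_transforms[OF u i(1)]
    by (intro sum.cong refl) (use i d n_pos in \<open>auto simp: orthogonality_same[OF \<rho>]\<close>)
  then show ?thesis using i by simp
qed

lemma unit_op_diff:
  assumes \<rho>: "simple_proj_rep d \<rho>" and \<rho>': "simple_proj_rep d' \<rho>'" and u: "transforms d \<rho> u"
    and i: "i < d" "k < d'" "l < d'" and ne: "a0 \<in> carrier H" "mtrace d (\<rho> a0) \<noteq> mtrace d' (\<rho>' a0)"
  shows "unit_op d' \<rho>' k l (u i) = 0"
  unfolding unit_op_transforms[OF u i(1)]
  by (intro sum.neutral ballI) (use i in \<open>simp add: orthogonality_inequivalent[OF \<rho> \<rho>' ne]\<close>)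

text \<open>For fixed j, sending e_i to E_ij w is a homomorphism from \<rho>: translate the sum
  defining E_ij by b from the left.\<close>

lemma transforms_unit_op:
  assumes \<rho>: "proj_rep d \<rho>" and j: "j < d" and w: "w \<in> W"
  shows "transforms d \<rho> (\<lambda>i. unit_op d \<rho> i j w)"
  unfolding transforms_def
proof (intro conjI allI impI ballI)
  fix b i assume b: "b \<in> carrier H" and i: "i < d"
  have bij: "bij_betw (\<lambda>a. b \<otimes> a) (carrier H) (carrier H)"
    using b by (intro bij_betw_byWitness[where f' = "\<lambda>a. inv b \<otimes> a"]) (auto simp: m_assoc[symmetric])
  have e: "rinv \<rho> a $$ (j, i) * \<alpha> b a = (\<Sum>k<d. \<rho> b $$ (k, i) * rinv \<rho> (b \<otimes> a) $$ (j, k))" if a: "a \<in> carrier H" for a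
  proof -
    have c: "rinv \<rho> (b \<otimes> a) \<in> carrier_mat d d" "\<rho> b \<in> carrier_mat d d" "rinv \<rho> a \<in> carrier_mat d d"
      using a b \<rho> rinv_carrier by (auto simp: proj_rep_def)
    have "(rinv \<rho> (b \<otimes> a) * \<rho> b) $$ (j, i) = (\<alpha> b a \<cdot>\<^sub>m rinv \<rho> a) $$ (j, i)"
      using rinv_mult(1)[OF \<rho> a b] by simp
    then show ?thesis using index_mult_mat_sum[OF c(1,2) j i] c i j by (simp add: mult.commute)
  qed
  have "\<pi> b (unit_op d \<rho> i j w) = s (of_nat d / of_nat n) (\<Sum>a\<in>carrier H. s (rinv \<rho> a $$ (j, i) * \<alpha> b a) (\<pi> (b \<otimes> a) w))"
    unfolding unit_op_def
    using b w by (simp add: \<pi>_scale \<pi>_sum subspace_sum[OF subW] subspace_scale[OF subW] \<pi>_in \<pi>_mult)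
  also have "(\<Sum>a\<in>carrier H. s (rinv \<rho> a $$ (j, i) * \<alpha> b a) (\<pi> (b \<otimes> a) w)) =
      (\<Sum>a\<in>carrier H. s (\<Sum>k<d. \<rho> b $$ (k, i) * rinv \<rho> (b \<otimes> a) $$ (j, k)) (\<pi> (b \<otimes> a) w))"
    by (simp add: e)
  also have "\<dots> = (\<Sum>a\<in>carrier H. s (\<Sum>k<d. \<rho> b $$ (k, i) * rinv \<rho> a $$ (j, k)) (\<pi> a w))"
    by (rule sum.reindex_bij_betw[OF bij])
  also have "\<dots> = (\<Sum>k<d. \<Sum>a\<in>carrier H. s (\<rho> b $$ (k, i) * rinv \<rho> a $$ (j, k)) (\<pi> a w))"
    unfolding scale_sum_left by (rule sum.swap)
  finally show "\<pi> b (unit_op d \<rho> i j w) = (\<Sum>k<d. s (\<rho> b $$ (k, i)) (unit_op d \<rho> k j w))"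
    unfolding unit_op_def by (simp add: scale_sum_right mult.commute mult.left_commute)
qed (simp add: unit_op_in[OF w])

text \<open>Right translation of the defining sum. This rule makes the coordinates E_0i w transform
  by \<rho>.\<close>

lemma unit_op_\<pi>:
  assumes \<rho>: "proj_rep d \<rho>" and ij: "i < d" "j < d" and b: "b \<in> carrier H" and w: "w \<in> W"
  shows "unit_op d \<rho> i j (\<pi> b w) = (\<Sum>k<d. s (\<rho> b $$ (j, k)) (unit_op d \<rho> i k w))"
proof -
  have bij: "bij_betw (\<lambda>a. a \<otimes> b) (carrier H) (carrier H)"
    using b by (intro bij_betw_byWitness[where f' = "\<lambda>a. a \<otimes> inv b"]) (auto simp: m_assoc)
  have e: "rinv \<rho> a $$ (j, i) * \<alpha> a b = (\<Sum>k<d. \<rho> b $$ (j, k) * rinv \<rho> (a \<otimes> b) $$ (k, i))" if a: "a \<in> carrier H" for a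
  proof -
    have c: "rinv \<rho> (a \<otimes> b) \<in> carrier_mat d d" "\<rho> b \<in> carrier_mat d d" "rinv \<rho> a \<in> carrier_mat d d"
      using a b \<rho> rinv_carrier by (auto simp: proj_rep_def)
    have "(\<rho> b * rinv \<rho> (a \<otimes> b)) $$ (j, i) = (\<alpha> a b \<cdot>\<^sub>m rinv \<rho> a) $$ (j, i)"
      using rinv_mult(2)[OF \<rho> b a] by simp
    then show ?thesis using index_mult_mat_sum[OF c(2,1) ij(2,1)] c ij by (simp add: mult.commute)
  qed
  have "unit_op d \<rho> i j (\<pi> b w) = s (of_nat d / of_nat n) (\<Sum>a\<in>carrier H. s (rinv \<rho> a $$ (j, i) * \<alpha> a b) (\<pi> (a \<otimes> b) w))"
    unfolding unit_op_def using b w by (simp add: \<pi>_mult)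
  also have "(\<Sum>a\<in>carrier H. s (rinv \<rho> a $$ (j, i) * \<alpha> a b) (\<pi> (a \<otimes> b) w)) =
      (\<Sum>a\<in>carrier H. s (\<Sum>k<d. \<rho> b $$ (j, k) * rinv \<rho> (a \<otimes> b) $$ (k, i)) (\<pi> (a \<otimes> b) w))"
    by (simp add: e)
  also have "\<dots> = (\<Sum>a\<in>carrier H. s (\<Sum>k<d. \<rho> b $$ (j, k) * rinv \<rho> a $$ (k, i)) (\<pi> a w))"
    by (rule sum.reindex_bij_betw[OF bij])
  also have "\<dots> = (\<Sum>k<d. \<Sum>a\<in>carrier H. s (\<rho> b $$ (j, k) * rinv \<rho> a $$ (k, i)) (\<pi> a w))"
    unfolding scale_sum_left by (rule sum.swap)
  finally show ?thesis
    unfolding unit_op_def by (simp add: scale_sum_right mult.commute mult.left_commute)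
qed

lemma unit_op_unit_op:
  assumes \<rho>: "simple_proj_rep d \<rho>" and i: "i < d" "j < d" "k < d" "l < d" and w: "w \<in> W"
  shows "unit_op d \<rho> k l (unit_op d \<rho> i j w) = (if i = l then unit_op d \<rho> k j w else 0)"
  using unit_op_same[OF \<rho> transforms_unit_op[OF _ i(2) w] i(1,3,4)] \<rho> by (simp add: simple_proj_rep_def)

lemma unit_op_unit_op_diff:
  assumes \<rho>: "simple_proj_rep d \<rho>" and \<rho>': "simple_proj_rep d' \<rho>'"
    and i: "i < d" "j < d" "k < d'" "l < d'" and w: "w \<in> W"
    and ne: "a0 \<in> carrier H" "mtrace d (\<rho> a0) \<noteq> mtrace d' (\<rho>' a0)"
  shows "unit_op d' \<rho>' k l (unit_op d \<rho> i j w) = 0"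
  using unit_op_diff[OF \<rho> \<rho>' transforms_unit_op[OF _ i(2) w] i(1,3,4) ne] \<rho> by (simp add: simple_proj_rep_def)

definition invariant :: "'a set \<Rightarrow> bool" where
  "invariant U \<longleftrightarrow> subspace U \<and> U \<subseteq> W \<and> (\<forall>a\<in>carrier H. \<forall>x\<in>U. \<pi> a x \<in> U)"

text \<open>The orbit of w spans a finite-dimensional invariant space even if W is
  infinite-dimensional. Among the independent families spanning a nonzero invariant subspace of it,
  take one with fewest elements.\<close>

lemma minimal_invariant:
  assumes w: "w \<in> W" "w \<noteq> 0"
  shows "\<exists>d u. d > 0 \<and> inj_on u {..<d::nat} \<and> independent (u ` {..<d}) \<and> invariant (span (u ` {..<d})) \<and>
     u ` {..<d} \<subseteq> span ((\<lambda>a. \<pi> a w) ` carrier H) \<and>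
     (\<forall>U. invariant U \<and> U \<subseteq> span (u ` {..<d}) \<longrightarrow> U = {0} \<or> U = span (u ` {..<d}))"
proof -
  define N where "N = span ((\<lambda>a. \<pi> a w) ` carrier H)"
  define P where "P B \<longleftrightarrow> finite B \<and> independent B \<and> B \<noteq> {} \<and> invariant (span B) \<and> B \<subseteq> N" for B
  have NW: "N \<subseteq> W" unfolding N_def using \<pi>_in w by (intro span_minimal subW) auto
  have fN: "finite ((\<lambda>a. \<pi> a w) ` carrier H)" using finite_carrier by simp
  have basis: "\<exists>B. finite B \<and> independent B \<and> B \<subseteq> U \<and> span B = U" if "subspace U" "U \<subseteq> N" for U
  proof -
    obtain B where B: "B \<subseteq> U" "independent B" "U \<subseteq> span B" using maximal_independent_subset by metis
    moreover have "finite B" using independent_span_bound[OF fN B(2)] B(1) that(2) by (auto simp: N_def)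
    moreover have "span B = U" using B span_minimal[OF B(1) that(1)] by blast
    ultimately show ?thesis by blast
  qed
  have "invariant N"
    unfolding invariant_def
  proof (intro conjI ballI)
    fix a x assume a: "a \<in> carrier H" and x: "x \<in> N"
    obtain f where f: "x = (\<Sum>v\<in>(\<lambda>a. \<pi> a w) ` carrier H. s (f v) v)" using x span_finite[OF fN] unfolding N_def by auto
    have in': "v \<in> W" if "v \<in> (\<lambda>a. \<pi> a w) ` carrier H" for v using that w \<pi>_in by auto
    have "\<pi> a x = (\<Sum>v\<in>(\<lambda>a. \<pi> a w) ` carrier H. s (f v) (\<pi> a v))"
      unfolding f using a in' by (subst \<pi>_sum) (auto simp: \<pi>_scale subspace_scale[OF subW])
    also have "\<dots> \<in> N"
    proof (intro span_sum span_scale subspace_sum[of N] subspace_scale[of N])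
      show "subspace N" "subspace N" by (simp_all add: N_def)
      fix v assume "v \<in> (\<lambda>a. \<pi> a w) ` carrier H"
      then obtain b where b: "b \<in> carrier H" "v = \<pi> b w" by blast
      have "\<pi> a v = s (\<alpha> a b) (\<pi> (a \<otimes> b) w)" using a b w \<pi>_mult by simp
      also have "\<dots> \<in> N" unfolding N_def using a b by (intro span_scale span_base) auto
      finally show "\<pi> a v \<in> N" .
    qed
    finally show "\<pi> a x \<in> N" .
  qed (use NW in \<open>auto simp: N_def\<close>)
  obtain B0 where B0: "finite B0" "independent B0" "B0 \<subseteq> N" "span B0 = N"
    using basis[of N] by (auto simp: N_def)
  have "w \<in> N"
  proof -
    have "\<pi> \<one> w \<in> N" unfolding N_def by (intro span_base) auto
    then have "s (inverse (\<alpha> \<one> \<one>)) (\<pi> \<one> w) \<in> N" unfolding N_def by (rule span_scale)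
    then show ?thesis using w cocycle_nonzero[of \<one> \<one>] by (simp add: \<pi>_one)
  qed
  then have "B0 \<noteq> {}" using B0 w by auto
  then have "P B0" using B0 \<open>invariant N\<close> by (simp add: P_def)
  then obtain B where B: "P B" "\<And>B'. P B' \<Longrightarrow> card B \<le> card B'"
    using ex_has_least_nat[of P B0 card] by blast
  have min: "U = {0} \<or> U = span B" if U: "invariant U" "U \<subseteq> span B" for U
  proof (rule ccontr)
    assume ne: "\<not> ?thesis"
    have "span B \<subseteq> N" using B(1) unfolding P_def N_def by (intro span_minimal) auto
    then obtain B' where B': "finite B'" "independent B'" "B' \<subseteq> U" "span B' = U" using basis[of U] U by (auto simp: invariant_def)
    have "B' \<noteq> {}" using B' ne by auto
    then have "P B'" using B' U \<open>span B \<subseteq> N\<close> by (auto simp: P_def)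
    \<comment> \<open>Minimality of the cardinality is contradicted by a vector outside U, which
      together with a basis of U is still independent.\<close>
    then have le: "card B \<le> card B'" by (rule B(2))
    obtain x where x: "x \<in> span B" "x \<notin> U" using ne U by blast
    have "independent (insert x B')" using B' x by (simp add: independent_insert)
    moreover have "insert x B' \<subseteq> span B" using x B' U by auto
    ultimately have "card (insert x B') \<le> card B" using independent_span_bound[of B "insert x B'"] B(1) by (simp add: P_def)
    moreover have "x \<notin> B'" using x B' by auto
    ultimately show False using le B' by simp
  qed
  define d where "d = card B"
  obtain u where u: "bij_betw u {..<d} B" using ex_bij_betw_nat_finite[of B] B(1) by (auto simp: P_def d_def atLeast0LessThan)
  have im: "u ` {..<d} = B" and inj: "inj_on u {..<d}" using u by (auto simp: bij_betw_def)
  have "d > 0" using B(1) by (auto simp: P_def d_def card_gt_0_iff)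
  then show ?thesis using B(1) min inj unfolding P_def N_def im[symmetric] by (intro exI[of _ d] exI[of _ u]) auto
qed

text \<open>The matrices of the action on the basis u form a projective representation by comparison
  of coordinates, and its invariant subspaces correspond to those of the span.\<close>

lemma minimal_invariant_rep:
  assumes w: "w \<in> W" "w \<noteq> 0"
  shows "\<exists>d \<rho> u. simple_proj_rep d \<rho> \<and> transforms d \<rho> u \<and> inj_on u {..<d} \<and> independent (u ` {..<d}) \<and>
     u ` {..<d} \<subseteq> span ((\<lambda>a. \<pi> a w) ` carrier H)"
proof -
  obtain d u where d: "d > 0" and u: "inj_on u {..<d::nat}" "independent (u ` {..<d})"
    and inv: "invariant (span (u ` {..<d}))" and sp: "u ` {..<d} \<subseteq> span ((\<lambda>a. \<pi> a w) ` carrier H)"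
    and min: "\<And>U. invariant U \<Longrightarrow> U \<subseteq> span (u ` {..<d}) \<Longrightarrow> U = {0} \<or> U = span (u ` {..<d})"
  proof -
    from minimal_invariant[OF w] obtain d u where A: "d > 0" "inj_on u {..<d::nat}" "independent (u ` {..<d})"
      "invariant (span (u ` {..<d}))" "u ` {..<d} \<subseteq> span ((\<lambda>a. \<pi> a w) ` carrier H)"
      and m: "\<forall>U. invariant U \<and> U \<subseteq> span (u ` {..<d}) \<longrightarrow> U = {0} \<or> U = span (u ` {..<d})"
      by (elim exE conjE) (rule that)
    from m have "U = {0} \<or> U = span (u ` {..<d})" if "invariant U" "U \<subseteq> span (u ` {..<d})" for U
      using that by simp
    with A show thesis by (rule that)
  qed
  have uS: "u i \<in> span (u ` {..<d})" if "i < d" for i using that by (intro span_base) auto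
  have uW: "u i \<in> W" if "i < d" for i using uS[OF that] inv by (auto simp: invariant_def)
  have "\<exists>c. \<pi> a (u i) = (\<Sum>k<d. s (c k) (u k))" if "a \<in> carrier H" "i < d" for a i
  proof -
    have "\<pi> a (u i) \<in> span (u ` {..<d})" using inv uS[OF that(2)] that(1) unfolding invariant_def by blast
    then show ?thesis by (rule span_family[OF _ u(1)])
  qed
  then have "\<forall>p\<in>carrier H \<times> {..<d}. \<exists>c. \<pi> (fst p) (u (snd p)) = (\<Sum>k<d. s (c k) (u k))" by auto
  from bchoice[OF this] obtain c' where c': "\<forall>p\<in>carrier H \<times> {..<d}. \<pi> (fst p) (u (snd p)) = (\<Sum>k<d. s (c' p k) (u k))" ..
  define c where "c a i = c' (a, i)" for a i
  have c: "\<pi> a (u i) = (\<Sum>k<d. s (c a i k) (u k))" if "a \<in> carrier H" "i < d" for a i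
    using c' that by (force simp: c_def)
  define \<rho> where "\<rho> a = mat d d (\<lambda>(k, i). c a i k)" for a
  have \<rho>c: "\<rho> a \<in> carrier_mat d d" for a by (simp add: \<rho>_def)
  have \<rho>: "\<pi> a (u i) = (\<Sum>k<d. s (\<rho> a $$ (k, i)) (u k))" if "a \<in> carrier H" "i < d" for a i
    using c[OF that] that by (simp add: \<rho>_def)
  have lin: "\<pi> a (\<Sum>i<d. s (x i) (u i)) = (\<Sum>k<d. s (\<Sum>i<d. \<rho> a $$ (k, i) * x i) (u k))" if a: "a \<in> carrier H" for a x
  proof -
    have "\<pi> a (\<Sum>i<d. s (x i) (u i)) = (\<Sum>i<d. \<pi> a (s (x i) (u i)))"
      by (rule \<pi>_sum[OF a]) (simp add: uW subspace_scale[OF subW])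
    also have "\<dots> = (\<Sum>i<d. \<Sum>k<d. s (\<rho> a $$ (k, i) * x i) (u k))"
      using a by (intro sum.cong refl) (simp add: \<pi>_scale uW \<rho> scale_sum_right mult.commute)
    also have "\<dots> = (\<Sum>k<d. \<Sum>i<d. s (\<rho> a $$ (k, i) * x i) (u k))" by (rule sum.swap)
    finally show ?thesis by (simp add: scale_sum_left)
  qed
  have pr: "proj_rep d \<rho>"
    unfolding proj_rep_def
  proof (intro conjI ballI \<rho>c)
    show "\<rho> \<one> = \<alpha> \<one> \<one> \<cdot>\<^sub>m 1\<^sub>m d"
    proof (rule eq_matI)
      fix k i assume "k < dim_row (\<alpha> \<one> \<one> \<cdot>\<^sub>m 1\<^sub>m d)" "i < dim_col (\<alpha> \<one> \<one> \<cdot>\<^sub>m 1\<^sub>m d)"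
      then have ki: "k < d" "i < d" by auto
      have "(\<Sum>k<d. s (if k = i then \<alpha> \<one> \<one> else 0) (u k)) = (\<Sum>k<d. if k = i then s (\<alpha> \<one> \<one>) (u k) else 0)"
        by (intro sum.cong) auto
      also have "\<dots> = \<pi> \<one> (u i)" using ki \<pi>_one[OF uW[OF ki(2)]] by simp
      finally have "(\<Sum>k<d. s (\<rho> \<one> $$ (k, i)) (u k)) = (\<Sum>k<d. s (if k = i then \<alpha> \<one> \<one> else 0) (u k))" using \<rho>[OF one_closed ki(2)] by simp
      from independent_family_eq[OF u this ki(1)] show "\<rho> \<one> $$ (k, i) = (\<alpha> \<one> \<one> \<cdot>\<^sub>m 1\<^sub>m d) $$ (k, i)" using ki by simp
    qed (simp_all add: \<rho>_def)
    fix a b assume a: "a \<in> carrier H" and b: "b \<in> carrier H"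
    show "\<rho> a * \<rho> b = \<alpha> a b \<cdot>\<^sub>m \<rho> (a \<otimes> b)"
    proof (rule eq_matI)
      fix k i assume "k < dim_row (\<alpha> a b \<cdot>\<^sub>m \<rho> (a \<otimes> b))" "i < dim_col (\<alpha> a b \<cdot>\<^sub>m \<rho> (a \<otimes> b))"
      then have ki: "k < d" "i < d" by (auto simp: \<rho>_def)
      have "(\<Sum>k<d. s (\<Sum>m<d. \<rho> a $$ (k, m) * \<rho> b $$ (m, i)) (u k)) = \<pi> a (\<pi> b (u i))"
        unfolding \<rho>[OF b ki(2)] by (rule lin[OF a, symmetric])
      also have "\<dots> = (\<Sum>k<d. s (\<alpha> a b * \<rho> (a \<otimes> b) $$ (k, i)) (u k))"
        using \<pi>_mult[OF a b uW[OF ki(2)]] \<rho>[OF m_closed[OF a b] ki(2)] by (simp add: scale_sum_right)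
      finally have "(\<Sum>k<d. s (\<Sum>m<d. \<rho> a $$ (k, m) * \<rho> b $$ (m, i)) (u k)) = (\<Sum>k<d. s (\<alpha> a b * \<rho> (a \<otimes> b) $$ (k, i)) (u k))" .
      from independent_family_eq[OF u this ki(1)] show "(\<rho> a * \<rho> b) $$ (k, i) = (\<alpha> a b \<cdot>\<^sub>m \<rho> (a \<otimes> b)) $$ (k, i)"
        using index_mult_mat_sum[OF \<rho>c \<rho>c ki] ki \<rho>c[of "a \<otimes> b"] by simp
    qed (simp_all add: \<rho>_def)
  qed
  have "X = {0\<^sub>v d} \<or> X = carrier_vec d" if X: "invariant_subspace d (carrier H) \<rho> X" for X
  proof -
    \<comment> \<open>The coordinate isomorphism from C^d to the span of u, through which invariant
      subspaces are transported.\<close>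
    define e where "e x = (\<Sum>k<d. s (x $ k) (u k))" for x :: "complex vec"
    have XD: "X \<subseteq> carrier_vec d" "0\<^sub>v d \<in> X" "\<And>x y. x \<in> X \<Longrightarrow> y \<in> X \<Longrightarrow> x + y \<in> X" "\<And>c x. x \<in> X \<Longrightarrow> c \<cdot>\<^sub>v x \<in> X"
      "\<And>a x. a \<in> carrier H \<Longrightarrow> x \<in> X \<Longrightarrow> \<rho> a *\<^sub>v x \<in> X" using X unfolding invariant_subspace_def by blast+
    have e_in: "e x \<in> span (u ` {..<d})" for x unfolding e_def by (intro span_sum span_scale uS) simp
    have inje: "x = y" if "x \<in> carrier_vec d" "y \<in> carrier_vec d" "e x = e y" for x y
    proof (rule eq_vecI)
      fix k assume "k < dim_vec y"
      then have "k < d" using that(2) by simp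
      then show "x $ k = y $ k" by (rule independent_family_eq[OF u that(3)[unfolded e_def]])
    qed (use that in auto)
    have e_add: "e (x + y) = e x + e y" if "x \<in> carrier_vec d" "y \<in> carrier_vec d" for x y
      using that by (simp add: e_def scale_left_distrib sum.distrib)
    have e_scale: "e (k \<cdot>\<^sub>v x) = s k (e x)" if "x \<in> carrier_vec d" for x k
      using that by (simp add: e_def scale_sum_right)
    have e_zero: "e (0\<^sub>v d) = 0" by (simp add: e_def)
    have e_\<pi>: "\<pi> a (e x) = e (\<rho> a *\<^sub>v x)" if a: "a \<in> carrier H" and x: "x \<in> carrier_vec d" for a x
    proof -
      have "(\<rho> a *\<^sub>v x) $ k = (\<Sum>i<d. \<rho> a $$ (k, i) * x $ i)" if "k < d" for k
        using that x \<rho>c[of a] by (simp add: scalar_prod_def atLeast0LessThan)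
      then show ?thesis unfolding e_def lin[OF a] by simp
    qed
    have "invariant (e ` X)"
      unfolding invariant_def
    proof (intro conjI ballI)
      show "subspace (e ` X)"
      proof (rule subspaceI)
        show "0 \<in> e ` X" using e_zero XD(2) by (intro image_eqI[of _ _ "0\<^sub>v d"]) simp_all
        fix x y assume "x \<in> e ` X" "y \<in> e ` X"
        then obtain x' y' where xy: "x' \<in> X" "y' \<in> X" "x = e x'" "y = e y'" by blast
        then have "x' \<in> carrier_vec d" "y' \<in> carrier_vec d" using XD(1) by auto
        then have "x + y = e (x' + y')" using e_add xy by simp
        then show "x + y \<in> e ` X" using XD(3)[OF xy(1,2)] by (rule image_eqI)
      next
        fix k x assume "x \<in> e ` X"
        then obtain x' where x: "x' \<in> X" "x = e x'" by blast
        then have "s k x = e (k \<cdot>\<^sub>v x')" using XD(1) e_scale[of x' k] by auto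
        then show "s k x \<in> e ` X" using XD(4)[OF x(1)] by (rule image_eqI)
      qed
      show "e ` X \<subseteq> W" using e_in inv by (auto simp: invariant_def)
      fix a x assume a: "a \<in> carrier H" and "x \<in> e ` X"
      then obtain x' where x: "x' \<in> X" "x = e x'" by blast
      then have "\<pi> a x = e (\<rho> a *\<^sub>v x')" using XD(1) e_\<pi>[OF a, of x'] by auto
      then show "\<pi> a x \<in> e ` X" using XD(5)[OF a x(1)] by (rule image_eqI)
    qed
    moreover have "e ` X \<subseteq> span (u ` {..<d})" using e_in by auto
    ultimately have "e ` X = {0} \<or> e ` X = span (u ` {..<d})" by (rule min)
    then show ?thesis
    proof
      assume z: "e ` X = {0}"
      have "x = 0\<^sub>v d" if "x \<in> X" for x
        using inje[of x "0\<^sub>v d"] that XD(1) z e_zero by auto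
      then show ?thesis using XD(2) by blast
    next
      assume full: "e ` X = span (u ` {..<d})"
      have "y \<in> X" if y: "y \<in> carrier_vec d" for y
      proof -
        have "e y \<in> e ` X" using full e_in by simp
        then obtain x where x: "x \<in> X" "e y = e x" by blast
        then have "y = x" using inje[OF y _ x(2)] XD(1) by blast
        then show ?thesis using x by simp
      qed
      then show ?thesis using XD(1) by blast
    qed
  qed
  then have "simple_proj_rep d \<rho>" using pr d by (simp add: simple_proj_rep_def)
  moreover have "transforms d \<rho> u" using uW \<rho> by (simp add: transforms_def)
  ultimately show ?thesis using u sp by (intro exI[of _ d] exI[of _ \<rho>] exI[of _ u] conjI)
qed

lemma unit_op_detects:
  assumes w: "w \<in> W" "w \<noteq> 0"
  shows "\<exists>d \<rho>. simple_proj_rep d \<rho> \<and> (\<forall>d' \<rho>'. simple_proj_rep d' \<rho>' \<and> (\<forall>a\<in>carrier H. mtrace d (\<rho> a) = mtrace d' (\<rho>' a)) \<longrightarrow>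
     (\<exists>i<d'. \<exists>j<d'. unit_op d' \<rho>' i j w \<noteq> 0))"
proof -
  obtain d \<rho> u where \<rho>: "simple_proj_rep d \<rho>" and tu: "transforms d \<rho> u" and u: "inj_on u {..<d}" "independent (u ` {..<d})"
     and sp: "u ` {..<d} \<subseteq> span ((\<lambda>a. \<pi> a w) ` carrier H)"
    using minimal_invariant_rep[OF w] by (elim exE conjE) (rule that)
  have "\<exists>i<d'. \<exists>j<d'. unit_op d' \<rho>' i j w \<noteq> 0"
    if \<rho>': "simple_proj_rep d' \<rho>'" and tr: "\<forall>a\<in>carrier H. mtrace d (\<rho> a) = mtrace d' (\<rho>' a)" for d' \<rho>'
  proof (rule ccontr)
    assume "\<not> ?thesis"
    then have z: "unit_op d' \<rho>' i j w = 0" if "i < d'" "j < d'" for i j using that by blast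
    have pr': "proj_rep d' \<rho>'" using \<rho>' by (simp add: simple_proj_rep_def)
    obtain i k where ik: "i < d" "k < d'" "(\<Sum>a\<in>carrier H. \<rho> a $$ (i, i) * rinv \<rho>' a $$ (k, k)) \<noteq> 0"
      using same_trace_overlap[OF \<rho> \<rho>'] tr by blast
    define U where "U = {x \<in> W. unit_op d' \<rho>' k k x = 0}"
    have "subspace U"
      unfolding U_def
      by (rule subspaceI) (auto simp: subspace_0[OF subW] subspace_add[OF subW] subspace_scale[OF subW]
          linear_on_0[OF unit_op_linear vector_space_axioms subW] linear_on_add[OF unit_op_linear] linear_on_scale[OF unit_op_linear])
    moreover have "\<pi> a w \<in> U" if a: "a \<in> carrier H" for a
      using unit_op_\<pi>[OF pr' ik(2,2) a w(1)] z ik(2) \<pi>_in[OF a w(1)] by (simp add: U_def)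
    ultimately have "span ((\<lambda>a. \<pi> a w) ` carrier H) \<subseteq> U" by (intro span_minimal) auto
    then have "u i \<in> U" using sp ik(1) by auto
    then have "(\<Sum>m<d. s (of_nat d' / of_nat n * (\<Sum>a\<in>carrier H. \<rho> a $$ (m, i) * rinv \<rho>' a $$ (k, k))) (u m)) = 0"
      using unit_op_transforms[OF tu ik(1), of d' \<rho>' k k] by (simp add: U_def)
    then have "of_nat d' / of_nat n * (\<Sum>a\<in>carrier H. \<rho> a $$ (i, i) * rinv \<rho>' a $$ (k, k)) = 0"
      by (rule independent_family_eq_0[OF u _ ik(1)])
    then show False using ik n_pos by auto
  qed
  then have D: "\<forall>d' \<rho>'. simple_proj_rep d' \<rho>' \<and> (\<forall>a\<in>carrier H. mtrace d (\<rho> a) = mtrace d' (\<rho>' a)) \<longrightarrow>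
     (\<exists>i<d'. \<exists>j<d'. unit_op d' \<rho>' i j w \<noteq> 0)" by simp
  show ?thesis by (rule exI, rule exI, rule conjI, rule \<rho>, rule D)
qed

text \<open>At most n characters occur: nonzero vectors from n + 1 distinct isotypic parts are
  independent, yet each is recovered by an idempotent from their sum w, so all of them lie in the
  span of the n vectors \<pi>(a) w.\<close>

lemma finite_isotypic:
  assumes simp: "\<And>\<chi>. \<chi> \<in> I \<Longrightarrow> simple_proj_rep (d \<chi>) (\<rho> \<chi>)"
    and dist: "\<And>\<chi> \<chi>'. \<chi> \<in> I \<Longrightarrow> \<chi>' \<in> I \<Longrightarrow> \<chi> \<noteq> \<chi>' \<Longrightarrow> \<exists>a\<in>carrier H. mtrace (d \<chi>) (\<rho> \<chi> a) \<noteq> mtrace (d \<chi>') (\<rho> \<chi>' a)"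
    and ne: "\<And>\<chi>. \<chi> \<in> I \<Longrightarrow> \<exists>w\<in>W. unit_op (d \<chi>) (\<rho> \<chi>) 0 0 w \<noteq> 0"
  shows "finite I"
proof (rule ccontr)
  assume "infinite I"
  then obtain F where F: "F \<subseteq> I" "finite F" "card F = Suc n" using infinite_arbitrarily_large by blast
  have d: "d \<chi> > 0" if "\<chi> \<in> I" for \<chi> using simp[OF that] by (simp add: simple_proj_rep_def)
  have "\<forall>\<chi>\<in>I. \<exists>w\<in>W. unit_op (d \<chi>) (\<rho> \<chi>) 0 0 w \<noteq> 0" using ne by blast
  then have "\<forall>\<chi>\<in>I. \<exists>w. w \<in> W \<and> unit_op (d \<chi>) (\<rho> \<chi>) 0 0 w \<noteq> 0" by blast
  from bchoice[OF this] obtain w0 where w0: "\<And>\<chi>. \<chi> \<in> I \<Longrightarrow> w0 \<chi> \<in> W \<and> unit_op (d \<chi>) (\<rho> \<chi>) 0 0 (w0 \<chi>) \<noteq> 0" by auto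
  define p where "p \<chi> = unit_op (d \<chi>) (\<rho> \<chi>) 0 0" for \<chi>
  define x where "x \<chi> = p \<chi> (w0 \<chi>)" for \<chi>
  have xW: "x \<chi> \<in> W" "x \<chi> \<noteq> 0" if "\<chi> \<in> I" for \<chi> using w0[OF that] unit_op_in by (auto simp: x_def p_def)
  have px: "p \<chi> (x \<chi>') = (if \<chi> = \<chi>' then x \<chi> else 0)" if \<chi>: "\<chi> \<in> I" and \<chi>': "\<chi>' \<in> I" for \<chi> \<chi>'
  proof (cases "\<chi> = \<chi>'")
    case True
    have "w0 \<chi> \<in> W" using w0[OF \<chi>] ..
    from unit_op_unit_op[OF simp[OF \<chi>] d[OF \<chi>] d[OF \<chi>] d[OF \<chi>] d[OF \<chi>] this]
    show ?thesis using True by (simp add: x_def p_def)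
  next
    case False
    then obtain a where a: "a \<in> carrier H" "mtrace (d \<chi>') (\<rho> \<chi>' a) \<noteq> mtrace (d \<chi>) (\<rho> \<chi> a)" using dist[OF \<chi>' \<chi>] by blast
    have "w0 \<chi>' \<in> W" using w0[OF \<chi>'] ..
    from unit_op_unit_op_diff[OF simp[OF \<chi>'] simp[OF \<chi>] d[OF \<chi>'] d[OF \<chi>'] d[OF \<chi>] d[OF \<chi>] this a]
    show ?thesis using False by (simp add: x_def p_def)
  qed
  define w where "w = (\<Sum>\<chi>\<in>F. x \<chi>)"
  have wW: "w \<in> W" unfolding w_def using F xW by (intro subspace_sum[OF subW]) auto
  have plin: "linear_on s s W (p \<chi>)" for \<chi> by (simp add: p_def unit_op_linear)
  have psum: "p \<chi> (\<Sum>\<chi>'\<in>F. s (c \<chi>') (x \<chi>')) = s (c \<chi>) (x \<chi>)" if "\<chi> \<in> F" for \<chi> c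
  proof -
    have "p \<chi> (\<Sum>\<chi>'\<in>F. s (c \<chi>') (x \<chi>')) = (\<Sum>\<chi>'\<in>F. p \<chi> (s (c \<chi>') (x \<chi>')))"
      using F xW by (intro linear_on_sum[OF plin vector_space_axioms subW]) (auto simp: subspace_scale[OF subW])
    also have "\<dots> = (\<Sum>\<chi>'\<in>F. if \<chi>' = \<chi> then s (c \<chi>') (x \<chi>') else 0)"
      using F that xW by (intro sum.cong refl) (auto simp: linear_on_scale[OF plin] px subset_iff)
    finally show ?thesis using F that by simp
  qed
  have pw: "p \<chi> w = x \<chi>" if "\<chi> \<in> F" for \<chi> using psum[OF that, of "\<lambda>_. 1"] by (simp add: w_def)
  have inj: "inj_on x F"
  proof (rule inj_onI)
    fix \<chi> \<chi>' assume c: "\<chi> \<in> F" "\<chi>' \<in> F" "x \<chi> = x \<chi>'"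
    then have i: "\<chi> \<in> I" "\<chi>' \<in> I" using F by auto
    show "\<chi> = \<chi>'"
    proof (rule ccontr)
      assume "\<chi> \<noteq> \<chi>'"
      then have "x \<chi> = 0" using px[OF i(1) i(1)] px[OF i] c(3) by simp
      then show False using xW[OF i(1)] by simp
    qed
  qed
  have "independent (x ` F)"
  proof (rule independent_if_scalars_zero)
    fix f v assume s0: "(\<Sum>v\<in>x ` F. s (f v) v) = 0" and "v \<in> x ` F"
    then obtain \<chi> where \<chi>: "\<chi> \<in> F" "v = x \<chi>" by blast
    have "(\<Sum>\<chi>\<in>F. s (f (x \<chi>)) (x \<chi>)) = 0" using s0 inj by (simp add: sum.reindex)
    then have "s (f (x \<chi>)) (x \<chi>) = p \<chi> 0" using psum[OF \<chi>(1), of "\<lambda>\<chi>. f (x \<chi>)"] by simp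
    also have "p \<chi> 0 = 0" by (rule linear_on_0[OF plin vector_space_axioms subW])
    finally show "f v = 0" using \<chi> xW F by auto
  qed (use F in simp)
  moreover have "x ` F \<subseteq> span ((\<lambda>a. \<pi> a w) ` carrier H)"
  proof
    fix v assume "v \<in> x ` F"
    then obtain \<chi> where "\<chi> \<in> F" "v = x \<chi>" by blast
    then have v: "v = s (of_nat (d \<chi>) / of_nat n) (\<Sum>a\<in>carrier H. s (rinv (\<rho> \<chi>) a $$ (0, 0)) (\<pi> a w))"
      using pw[of \<chi>] by (simp add: p_def unit_op_def)
    show "v \<in> span ((\<lambda>a. \<pi> a w) ` carrier H)"
      unfolding v by (intro span_scale span_sum span_base imageI)
  qed
  ultimately have "card (x ` F) \<le> card ((\<lambda>a. \<pi> a w) ` carrier H)"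
    using independent_span_bound[of "(\<lambda>a. \<pi> a w) ` carrier H" "x ` F"] finite_carrier by simp
  also have "\<dots> \<le> n" using finite_carrier by (rule card_image_le)
  finally show False using F inj by (simp add: card_image)
qed

text \<open>The difference of the two sides is killed by every matrix unit of every representative,
  hence zero by detection.\<close>

lemma isotypic_decomposition:
  assumes fin: "finite I" and simp: "\<And>\<chi>. \<chi> \<in> I \<Longrightarrow> simple_proj_rep (d \<chi>) (\<rho> \<chi>)"
    and dist: "\<And>\<chi> \<chi>'. \<chi> \<in> I \<Longrightarrow> \<chi>' \<in> I \<Longrightarrow> \<chi> \<noteq> \<chi>' \<Longrightarrow> \<exists>a\<in>carrier H. mtrace (d \<chi>) (\<rho> \<chi> a) \<noteq> mtrace (d \<chi>') (\<rho> \<chi>' a)"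
    and all: "\<And>d' \<rho>'. simple_proj_rep d' \<rho>' \<Longrightarrow> \<exists>\<chi>\<in>I. \<forall>a\<in>carrier H. mtrace d' (\<rho>' a) = mtrace (d \<chi>) (\<rho> \<chi> a)"
    and w: "w \<in> W"
  shows "w = (\<Sum>\<chi>\<in>I. \<Sum>i<d \<chi>. unit_op (d \<chi>) (\<rho> \<chi>) i i w)"
proof (rule ccontr)
  assume ne: "\<not> ?thesis"
  let ?e = "\<Sum>\<chi>\<in>I. \<Sum>i<d \<chi>. unit_op (d \<chi>) (\<rho> \<chi>) i i w"
  have eW: "?e \<in> W" by (intro subspace_sum[OF subW] unit_op_in w)
  have "w - ?e \<in> W" "w - ?e \<noteq> 0" using ne w eW subspace_diff[OF subW] by auto
  from unit_op_detects[OF this] obtain d' \<rho>' where \<rho>': "simple_proj_rep d' \<rho>'" and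
    det: "\<forall>d'' \<rho>''. simple_proj_rep d'' \<rho>'' \<and> (\<forall>a\<in>carrier H. mtrace d' (\<rho>' a) = mtrace d'' (\<rho>'' a)) \<longrightarrow>
     (\<exists>i<d''. \<exists>j<d''. unit_op d'' \<rho>'' i j (w - ?e) \<noteq> 0)" by (elim exE conjE) (rule that)
  obtain \<chi>0 where \<chi>0: "\<chi>0 \<in> I" "\<forall>a\<in>carrier H. mtrace d' (\<rho>' a) = mtrace (d \<chi>0) (\<rho> \<chi>0 a)" using all[OF \<rho>'] by blast
  from det[rule_format, OF conjI[OF simp[OF \<chi>0(1)]]] \<chi>0(2) obtain k l where kl: "k < d \<chi>0" "l < d \<chi>0"
    and nz: "unit_op (d \<chi>0) (\<rho> \<chi>0) k l (w - ?e) \<noteq> 0" by blast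
  let ?p = "unit_op (d \<chi>0) (\<rho> \<chi>0) k l"
  have inner: "?p (\<Sum>i<d \<chi>. unit_op (d \<chi>) (\<rho> \<chi>) i i w) = (if \<chi> = \<chi>0 then ?p w else 0)" if \<chi>: "\<chi> \<in> I" for \<chi>
  proof -
    have "?p (\<Sum>i<d \<chi>. unit_op (d \<chi>) (\<rho> \<chi>) i i w) = (\<Sum>i<d \<chi>. ?p (unit_op (d \<chi>) (\<rho> \<chi>) i i w))"
      by (rule linear_on_sum[OF unit_op_linear vector_space_axioms subW]) (rule unit_op_in[OF w])
    also have "\<dots> = (if \<chi> = \<chi>0 then ?p w else 0)"
    proof (cases "\<chi> = \<chi>0")
      case True
      have "(\<Sum>i<d \<chi>. ?p (unit_op (d \<chi>) (\<rho> \<chi>) i i w)) = (\<Sum>i<d \<chi>0. if i = l then unit_op (d \<chi>0) (\<rho> \<chi>0) k i w else 0)"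
        unfolding True by (intro sum.cong refl) (simp add: unit_op_unit_op[OF simp[OF \<chi>0(1)]] kl w)
      then show ?thesis using True kl by simp
    next
      case False
      obtain a where a: "a \<in> carrier H" "mtrace (d \<chi>) (\<rho> \<chi> a) \<noteq> mtrace (d \<chi>0) (\<rho> \<chi>0 a)" using dist[OF \<chi> \<chi>0(1) False] by blast
      then show ?thesis using False
        by (auto intro!: sum.neutral unit_op_unit_op_diff[OF simp[OF \<chi>] simp[OF \<chi>0(1)] _ _ kl w a])
    qed
    finally show ?thesis .
  qed
  have "?p ?e = (\<Sum>\<chi>\<in>I. ?p (\<Sum>i<d \<chi>. unit_op (d \<chi>) (\<rho> \<chi>) i i w))"
    by (rule linear_on_sum[OF unit_op_linear vector_space_axioms subW]) (intro subspace_sum[OF subW] unit_op_in w)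
  also have "\<dots> = ?p w" using fin \<chi>0(1) by (simp add: inner)
  finally have "?p (w - ?e) = 0"
    using linear_on_diff[OF unit_op_linear vector_space_axioms vector_space_axioms subW w eW] by simp
  with nz show False by simp
qed

end

section \<open>Equivariant families\<close>

locale equivariant_family = module_family V G M
  for V :: "('v::ab_group_add) voa" and G :: "('v \<Rightarrow> 'v) set" and M :: "('v \<Rightarrow> 'v) \<Rightarrow> ('v, 'm::ab_group_add) twmod" +
  fixes \<phi> :: "('v, 'm) intertwiner_family"
  assumes inter: "intertwiners V G M \<phi>"
begin

abbreviation "cj \<equiv> conjg AutV"
abbreviation mulG (infixl "\<odot>" 70) where "h \<odot> k \<equiv> h \<otimes>\<^bsub>AutV\<^esub> k"
abbreviation "iG k \<equiv> inv\<^bsub>AutV\<^esub> k"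
abbreviation "oneG \<equiv> \<one>\<^bsub>AutV\<^esub>"
abbreviation "al \<equiv> cocycle V M \<phi>"
abbreviation "Cent \<equiv> centralizer AutV G"
abbreviation "HC g \<equiv> AutV\<lparr>carrier := Cent g\<rparr>"

lemma mul_in: "h \<in> G \<Longrightarrow> k \<in> G \<Longrightarrow> h \<odot> k \<in> G"
  and one_in: "oneG \<in> G"
  and iG_in: "k \<in> G \<Longrightarrow> iG k \<in> G"
  using subG by (auto simp: subgroup.m_closed subgroup.one_closed subgroup.m_inv_closed)

lemma cj_in: "k \<in> G \<Longrightarrow> g \<in> G \<Longrightarrow> cj k g \<in> G"
  by (simp add: conjg_def mul_in iG_in)

lemma cj_mul: "h \<in> G \<Longrightarrow> k \<in> G \<Longrightarrow> g \<in> G \<Longrightarrow> cj (h \<odot> k) g = cj h (cj k g)"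
  by (simp add: conjg_def G_in Aut.m_assoc Aut.inv_mult_group)

lemma cj_one: "g \<in> G \<Longrightarrow> cj oneG g = g"
  by (simp add: conjg_def G_in)

lemma cj_inv: "k \<in> G \<Longrightarrow> g \<in> G \<Longrightarrow> cj k (cj (iG k) g) = g" "k \<in> G \<Longrightarrow> g \<in> G \<Longrightarrow> cj (iG k) (cj k g) = g"
  by (simp_all add: cj_mul[symmetric] iG_in G_in cj_one)

lemma cj_fix_iff: "k \<in> G \<Longrightarrow> g \<in> G \<Longrightarrow> cj k g = g \<longleftrightarrow> k \<in> Cent g"
proof -
  assume k: "k \<in> G" and g: "g \<in> G"
  have "cj k g = g \<longleftrightarrow> k \<odot> g = g \<odot> k"
    unfolding conjg_def by (rule Aut.inv_solve_right') (simp_all add: G_in k g)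
  then show ?thesis using k by (simp add: centralizer_def)
qed

lemma Cent_sub: "a \<in> Cent g \<Longrightarrow> a \<in> G"
  by (simp add: centralizer_def)

lemma cj_Cent: "a \<in> Cent g \<Longrightarrow> g \<in> G \<Longrightarrow> cj a g = g"
  using cj_fix_iff Cent_sub by blast

lemma subgroup_Cent:
  assumes g: "g \<in> G"
  shows "subgroup (Cent g) AutV"
proof (rule Aut.subgroupI)
  show "Cent g \<subseteq> carrier AutV" using G_in by (auto simp: centralizer_def)
  have "oneG \<in> Cent g" using cj_fix_iff[OF one_in g] cj_one[OF g] by simp
  then show "Cent g \<noteq> {}" by blast
  fix a assume a: "a \<in> Cent g"
  have "cj (iG a) g = g" using cj_inv(2)[OF Cent_sub[OF a] g] cj_Cent[OF a g] by simp
  then show "iG a \<in> Cent g" using cj_fix_iff iG_in Cent_sub[OF a] g by blast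
  fix b assume b: "b \<in> Cent g"
  have "cj (a \<odot> b) g = g" using cj_mul[OF Cent_sub[OF a] Cent_sub[OF b] g] cj_Cent[OF a g] cj_Cent[OF b g] by simp
  then show "a \<odot> b \<in> Cent g" using cj_fix_iff mul_in Cent_sub[OF a] Cent_sub[OF b] g by blast
qed

lemma group_HC: "g \<in> G \<Longrightarrow> group (HC g)"
  using subgroup.subgroup_is_group[OF subgroup_Cent group_aut] .

lemma finite_Cent: "finite (Cent g)"
  using finG by (simp add: centralizer_def)

lemma phi_bij: "g \<in> G \<Longrightarrow> h \<in> G \<Longrightarrow> bij_betw (\<phi> g h) (sp g) (sp (cj h g))"
  and phi_linear: "g \<in> G \<Longrightarrow> h \<in> G \<Longrightarrow> linear_on (sc g) (sc (cj h g)) (sp g) (\<phi> g h)"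
  and phi_mode: "g \<in> G \<Longrightarrow> h \<in> G \<Longrightarrow> v \<in> vspace V \<Longrightarrow> w \<in> sp g \<Longrightarrow>
     \<phi> g h (mo g v n w) = mo (cj h g) (h v) n (\<phi> g h w)"
proof -
  have *: "\<forall>g\<in>G. \<forall>h\<in>G. bij_betw (\<phi> g h) (sp g) (sp (cj h g)) \<and> linear_on (sc g) (sc (cj h g)) (sp g) (\<phi> g h) \<and>
     (\<forall>v\<in>vspace V. \<forall>n. \<forall>w\<in>sp g. \<phi> g h (mo g v n w) = mo (cj h g) (h v) n (\<phi> g h w))"
    using inter unfolding intertwiners_def Let_def .
  show "g \<in> G \<Longrightarrow> h \<in> G \<Longrightarrow> bij_betw (\<phi> g h) (sp g) (sp (cj h g))"
    "g \<in> G \<Longrightarrow> h \<in> G \<Longrightarrow> linear_on (sc g) (sc (cj h g)) (sp g) (\<phi> g h)"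
    "g \<in> G \<Longrightarrow> h \<in> G \<Longrightarrow> v \<in> vspace V \<Longrightarrow> w \<in> sp g \<Longrightarrow> \<phi> g h (mo g v n w) = mo (cj h g) (h v) n (\<phi> g h w)"
    using * by simp_all
qed

lemma phi_in: "g \<in> G \<Longrightarrow> h \<in> G \<Longrightarrow> w \<in> sp g \<Longrightarrow> \<phi> g h w \<in> sp (cj h g)"
  using phi_bij bij_betwE by blast

lemma vsp: "g \<in> G \<Longrightarrow> vector_space (sc g)"
  using vs by (simp add: cvector_space_def)

lemma phi_0: "g \<in> G \<Longrightarrow> h \<in> G \<Longrightarrow> \<phi> g h 0 = 0"
  by (rule linear_on_0[OF phi_linear vsp sub_sp])

lemma phi_eq_0:
  assumes "g \<in> G" "h \<in> G" "w \<in> sp g" "\<phi> g h w = 0"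
  shows "w = 0"
proof -
  interpret cvector_space "sc g" by (rule vs) fact
  have "inj_on (\<phi> g h) (sp g)" using phi_bij assms by (auto simp: bij_betw_def)
  moreover have "\<phi> g h w = \<phi> g h 0" using phi_0 assms by simp
  ultimately show ?thesis using assms subspace_0[OF sub_sp] by (simp add: inj_on_def)
qed

text \<open>Compose f with the inverse of f': the twist by a cancels and Schur's lemma for M(g)
  applies.\<close>

lemma proportional:
  assumes g: "g \<in> G" and h: "h \<in> G" and a: "a \<in> G"
    and f: "linear_on (sc g) (sc h) (sp g) f" "\<And>w. w \<in> sp g \<Longrightarrow> f w \<in> sp h"
      "\<And>v n w. v \<in> vspace V \<Longrightarrow> w \<in> sp g \<Longrightarrow> f (mo g v n w) = mo h (a v) n (f w)"
    and f': "linear_on (sc g) (sc h) (sp g) f'" "bij_betw f' (sp g) (sp h)"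
      "\<And>v n w. v \<in> vspace V \<Longrightarrow> w \<in> sp g \<Longrightarrow> f' (mo g v n w) = mo h (a v) n (f' w)"
  shows "\<exists>c. \<forall>w\<in>sp g. f w = sc h c (f' w)"
proof -
  interpret A: cvector_space "sc g" by (rule vs[OF g])
  interpret B: cvector_space "sc h" by (rule vs[OF h])
  define \<theta> where "\<theta> w = inv_into (sp g) f' (f w)" for w
  have inj: "inj_on f' (sp g)" using f'(2) by (simp add: bij_betw_def)
  have th: "\<theta> w \<in> sp g" "f' (\<theta> w) = f w" if "w \<in> sp g" for w
    using f(2)[OF that] f'(2) by (auto simp: \<theta>_def bij_betw_def inv_into_into f_inv_into_f)
  have eqI: "x = y" if "x \<in> sp g" "y \<in> sp g" "f' x = f' y" for x y using inj that by (simp add: inj_on_def)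
  have "linear_on (sc g) (sc g) (sp g) \<theta>"
    unfolding linear_on_def
  proof (intro conjI ballI allI)
    fix x y assume xy: "x \<in> sp g" "y \<in> sp g"
    then have s: "x + y \<in> sp g" by (intro A.subspace_add[OF sub_sp[OF g]])
    show "\<theta> (x + y) = \<theta> x + \<theta> y"
      by (rule eqI) (use th[OF s] th[OF xy(1)] th[OF xy(2)] xy linear_on_add[OF f(1)] linear_on_add[OF f'(1)]
        A.subspace_add[OF sub_sp[OF g] th(1)[OF xy(1)] th(1)[OF xy(2)]] in simp_all)
  next
    fix c x assume x: "x \<in> sp g"
    then have s: "sc g c x \<in> sp g" by (intro A.subspace_scale[OF sub_sp[OF g]])
    show "\<theta> (sc g c x) = sc g c (\<theta> x)"
      by (rule eqI) (use th[OF s] th[OF x] x linear_on_scale[OF f(1)] linear_on_scale[OF f'(1)]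
        A.subspace_scale[OF sub_sp[OF g] th(1)[OF x]] in simp_all)
  qed
  moreover have "\<theta> (mo g v n w) = mo g v n (\<theta> w)" if v: "v \<in> vspace V" and w: "w \<in> sp g" for v n w
    by (rule eqI) (use th[OF mo_in[OF g v w]] th[OF w] mo_in[OF g v th(1)[OF w]] f(3)[OF v w] f'(3)[OF v th(1)[OF w]] in simp_all)
  ultimately obtain c where c: "\<forall>w\<in>sp g. \<theta> w = sc g c w"
    using intertwiner_scalar[OF g, of \<theta>] th(1) by blast
  have "f w = sc h c (f' w)" if w: "w \<in> sp g" for w
    using th(2)[OF w] c w linear_on_scale[OF f'(1) w] by simp
  then show ?thesis by blast
qed

lemma ex_nonzero: "g \<in> G \<Longrightarrow> \<exists>w\<in>sp g. w \<noteq> 0"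
proof -
  assume g: "g \<in> G"
  interpret cvector_space "sc g" by (rule vs[OF g])
  show ?thesis using sp_ne[OF g] subspace_0[OF sub_sp[OF g]] by blast
qed

lemma compose_linear:
  assumes "linear_on s t S f" "linear_on t r T f'" "\<And>w. w \<in> S \<Longrightarrow> f w \<in> T"
  shows "linear_on s r S (\<lambda>w. f' (f w))"
  using assms by (simp add: linear_on_def)

text \<open>Both maps intertwine Y_g with the same vertex operators twisted by h k, hence are
  proportional; a nonzero vector gives uniqueness. This justifies the definite description in
  \<open>cocycle\<close>.\<close>

lemma cocycle_ex:
  assumes g: "g \<in> G" and h: "h \<in> G" and k: "k \<in> G"
  shows "\<exists>!c. c \<noteq> 0 \<and> (\<forall>w\<in>sp g. \<phi> g (h \<odot> k) w = sc (cj (h \<odot> k) g) (inverse c) (\<phi> (cj k g) h (\<phi> g k w)))"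
proof -
  have kg: "cj k g \<in> G" and hk: "h \<odot> k \<in> G" and hkg: "cj (h \<odot> k) g \<in> G" using g h k by (auto intro: cj_in mul_in)
  have e: "cj (h \<odot> k) g = cj h (cj k g)" by (rule cj_mul[OF h k g])
  interpret B: cvector_space "sc (cj (h \<odot> k) g)" by (rule vs[OF hkg])
  have "\<exists>c. \<forall>w\<in>sp g. \<phi> g (h \<odot> k) w = sc (cj (h \<odot> k) g) c (\<phi> (cj k g) h (\<phi> g k w))"
  proof (rule proportional[where f = "\<phi> g (h \<odot> k)" and f' = "\<lambda>w. \<phi> (cj k g) h (\<phi> g k w)" and a = "h \<odot> k", OF g hkg hk phi_linear[OF g hk]])
    show "\<phi> g (h \<odot> k) w \<in> sp (cj (h \<odot> k) g)" if "w \<in> sp g" for w by (rule phi_in[OF g hk that])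
    show "\<phi> g (h \<odot> k) (mo g v n w) = mo (cj (h \<odot> k) g) ((h \<odot> k) v) n (\<phi> g (h \<odot> k) w)"
      if "v \<in> vspace V" "w \<in> sp g" for v n w by (rule phi_mode[OF g hk that])
    show "linear_on (sc g) (sc (cj (h \<odot> k) g)) (sp g) (\<lambda>w. \<phi> (cj k g) h (\<phi> g k w))"
      unfolding e by (rule compose_linear[OF phi_linear[OF g k] phi_linear[OF kg h]]) (rule phi_in[OF g k])
    show "bij_betw (\<lambda>w. \<phi> (cj k g) h (\<phi> g k w)) (sp g) (sp (cj (h \<odot> k) g))"
      unfolding e using bij_betw_trans[OF phi_bij[OF g k] phi_bij[OF kg h]] by (simp add: comp_def)
    fix v n w assume v: "v \<in> vspace V" and w: "w \<in> sp g"
    show "\<phi> (cj k g) h (\<phi> g k (mo g v n w)) = mo (cj (h \<odot> k) g) ((h \<odot> k) v) n (\<phi> (cj k g) h (\<phi> g k w))"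
      unfolding e phi_mode[OF g k v w] aut_mult[OF G_in[OF h] G_in[OF k] v]
      by (rule phi_mode[OF kg h aut_in[OF G_in[OF k] v] phi_in[OF g k w]])
  qed
  then obtain c where c: "\<And>w. w \<in> sp g \<Longrightarrow> \<phi> g (h \<odot> k) w = sc (cj (h \<odot> k) g) c (\<phi> (cj k g) h (\<phi> g k w))" by blast
  obtain w0 where w0: "w0 \<in> sp g" "w0 \<noteq> 0" using ex_nonzero[OF g] by blast
  have nz: "\<phi> g (h \<odot> k) w0 \<noteq> 0" "\<phi> (cj k g) h (\<phi> g k w0) \<noteq> 0"
    using phi_eq_0[OF g hk w0(1)] phi_eq_0[OF g k w0(1)] phi_eq_0[OF kg h phi_in[OF g k w0(1)]] w0(2) by auto
  have "c \<noteq> 0" using c[OF w0(1)] nz by auto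
  show ?thesis
  proof (rule ex1I[of _ "inverse c"])
    show "inverse c \<noteq> 0 \<and> (\<forall>w\<in>sp g. \<phi> g (h \<odot> k) w = sc (cj (h \<odot> k) g) (inverse (inverse c)) (\<phi> (cj k g) h (\<phi> g k w)))"
      using \<open>c \<noteq> 0\<close> c by simp
    fix c' assume "c' \<noteq> 0 \<and> (\<forall>w\<in>sp g. \<phi> g (h \<odot> k) w = sc (cj (h \<odot> k) g) (inverse c') (\<phi> (cj k g) h (\<phi> g k w)))"
    then have "sc (cj (h \<odot> k) g) (inverse c') (\<phi> (cj k g) h (\<phi> g k w0)) = sc (cj (h \<odot> k) g) c (\<phi> (cj k g) h (\<phi> g k w0))"
      using c[OF w0(1)] w0(1) by simp
    then have "inverse c' = c" using nz by simp
    then show "c' = inverse c" by auto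
  qed
qed

lemma al_nz: "g \<in> G \<Longrightarrow> h \<in> G \<Longrightarrow> k \<in> G \<Longrightarrow> al g h k \<noteq> 0"
  and al_eq: "g \<in> G \<Longrightarrow> h \<in> G \<Longrightarrow> k \<in> G \<Longrightarrow> w \<in> sp g \<Longrightarrow>
     \<phi> (cj k g) h (\<phi> g k w) = sc (cj (h \<odot> k) g) (al g h k) (\<phi> g (h \<odot> k) w)"
proof -
  assume g: "g \<in> G" and h: "h \<in> G" and k: "k \<in> G"
  have A: "al g h k \<noteq> 0 \<and> (\<forall>w\<in>sp g. \<phi> g (h \<odot> k) w = sc (cj (h \<odot> k) g) (inverse (al g h k)) (\<phi> (cj k g) h (\<phi> g k w)))"
    unfolding cocycle_def by (rule theI'[OF cocycle_ex[OF g h k]])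
  then show "al g h k \<noteq> 0" by simp
  interpret B: cvector_space "sc (cj (h \<odot> k) g)" by (rule vs) (intro cj_in mul_in g h k)
  show "\<phi> (cj k g) h (\<phi> g k w) = sc (cj (h \<odot> k) g) (al g h k) (\<phi> g (h \<odot> k) w)" if "w \<in> sp g"
    using A that by simp
qed

text \<open>The cocycle relation for h = k = 1 shows that the map and the scalar agree after a
  further application of the map, which is injective.\<close>

lemma phi_one: "g \<in> G \<Longrightarrow> w \<in> sp g \<Longrightarrow> \<phi> g oneG w = sc g (al g oneG oneG) w"
proof -
  assume g: "g \<in> G" and w: "w \<in> sp g"
  interpret cvector_space "sc g" by (rule vs[OF g])
  have in1: "\<phi> g oneG w \<in> sp g" using phi_in[OF g one_in w] cj_one[OF g] by simp
  have "\<phi> g oneG (\<phi> g oneG w) = sc g (al g oneG oneG) (\<phi> g oneG w)"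
    using al_eq[OF g one_in one_in w] cj_one[OF g] by simp
  also have "\<dots> = \<phi> g oneG (sc g (al g oneG oneG) w)"
    using linear_on_scale[OF phi_linear[OF g one_in] w] cj_one[OF g] by simp
  finally show ?thesis
    using phi_bij[OF g one_in] in1 w subspace_scale[OF sub_sp[OF g]] by (auto simp: bij_betw_def inj_on_def)
qed

lemma proj_action: "g \<in> G \<Longrightarrow> proj_action (HC g) (al g) (sc g) (sp g) (\<phi> g)"
proof -
  assume g: "g \<in> G"
  interpret group "HC g" by (rule group_HC[OF g])
  interpret cvector_space "sc g" by (rule vs[OF g])
  show ?thesis
  proof (unfold_locales)
    show "finite (carrier (HC g))" using finite_Cent by simp
    show "al g a b \<noteq> 0" if "a \<in> carrier (HC g)" "b \<in> carrier (HC g)" for a b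
      using that al_nz[OF g] Cent_sub by simp
    show "subspace (sp g)" by (rule sub_sp[OF g])
    show "linear_on (sc g) (sc g) (sp g) (\<phi> g a)" if "a \<in> carrier (HC g)" for a
    proof -
      have a: "a \<in> Cent g" using that by simp
      show ?thesis using phi_linear[OF g Cent_sub[OF a]] cj_Cent[OF a g] by simp
    qed
    show "\<phi> g a w \<in> sp g" if "a \<in> carrier (HC g)" "w \<in> sp g" for a w
    proof -
      have a: "a \<in> Cent g" using that by simp
      show ?thesis using phi_in[OF g Cent_sub[OF a] that(2)] cj_Cent[OF a g] by simp
    qed
    show "\<phi> g a (\<phi> g b w) = sc g (al g a b) (\<phi> g (a \<otimes>\<^bsub>HC g\<^esub> b) w)"
      if "a \<in> carrier (HC g)" "b \<in> carrier (HC g)" "w \<in> sp g" for a b w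
    proof -
      have ab: "a \<in> Cent g" "b \<in> Cent g" and w: "w \<in> sp g" using that by auto
      have "a \<odot> b \<in> Cent g" using subgroup.m_closed[OF subgroup_Cent[OF g] ab] .
      then show ?thesis using al_eq[OF g Cent_sub[OF ab(1)] Cent_sub[OF ab(2)] w] cj_Cent[OF _ g] ab by simp
    qed
    show "\<phi> g \<one>\<^bsub>HC g\<^esub> w = sc g (al g \<one>\<^bsub>HC g\<^esub> \<one>\<^bsub>HC g\<^esub>) w" if "w \<in> sp g" for w
      using phi_one[OF g that] by simp
  qed
qed

lemma cent_algebra_eq: "cent_algebra V G M \<phi> g = twisted_group_algebra (HC g) (al g)"
  by (simp add: cent_algebra_def)

section \<open>Averaging over G and density of the modes of the fixed-point algebra\<close>

definition fixedV :: "'v set" where "fixedV = {v \<in> vspace V. \<forall>g\<in>G. g v = v}"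

definition fixed_modes :: "('v \<times> rat) list \<Rightarrow> bool" where
  "fixed_modes xs \<longleftrightarrow> fst ` set xs \<subseteq> fixedV"

definition average :: "('v \<times> rat) list \<Rightarrow> ('v \<times> rat) list" where
  "average xs = map (\<lambda>(v, n). (\<Sum>k\<in>G. k v, n)) xs"

text \<open>Inverse of the intertwiner for k that ends in the sector g; it starts in the sector of
  k^(-1) g k.\<close>

definition phi_inverse :: "('v \<Rightarrow> 'v) \<Rightarrow> ('v \<Rightarrow> 'v) \<Rightarrow> 'm \<Rightarrow> 'm" where
  "phi_inverse k g w = inv_into (sp (cj (iG k) g)) (\<phi> (cj (iG k) g) k) w"

lemma phi_inverse_in: "k \<in> G \<Longrightarrow> g \<in> G \<Longrightarrow> w \<in> sp g \<Longrightarrow> phi_inverse k g w \<in> sp (cj (iG k) g)"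
  and phi_phi_inverse: "k \<in> G \<Longrightarrow> g \<in> G \<Longrightarrow> w \<in> sp g \<Longrightarrow> \<phi> (cj (iG k) g) k (phi_inverse k g w) = w"
proof -
  assume k: "k \<in> G" and g: "g \<in> G" and w: "w \<in> sp g"
  have "\<phi> (cj (iG k) g) k ` sp (cj (iG k) g) = sp g"
    using phi_bij[OF cj_in[OF iG_in[OF k] g] k] cj_inv(1)[OF k g] by (simp add: bij_betw_def)
  then show "phi_inverse k g w \<in> sp (cj (iG k) g)" "\<phi> (cj (iG k) g) k (phi_inverse k g w) = w"
    using w by (auto simp: phi_inverse_def inv_into_into f_inv_into_f)
qed

lemma sum_G_fixed: "v \<in> vspace V \<Longrightarrow> (\<Sum>k\<in>G. k v) \<in> fixedV"
proof -
  assume v: "v \<in> vspace V"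
  have kv: "k v \<in> vspace V" if "k \<in> G" for k using that v aut_in G_in by blast
  have "h (\<Sum>k\<in>G. k v) = (\<Sum>k\<in>G. k v)" if h: "h \<in> G" for h
  proof -
    have bij: "bij_betw (\<lambda>k. h \<odot> k) G G"
      using h mul_in iG_in G_in by (intro bij_betw_byWitness[where f' = "\<lambda>k. iG h \<odot> k"]) (auto simp: Aut.m_assoc[symmetric])
    have "h (\<Sum>k\<in>G. k v) = (\<Sum>k\<in>G. h (k v))"
      by (rule linear_on_sum[OF aut_linear[OF G_in[OF h]] vector_space_V subspace_V kv])
    also have "\<dots> = (\<Sum>k\<in>G. (h \<odot> k) v)" using h v by (intro sum.cong refl) (simp add: aut_mult G_in)
    also have "\<dots> = (\<Sum>k\<in>G. k v)" by (rule sum.reindex_bij_betw[OF bij])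
    finally show ?thesis .
  qed
  then show ?thesis using VS.subspace_sum[OF subspace_V kv] by (simp add: fixedV_def)
qed

lemma average_fixed: "modes xs \<Longrightarrow> fixed_modes (average xs)"
  using sum_G_fixed by (auto simp: modes_def fixed_modes_def average_def)

text \<open>On M(g) a mode of k v is the mode of v on the sector of k^(-1) g k, conjugated by the
  intertwiner for k.\<close>

lemma act_average:
  assumes xs: "modes xs" and g: "g \<in> G" and w: "w \<in> sp g"
  shows "act (average xs) g w = (\<Sum>k\<in>G. \<phi> (cj (iG k) g) k (act xs (cj (iG k) g) (phi_inverse k g w)))"
  using xs
proof (induction xs)
  case Nil
  have "\<phi> (cj (iG k) g) k 0 = 0" if "k \<in> G" for k using that g by (intro phi_0 cj_in iG_in)
  then show ?case by (simp add: average_def)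
next
  case (Cons a xs)
  obtain v n where a: "a = (v, n)" by (cases a)
  have v: "v \<in> vspace V" and xs: "modes xs" using Cons a by auto
  have kv: "k v \<in> vspace V" if "k \<in> G" for k using that v aut_in G_in by blast
  have "mo g (\<Sum>k\<in>G. k v) n w = (\<Sum>k\<in>G. mo g (k v) n w)"
    by (rule linear_on_sum[OF mo_linear_left[OF g w] vector_space_V subspace_V kv])
  also have "\<dots> = (\<Sum>k\<in>G. \<phi> (cj (iG k) g) k (mo (cj (iG k) g) v n (phi_inverse k g w)))"
  proof (intro sum.cong refl)
    fix k assume k: "k \<in> G"
    show "mo g (k v) n w = \<phi> (cj (iG k) g) k (mo (cj (iG k) g) v n (phi_inverse k g w))"
      using phi_mode[OF cj_in[OF iG_in[OF k] g] k v phi_inverse_in[OF k g w]] phi_phi_inverse[OF k g w] cj_inv(1)[OF k g] by simp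
  qed
  finally have "act (average (a # xs)) g w = (\<Sum>k\<in>G. \<phi> (cj (iG k) g) k (mo (cj (iG k) g) v n (phi_inverse k g w)) +
      \<phi> (cj (iG k) g) k (act xs (cj (iG k) g) (phi_inverse k g w)))"
    using Cons.IH[OF xs] by (simp add: average_def a sum.distrib)
  also have "\<dots> = (\<Sum>k\<in>G. \<phi> (cj (iG k) g) k (act (a # xs) (cj (iG k) g) (phi_inverse k g w)))"
  proof (intro sum.cong refl)
    fix k assume k: "k \<in> G"
    have kg: "cj (iG k) g \<in> G" by (intro cj_in iG_in k g)
    show "\<phi> (cj (iG k) g) k (mo (cj (iG k) g) v n (phi_inverse k g w)) + \<phi> (cj (iG k) g) k (act xs (cj (iG k) g) (phi_inverse k g w)) =
       \<phi> (cj (iG k) g) k (act (a # xs) (cj (iG k) g) (phi_inverse k g w))"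
      using linear_on_add[OF phi_linear[OF kg k] mo_in[OF kg v phi_inverse_in[OF k g w]] act_in[OF xs kg phi_inverse_in[OF k g w]]]
      by (simp add: a)
  qed
  finally show ?case .
qed

text \<open>Density yields a list for V that sends w to a multiple of y and kills every other vector
  arising when the list is averaged. Terms outside the centraliser then vanish, and those inside add
  up to E_00 applied to y.\<close>

lemma fixed_density:
  assumes g: "g \<in> G" and \<rho>: "twisted_group.simple_proj_rep (HC g) (al g) d \<rho>"
    and w: "w \<in> sp g" "w \<noteq> 0" "proj_action.unit_op (HC g) (al g) (sc g) (\<phi> g) d \<rho> 0 0 w = w"
    and y: "y \<in> sp g" "proj_action.unit_op (HC g) (al g) (sc g) (\<phi> g) d \<rho> 0 0 y = y"
    and X: "finite_points X" "\<And>h x k. (h, x) \<in> X \<Longrightarrow> k \<in> G \<Longrightarrow> cj (iG k) h = g \<Longrightarrow>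
        proj_action.unit_op (HC g) (al g) (sc g) (\<phi> g) d \<rho> 0 0 (phi_inverse k h x) = 0"
  shows "\<exists>xs. fixed_modes xs \<and> act xs g w = y \<and> (\<forall>h x. (h, x) \<in> X \<longrightarrow> act xs h x = 0)"
proof -
  interpret P: proj_action "HC g" "al g" "sc g" "sp g" "\<phi> g" by (rule proj_action[OF g])
  have d: "d > 0" and pr: "P.proj_rep d \<rho>" using \<rho> by (auto simp: P.simple_proj_rep_def)
  define u where "u i = P.unit_op d \<rho> i 0 w" for i
  have u0: "u 0 = w" using w(3) by (simp add: u_def)
  have u_in: "u i \<in> sp g" for i by (simp add: u_def P.unit_op_in w(1))
  have tu: "P.transforms d \<rho> u" unfolding u_def[abs_def] by (rule P.transforms_unit_op[OF pr d w(1)])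
  define e where "e = P.unit_op d \<rho> 0 0"
  have e_lin: "linear_on (sc g) (sc g) (sp g) e" by (simp add: e_def P.unit_op_linear)
  have e_u: "e (u i) = (if i = 0 then w else 0)" if "i < d" for i
    unfolding e_def P.unit_op_same[OF \<rho> tu that d d] by (simp add: u0)
  \<comment> \<open>Three kinds of vectors to be killed: the remaining members of the copy of \<rho>
    through w, the transports of w into other sectors, and all transports of the points of
    X.\<close>
  define Z where "Z = ((\<lambda>i. (g, u i)) ` {0<..<d}) \<union> ((\<lambda>k. (cj (iG k) g, phi_inverse k g w)) ` (G - Cent g)) \<union>
     (\<lambda>(p, k). (cj (iG k) (fst p), phi_inverse k (fst p) (snd p))) ` (X \<times> G)"
  have finZ: "finite Z" using X(1) finG by (auto simp: Z_def finite_points_def)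
  have finiteZ: "finite_points Z"
    unfolding finite_points_def
  proof (intro conjI allI impI finZ)
    fix h z assume "(h, z) \<in> Z"
    then show "h \<in> G" "z \<in> sp h"
      unfolding Z_def using X(1) g w(1) u_in by (auto simp: finite_points_def cj_in iG_in phi_inverse_in)
  qed
  have eZ: "e z = 0" if z: "(g, z) \<in> Z" for z
  proof -
    from z consider (1) "(g, z) \<in> (\<lambda>i. (g, u i)) ` {0<..<d}"
      | (2) "(g, z) \<in> (\<lambda>k. (cj (iG k) g, phi_inverse k g w)) ` (G - Cent g)"
      | (3) "(g, z) \<in> (\<lambda>(p, k). (cj (iG k) (fst p), phi_inverse k (fst p) (snd p))) ` (X \<times> G)"
      unfolding Z_def by (elim UnE)
    then show ?thesis
    proof cases
      case 1
      then obtain i where "i \<in> {0<..<d}" "z = u i" by auto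
      then show ?thesis using e_u[of i] by simp
    next
      case 2
      then obtain k where k: "k \<in> G" "k \<notin> Cent g" "cj (iG k) g = g" by auto
      then have "cj k g = g" using cj_inv(1)[OF k(1) g] by simp
      then show ?thesis using cj_fix_iff[OF k(1) g] k by simp
    next
      case 3
      then obtain h x k where "(h, x) \<in> X" "k \<in> G" "cj (iG k) h = g" "z = phi_inverse k h x" by auto
      then show ?thesis using X(2) by (simp add: e_def)
    qed
  qed
  \<comment> \<open>E_00 kills all points of Z in the sector g but fixes w.\<close>
  have out: "w \<notin> P.span {z. (g, z) \<in> Z}"
  proof
    assume a: "w \<in> P.span {z. (g, z) \<in> Z}"
    define K where "K = {x \<in> sp g. e x = 0}"
    have "P.subspace K"
      unfolding K_def
      by (rule P.subspaceI) (auto simp: P.subspace_0[OF sub_sp] P.subspace_add[OF sub_sp] P.subspace_scale[OF sub_sp] g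
          linear_on_0[OF e_lin P.vector_space_axioms sub_sp] linear_on_add[OF e_lin] linear_on_scale[OF e_lin])
    moreover have "{z. (g, z) \<in> Z} \<subseteq> K" using eZ finiteZ by (auto simp: K_def finite_points_def)
    ultimately have "w \<in> K" using P.span_minimal a by blast
    then show False using w by (simp add: K_def e_def)
  qed
  \<comment> \<open>The constant in the definition of \<open>unit_op\<close>; it is built in so that
    the average gives y exactly.\<close>
  define q where "q = (of_nat d / of_nat P.n :: complex)"
  obtain xs where xs: "annihilates xs Z" "act xs g w = sc g q y"
    using density[OF finZ finiteZ g w(1) out P.subspace_scale[OF sub_sp[OF g] y(1), of q]] by (elim exE conjE)
  have mx: "modes xs" using xs by (simp add: annihilates_def)
  have killed: "act xs (cj (iG k) h) (phi_inverse k h x) = 0" if "(h, x) \<in> X" "k \<in> G" for h x k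
  proof -
    have "(cj (iG k) h, phi_inverse k h x) \<in> Z"
      unfolding Z_def by (rule UnI2, rule image_eqI[of _ _ "((h, x), k)"]) (use that in auto)
    then show ?thesis using xs(1) by (simp add: annihilates_def)
  qed
  have killed': "act xs (cj (iG k) g) (phi_inverse k g w) = 0" if "k \<in> G" "k \<notin> Cent g" for k
  proof -
    have "(cj (iG k) g, phi_inverse k g w) \<in> Z"
      unfolding Z_def by (rule UnI1, rule UnI2, rule image_eqI[of _ _ k]) (use that in auto)
    then show ?thesis using xs(1) by (simp add: annihilates_def)
  qed
  \<comment> \<open>For k in the centraliser, the inverse of \<phi>_g(k) maps w to the combination
    of the u_j given by column 0 of the inverse of \<rho>(k). Of it xs sees only u_0 = w.\<close>
  have cent: "\<phi> (cj (iG k) g) k (act xs (cj (iG k) g) (phi_inverse k g w)) = sc g (q * P.rinv \<rho> k $$ (0, 0)) (\<phi> g k y)"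
    if k: "k \<in> Cent g" for k
  proof -
    have kG: "k \<in> G" by (rule Cent_sub[OF k])
    have ik: "cj (iG k) g = g" using cj_inv(2)[OF kG g] cj_Cent[OF k g] by simp
    have kH: "k \<in> carrier (HC g)" using k by simp
    define b where "b = (\<Sum>j<d. sc g (P.rinv \<rho> k $$ (j, 0)) (u j))"
    have b_in: "b \<in> sp g" unfolding b_def by (intro P.subspace_sum[OF sub_sp[OF g]] P.subspace_scale[OF sub_sp[OF g]] u_in)
    have "\<phi> g k b = (\<Sum>j<d. \<phi> g k (sc g (P.rinv \<rho> k $$ (j, 0)) (u j)))"
      unfolding b_def by (rule P.\<pi>_sum[OF kH]) (intro P.subspace_scale[OF sub_sp[OF g]] u_in)
    also have "\<dots> = (\<Sum>j<d. \<Sum>m<d. sc g (\<rho> k $$ (m, j) * P.rinv \<rho> k $$ (j, 0)) (u m))"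
      using tu kH by (intro sum.cong refl) (simp add: P.\<pi>_scale[OF kH] u_in P.transforms_def P.scale_sum_right mult.commute)
    also have "\<dots> = (\<Sum>m<d. \<Sum>j<d. sc g (\<rho> k $$ (m, j) * P.rinv \<rho> k $$ (j, 0)) (u m))" by (rule sum.swap)
    also have "\<dots> = (\<Sum>m<d. if m = 0 then u m else 0)"
    proof (intro sum.cong refl)
      fix m assume m: "m \<in> {..<d}"
      have c: "\<rho> k \<in> carrier_mat d d" "P.rinv \<rho> k \<in> carrier_mat d d" using kH pr P.rinv_carrier by (auto simp: P.proj_rep_def)
      have "(\<Sum>j<d. \<rho> k $$ (m, j) * P.rinv \<rho> k $$ (j, 0)) = 1\<^sub>m d $$ (m, 0)"
        using index_mult_mat_sum[OF c, of m 0] P.rep_rinv(1)[OF pr kH] m d by simp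
      then show "(\<Sum>j<d. sc g (\<rho> k $$ (m, j) * P.rinv \<rho> k $$ (j, 0)) (u m)) = (if m = 0 then u m else 0)"
        using m d by (simp add: P.scale_sum_left[symmetric])
    qed
    also have "\<dots> = w" using d by (simp add: u0)
    finally have "\<phi> g k b = \<phi> g k (phi_inverse k g w)" using phi_phi_inverse[OF kG g w(1)] ik by simp
    then have phi_inverse: "phi_inverse k g w = b"
      using phi_bij[OF g kG] b_in phi_inverse_in[OF kG g w(1)] ik by (auto simp: bij_betw_def inj_on_def)
    have lin: "linear_on (sc g) (sc g) (sp g) (act xs g)" by (rule act_linear[OF mx g])
    have "act xs g b = (\<Sum>j<d. act xs g (sc g (P.rinv \<rho> k $$ (j, 0)) (u j)))"
      unfolding b_def by (rule linear_on_sum[OF lin P.vector_space_axioms sub_sp[OF g]]) (intro P.subspace_scale[OF sub_sp[OF g]] u_in)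
    also have "\<dots> = (\<Sum>j<d. if j = 0 then sc g (P.rinv \<rho> k $$ (j, 0)) (sc g q y) else 0)"
    proof (intro sum.cong refl)
      fix j assume j: "j \<in> {..<d}"
      have "act xs g (u j) = (if j = 0 then sc g q y else 0)"
      proof (cases "j = 0")
        case False
        then have "(g, u j) \<in> Z" using j by (auto simp: Z_def)
        then show ?thesis using xs(1) False by (simp add: annihilates_def)
      qed (simp add: u0 xs)
      then show "act xs g (sc g (P.rinv \<rho> k $$ (j, 0)) (u j)) = (if j = 0 then sc g (P.rinv \<rho> k $$ (j, 0)) (sc g q y) else 0)"
        by (simp add: linear_on_scale[OF lin u_in])
    qed
    also have "\<dots> = sc g (q * P.rinv \<rho> k $$ (0, 0)) y" using d by (simp add: mult.commute)
    finally have "act xs g b = sc g (q * P.rinv \<rho> k $$ (0, 0)) y" .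
    then show ?thesis unfolding ik phi_inverse using P.\<pi>_scale[OF kH y(1)] by simp
  qed
  have "act (average xs) g w = (\<Sum>k\<in>G. \<phi> (cj (iG k) g) k (act xs (cj (iG k) g) (phi_inverse k g w)))"
    by (rule act_average[OF mx g w(1)])
  also have "\<dots> = (\<Sum>k\<in>Cent g. \<phi> (cj (iG k) g) k (act xs (cj (iG k) g) (phi_inverse k g w)))"
    by (rule sum.mono_neutral_right) (use finG g Cent_sub in \<open>auto simp: killed' intro!: phi_0 cj_in iG_in\<close>)
  also have "\<dots> = (\<Sum>k\<in>Cent g. sc g q (sc g (P.rinv \<rho> k $$ (0, 0)) (\<phi> g k y)))"
    by (intro sum.cong refl) (simp add: cent)
  also have "\<dots> = P.unit_op d \<rho> 0 0 y"
    unfolding P.unit_op_def q_def by (simp add: P.scale_sum_right)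
  finally have "act (average xs) g w = y" using y(2) by simp
  moreover have "act (average xs) h x = 0" if hx: "(h, x) \<in> X" for h x
  proof -
    have h: "h \<in> G" and x: "x \<in> sp h" using hx X(1) by (auto simp: finite_points_def)
    show ?thesis unfolding act_average[OF mx h x]
      by (intro sum.neutral ballI) (use hx h in \<open>auto simp: killed intro!: phi_0 cj_in iG_in\<close>)
  qed
  ultimately show ?thesis using average_fixed[OF mx] by blast
qed

end

section \<open>Linear independence of the operators of the centraliser\<close>

context equivariant_family
begin

lemma separating_functional:
  assumes "x \<noteq> 0"
  shows "\<exists>f. f x = 1 \<and> (\<forall>u v. f (u + v) = f u + f v) \<and> (\<forall>c v. f (vscale V c v) = c * f v)"
proof -
  have ind: "VS.independent {x}" using assms by simp
  define B where "B = VS.extend_basis {x}"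
  have B: "VS.independent B" "VS.span B = UNIV" "x \<in> B"
    using VS.independent_extend_basis[OF ind] VS.span_extend_basis[OF ind] VS.extend_basis_superset[OF ind] by (auto simp: B_def)
  define f where "f v = VS.representation B v x" for v
  have "f x = 1" using VS.representation_basis[OF B(1,3)] by (simp add: f_def)
  moreover have "f (u + v) = f u + f v" for u v
    using VS.representation_add[OF B(1), of v u] B(2) by (simp add: f_def)
  moreover have "f (vscale V c v) = c * f v" for c v
    using VS.representation_scale[OF B(1), of v c] B(2) by (simp add: f_def)
  ultimately show ?thesis by blast
qed

definition relation :: "('v \<Rightarrow> 'v) \<Rightarrow> (('v \<Rightarrow> 'v) \<Rightarrow> complex) \<Rightarrow> bool" where
  "relation g c \<longleftrightarrow> (\<forall>w\<in>sp g. (\<Sum>a\<in>Cent g. sc g (c a) (\<phi> g a w)) = 0)"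

text \<open>Relations among the operators \<open>\<phi> g a\<close> form a module over the algebra generated by
  the matrix coefficients of $G$ on $V$: in $\sum_a c_a Y_g(au,z)\phi_g(a)w = 0$ the left factors can be
  tested separately because $u \otimes w \mapsto Y_g(u,z)w$ is injective.\<close>

lemma relation_coefficient:
  assumes g: "g \<in> G" and rel: "relation g c" and u: "u \<in> vspace V"
    and f: "\<And>u v. f (u + v) = f u + f v" "\<And>k v. f (vscale V k v) = k * f v"
  shows "relation g (\<lambda>a. c a * f (a u))"
  unfolding relation_def
proof
  fix w assume w: "w \<in> sp g"
  interpret T: twisted_on V g "M g" by (rule tw[OF g])
  let ?C = "Cent g"
  have fin: "finite ?C" by (rule finite_Cent)
  have phiw: "\<phi> g a w \<in> sp g" if "a \<in> ?C" for a using phi_in[OF g Cent_sub[OF that] w] cj_Cent[OF that g] by simp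
  have au: "a u \<in> vspace V" if "a \<in> ?C" for a using aut_in[OF G_in[OF Cent_sub[OF that]] u] .
  \<comment> \<open>The vectors \<phi>_g(a) w may be dependent, so they are expressed in a basis B
    chosen among them; the relation is regrouped along B.\<close>
  define S where "S = (\<lambda>a. \<phi> g a w) ` ?C"
  obtain B where B: "B \<subseteq> S" "T.MS.independent B" "S \<subseteq> T.MS.span B"
    using T.MS.maximal_independent_subset[of S] by metis
  have finB: "finite B" using B(1) fin finite_subset by (auto simp: S_def)
  have Bsp: "b \<in> sp g" if "b \<in> B" for b using that B(1) phiw by (auto simp: S_def)
  define r where "r a b = T.MS.representation B (\<phi> g a w) b" for a b
  have r: "\<phi> g a w = (\<Sum>b\<in>B. sc g (r a b) b)" if "a \<in> ?C" for a
    using T.MS.sum_representation_eq[OF B(2) _ finB subset_refl, of "\<phi> g a w"] B(3) that by (auto simp: r_def S_def)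
  define vb where "vb b = (\<Sum>a\<in>?C. vscale V (c a * r a b) (a u))" for b
  have vb_in: "vb b \<in> vspace V" for b
    unfolding vb_def by (intro VS.subspace_sum[OF subspace_V] VS.subspace_scale[OF subspace_V] au)
  \<comment> \<open>This is the given relation evaluated at u_n w, since \<phi>_g(a) u_n w = (a u)_n
    \<phi>_g(a) w.\<close>
  have z: "(\<Sum>b\<in>B. mo g (vb b) n b) = 0" for n
  proof -
    have "mo g (vb b) n b = (\<Sum>a\<in>?C. sc g (c a) (sc g (r a b) (mo g (a u) n b)))" if b: "b \<in> B" for b
    proof -
      have "mo g (vb b) n b = (\<Sum>a\<in>?C. mo g (vscale V (c a * r a b) (a u)) n b)"
        unfolding vb_def
        by (rule linear_on_sum[OF mo_linear_left[OF g Bsp[OF b]] vector_space_V subspace_V])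
          (intro VS.subspace_scale[OF subspace_V] au)
      then show ?thesis by (simp add: linear_on_scale[OF mo_linear_left[OF g Bsp[OF b]] au])
    qed
    then have "(\<Sum>b\<in>B. mo g (vb b) n b) = (\<Sum>b\<in>B. \<Sum>a\<in>?C. sc g (c a) (sc g (r a b) (mo g (a u) n b)))" by simp
    also have "\<dots> = (\<Sum>a\<in>?C. \<Sum>b\<in>B. sc g (c a) (sc g (r a b) (mo g (a u) n b)))" by (rule sum.swap)
    also have "\<dots> = (\<Sum>a\<in>?C. sc g (c a) (\<phi> g a (mo g u n w)))"
    proof (intro sum.cong refl)
      fix a assume a: "a \<in> ?C"
      have "\<phi> g a (mo g u n w) = mo g (a u) n (\<phi> g a w)"
        using phi_mode[OF g Cent_sub[OF a] u w] cj_Cent[OF a g] by simp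
      also have "\<dots> = (\<Sum>b\<in>B. mo g (a u) n (sc g (r a b) b))"
        unfolding r[OF a] by (rule linear_on_sum[OF T.md_linear[OF au[OF a]] T.vector_space_M T.subspace_MM])
          (intro T.MS.subspace_scale[OF T.subspace_MM] Bsp)
      also have "\<dots> = (\<Sum>b\<in>B. sc g (r a b) (mo g (a u) n b))"
        by (intro sum.cong refl) (simp add: linear_on_scale[OF T.md_linear[OF au[OF a]]] Bsp)
      finally show "(\<Sum>b\<in>B. sc g (c a) (sc g (r a b) (mo g (a u) n b))) = sc g (c a) (\<phi> g a (mo g u n w))"
        by (simp add: T.MS.scale_sum_right)
    qed
    also have "\<dots> = 0" using rel mo_in[OF g u w] by (simp add: relation_def)
    finally show ?thesis .
  qed
  \<comment> \<open>One use of \<open>locality_sum\<close> per summand suffices, because xs is a sum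
    of single modes.\<close>
  have zact: "(\<Sum>b\<in>B. mo g (vb b) n (act xs g b)) = 0" if "modes xs" for xs n
    using that
  proof (induction xs)
    case Nil
    then show ?case using T.md_0[OF vb_in] by simp
  next
    case (Cons p xs)
    obtain v m where p: "p = (v, m)" by (cases p)
    have v: "v \<in> vspace V" and xs: "modes xs" using Cons p by auto
    have "(\<Sum>b\<in>B. mo g (vb b) n (act (p # xs) g b)) =
      (\<Sum>b\<in>B. mo g (vb b) n (mo g v m b) + mo g (vb b) n (act xs g b))"
      using act_in[OF xs g] mo_in[OF g v] Bsp by (intro sum.cong refl) (simp add: p linear_on_add[OF T.md_linear[OF vb_in]])
    also have "\<dots> = 0"
      using Cons.IH[OF xs] T.locality_sum[OF v finB vb_in Bsp z] by (simp add: sum.distrib)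
    finally show ?case .
  qed
  \<comment> \<open>By density some list sends b to an arbitrary y and the rest of B to zero, so all
    modes of \<open>vb b\<close> vanish on M(g).\<close>
  have vb0: "vb b = 0" if b: "b \<in> B" for b
  proof (rule faithful_module[OF g vb_in])
    fix n y assume y: "y \<in> sp g"
    define Z where "Z = Pair g ` (B - {b})"
    have Z: "finite Z" "finite_points Z" using finB Bsp g by (auto simp: Z_def finite_points_def)
    have "{z. (g, z) \<in> Z} = B - {b}" by (auto simp: Z_def)
    then have "b \<notin> T.MS.span {z. (g, z) \<in> Z}" using B(2) b by (simp add: T.MS.dependent_def)
    from density[OF Z g Bsp[OF b] this y] obtain xs where xs: "annihilates xs Z" "act xs g b = y" by (elim exE conjE)
    have "mo g (vb b) n y = (\<Sum>b'\<in>B. if b' = b then mo g (vb b') n y else 0)" using finB b by simp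
    also have "\<dots> = (\<Sum>b'\<in>B. mo g (vb b') n (act xs g b'))"
      using xs T.md_0[OF vb_in] by (intro sum.cong refl) (auto simp: annihilates_def Z_def)
    also have "\<dots> = 0" using xs(1) by (intro zact) (simp add: annihilates_def)
    finally show "mo g (vb b) n y = 0" .
  qed
  have f0: "f 0 = 0" using f(1)[of 0 0] by simp
  have fsum: "f (\<Sum>i\<in>I. x i) = (\<Sum>i\<in>I. f (x i))" for I :: "('v \<Rightarrow> 'v) set" and x
    by (induction I rule: infinite_finite_induct) (simp_all add: f0 f(1))
  have coef: "(\<Sum>a\<in>?C. c a * r a b * f (a u)) = 0" if "b \<in> B" for b
    using fsum[of "\<lambda>a. vscale V (c a * r a b) (a u)" ?C] vb0[OF that] f0 by (simp add: vb_def f(2))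
  have "(\<Sum>a\<in>?C. sc g (c a * f (a u)) (\<phi> g a w)) = (\<Sum>a\<in>?C. \<Sum>b\<in>B. sc g (c a * r a b * f (a u)) b)"
    by (intro sum.cong refl) (simp add: r T.MS.scale_sum_right mult.commute mult.left_commute)
  also have "\<dots> = (\<Sum>b\<in>B. \<Sum>a\<in>?C. sc g (c a * r a b * f (a u)) b)" by (rule sum.swap)
  also have "\<dots> = 0" by (simp add: T.MS.scale_sum_left[symmetric] coef)
  finally show "(\<Sum>a\<in>?C. sc g (c a * f (a u)) (\<phi> g a w)) = 0" .
qed

lemma relation_diff_scale:
  assumes g: "g \<in> G" and "relation g c" "relation g c'"
  shows "relation g (\<lambda>a. c a - k * c' a)"
proof -
  interpret cvector_space "sc g" by (rule vs[OF g])
  show ?thesis using assms(2,3)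
    by (simp add: relation_def scale_left_diff_distrib sum_subtractf scale_sum_right[symmetric] flip: scale_scale)
qed

text \<open>As in the proof that distinct characters are independent: multiplying the coefficients
  by f(a u) - f(a1 u) removes a1, and f can be chosen so that a0 survives. Removing all others
  leaves one invertible operator.\<close>

lemma relation_trivial:
  assumes g: "g \<in> G" and rel: "relation g c" and a0: "a0 \<in> Cent g"
  shows "c a0 = 0"
proof -
  interpret cvector_space "sc g" by (rule vs[OF g])
  have "\<exists>q. relation g (\<lambda>a. c a * q a) \<and> q a0 \<noteq> 0 \<and> (\<forall>a\<in>S. q a = 0)" if "S \<subseteq> Cent g - {a0}" for S
    using finite_subset[OF that] finite_Cent that
  proof -
    have "finite S" using that finite_Cent finite_subset by blast
    then show ?thesis using that
    proof (induction S rule: finite_induct)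
      case empty
      then show ?case using rel by (intro exI[of _ "\<lambda>_. 1"]) simp
    next
      case (insert a1 S)
      then obtain q where q: "relation g (\<lambda>a. c a * q a)" "q a0 \<noteq> 0" "\<And>a. a \<in> S \<Longrightarrow> q a = 0" by auto
      have ne: "a0 \<noteq> a1" and a1: "a1 \<in> Cent g" using insert by auto
      obtain u where u: "u \<in> vspace V" "a0 u \<noteq> a1 u"
        using aut_eqI[OF G_in[OF Cent_sub[OF a0]] G_in[OF Cent_sub[OF a1]]] ne by blast
      then have "a0 u - a1 u \<noteq> 0" by simp
      from separating_functional[OF this] obtain f where f': "f (a0 u - a1 u) = (1::complex)"
        "\<forall>u v. f (u + v) = f u + f v" "\<forall>c v. f (vscale V c v) = c * f v" by (elim exE conjE)
      note f = f'(1) f'(2)[rule_format] f'(3)[rule_format]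
      have "f (a0 u) = f (a0 u - a1 u) + f (a1 u)" using f(2)[of "a0 u - a1 u" "a1 u"] by simp
      then have fne: "f (a0 u) - f (a1 u) = 1" using f(1) by simp
      \<comment> \<open>Vanishes at a1 and wherever q does, and equals q at a0 by the choice of
        f.\<close>
      define q' where "q' a = q a * (f (a u) - f (a1 u))" for a
      have "relation g (\<lambda>a. c a * q a * f (a u) - f (a1 u) * (c a * q a))"
        by (intro relation_diff_scale[OF g] relation_coefficient[OF g] q u f)
      then have "relation g (\<lambda>a. c a * q' a)" by (simp add: q'_def algebra_simps)
      then show ?case using q(2,3) fne by (intro exI[of _ q']) (auto simp: q'_def)
    qed
  qed
  from this[of "Cent g - {a0}"] obtain q where q: "relation g (\<lambda>a. c a * q a)" "q a0 \<noteq> 0"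
    "\<And>a. a \<in> Cent g - {a0} \<Longrightarrow> q a = 0" by auto
  obtain w where w: "w \<in> sp g" "w \<noteq> 0" using ex_nonzero[OF g] by blast
  have "0 = (\<Sum>a\<in>Cent g. sc g (c a * q a) (\<phi> g a w))" using q(1) w by (simp add: relation_def)
  also have "\<dots> = (\<Sum>a\<in>Cent g. if a = a0 then sc g (c a * q a) (\<phi> g a w) else 0)"
    by (intro sum.cong refl) (use q(3) in auto)
  also have "\<dots> = sc g (c a0 * q a0) (\<phi> g a0 w)" using a0 finite_Cent by simp
  finally have "c a0 * q a0 = 0 \<or> \<phi> g a0 w = 0" by (metis scale_eq_0_iff)
  then show ?thesis using q(2) phi_eq_0[OF g Cent_sub[OF a0] w(1)] w(2) by auto
qed

text \<open>Every simple character occurs in M(g). If E_00 were zero, its coefficients would form a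
  relation and hence vanish, but at the neutral element the coefficient is a nonzero multiple of the
  inverse of \<alpha>_g(1,1).\<close>

lemma unit_op_nonzero:
  assumes g: "g \<in> G" and \<rho>: "twisted_group.simple_proj_rep (HC g) (al g) d \<rho>"
  shows "\<exists>w\<in>sp g. proj_action.unit_op (HC g) (al g) (sc g) (\<phi> g) d \<rho> 0 0 w \<noteq> 0"
proof (rule ccontr)
  interpret P: proj_action "HC g" "al g" "sc g" "sp g" "\<phi> g" by (rule proj_action[OF g])
  assume "\<not> ?thesis"
  then have z: "P.unit_op d \<rho> 0 0 w = 0" if "w \<in> sp g" for w using that by blast
  have d: "d > 0" and pr: "P.proj_rep d \<rho>" using \<rho> by (auto simp: P.simple_proj_rep_def)
  have q: "(of_nat d / of_nat P.n :: complex) \<noteq> 0" using d P.n_pos by simp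
  have "relation g (\<lambda>a. P.rinv \<rho> a $$ (0, 0))"
    unfolding relation_def
  proof
    fix w assume "w \<in> sp g"
    then show "(\<Sum>a\<in>Cent g. sc g (P.rinv \<rho> a $$ (0, 0)) (\<phi> g a w)) = 0" using z[of w] q by (simp add: P.unit_op_def)
  qed
  then have "P.rinv \<rho> oneG $$ (0, 0) = 0"
    by (rule relation_trivial[OF g]) (rule subgroup.one_closed[OF subgroup_Cent[OF g]])
  moreover have o: "oneG \<in> carrier (HC g)" using subgroup.one_closed[OF subgroup_Cent[OF g]] by simp
  have "\<rho> oneG = al g oneG oneG \<cdot>\<^sub>m 1\<^sub>m d" using pr by (simp add: P.proj_rep_def)
  then have "1\<^sub>m d = al g oneG oneG \<cdot>\<^sub>m P.rinv \<rho> oneG"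
    using P.rep_rinv(1)[OF pr o] P.rinv_carrier[OF pr o] by (simp add: mult_smult_assoc_mat[of _ d d _ d])
  then have "(1\<^sub>m d :: complex mat) $$ (0, 0) = al g oneG oneG * P.rinv \<rho> oneG $$ (0, 0)"
    using P.rinv_carrier[OF pr o] d by simp
  ultimately show False using d by simp
qed

end

section \<open>Decomposition\<close>

lemma finite_dim_subspace:
  assumes "vector_space s" "finite_dim s E" "csubspace s E'" "E' \<subseteq> E"
  shows "finite_dim s E'"
proof -
  interpret vector_space s by fact
  obtain B where B: "finite B" "E = span B" using assms(2) by (auto simp: finite_dim_def)
  obtain B' where B': "B' \<subseteq> E'" "independent B'" "E' \<subseteq> span B'" using maximal_independent_subset by metis
  have "finite B'" using independent_span_bound[OF B(1) B'(2)] B'(1) assms(4) B(2) by auto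
  moreover have "span B' = E'" using B' span_minimal[OF B'(1) assms(3)] by blast
  ultimately show ?thesis by (auto simp: finite_dim_def)
qed

lemma vector_space_fun:
  assumes "vector_space s"
  shows "vector_space (\<lambda>c f i. s c (f i))"
proof -
  interpret vector_space s by fact
  show ?thesis by unfold_locales (auto simp: fun_eq_iff scale_right_distrib scale_left_distrib)
qed

context equivariant_family
begin

abbreviation "FV \<equiv> fixed_voa V G"
abbreviation "Irr g \<equiv> irr V G M \<phi> g"
abbreviation "CA g \<equiv> cent_algebra V G M \<phi> g"

lemma vspace_FV: "vspace FV = fixedV"
  and FV_simps [simp]: "vmode FV = vmode V" "vscale FV = vscale V" "vac FV = vac V" "conf FV = conf V" "vrank FV = vrank V"
  by (simp_all add: fixed_voa_def fixedV_def)

lemma fixedV_sub: "v \<in> fixedV \<Longrightarrow> v \<in> vspace V"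
  and fixedV_fix: "v \<in> fixedV \<Longrightarrow> g \<in> G \<Longrightarrow> g v = v"
  by (simp_all add: fixedV_def)

lemma conf_fixed: "conf V \<in> fixedV" and vac_fixed: "vac V \<in> fixedV"
  using aut_conf aut_vac G_in conf_in vac_in by (auto simp: fixedV_def)

lemma core_FV: "voa_core FV"
proof (rule voa_core.intro, unfold FV_simps vspace_FV)
  show "VS.subspace fixedV"
    using linear_on_0[OF aut_linear[OF G_in] vector_space_V subspace_V]
    by (intro VS.subspaceI)
      (auto simp: fixedV_def VS.subspace_0[OF subspace_V] VS.subspace_add[OF subspace_V] VS.subspace_scale[OF subspace_V]
        linear_on_add[OF aut_linear[OF G_in]] linear_on_scale[OF aut_linear[OF G_in]])
  show "vmode V u n v \<in> fixedV" if "u \<in> fixedV" "v \<in> fixedV" for u v n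
  proof -
    have uv: "u \<in> vspace V" "v \<in> vspace V" using that fixedV_sub by auto
    have "g (vmode V u n v) = vmode V u n v" if g: "g \<in> G" for g
      using aut_vmode[OF G_in[OF g] uv] fixedV_fix[OF \<open>u \<in> fixedV\<close> g] fixedV_fix[OF \<open>v \<in> fixedV\<close> g] by simp
    then show ?thesis using vmode_in[OF uv] by (simp add: fixedV_def)
  qed
qed (rule vector_space_V vac_fixed conf_fixed)+

definition irr_data :: "('v \<Rightarrow> 'v) \<Rightarrow> 'v character \<Rightarrow> nat \<times> ((('v \<Rightarrow> 'v) \<Rightarrow> complex) \<Rightarrow> complex mat)" where
  "irr_data g \<chi> = (SOME p. simple_matrix_rep (CA g) (fst p) (snd p) \<and> rep_character (CA g) (fst p) (snd p) = \<chi>)"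

definition "dimg g \<chi> = fst (irr_data g \<chi>)"
definition "repg g \<chi> = snd (irr_data g \<chi>)"
definition "basisrep g \<chi> a = repg g \<chi> (basis_elt a)"

lemma irr_data:
  assumes "\<chi> \<in> Irr g"
  shows "simple_matrix_rep (CA g) (dimg g \<chi>) (repg g \<chi>)" "rep_character (CA g) (dimg g \<chi>) (repg g \<chi>) = \<chi>"
proof -
  obtain n R where "simple_matrix_rep (CA g) n R \<and> rep_character (CA g) n R = \<chi>"
    using assms by (auto simp: simple_characters_def)
  then have "\<exists>p. simple_matrix_rep (CA g) (fst p) (snd p) \<and> rep_character (CA g) (fst p) (snd p) = \<chi>"
    by (intro exI[of _ "(n, R)"]) simp
  from someI_ex[OF this] show "simple_matrix_rep (CA g) (dimg g \<chi>) (repg g \<chi>)" "rep_character (CA g) (dimg g \<chi>) (repg g \<chi>) = \<chi>"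
    by (simp_all add: irr_data_def dimg_def repg_def)
qed

abbreviation "uop g \<chi> \<equiv> proj_action.unit_op (HC g) (al g) (sc g) (\<phi> g) (dimg g \<chi>) (basisrep g \<chi>)"

lemma twisted_group: "g \<in> G \<Longrightarrow> twisted_group (HC g) (al g)"
  using proj_action by (simp add: proj_action_def)

lemma simple_basisrep:
  assumes g: "g \<in> G" and \<chi>: "\<chi> \<in> Irr g"
  shows "twisted_group.simple_proj_rep (HC g) (al g) (dimg g \<chi>) (basisrep g \<chi>)"
  using twisted_group.simple_matrix_rep_basis[OF twisted_group[OF g] irr_data(1)[OF \<chi>, unfolded cent_algebra_eq]]
  by (simp add: basisrep_def[abs_def])

lemma proj_basisrep: "g \<in> G \<Longrightarrow> \<chi> \<in> Irr g \<Longrightarrow> twisted_group.proj_rep (HC g) (al g) (dimg g \<chi>) (basisrep g \<chi>)"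
  and dimg_pos: "g \<in> G \<Longrightarrow> \<chi> \<in> Irr g \<Longrightarrow> dimg g \<chi> > 0"
  using simple_basisrep by (auto simp: twisted_group.simple_proj_rep_def[OF twisted_group])

lemma character_basis:
  assumes g: "g \<in> G" and \<chi>: "\<chi> \<in> Irr g" and a: "a \<in> Cent g"
  shows "\<chi> (basis_elt a) = mtrace (dimg g \<chi>) (basisrep g \<chi> a)"
  using twisted_group.rep_character_basis[OF twisted_group[OF g], of a "dimg g \<chi>" "repg g \<chi>"] a irr_data(2)[OF \<chi>]
  by (simp add: basisrep_def cent_algebra_eq)

lemma irr_distinct:
  assumes g: "g \<in> G" and \<chi>: "\<chi> \<in> Irr g" "\<chi>' \<in> Irr g" "\<chi> \<noteq> \<chi>'"
  shows "\<exists>a\<in>Cent g. mtrace (dimg g \<chi>) (basisrep g \<chi> a) \<noteq> mtrace (dimg g \<chi>') (basisrep g \<chi>' a)"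
proof (rule ccontr)
  assume n: "\<not> ?thesis"
  have "rep_character (CA g) (dimg g \<chi>) (repg g \<chi>) = rep_character (CA g) (dimg g \<chi>') (repg g \<chi>')"
    unfolding cent_algebra_eq
  proof (rule twisted_group.rep_character_eqI[OF twisted_group[OF g]])
    show "matrix_rep (twisted_group_algebra (HC g) (al g)) (dimg g \<chi>) (repg g \<chi>)"
      "matrix_rep (twisted_group_algebra (HC g) (al g)) (dimg g \<chi>') (repg g \<chi>')"
      using irr_data(1)[OF \<chi>(1)] irr_data(1)[OF \<chi>(2)] by (simp_all add: simple_matrix_rep_def cent_algebra_eq)
  qed (use n in \<open>auto simp: basisrep_def\<close>)
  then show False using irr_data(2) \<chi> by simp
qed

lemma irr_complete:
  assumes g: "g \<in> G" and \<rho>: "twisted_group.simple_proj_rep (HC g) (al g) d \<rho>"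
  shows "\<exists>\<chi>\<in>Irr g. \<forall>a\<in>Cent g. mtrace d (\<rho> a) = mtrace (dimg g \<chi>) (basisrep g \<chi> a)"
proof -
  interpret T: twisted_group "HC g" "al g" by (rule twisted_group[OF g])
  define \<chi> where "\<chi> = rep_character (CA g) d (T.ext d \<rho>)"
  have pr: "T.proj_rep d \<rho>" using \<rho> by (simp add: T.simple_proj_rep_def)
  have \<chi>: "\<chi> \<in> Irr g"
    using T.simple_matrix_rep_ext[OF \<rho>] by (auto simp: \<chi>_def simple_characters_def cent_algebra_eq)
  moreover have "mtrace d (\<rho> a) = mtrace (dimg g \<chi>) (basisrep g \<chi> a)" if a: "a \<in> Cent g" for a
    using character_basis[OF g \<chi> a] T.rep_character_basis[of a d "T.ext d \<rho>"] T.ext_basis[OF pr, of a] a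
    by (simp add: \<chi>_def cent_algebra_eq)
  ultimately show ?thesis by blast
qed

text \<open>Deduced from the action on M(g), where all simple characters occur, without a structure
  theory of the algebra.\<close>

lemma finite_irr:
  assumes g: "g \<in> G"
  shows "finite (Irr g)"
proof -
  interpret P: proj_action "HC g" "al g" "sc g" "sp g" "\<phi> g" by (rule proj_action[OF g])
  show ?thesis
  proof (rule P.finite_isotypic[where d = "dimg g" and \<rho> = "basisrep g"])
    show "P.simple_proj_rep (dimg g \<chi>) (basisrep g \<chi>)" if "\<chi> \<in> Irr g" for \<chi> by (rule simple_basisrep[OF g that])
    show "\<exists>a\<in>carrier (HC g). mtrace (dimg g \<chi>) (basisrep g \<chi> a) \<noteq> mtrace (dimg g \<chi>') (basisrep g \<chi>' a)"
      if "\<chi> \<in> Irr g" "\<chi>' \<in> Irr g" "\<chi> \<noteq> \<chi>'" for \<chi> \<chi>' using irr_distinct[OF g that] by simp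
    show "\<exists>w\<in>sp g. uop g \<chi> 0 0 w \<noteq> 0" if "\<chi> \<in> Irr g" for \<chi>
      by (rule unit_op_nonzero[OF g simple_basisrep[OF g that]])
  qed
qed

lemma decomposition_identity:
  assumes g: "g \<in> G" and w: "w \<in> sp g"
  shows "w = (\<Sum>\<chi>\<in>Irr g. \<Sum>i<dimg g \<chi>. uop g \<chi> i i w)"
proof -
  interpret P: proj_action "HC g" "al g" "sc g" "sp g" "\<phi> g" by (rule proj_action[OF g])
  show ?thesis
  proof (rule P.isotypic_decomposition[where I = "Irr g" and d = "dimg g" and \<rho> = "basisrep g" and w = w])
    show "finite (Irr g)" "w \<in> sp g" by (rule finite_irr[OF g] w)+
    show "P.simple_proj_rep (dimg g \<chi>) (basisrep g \<chi>)" if "\<chi> \<in> Irr g" for \<chi> by (rule simple_basisrep[OF g that])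
    show "\<exists>a\<in>carrier (HC g). mtrace (dimg g \<chi>) (basisrep g \<chi> a) \<noteq> mtrace (dimg g \<chi>') (basisrep g \<chi>' a)"
      if "\<chi> \<in> Irr g" "\<chi>' \<in> Irr g" "\<chi> \<noteq> \<chi>'" for \<chi> \<chi>' using irr_distinct[OF g that] by simp
    show "\<exists>\<chi>\<in>Irr g. \<forall>a\<in>carrier (HC g). mtrace d' (\<rho>' a) = mtrace (dimg g \<chi>) (basisrep g \<chi> a)"
      if "P.simple_proj_rep d' \<rho>'" for d' \<rho>' using irr_complete[OF g that] by simp
  qed
qed

lemma uop_in: "g \<in> G \<Longrightarrow> w \<in> sp g \<Longrightarrow> uop g \<chi> i j w \<in> sp g"
  by (rule proj_action.unit_op_in[OF proj_action])

lemma uop_linear: "g \<in> G \<Longrightarrow> linear_on (sc g) (sc g) (sp g) (uop g \<chi> i j)"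
  by (rule proj_action.unit_op_linear[OF proj_action])

lemma uop_0: "g \<in> G \<Longrightarrow> uop g \<chi> i j 0 = 0"
  by (rule linear_on_0[OF uop_linear vsp sub_sp])

lemma uop_uop:
  assumes g: "g \<in> G" and \<chi>: "\<chi> \<in> Irr g" "\<chi>' \<in> Irr g" and i: "i < dimg g \<chi>" "j < dimg g \<chi>" "k < dimg g \<chi>'" "l < dimg g \<chi>'"
    and w: "w \<in> sp g"
  shows "uop g \<chi>' k l (uop g \<chi> i j w) = (if \<chi>' = \<chi> \<and> i = l then uop g \<chi> k j w else 0)"
proof (cases "\<chi>' = \<chi>")
  case True
  interpret P: proj_action "HC g" "al g" "sc g" "sp g" "\<phi> g" by (rule proj_action[OF g])
  have "uop g \<chi> k l (uop g \<chi> i j w) = (if i = l then uop g \<chi> k j w else 0)"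
  proof (rule P.unit_op_unit_op)
    show "P.simple_proj_rep (dimg g \<chi>) (basisrep g \<chi>)" by (rule simple_basisrep[OF g \<chi>(1)])
  qed (use i w True in simp_all)
  then show ?thesis using True by simp
next
  case False
  then obtain a where a: "a \<in> Cent g" "mtrace (dimg g \<chi>) (basisrep g \<chi> a) \<noteq> mtrace (dimg g \<chi>') (basisrep g \<chi>' a)"
    using irr_distinct[OF g \<chi>] by blast
  have "a \<in> carrier (HC g)" using a by simp
  interpret P: proj_action "HC g" "al g" "sc g" "sp g" "\<phi> g" by (rule proj_action[OF g])
  have "uop g \<chi>' k l (uop g \<chi> i j w) = 0"
  proof (rule P.unit_op_unit_op_diff[where ?a0.0 = a])
    show "P.simple_proj_rep (dimg g \<chi>) (basisrep g \<chi>)" "P.simple_proj_rep (dimg g \<chi>') (basisrep g \<chi>')"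
      by (rule simple_basisrep[OF g \<chi>(1)], rule simple_basisrep[OF g \<chi>(2)])
  qed (use i w a in simp_all)
  then show ?thesis using False by simp
qed

lemma uop_fixed_mode:
  assumes g: "g \<in> G" and v: "v \<in> fixedV" and w: "w \<in> sp g"
  shows "uop g \<chi> i j (mo g v n w) = mo g v n (uop g \<chi> i j w)"
proof -
  interpret P: proj_action "HC g" "al g" "sc g" "sp g" "\<phi> g" by (rule proj_action[OF g])
  have vV: "v \<in> vspace V" using v by (rule fixedV_sub)
  have lin: "linear_on (sc g) (sc g) (sp g) (mo g v n)" by (rule mo_linear[OF g vV])
  have c: "\<phi> g a (mo g v n w) = mo g v n (\<phi> g a w)" if a: "a \<in> Cent g" for a
    using phi_mode[OF g Cent_sub[OF a] vV w] cj_Cent[OF a g] fixedV_fix[OF v Cent_sub[OF a]] by simp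
  have pin: "\<phi> g a w \<in> sp g" if "a \<in> Cent g" for a using P.\<pi>_in that w by simp
  let ?r = "P.rinv (basisrep g \<chi>)"
  have "mo g v n (\<Sum>a\<in>Cent g. sc g (?r a $$ (j, i)) (\<phi> g a w)) = (\<Sum>a\<in>Cent g. mo g v n (sc g (?r a $$ (j, i)) (\<phi> g a w)))"
    by (rule linear_on_sum[OF lin P.vector_space_axioms P.subW]) (intro P.subspace_scale[OF P.subW] pin)
  also have "\<dots> = (\<Sum>a\<in>Cent g. sc g (?r a $$ (j, i)) (\<phi> g a (mo g v n w)))"
    by (intro sum.cong refl) (simp add: linear_on_scale[OF lin pin] c)
  finally have e: "(\<Sum>a\<in>Cent g. sc g (?r a $$ (j, i)) (\<phi> g a (mo g v n w))) = mo g v n (\<Sum>a\<in>Cent g. sc g (?r a $$ (j, i)) (\<phi> g a w))" ..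
  have "(\<Sum>a\<in>Cent g. sc g (?r a $$ (j, i)) (\<phi> g a w)) \<in> sp g"
    by (intro P.subspace_sum[OF P.subW] P.subspace_scale[OF P.subW] pin)
  from linear_on_scale[OF lin this] show ?thesis unfolding P.unit_op_def by (simp add: e)
qed

text \<open>The image of the idempotent $E_{00}$ serves as the multiplicity space of \<open>\<chi>\<close>.\<close>

definition Wsp :: "('v \<Rightarrow> 'v) \<Rightarrow> 'v character \<Rightarrow> 'm set" where
  "Wsp g \<chi> = {w \<in> sp g. uop g \<chi> 0 0 w = w}"

definition Wmod :: "('v \<Rightarrow> 'v) \<Rightarrow> 'v character \<Rightarrow> ('v, 'm) twmod" where
  "Wmod g \<chi> = (M g) \<lparr>mspace := Wsp g \<chi>, mgrade := (\<lambda>l. mgrade (M g) l \<inter> Wsp g \<chi>)\<rparr>"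

lemma Wmod_simps [simp]: "mscale (Wmod g \<chi>) = sc g" "mspace (Wmod g \<chi>) = Wsp g \<chi>" "mmode (Wmod g \<chi>) = mo g"
  "mgrade (Wmod g \<chi>) l = mgrade (M g) l \<inter> Wsp g \<chi>"
  by (simp_all add: Wmod_def)

lemma Wsp_sub: "w \<in> Wsp g \<chi> \<Longrightarrow> w \<in> sp g" and Wsp_fix: "w \<in> Wsp g \<chi> \<Longrightarrow> uop g \<chi> 0 0 w = w"
  by (simp_all add: Wsp_def)

lemma subspace_Wsp: "g \<in> G \<Longrightarrow> csubspace (sc g) (Wsp g \<chi>)"
proof -
  assume g: "g \<in> G"
  interpret cvector_space "sc g" by (rule vs[OF g])
  show ?thesis unfolding Wsp_def
    by (rule subspaceI)
      (auto simp: subspace_0[OF sub_sp] subspace_add[OF sub_sp] subspace_scale[OF sub_sp] g uop_0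
       linear_on_add[OF uop_linear] linear_on_scale[OF uop_linear])
qed

lemma Wsp_mode: "g \<in> G \<Longrightarrow> v \<in> fixedV \<Longrightarrow> w \<in> Wsp g \<chi> \<Longrightarrow> mo g v n w \<in> Wsp g \<chi>"
  using mo_in fixedV_sub uop_fixed_mode by (auto simp: Wsp_def)

lemma uop_0_in_Wsp: "g \<in> G \<Longrightarrow> \<chi> \<in> Irr g \<Longrightarrow> j < dimg g \<chi> \<Longrightarrow> w \<in> sp g \<Longrightarrow> uop g \<chi> 0 j w \<in> Wsp g \<chi>"
  using uop_in uop_uop dimg_pos by (simp add: Wsp_def)

lemma Wsp_ne: "g \<in> G \<Longrightarrow> \<chi> \<in> Irr g \<Longrightarrow> \<exists>w\<in>Wsp g \<chi>. w \<noteq> 0"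
  using unit_op_nonzero[OF _ simple_basisrep] uop_0_in_Wsp dimg_pos by blast

text \<open>Density for the modes of the fixed-point algebra, with no further points to be killed,
  reaches every vector of the multiplicity space from any nonzero one.\<close>

lemma Wsp_simple:
  assumes g: "g \<in> G" and \<chi>: "\<chi> \<in> Irr g" and U: "csubspace (sc g) U" "U \<subseteq> Wsp g \<chi>"
    and st: "\<And>v n w. v \<in> fixedV \<Longrightarrow> w \<in> U \<Longrightarrow> mo g v n w \<in> U"
  shows "U = {0} \<or> U = Wsp g \<chi>"
proof (rule ccontr)
  interpret cvector_space "sc g" by (rule vs[OF g])
  assume n: "\<not> ?thesis"
  then obtain w where w: "w \<in> U" "w \<noteq> 0" using subspace_0[OF U(1)] by blast
  have ww: "w \<in> sp g" "uop g \<chi> 0 0 w = w" using w U by (auto simp: Wsp_def)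
  have "y \<in> U" if y: "y \<in> Wsp g \<chi>" for y
  proof -
    have X: "finite_points {}" by (simp add: finite_points_def)
    obtain xs where xs: "fixed_modes xs" "act xs g w = y"
      using fixed_density[OF g simple_basisrep[OF g \<chi>] ww(1) w(2) ww(2) Wsp_sub[OF y] Wsp_fix[OF y] X] by auto
    have "act xs g w \<in> U" using xs(1)
    proof (induction xs)
      case Nil then show ?case using subspace_0[OF U(1)] by simp
    next
      case (Cons p xs)
      then show ?case using st w(1) by (cases p) (auto simp: fixed_modes_def intro!: subspace_add[OF U(1)])
    qed
    then show ?thesis using xs(2) by simp
  qed
  then show False using n U by blast
qed

text \<open>The twisted axioms restrict to the untwisted ones because vectors fixed by G have
  g-eigenvalue 1. The grading and its finiteness survive since E_00 commutes with L(0).\<close>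

lemma simple_Wmod:
  assumes g: "g \<in> G" and \<chi>: "\<chi> \<in> Irr g"
  shows "simple_module FV (Wmod g \<chi>)"
proof -
  interpret F: voa_core FV by (rule core_FV)
  interpret T: twisted_on V g "M g" by (rule tw[OF g])
  let ?W = "Wsp g \<chi>" and ?A = "voa_aut FV"
  have ord1: "group.ord ?A \<one>\<^bsub>?A\<^esub> = 1" using F.Aut.ord_eq_1 by simp
  have eig0: "v \<in> eigenspace V g (group.ord AutV g) 0" if "v \<in> fixedV" for v
    using that g by (simp add: eigenspace_def fixedV_def)
  have WM: "?W \<subseteq> sp g" by (auto simp: Wsp_def)
  have gr: "csubspace (sc g) (mgrade (M g) l)" "mgrade (M g) l \<subseteq> sp g" for l
    using T.grading by (auto simp: direct_sum_decomp_def)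
  have gsub: "csubspace (sc g) (mgrade (M g) l \<inter> ?W)" for l
    by (rule T.MS.subspace_inter[OF gr(1) subspace_Wsp[OF g]])
  \<comment> \<open>Graded pieces are full L(0)-eigenspaces, so an operator commuting with L(0)
    preserves them.\<close>
  have p_gr: "uop g \<chi> 0 0 w \<in> mgrade (M g) l" if w: "w \<in> mgrade (M g) l" for w l
    using w uop_fixed_mode[OF g conf_fixed, of w \<chi> 0 0 1] linear_on_scale[OF uop_linear[OF g], of w \<chi> 0 0 l] uop_in[OF g]
    by (auto simp: T.grade_eq)
  have wt: "weak_twisted_module FV \<one>\<^bsub>?A\<^esub> (Wmod g \<chi>)"
    unfolding weak_twisted_module_def Let_def ord1 Wmod_simps FV_simps vspace_FV
  proof (intro conjI)
    show "\<one>\<^bsub>?A\<^esub> \<in> carrier ?A" by simp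
    show "0 < (1::nat)" by simp
    show "vector_space (sc g)" by (rule vsp[OF g])
    show "csubspace (sc g) ?W" by (rule subspace_Wsp[OF g])
    show "direct_sum_decomp (sc g) ?W (\<lambda>l. mgrade (M g) l \<inter> ?W)"
      unfolding direct_sum_decomp_def Wmod_simps
    proof (intro conjI allI ballI gsub)
      fix w assume w: "w \<in> ?W"
      then obtain f where f: "\<And>n. f n \<in> mgrade (M g) n" "finite {n. f n \<noteq> 0}" "Sum_any f = w"
        using T.grading WM unfolding direct_sum_decomp_def by blast
      \<comment> \<open>Applying E_00 to the components gives a second decomposition of w = E_00 w;
        uniqueness puts the components into the image of E_00.\<close>
      define f' where "f' n = uop g \<chi> 0 0 (f n)" for n
      have f'g: "f' n \<in> mgrade (M g) n" for n using p_gr[OF f(1)] by (simp add: f'_def)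
      have sub: "{n. f' n \<noteq> 0} \<subseteq> {n. f n \<noteq> 0}" using uop_0[OF g] by (auto simp: f'_def)
      then have fin: "finite {n. f' n \<noteq> 0}" using f(2) by (rule finite_subset)
      have "Sum_any f' = (\<Sum>n\<in>{n. f n \<noteq> 0}. f' n)" by (rule Sum_any.expand_superset[OF f(2) sub])
      also have "\<dots> = uop g \<chi> 0 0 (\<Sum>n\<in>{n. f n \<noteq> 0}. f n)"
        unfolding f'_def by (rule linear_on_sum[OF uop_linear[OF g] vsp[OF g] sub_sp[OF g], symmetric]) (use f(1) gr(2) in blast)
      also have "(\<Sum>n\<in>{n. f n \<noteq> 0}. f n) = w" using f(3) by (simp add: Sum_any.expand_set)
      finally have "Sum_any f' = Sum_any f" using w f(3) by (simp add: Wsp_def)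
      then have "f' = f"
        using direct_sum_decomp_unique[OF T.grading f'g fin f(1,2)] f(3) w WM by auto
      then have fW: "f n \<in> mgrade (M g) n \<inter> ?W" for n
        using f(1)[of n] gr(2) unfolding f'_def Wsp_def by (auto dest: fun_cong[of _ _ n])
      show "\<exists>!f. (\<forall>n. f n \<in> mgrade (M g) n \<inter> ?W) \<and> finite {n. f n \<noteq> 0} \<and> Sum_any f = w"
      proof (rule ex1I[of _ f])
        show "(\<forall>n. f n \<in> mgrade (M g) n \<inter> ?W) \<and> finite {n. f n \<noteq> 0} \<and> Sum_any f = w" using fW f by simp
        fix h assume h: "(\<forall>n. h n \<in> mgrade (M g) n \<inter> ?W) \<and> finite {n. h n \<noteq> 0} \<and> Sum_any h = w"
        show "h = f" by (rule direct_sum_decomp_unique[OF T.grading]) (use h f w WM in auto)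
      qed
    qed auto
    show "\<forall>l. \<exists>K::int. \<forall>s<K. mgrade (M g) (l + of_int s / of_nat 1) \<inter> ?W = {0}"
    proof
      fix l
      obtain K where K: "\<And>s. s < K \<Longrightarrow> mgrade (M g) (l + of_int s / of_nat T.ordg) = {0}" using T.grade_bound by blast
      \<comment> \<open>The given bound concerns steps of 1/N. For s < 0 the multiple s N is at most
        s, so it lies below K whenever s does.\<close>
      have "mgrade (M g) (l + of_int s / of_nat 1) \<inter> ?W = {0}" if s: "s < min K 0" for s
      proof -
        have "s * int T.ordg \<le> s * 1" using s T.ord_pos by (intro mult_left_mono_neg) auto
        then have "s * int T.ordg < K" using s by linarith
        then have "mgrade (M g) (l + of_int (s * int T.ordg) / of_nat T.ordg) = {0}" by (rule K)
        moreover have "(of_int (s * int T.ordg) / of_nat T.ordg :: complex) = of_int s" using T.ord_pos by simp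
        ultimately show ?thesis using T.MS.subspace_0[OF subspace_Wsp[OF g]] by simp
      qed
      then show "\<exists>K::int. \<forall>s<K. mgrade (M g) (l + of_int s / of_nat 1) \<inter> ?W = {0}" by blast
    qed
    show "\<forall>v\<in>fixedV. \<forall>n. \<forall>w\<in>?W. mo g v n w \<in> ?W" using Wsp_mode[OF g] by blast
    show "\<forall>v\<in>fixedV. \<forall>n. linear_on (sc g) (sc g) ?W (mo g v n)"
      by (intro ballI allI linear_on_subset[OF mo_linear[OF g fixedV_sub] WM])
    show "\<forall>w\<in>?W. \<forall>n. linear_on (vscale V) (sc g) fixedV (\<lambda>v. mo g v n w)"
    proof (intro ballI allI)
      fix w n assume "w \<in> ?W"
      then have "w \<in> sp g" by (rule Wsp_sub)
      then show "linear_on (vscale V) (sc g) fixedV (\<lambda>v. mo g v n w)"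
        by (rule linear_on_subset[OF mo_linear_left[OF g]]) (use fixedV_sub in blast)
    qed
    show "\<forall>j. \<forall>v\<in>eigenspace FV \<one>\<^bsub>?A\<^esub> 1 j. \<forall>n. (\<nexists>i. n = of_int j / of_nat 1 + of_int i) \<longrightarrow> (\<forall>w\<in>?W. mo g v n w = 0)"
    proof (intro allI ballI impI)
      fix j v and n :: rat and w
      assume v: "v \<in> eigenspace FV \<one>\<^bsub>?A\<^esub> 1 j" and n: "\<nexists>i. n = of_int j / of_nat 1 + of_int i" and w: "w \<in> ?W"
      have "v \<in> fixedV" using v by (simp add: eigenspace_def vspace_FV)
      moreover have "\<nexists>i. n = of_int 0 / of_nat T.ordg + of_int i"
      proof
        assume "\<exists>i. n = of_int 0 / of_nat T.ordg + of_int i"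
        then obtain i where "n = of_int i" by auto
        then have "n = of_int j / of_nat 1 + of_int (i - j)" by simp
        with n show False by blast
      qed
      ultimately show "mo g v n w = 0" using T.md_eigen[OF eig0 _ Wsp_sub[OF w], of v n] by simp
    qed
    show "\<forall>v\<in>fixedV. \<forall>w\<in>?W. \<exists>K. \<forall>n\<ge>K. mo g v n w = 0"
      by (intro ballI T.md_truncate fixedV_sub Wsp_sub)
    show "\<forall>w\<in>?W. \<forall>n. mo g (vac V) n w = (if n = -1 then w else 0)"
      by (intro ballI allI T.md_vac Wsp_sub)
    show "\<forall>k. \<forall>u\<in>eigenspace FV \<one>\<^bsub>?A\<^esub> 1 k. \<forall>v\<in>fixedV. \<forall>w\<in>?W. \<forall>(r::int) m n. (\<exists>i. m = of_int k / of_nat 1 + of_int i) \<longrightarrow>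
        Sum_any (\<lambda>i::nat. sc g ((-1) ^ i * (of_int r gchoose i))
          (mo g u (m + of_int r - of_nat i) (mo g v (n + of_nat i) w)
           - sc g ((-1) powi r) (mo g v (n + of_int r - of_nat i) (mo g u (m + of_nat i) w))))
        = Sum_any (\<lambda>i::nat. sc g (of_rat m gchoose i)
            (mo g (vmode V u (r + int i) v) (m + n - of_nat i) w))"
    proof (intro allI ballI impI)
      fix k :: int and u v w and r :: int and m n :: rat
      assume u: "u \<in> eigenspace FV \<one>\<^bsub>?A\<^esub> 1 k" and v: "v \<in> fixedV" and w: "w \<in> ?W" and m: "\<exists>i. m = of_int k / of_nat 1 + of_int i"
      have u': "u \<in> fixedV" using u by (simp add: eigenspace_def vspace_FV)
      obtain i where "m = of_int k + of_int i" using m by auto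
      \<comment> \<open>The identity needed is the case k = 0 of the twisted one, where m ranges
        over the integers.\<close>
      then have "m = of_int 0 / of_nat T.ordg + of_int (k + i)" by simp
      from T.jacobi[OF eig0[OF u'] fixedV_sub[OF v] Wsp_sub[OF w] this]
      show "Sum_any (\<lambda>i::nat. sc g ((-1) ^ i * (of_int r gchoose i))
          (mo g u (m + of_int r - of_nat i) (mo g v (n + of_nat i) w)
           - sc g ((-1) powi r) (mo g v (n + of_int r - of_nat i) (mo g u (m + of_nat i) w))))
        = Sum_any (\<lambda>i::nat. sc g (of_rat m gchoose i)
            (mo g (vmode V u (r + int i) v) (m + n - of_nat i) w))" .
    qed
    show "\<forall>w\<in>?W. \<forall>m n :: int.
        mo g (conf V) (of_int m + 1) (mo g (conf V) (of_int n + 1) w)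
        - mo g (conf V) (of_int n + 1) (mo g (conf V) (of_int m + 1) w)
        = sc g (of_int (m - n)) (mo g (conf V) (of_int (m + n) + 1) w)
          + (if m + n = 0 then sc g (of_int (m ^ 3 - m) / 12 * of_rat (vrank V)) w else 0)"
      by (intro ballI) (rule bspec[OF T.virasoro Wsp_sub])
    show "\<forall>l. \<forall>w\<in>mgrade (M g) l \<inter> ?W. mo g (conf V) 1 w = sc g l w" using T.grade_eigen by blast
    show "\<forall>v\<in>fixedV. \<forall>w\<in>?W. \<forall>n. mo g (vmode V (conf V) 0 v) n w = sc g (- of_rat n) (mo g v (n - 1) w)"
      by (intro ballI) (rule bspec[OF bspec[OF T.derivative fixedV_sub] Wsp_sub])
  qed
  have "finite_dim (sc g) (mgrade (M g) l \<inter> ?W)" for l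
  proof (rule finite_dim_subspace[OF vsp[OF g] _ gsub])
    show "finite_dim (sc g) (mgrade (M g) l)" using simpleM[OF g] by (simp add: simple_twisted_module_def twisted_module_def)
  qed simp
  moreover have "?W \<noteq> {0}" using Wsp_ne[OF g \<chi>] by blast
  moreover have "\<forall>U. csubspace (sc g) U \<and> U \<subseteq> ?W \<and> (\<forall>v\<in>fixedV. \<forall>n. \<forall>w\<in>U. mo g v n w \<in> U) \<longrightarrow> U = {0} \<or> U = ?W"
    by (intro allI impI) (rule Wsp_simple[OF g \<chi>], blast+)
  ultimately show ?thesis
    using wt unfolding simple_twisted_module_def twisted_module_def Wmod_simps vspace_FV by simp
qed

end

section \<open>The isomorphism from M(g) to the sum of tensor products\<close>

context equivariant_family
begin

text \<open>The algebra element that acts on M(g) as the operator E_ij; its coefficients are those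
  in \<open>unit_op\<close>.\<close>

definition unit_elt :: "('v \<Rightarrow> 'v) \<Rightarrow> 'v character \<Rightarrow> nat \<Rightarrow> nat \<Rightarrow> ('v \<Rightarrow> 'v) \<Rightarrow> complex" where
  "unit_elt g \<chi> i j a = (if a \<in> Cent g
     then of_nat (dimg g \<chi>) / of_nat (card (Cent g)) * twisted_group.rinv (HC g) (al g) (basisrep g \<chi>) a $$ (j, i) else 0)"

lemma unit_elt:
  assumes g: "g \<in> G" and \<chi>: "\<chi> \<in> Irr g" and ij: "i < dimg g \<chi>" "j < dimg g \<chi>" "k < dimg g \<chi>" "l < dimg g \<chi>"
  shows "unit_elt g \<chi> i j \<in> carrier (CA g)"
    "repg g \<chi> (unit_elt g \<chi> i j) $$ (k, l) = (if k = i \<and> l = j then 1 else 0)"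
proof -
  interpret T: twisted_group "HC g" "al g" by (rule twisted_group[OF g])
  have mr: "matrix_rep T.Alg (dimg g \<chi>) (repg g \<chi>)"
    using irr_data(1)[OF \<chi>] by (simp add: simple_matrix_rep_def cent_algebra_eq)
  have c: "unit_elt g \<chi> i j \<in> carrier T.Alg" by (simp add: T.carrier_Alg unit_elt_def)
  then show "unit_elt g \<chi> i j \<in> carrier (CA g)" by (simp add: cent_algebra_eq)
  have cne: "card (Cent g) \<noteq> 0" using finite_Cent subgroup.one_closed[OF subgroup_Cent[OF g]] by (auto simp: card_eq_0_iff)
  have "repg g \<chi> (unit_elt g \<chi> i j) $$ (k, l) = (\<Sum>a\<in>Cent g. unit_elt g \<chi> i j a * basisrep g \<chi> a $$ (k, l))"
    using T.matrix_rep_expand[OF mr c] ij by (simp add: T.ext_def basisrep_def)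
  also have "\<dots> = of_nat (dimg g \<chi>) / of_nat (card (Cent g)) * (\<Sum>a\<in>Cent g. basisrep g \<chi> a $$ (k, l) * T.rinv (basisrep g \<chi>) a $$ (j, i))"
    unfolding sum_distrib_left by (intro sum.cong refl) (simp add: unit_elt_def mult.commute mult.left_commute)
  also have "(\<Sum>a\<in>Cent g. basisrep g \<chi> a $$ (k, l) * T.rinv (basisrep g \<chi>) a $$ (j, i)) =
      (if k = i \<and> l = j then of_nat (card (Cent g)) / of_nat (dimg g \<chi>) else 0)"
    using T.orthogonality_same[OF simple_basisrep[OF g \<chi>] ij(3,4,2,1)] by simp
  finally show "repg g \<chi> (unit_elt g \<chi> i j) $$ (k, l) = (if k = i \<and> l = j then 1 else 0)"
    using dimg_pos[OF g \<chi>] cne by simp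
qed

text \<open>The elementary tensor of e_j and w.\<close>

definition single :: "nat \<Rightarrow> 'm \<Rightarrow> nat \<Rightarrow> 'm" where
  "single j w = (\<lambda>k. if k = j then w else 0)"

text \<open>Matrix units move any coordinate of an element of U into any position, so U is
  determined by the vectors w for which the tensor of e_0 and w lies in U. These form a submodule of
  a simple module.\<close>

lemma simple_tensor_Wmod:
  assumes g: "g \<in> G" and \<chi>: "\<chi> \<in> Irr g"
  shows "simple_tensor (CA g) FV (dimg g \<chi>) (repg g \<chi>) (Wmod g \<chi>)"
proof -
  interpret S: cvector_space "sc g" by (rule vs[OF g])
  interpret F: vector_space "\<lambda>c f i. sc g c (f i)" by (rule vector_space_fun[OF vsp[OF g]])
  let ?d = "dimg g \<chi>" and ?W = "Wsp g \<chi>"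
  have d: "?d > 0" by (rule dimg_pos[OF g \<chi>])
  have W0: "0 \<in> ?W" by (rule S.subspace_0[OF subspace_Wsp[OF g]])
  define T where "T = {f. \<forall>i. if i < ?d then f i \<in> ?W else f i = 0}"
  have sp: "mspace (tensor_mod ?d (Wmod g \<chi>)) = T" and scl: "mscale (tensor_mod ?d (Wmod g \<chi>)) = (\<lambda>c f i. sc g c (f i))"
    and md: "mmode (tensor_mod ?d (Wmod g \<chi>)) v m f = (\<lambda>i. if i < ?d then mo g v m (f i) else 0)" for v m f
    by (simp_all add: tensor_mod_def T_def fun_eq_iff)
  have act: "matrix_action ?d (repg g \<chi> (unit_elt g \<chi> i j)) (Wmod g \<chi>) f = single i (f j)" if "i < ?d" "j < ?d" for i j f
  proof
    fix k
    show "matrix_action ?d (repg g \<chi> (unit_elt g \<chi> i j)) (Wmod g \<chi>) f k = single i (f j) k"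
    proof (cases "k < ?d")
      case True
      have "(\<Sum>l<?d. sc g (repg g \<chi> (unit_elt g \<chi> i j) $$ (k, l)) (f l)) = (\<Sum>l<?d. if l = j then (if k = i then f l else 0) else 0)"
        by (intro sum.cong refl) (auto simp: unit_elt(2)[OF g \<chi> that True])
      then show ?thesis using True that by (simp add: matrix_action_def single_def)
    qed (use that in \<open>simp add: matrix_action_def single_def\<close>)
  qed
  have "U = {0} \<or> U = T" if U: "F.subspace U" "U \<subseteq> T"
    and m: "\<forall>v\<in>fixedV. \<forall>m. \<forall>f\<in>U. (\<lambda>i. if i < ?d then mo g v m (f i) else 0) \<in> U"
    and a: "\<forall>x\<in>carrier (CA g). \<forall>f\<in>U. matrix_action ?d (repg g \<chi> x) (Wmod g \<chi>) f \<in> U" for U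
  proof (rule ccontr)
    assume n: "\<not> ?thesis"
    have sing: "single i (f j) \<in> U" if "f \<in> U" "i < ?d" "j < ?d" for f i j
    proof -
      have "matrix_action ?d (repg g \<chi> (unit_elt g \<chi> i j)) (Wmod g \<chi>) f \<in> U"
        using a that unit_elt(1)[OF g \<chi> that(2,3,2,3)] by blast
      then show ?thesis by (simp add: act that)
    qed
    obtain f where f: "f \<in> U" "f \<noteq> 0" using n F.subspace_0[OF U(1)] by (auto simp: zero_fun_def)
    then obtain i where i: "f i \<noteq> 0" by (auto simp: fun_eq_iff)
    then have id: "i < ?d" using f(1) U(2) unfolding T_def by (cases "i < ?d") auto
    define U0 where "U0 = {w \<in> ?W. single 0 w \<in> U}"
    have "S.subspace U0"
    proof (rule S.subspaceI)
      have "single 0 0 = (0 :: nat \<Rightarrow> 'm)" by (auto simp: single_def)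
      then show "0 \<in> U0" using F.subspace_0[OF U(1)] W0 by (simp add: U0_def)
      fix x y assume xy: "x \<in> U0" "y \<in> U0"
      have "single 0 (x + y) = single 0 x + single 0 y" by (auto simp: single_def)
      then show "x + y \<in> U0" using xy F.subspace_add[OF U(1)] S.subspace_add[OF subspace_Wsp[OF g]] by (simp add: U0_def)
    next
      fix c x assume x: "x \<in> U0"
      have "single 0 (sc g c x) = (\<lambda>i. sc g c (single 0 x i))" by (auto simp: single_def)
      then show "sc g c x \<in> U0" using x F.subspace_scale[OF U(1)] S.subspace_scale[OF subspace_Wsp[OF g]] by (simp add: U0_def)
    qed
    moreover have "U0 \<subseteq> ?W" by (auto simp: U0_def)
    moreover have "mo g v n w \<in> U0" if v: "v \<in> fixedV" and w: "w \<in> U0" for v n w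
    proof -
      have "(\<lambda>i. if i < ?d then mo g v n (single 0 w i) else 0) \<in> U" using m v w by (simp add: U0_def)
      also have "(\<lambda>i. if i < ?d then mo g v n (single 0 w i) else 0) = single 0 (mo g v n w)"
        using d twisted_on.md_0[OF tw[OF g] fixedV_sub[OF v]] by (auto simp: single_def)
      finally show ?thesis using Wsp_mode[OF g v] w by (simp add: U0_def)
    qed
    ultimately have "U0 = {0} \<or> U0 = ?W" by (rule Wsp_simple[OF g \<chi>])
    moreover have "f i \<in> ?W" using f(1) U(2) id by (auto simp: T_def)
    then have "f i \<in> U0" using sing[OF f(1) d id] by (simp add: U0_def)
    ultimately have U0: "U0 = ?W" using i by blast
    have "h \<in> U" if h: "h \<in> T" for h
    proof -
      have hW: "h j \<in> ?W" if "j < ?d" for j using h that by (auto simp: T_def)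
      have "single j (h j) \<in> U" if j: "j < ?d" for j
      proof -
        have "single 0 (h j) \<in> U" using hW[OF j] U0 by (auto simp: U0_def)
        from sing[OF this j d] show ?thesis by (simp add: single_def)
      qed
      then have "(\<Sum>j<?d. single j (h j)) \<in> U" by (intro F.subspace_sum[OF U(1)]) simp
      also have "(\<Sum>j<?d. single j (h j)) = h"
      proof
        fix k
        have sum_apply: "(\<Sum>j<n. F j) k = (\<Sum>j<n. F j k)" for F :: "nat \<Rightarrow> nat \<Rightarrow> 'm" and n :: nat by (induction n) simp_all
        have "(\<Sum>j<?d. single j (h j)) k = (\<Sum>j<?d. single j (h j) k)" by (rule sum_apply)
        also have "\<dots> = (\<Sum>j<?d. if j = k then h j else 0)" by (intro sum.cong) (auto simp: single_def)
        also have "\<dots> = h k" using h by (auto simp: T_def)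
        finally show "(\<Sum>j<?d. single j (h j)) k = h k" .
      qed
      finally show ?thesis .
    qed
    then show False using n U(2) by blast
  qed
  moreover have "T \<noteq> {0}"
  proof -
    obtain w where w: "w \<in> ?W" "w \<noteq> 0" using Wsp_ne[OF g \<chi>] by blast
    have "single 0 w \<in> T" using w W0 d by (auto simp: T_def single_def)
    moreover have "single 0 w \<noteq> 0" using w by (auto simp: single_def fun_eq_iff)
    ultimately show ?thesis by blast
  qed
  ultimately show ?thesis
    unfolding simple_tensor_def sp scl md vspace_FV by (intro conjI allI impI) auto
qed

text \<open>E_0i carries the image of E_ii to the common image of E_00, which therefore serves as
  target for all i.\<close>

definition Phi :: "('v \<Rightarrow> 'v) \<Rightarrow> 'm \<Rightarrow> 'v character \<Rightarrow> nat \<Rightarrow> 'm" where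
  "Phi g w \<chi> i = (if \<chi> \<in> Irr g \<and> i < dimg g \<chi> then uop g \<chi> 0 i w else 0)"

lemma uop_sum: "g \<in> G \<Longrightarrow> (\<And>i. i \<in> I \<Longrightarrow> x i \<in> sp g) \<Longrightarrow> uop g \<chi> k l (\<Sum>i\<in>I. x i) = (\<Sum>i\<in>I. uop g \<chi> k l (x i))"
  by (rule linear_on_sum[OF uop_linear vsp sub_sp])

lemma Phi_iso:
  assumes g: "g \<in> G"
  shows "module_iso FV (M g) (direct_sum_mod (Irr g) (\<lambda>\<chi>. tensor_mod (dimg g \<chi>) (Wmod g \<chi>))) (Phi g)"
proof -
  interpret S: cvector_space "sc g" by (rule vs[OF g])
  let ?d = "dimg g"
  let ?D = "direct_sum_mod (Irr g) (\<lambda>\<chi>. tensor_mod (?d \<chi>) (Wmod g \<chi>))"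
  have memD: "F \<in> mspace ?D \<longleftrightarrow> finite {\<chi>. F \<chi> \<noteq> 0} \<and>
     (\<forall>\<chi>. if \<chi> \<in> Irr g then (\<forall>i. if i < ?d \<chi> then F \<chi> i \<in> Wsp g \<chi> else F \<chi> i = 0) else F \<chi> = 0)" for F
    by (simp add: direct_sum_mod_def tensor_mod_def)
  have lin: "linear_on (sc g) (mscale ?D) (sp g) (Phi g)"
    unfolding linear_on_def
  proof (intro conjI ballI allI ext)
    fix x y \<chi> i assume "x \<in> sp g" "y \<in> sp g"
    then show "Phi g (x + y) \<chi> i = (Phi g x + Phi g y) \<chi> i"
      by (simp add: Phi_def linear_on_add[OF uop_linear[OF g]])
  next
    fix c x \<chi> i assume "x \<in> sp g"
    then show "Phi g (sc g c x) \<chi> i = mscale ?D c (Phi g x) \<chi> i"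
      by (simp add: Phi_def direct_sum_mod_def tensor_mod_def linear_on_scale[OF uop_linear[OF g]])
  qed
  have mode: "Phi g (mo g v n w) = mmode ?D v n (Phi g w)" if "v \<in> fixedV" "w \<in> sp g" for v n w
    using that by (intro ext) (simp add: Phi_def direct_sum_mod_def tensor_mod_def uop_fixed_mode[OF g])
  have into: "Phi g w \<in> mspace ?D" if w: "w \<in> sp g" for w
  proof -
    have "{\<chi>. Phi g w \<chi> \<noteq> 0} \<subseteq> Irr g" by (auto simp: Phi_def fun_eq_iff)
    then have "finite {\<chi>. Phi g w \<chi> \<noteq> 0}" using finite_irr[OF g] by (rule finite_subset)
    then show ?thesis using w unfolding memD by (auto simp: Phi_def uop_0_in_Wsp[OF g] fun_eq_iff)
  qed
  have inj: "inj_on (Phi g) (sp g)"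
  proof (rule inj_onI)
    fix x y assume x: "x \<in> sp g" and y: "y \<in> sp g" and e: "Phi g x = Phi g y"
    \<comment> \<open>E_ii = E_i0 E_0i is recovered from the coordinates, and the E_ii sum to the
      identity.\<close>
    have "uop g \<chi> i i x = uop g \<chi> i i y" if \<chi>: "\<chi> \<in> Irr g" and i: "i < ?d \<chi>" for \<chi> i
    proof -
      have "uop g \<chi> 0 i x = uop g \<chi> 0 i y" using fun_cong[OF fun_cong[OF e, of \<chi>], of i] \<chi> i by (simp add: Phi_def)
      then have "uop g \<chi> i 0 (uop g \<chi> 0 i x) = uop g \<chi> i 0 (uop g \<chi> 0 i y)" by simp
      then show ?thesis using uop_uop[OF g \<chi> \<chi> dimg_pos[OF g \<chi>] i i dimg_pos[OF g \<chi>]] x y by simp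
    qed
    then have "(\<Sum>\<chi>\<in>Irr g. \<Sum>i<?d \<chi>. uop g \<chi> i i x) = (\<Sum>\<chi>\<in>Irr g. \<Sum>i<?d \<chi>. uop g \<chi> i i y)" by (intro sum.cong refl) auto
    then show "x = y" using decomposition_identity[OF g x] decomposition_identity[OF g y] by simp
  qed
  have surj: "\<exists>w\<in>sp g. Phi g w = F" if F: "F \<in> mspace ?D" for F
  proof -
    have FW: "F \<chi> i \<in> Wsp g \<chi>" if "\<chi> \<in> Irr g" "i < ?d \<chi>" for \<chi> i
    proof -
      have "\<forall>i. if i < ?d \<chi> then F \<chi> i \<in> Wsp g \<chi> else F \<chi> i = 0" using F that(1) unfolding memD by (simp split: if_splits)
      then show ?thesis using that(2) by (simp split: if_splits)
    qed
    have F0: "F \<chi> i = 0" if n: "\<not> (\<chi> \<in> Irr g \<and> i < ?d \<chi>)" for \<chi> i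
    proof (cases "\<chi> \<in> Irr g")
      case True
      then have "\<forall>i. if i < ?d \<chi> then F \<chi> i \<in> Wsp g \<chi> else F \<chi> i = 0" using F unfolding memD by (simp split: if_splits)
      then show ?thesis using n True by (simp split: if_splits)
    next
      case False
      then have "F \<chi> = 0" using F unfolding memD by (simp split: if_splits)
      then show ?thesis by simp
    qed
    \<comment> \<open>The preimage places the coordinates back by E_i0, the partner of E_0i.\<close>
    define w where "w = (\<Sum>\<chi>\<in>Irr g. \<Sum>i<?d \<chi>. uop g \<chi> i 0 (F \<chi> i))"
    have in1: "uop g \<chi> i 0 (F \<chi> i) \<in> sp g" if "\<chi> \<in> Irr g" "i < ?d \<chi>" for \<chi> i
      using uop_in[OF g] Wsp_sub[OF FW[OF that]] by blast
    have in2: "(\<Sum>i<?d \<chi>. uop g \<chi> i 0 (F \<chi> i)) \<in> sp g" if "\<chi> \<in> Irr g" for \<chi>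
      using in1[OF that] by (intro S.subspace_sum[OF sub_sp[OF g]]) simp
    have w_in: "w \<in> sp g" unfolding w_def by (intro S.subspace_sum[OF sub_sp[OF g]] in2)
    have key: "uop g \<chi> 0 j w = F \<chi> j" if \<chi>: "\<chi> \<in> Irr g" and j: "j < ?d \<chi>" for \<chi> j
    proof -
      have "uop g \<chi> 0 j w = (\<Sum>\<chi>'\<in>Irr g. uop g \<chi> 0 j (\<Sum>i<?d \<chi>'. uop g \<chi>' i 0 (F \<chi>' i)))"
        unfolding w_def by (rule uop_sum[OF g in2])
      also have "\<dots> = (\<Sum>\<chi>'\<in>Irr g. if \<chi>' = \<chi> then F \<chi> j else 0)"
      proof (intro sum.cong refl)
        fix \<chi>' assume \<chi>': "\<chi>' \<in> Irr g"
        have "uop g \<chi> 0 j (\<Sum>i<?d \<chi>'. uop g \<chi>' i 0 (F \<chi>' i)) = (\<Sum>i<?d \<chi>'. uop g \<chi> 0 j (uop g \<chi>' i 0 (F \<chi>' i)))"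
          using in1[OF \<chi>'] by (intro uop_sum[OF g]) simp
        also have "\<dots> = (\<Sum>i<?d \<chi>'. if i = j then (if \<chi>' = \<chi> then F \<chi> i else 0) else 0)"
        proof (intro sum.cong refl)
          fix i assume "i \<in> {..<?d \<chi>'}"
          then have i: "i < ?d \<chi>'" by simp
          show "uop g \<chi> 0 j (uop g \<chi>' i 0 (F \<chi>' i)) = (if i = j then (if \<chi>' = \<chi> then F \<chi> i else 0) else 0)"
            using uop_uop[OF g \<chi>' \<chi> i dimg_pos[OF g \<chi>'] dimg_pos[OF g \<chi>] j Wsp_sub[OF FW[OF \<chi>' i]]] Wsp_fix[OF FW[OF \<chi>' i]]
            by auto
        qed
        also have "\<dots> = (if \<chi>' = \<chi> then F \<chi> j else 0)" using j by auto
        finally show "uop g \<chi> 0 j (\<Sum>i<?d \<chi>'. uop g \<chi>' i 0 (F \<chi>' i)) = (if \<chi>' = \<chi> then F \<chi> j else 0)" .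
      qed
      also have "\<dots> = F \<chi> j" using \<chi> finite_irr[OF g] by simp
      finally show ?thesis .
    qed
    have "Phi g w = F"
    proof (intro ext)
      fix \<chi> i
      show "Phi g w \<chi> i = F \<chi> i" using key F0 by (simp add: Phi_def)
    qed
    then show ?thesis using w_in by blast
  qed
  have "Phi g ` sp g = mspace ?D"
  proof
    show "Phi g ` sp g \<subseteq> mspace ?D" using into by (rule image_subsetI)
    show "mspace ?D \<subseteq> Phi g ` sp g"
    proof
      fix F assume "F \<in> mspace ?D"
      from surj[OF this] obtain w where "w \<in> sp g" "Phi g w = F" by (elim bexE)
      then show "F \<in> Phi g ` sp g" by (intro image_eqI[of _ _ w]) simp_all
    qed
  qed
  then have "bij_betw (Phi g) (sp g) (mspace ?D)" using inj by (simp add: bij_betw_def)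
  then show ?thesis unfolding module_iso_def vspace_FV by (intro conjI lin ballI allI mode)
qed

lemma Phi_action:
  assumes g: "g \<in> G" and x: "x \<in> carrier (CA g)" and w: "w \<in> sp g" and \<chi>: "\<chi> \<in> Irr g"
  shows "Phi g (cent_action V G M \<phi> g x w) \<chi> = matrix_action (dimg g \<chi>) (repg g \<chi> x) (Wmod g \<chi>) (Phi g w \<chi>)"
proof
  fix i
  interpret P: proj_action "HC g" "al g" "sc g" "sp g" "\<phi> g" by (rule proj_action[OF g])
  let ?d = "dimg g \<chi>"
  have mr: "matrix_rep P.Alg ?d (repg g \<chi>)"
    using irr_data(1)[OF \<chi>] by (simp add: simple_matrix_rep_def cent_algebra_eq)
  show "Phi g (cent_action V G M \<phi> g x w) \<chi> i = matrix_action ?d (repg g \<chi> x) (Wmod g \<chi>) (Phi g w \<chi>) i"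
  proof (cases "i < ?d")
    case True
    have pin: "\<phi> g a w \<in> sp g" if "a \<in> Cent g" for a using P.\<pi>_in that w by simp
    have "uop g \<chi> 0 i (cent_action V G M \<phi> g x w) = (\<Sum>a\<in>Cent g. uop g \<chi> 0 i (sc g (x a) (\<phi> g a w)))"
      unfolding cent_action_def by (rule uop_sum[OF g]) (intro P.subspace_scale[OF P.subW] pin)
    also have "\<dots> = (\<Sum>a\<in>Cent g. \<Sum>k<?d. sc g (x a * basisrep g \<chi> a $$ (i, k)) (uop g \<chi> 0 k w))"
    proof (intro sum.cong refl)
      fix a assume a: "a \<in> Cent g"
      have "uop g \<chi> 0 i (\<phi> g a w) = (\<Sum>k<?d. sc g (basisrep g \<chi> a $$ (i, k)) (uop g \<chi> 0 k w))"
      proof (rule P.unit_op_\<pi>)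
        show "P.proj_rep ?d (basisrep g \<chi>)" by (rule proj_basisrep[OF g \<chi>])
      qed (use a w True dimg_pos[OF g \<chi>] in simp_all)
      then show "uop g \<chi> 0 i (sc g (x a) (\<phi> g a w)) = (\<Sum>k<?d. sc g (x a * basisrep g \<chi> a $$ (i, k)) (uop g \<chi> 0 k w))"
        using linear_on_scale[OF uop_linear[OF g] pin[OF a]] by (simp add: P.scale_sum_right)
    qed
    also have "\<dots> = (\<Sum>k<?d. \<Sum>a\<in>Cent g. sc g (x a * basisrep g \<chi> a $$ (i, k)) (uop g \<chi> 0 k w))" by (rule sum.swap)
    also have "\<dots> = (\<Sum>k<?d. sc g (repg g \<chi> x $$ (i, k)) (uop g \<chi> 0 k w))"
    proof (intro sum.cong refl)
      fix k assume "k \<in> {..<?d}"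
      then have "repg g \<chi> x $$ (i, k) = (\<Sum>a\<in>Cent g. x a * basisrep g \<chi> a $$ (i, k))"
        using P.matrix_rep_expand[OF mr] x True by (simp add: P.ext_def basisrep_def cent_algebra_eq)
      then show "(\<Sum>a\<in>Cent g. sc g (x a * basisrep g \<chi> a $$ (i, k)) (uop g \<chi> 0 k w)) = sc g (repg g \<chi> x $$ (i, k)) (uop g \<chi> 0 k w)"
        by (simp add: P.scale_sum_left)
    qed
    finally show ?thesis using True \<chi> by (simp add: Phi_def matrix_action_def)
  qed (simp add: Phi_def matrix_action_def)
qed

lemma decomposition:
  assumes g: "g \<in> G"
  shows "simple_decomposition V G M \<phi> g (dimg g) (repg g) (Wmod g)"
  unfolding simple_decomposition_def
proof (intro conjI ballI)
  fix \<chi> assume \<chi>: "\<chi> \<in> Irr g"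
  show "matrix_rep (CA g) (dimg g \<chi>) (repg g \<chi>)" using irr_data(1)[OF \<chi>] by (simp add: simple_matrix_rep_def)
  show "rep_character (CA g) (dimg g \<chi>) (repg g \<chi>) = \<chi>" by (rule irr_data(2)[OF \<chi>])
  show "simple_module FV (Wmod g \<chi>)" by (rule simple_Wmod[OF g \<chi>])
  show "simple_tensor (CA g) FV (dimg g \<chi>) (repg g \<chi>) (Wmod g \<chi>)" by (rule simple_tensor_Wmod[OF g \<chi>])
next
  show "\<exists>\<Phi>. module_iso FV (M g) (direct_sum_mod (Irr g) (\<lambda>\<chi>. tensor_mod (dimg g \<chi>) (Wmod g \<chi>))) \<Phi> \<and>
    (\<forall>x\<in>carrier (CA g). \<forall>w\<in>sp g. \<forall>\<chi>\<in>Irr g. \<Phi> (cent_action V G M \<phi> g x w) \<chi> = matrix_action (dimg g \<chi>) (repg g \<chi> x) (Wmod g \<chi>) (\<Phi> w \<chi>))"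
    by (intro exI[of _ "Phi g"] conjI ballI Phi_iso[OF g] Phi_action[OF g])
qed

end

section \<open>Isomorphisms between multiplicity spaces\<close>

context equivariant_family
begin

definition conj_factor :: "('v \<Rightarrow> 'v) \<Rightarrow> ('v \<Rightarrow> 'v) \<Rightarrow> ('v \<Rightarrow> 'v) \<Rightarrow> complex" where
  "conj_factor g k z = al g k z / al g (cj k z) k"

lemma conj_elt_eq: "conj_elt V M \<phi> g k z = (\<lambda>b. conj_factor g k z * basis_elt (cj k z) b)"
  by (simp add: conj_elt_def Let_def conj_factor_def)

lemma conj_factor_nz: "g \<in> G \<Longrightarrow> k \<in> G \<Longrightarrow> z \<in> G \<Longrightarrow> conj_factor g k z \<noteq> 0"
  by (simp add: conj_factor_def al_nz cj_in)

lemma cj_Cent_in: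
  assumes g: "g \<in> G" and k: "k \<in> G" and z: "z \<in> Cent g"
  shows "cj k z \<in> Cent (cj k g)"
proof -
  have zG: "z \<in> G" by (rule Cent_sub[OF z])
  have e: "cj k z \<odot> k = k \<odot> z" using k zG by (simp add: conjg_def G_in Aut.m_assoc)
  have "cj (cj k z) (cj k g) = cj (cj k z \<odot> k) g" using cj_mul[OF cj_in[OF k zG] k g] by simp
  also have "\<dots> = cj k g" unfolding e using cj_mul[OF k zG g] cj_Cent[OF z g] by simp
  finally show ?thesis using cj_fix_iff[OF cj_in[OF k zG] cj_in[OF k g]] by simp
qed

lemma cj_Cent_bij:
  assumes g: "g \<in> G" and k: "k \<in> G"
  shows "bij_betw (cj k) (Cent g) (Cent (cj k g))"
proof (rule bij_betw_byWitness[where f' = "cj (iG k)"])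
  show "\<forall>a\<in>Cent g. cj (iG k) (cj k a) = a" "\<forall>a\<in>Cent (cj k g). cj k (cj (iG k) a) = a"
    using cj_inv k Cent_sub by blast+
  show "cj k ` Cent g \<subseteq> Cent (cj k g)" using cj_Cent_in[OF g k] by blast
  show "cj (iG k) ` Cent (cj k g) \<subseteq> Cent g"
    using cj_Cent_in[OF cj_in[OF k g] iG_in[OF k]] cj_inv(2)[OF k g] by auto
qed

text \<open>Both sides are multiples of \<phi>_g(k z) w, because (k z k^(-1)) k = k z; the quotient
  of the two cocycle values is the factor.\<close>

lemma phi_conj:
  assumes g: "g \<in> G" and k: "k \<in> G" and z: "z \<in> Cent g" and w: "w \<in> sp g"
  shows "\<phi> g k (\<phi> g z w) = sc (cj k g) (conj_factor g k z) (\<phi> (cj k g) (cj k z) (\<phi> g k w))"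
proof -
  have zG: "z \<in> G" by (rule Cent_sub[OF z])
  interpret cvector_space "sc (cj k g)" by (rule vs[OF cj_in[OF k g]])
  have e: "cj k z \<odot> k = k \<odot> z" using k zG by (simp add: conjg_def G_in Aut.m_assoc)
  have e2: "cj (k \<odot> z) g = cj k g" using cj_mul[OF k zG g] cj_Cent[OF z g] by simp
  have 1: "\<phi> g k (\<phi> g z w) = sc (cj k g) (al g k z) (\<phi> g (k \<odot> z) w)"
    using al_eq[OF g k zG w] cj_Cent[OF z g] e2 by simp
  have 2: "\<phi> (cj k g) (cj k z) (\<phi> g k w) = sc (cj k g) (al g (cj k z) k) (\<phi> g (k \<odot> z) w)"
    using al_eq[OF g cj_in[OF k zG] k w] e e2 by simp
  show ?thesis unfolding 1 2 using al_nz[OF g cj_in[OF k zG] k] by (simp add: conj_factor_def)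
qed

lemma phi_scale: "g \<in> G \<Longrightarrow> k \<in> G \<Longrightarrow> w \<in> sp g \<Longrightarrow> \<phi> g k (sc g c w) = sc (cj k g) c (\<phi> g k w)"
  by (rule linear_on_scale[OF phi_linear])

lemma phi_sum: "g \<in> G \<Longrightarrow> k \<in> G \<Longrightarrow> (\<And>i. i \<in> I \<Longrightarrow> x i \<in> sp g) \<Longrightarrow> \<phi> g k (\<Sum>i\<in>I. x i) = (\<Sum>i\<in>I. \<phi> g k (x i))"
  by (rule linear_on_sum[OF phi_linear vsp sub_sp])

text \<open>Without the scalar, the composition with conjugation would in general obey a cocycle
  different from \<alpha>_g.\<close>

definition pullback :: "('v \<Rightarrow> 'v) \<Rightarrow> ('v \<Rightarrow> 'v) \<Rightarrow> (('v \<Rightarrow> 'v) \<Rightarrow> complex mat) \<Rightarrow> ('v \<Rightarrow> 'v) \<Rightarrow> complex mat" where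
  "pullback g k \<rho> z = conj_factor g k z \<cdot>\<^sub>m \<rho> (cj k z)"

text \<open>Conjugation by \<phi>_g(k) respects products of operators, and this is what relates the
  factors to the two cocycles. The relations are read off from a nonzero vector of M(g).\<close>

lemma simple_pullback:
  assumes g: "g \<in> G" and k: "k \<in> G" and \<rho>: "twisted_group.simple_proj_rep (HC (cj k g)) (al (cj k g)) d \<rho>"
  shows "twisted_group.simple_proj_rep (HC g) (al g) d (pullback g k \<rho>)"
proof -
  let ?h = "cj k g" and ?f = "conj_factor g k"
  have h: "?h \<in> G" by (rule cj_in[OF k g])
  interpret A: proj_action "HC g" "al g" "sc g" "sp g" "\<phi> g" by (rule proj_action[OF g])
  interpret B: proj_action "HC ?h" "al ?h" "sc ?h" "sp ?h" "\<phi> ?h" by (rule proj_action[OF h])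
  have pr: "B.proj_rep d \<rho>" and d: "d > 0" using \<rho> by (auto simp: B.simple_proj_rep_def)
  have cin: "cj k a \<in> carrier (HC ?h)" if "a \<in> Cent g" for a using cj_Cent_in[OF g k that] by simp
  have c: "\<rho> (cj k a) \<in> carrier_mat d d" if "a \<in> Cent g" for a using pr cin[OF that] by (simp add: B.proj_rep_def)
  have cm: "cj k (a \<odot> b) = cj k a \<odot> cj k b" if "a \<in> G" "b \<in> G" for a b
  proof -
    have "k \<odot> a \<odot> iG k \<odot> (k \<odot> b \<odot> iG k) = k \<odot> a \<odot> (iG k \<odot> k) \<odot> b \<odot> iG k"
      using that k by (simp only: Aut.m_assoc Aut.m_closed Aut.inv_closed G_in)
    then show ?thesis using that k by (simp add: conjg_def G_in Aut.m_assoc)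
  qed
  obtain w where w: "w \<in> sp g" "w \<noteq> 0" using ex_nonzero[OF g] by blast
  have kw: "\<phi> g k w \<in> sp ?h" by (rule phi_in[OF g k w(1)])
  have nz: "\<phi> ?h b (\<phi> g k w) \<noteq> 0" if "b \<in> G" for b
    using phi_eq_0[OF h that kw] phi_eq_0[OF g k w(1)] w(2) by blast
  \<comment> \<open>\<phi>_g(k) \<phi>_g(a) \<phi>_g(b) w is computed in two ways: by moving
    \<phi>_g(k) past each factor, and after first multiplying a and b.\<close>
  have mult: "?f a * ?f b * al ?h (cj k a) (cj k b) = al g a b * ?f (a \<odot> b)" if a: "a \<in> Cent g" and b: "b \<in> Cent g" for a b
  proof -
    have aG: "a \<in> G" "b \<in> G" using a b Cent_sub by auto
    have ab: "a \<odot> b \<in> Cent g" using subgroup.m_closed[OF subgroup_Cent[OF g] a b] .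
    have bw: "\<phi> g b w \<in> sp g" using A.\<pi>_in b w by simp
    have kb: "\<phi> ?h (cj k b) (\<phi> g k w) \<in> sp ?h" using B.\<pi>_in[OF cin[OF b] kw] .
    let ?y = "\<phi> ?h (cj k (a \<odot> b)) (\<phi> g k w)"
    have "\<phi> g k (\<phi> g a (\<phi> g b w)) = sc ?h (?f a) (\<phi> ?h (cj k a) (\<phi> g k (\<phi> g b w)))" by (rule phi_conj[OF g k a bw])
    also have "\<dots> = sc ?h (?f a) (\<phi> ?h (cj k a) (sc ?h (?f b) (\<phi> ?h (cj k b) (\<phi> g k w))))"
      by (simp only: phi_conj[OF g k b w(1)])
    also have "\<dots> = sc ?h (?f a * ?f b * al ?h (cj k a) (cj k b)) ?y"
      using B.\<pi>_scale[OF cin[OF a] kb] B.\<pi>_mult[OF cin[OF a] cin[OF b] kw] cm[OF aG] by (simp add: mult.assoc)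
    finally have 1: "\<phi> g k (\<phi> g a (\<phi> g b w)) = sc ?h (?f a * ?f b * al ?h (cj k a) (cj k b)) ?y" .
    have "\<phi> g a (\<phi> g b w) = sc g (al g a b) (\<phi> g (a \<odot> b) w)" using A.\<pi>_mult[of a b w] a b w by simp
    then have "\<phi> g k (\<phi> g a (\<phi> g b w)) = sc ?h (al g a b) (\<phi> g k (\<phi> g (a \<odot> b) w))"
      using phi_scale[OF g k] A.\<pi>_in[of "a \<odot> b" w] ab w by simp
    also have "\<dots> = sc ?h (al g a b * ?f (a \<odot> b)) ?y" unfolding phi_conj[OF g k ab w(1)] by simp
    finally show ?thesis using 1 nz[of "cj k (a \<odot> b)"] cj_in[OF k mul_in[OF aG]] by simp
  qed
  have one: "?f oneG * al ?h oneG oneG = al g oneG oneG"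
  proof -
    have o: "oneG \<in> Cent g" using subgroup.one_closed[OF subgroup_Cent[OF g]] .
    have co: "cj k oneG = oneG" using k by (simp add: conjg_def G_in)
    have "\<phi> g k (\<phi> g oneG w) = sc ?h (?f oneG * al ?h oneG oneG) (\<phi> g k w)"
      using phi_conj[OF g k o w(1)] phi_one[OF h kw] co by simp
    moreover have "\<phi> g k (\<phi> g oneG w) = sc ?h (al g oneG oneG) (\<phi> g k w)"
      using phi_one[OF g w(1)] phi_scale[OF g k w(1)] by simp
    moreover have "\<phi> g k w \<noteq> 0" using phi_eq_0[OF g k w(1)] w(2) by blast
    ultimately show ?thesis by simp
  qed
  have "A.proj_rep d (pullback g k \<rho>)"
    unfolding A.proj_rep_def
  proof (intro conjI ballI)
    fix a assume "a \<in> carrier (HC g)"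
    then have a: "a \<in> Cent g" by simp
    show "pullback g k \<rho> a \<in> carrier_mat d d" using c[OF a] by (simp add: pullback_def)
    fix b assume "b \<in> carrier (HC g)"
    then have b: "b \<in> Cent g" by simp
    have ab: "cj k (a \<odot> b) = cj k a \<odot> cj k b" using cm Cent_sub a b by blast
    have abC: "a \<odot> b \<in> Cent g" using subgroup.m_closed[OF subgroup_Cent[OF g] a b] .
    have "pullback g k \<rho> a * pullback g k \<rho> b = ?f b \<cdot>\<^sub>m (?f a \<cdot>\<^sub>m (\<rho> (cj k a) * \<rho> (cj k b)))"
      unfolding pullback_def using c[OF a] c[OF b]
      by (simp add: mult_smult_distrib[of _ d d _ d] mult_smult_assoc_mat[of _ d d _ d])
    also have "\<rho> (cj k a) * \<rho> (cj k b) = al ?h (cj k a) (cj k b) \<cdot>\<^sub>m \<rho> (cj k (a \<odot> b))"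
      using pr cin[OF a] cin[OF b] ab by (simp add: B.proj_rep_def)
    also have "?f b \<cdot>\<^sub>m (?f a \<cdot>\<^sub>m (al ?h (cj k a) (cj k b) \<cdot>\<^sub>m \<rho> (cj k (a \<odot> b)))) =
        (?f a * ?f b * al ?h (cj k a) (cj k b)) \<cdot>\<^sub>m \<rho> (cj k (a \<odot> b))"
      by (intro eq_matI) auto
    also have "\<dots> = al g a b \<cdot>\<^sub>m pullback g k \<rho> (a \<odot> b)"
      unfolding mult[OF a b] pullback_def by (intro eq_matI) auto
    finally show "pullback g k \<rho> a * pullback g k \<rho> b = al g a b \<cdot>\<^sub>m pullback g k \<rho> (a \<otimes>\<^bsub>HC g\<^esub> b)" by simp
  next
    have co: "cj k oneG = oneG" using k by (simp add: conjg_def G_in)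
    have "\<rho> oneG = al ?h oneG oneG \<cdot>\<^sub>m 1\<^sub>m d" using pr by (simp add: B.proj_rep_def)
    then have "pullback g k \<rho> oneG = (?f oneG * al ?h oneG oneG) \<cdot>\<^sub>m 1\<^sub>m d"
      unfolding pullback_def co by (intro eq_matI) auto
    then show "pullback g k \<rho> \<one>\<^bsub>HC g\<^esub> = al g \<one>\<^bsub>HC g\<^esub> \<one>\<^bsub>HC g\<^esub> \<cdot>\<^sub>m 1\<^sub>m d" unfolding one by simp
  qed
  moreover have "U = {0\<^sub>v d} \<or> U = carrier_vec d" if U: "invariant_subspace d (Cent g) (pullback g k \<rho>) U" for U
  proof -
    have UD: "U \<subseteq> carrier_vec d" "\<And>e x. x \<in> U \<Longrightarrow> e \<cdot>\<^sub>v x \<in> U" "\<And>a x. a \<in> Cent g \<Longrightarrow> x \<in> U \<Longrightarrow> pullback g k \<rho> a *\<^sub>v x \<in> U"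
      using U by (auto simp: invariant_subspace_def)
    \<comment> \<open>Nonzero scalars do not affect invariance, and every b is the conjugate of some
      a.\<close>
    have "\<rho> b *\<^sub>v x \<in> U" if b: "b \<in> Cent ?h" and x: "x \<in> U" for b x
    proof -
      obtain a where a: "a \<in> Cent g" "b = cj k a" using cj_Cent_bij[OF g k] b by (auto simp: bij_betw_def)
      have fa: "?f a \<noteq> 0" by (rule conj_factor_nz[OF g k Cent_sub[OF a(1)]])
      have xc: "x \<in> carrier_vec d" using x UD(1) by blast
      have "inverse (?f a) \<cdot>\<^sub>v (pullback g k \<rho> a *\<^sub>v x) \<in> U" using UD(2) UD(3)[OF a(1) x] by blast
      also have "inverse (?f a) \<cdot>\<^sub>v (pullback g k \<rho> a *\<^sub>v x) = \<rho> b *\<^sub>v x"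
        unfolding pullback_def a(2) smult_mat_mult_vec[OF c[OF a(1)] xc] using fa by (intro eq_vecI) auto
      finally show ?thesis .
    qed
    then have "invariant_subspace d (carrier (HC ?h)) \<rho> U" using U unfolding invariant_subspace_def by simp
    then show ?thesis using \<rho> by (simp add: B.simple_proj_rep_def)
  qed
  ultimately show ?thesis using d by (simp add: A.simple_proj_rep_def)
qed

lemma character_conj_elt:
  assumes g: "g \<in> G" and k: "k \<in> G" and \<psi>: "\<psi> \<in> Irr (cj k g)" and z: "z \<in> Cent g"
  shows "\<psi> (conj_elt V M \<phi> g k z) = mtrace (dimg (cj k g) \<psi>) (pullback g k (basisrep (cj k g) \<psi>) z)"
proof -
  let ?h = "cj k g"
  have h: "?h \<in> G" by (rule cj_in[OF k g])
  interpret T: twisted_group "HC ?h" "al ?h" by (rule twisted_group[OF h])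
  have mr: "matrix_rep T.Alg (dimg ?h \<psi>) (repg ?h \<psi>)"
    using irr_data(1)[OF \<psi>] by (simp add: simple_matrix_rep_def cent_algebra_eq)
  have zc: "cj k z \<in> carrier (HC ?h)" using cj_Cent_in[OF g k z] by simp
  have c: "basisrep ?h \<psi> (cj k z) \<in> carrier_mat (dimg ?h \<psi>) (dimg ?h \<psi>)"
    using proj_basisrep[OF h \<psi>] zc by (simp add: T.proj_rep_def)
  have el: "conj_elt V M \<phi> g k z \<in> carrier T.Alg" unfolding conj_elt_eq by (rule T.scale_basis_in[OF zc])
  have "\<psi> (conj_elt V M \<phi> g k z) = rep_character (CA ?h) (dimg ?h \<psi>) (repg ?h \<psi>) (conj_elt V M \<phi> g k z)"
    by (simp add: irr_data(2)[OF \<psi>])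
  also have "\<dots> = mtrace (dimg ?h \<psi>) (repg ?h \<psi> (conj_elt V M \<phi> g k z))"
    using el by (simp add: cent_algebra_eq rep_character_def mtrace_def)
  also have "repg ?h \<psi> (conj_elt V M \<phi> g k z) = pullback g k (basisrep ?h \<psi>) z"
    unfolding conj_elt_eq pullback_def basisrep_def by (rule T.matrix_repD(5)[OF mr T.basis_elt_in[OF zc]])
  finally show ?thesis .
qed

text \<open>Apply the injective map \<phi>_g(k) to the transformation rule. The factor in
  \<open>phi_conj\<close> and the one in \<open>pullback\<close> are the same and cancel.\<close>

lemma transport_family:
  assumes g: "g \<in> G" and k: "k \<in> G" and \<rho>: "twisted_group.proj_rep (HC (cj k g)) (al (cj k g)) d \<rho>"
    and u: "\<And>i. i < d \<Longrightarrow> u i \<in> sp g"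
  shows "proj_action.transforms (HC g) (sc g) (sp g) (\<phi> g) d (pullback g k \<rho>) u \<longleftrightarrow>
    proj_action.transforms (HC (cj k g)) (sc (cj k g)) (sp (cj k g)) (\<phi> (cj k g)) d \<rho> (\<lambda>i. \<phi> g k (u i))"
proof -
  let ?h = "cj k g" and ?f = "conj_factor g k"
  have h: "?h \<in> G" by (rule cj_in[OF k g])
  interpret A: proj_action "HC g" "al g" "sc g" "sp g" "\<phi> g" by (rule proj_action[OF g])
  interpret B: proj_action "HC ?h" "al ?h" "sc ?h" "sp ?h" "\<phi> ?h" by (rule proj_action[OF h])
  have inj: "inj_on (\<phi> g k) (sp g)" using phi_bij[OF g k] by (simp add: bij_betw_def)
  have eq: "\<phi> g a (u i) = (\<Sum>m<d. sc g (pullback g k \<rho> a $$ (m, i)) (u m)) \<longleftrightarrow>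
     \<phi> ?h (cj k a) (\<phi> g k (u i)) = (\<Sum>m<d. sc ?h (\<rho> (cj k a) $$ (m, i)) (\<phi> g k (u m)))"
    if a: "a \<in> Cent g" and i: "i < d" for a i
  proof -
    have fa: "?f a \<noteq> 0" by (rule conj_factor_nz[OF g k Cent_sub[OF a]])
    have c: "\<rho> (cj k a) \<in> carrier_mat d d" using \<rho> cj_Cent_in[OF g k a] by (simp add: B.proj_rep_def)
    have s_in: "(\<Sum>m<d. sc g (pullback g k \<rho> a $$ (m, i)) (u m)) \<in> sp g"
      by (intro A.subspace_sum[OF A.subW] A.subspace_scale[OF A.subW] u) simp
    have a_in: "\<phi> g a (u i) \<in> sp g" using A.\<pi>_in[of a "u i"] a u[OF i] by simp
    have "\<phi> g k (\<Sum>m<d. sc g (pullback g k \<rho> a $$ (m, i)) (u m)) = (\<Sum>m<d. sc ?h (pullback g k \<rho> a $$ (m, i)) (\<phi> g k (u m)))"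
      by (subst phi_sum[OF g k]) (simp_all add: A.subspace_scale[OF A.subW] u phi_scale[OF g k])
    also have "\<dots> = sc ?h (?f a) (\<Sum>m<d. sc ?h (\<rho> (cj k a) $$ (m, i)) (\<phi> g k (u m)))"
      unfolding B.scale_sum_right by (intro sum.cong refl) (use c i in \<open>simp add: pullback_def\<close>)
    finally have r: "\<phi> g k (\<Sum>m<d. sc g (pullback g k \<rho> a $$ (m, i)) (u m)) = sc ?h (?f a) (\<Sum>m<d. sc ?h (\<rho> (cj k a) $$ (m, i)) (\<phi> g k (u m)))" .
    have "\<phi> g a (u i) = (\<Sum>m<d. sc g (pullback g k \<rho> a $$ (m, i)) (u m)) \<longleftrightarrow>
       \<phi> g k (\<phi> g a (u i)) = \<phi> g k (\<Sum>m<d. sc g (pullback g k \<rho> a $$ (m, i)) (u m))"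
      by (rule inj_on_eq_iff[OF inj a_in s_in, symmetric])
    then show ?thesis unfolding r phi_conj[OF g k a u[OF i]] using fa by simp
  qed
  have "(\<forall>a\<in>Cent g. \<forall>i<d. \<phi> g a (u i) = (\<Sum>m<d. sc g (pullback g k \<rho> a $$ (m, i)) (u m))) \<longleftrightarrow>
     (\<forall>a\<in>Cent g. \<forall>i<d. \<phi> ?h (cj k a) (\<phi> g k (u i)) = (\<Sum>m<d. sc ?h (\<rho> (cj k a) $$ (m, i)) (\<phi> g k (u m))))"
    using eq by (intro ball_cong refl all_cong) simp
  also have "\<dots> \<longleftrightarrow> (\<forall>b\<in>Cent ?h. \<forall>i<d. \<phi> ?h b (\<phi> g k (u i)) = (\<Sum>m<d. sc ?h (\<rho> b $$ (m, i)) (\<phi> g k (u m))))"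
    using bij_betw_imp_surj_on[OF cj_Cent_bij[OF g k], symmetric] by simp
  finally show ?thesis unfolding A.transforms_def B.transforms_def using u phi_in[OF g k] by simp
qed

lemma uop_transforms:
  assumes g: "g \<in> G" and \<chi>: "\<chi> \<in> Irr g" and w: "w \<in> sp g"
  shows "proj_action.transforms (HC g) (sc g) (sp g) (\<phi> g) (dimg g \<chi>) (basisrep g \<chi>) (\<lambda>i. uop g \<chi> i 0 w)"
proof -
  interpret P: proj_action "HC g" "al g" "sc g" "sp g" "\<phi> g" by (rule proj_action[OF g])
  show ?thesis
  proof (rule P.transforms_unit_op)
    show "P.proj_rep (dimg g \<chi>) (basisrep g \<chi>)" by (rule proj_basisrep[OF g \<chi>])
    show "0 < dimg g \<chi>" by (rule dimg_pos[OF g \<chi>])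
  qed (rule w)
qed

text \<open>Equal traces give an invertible S from the pullback of \<psi> to \<chi>. With it the
  vectors E_l0 w are recombined into a family of the pullback type, which \<phi>_g(k) moves to the
  sector of h; member 0 of this family is the image of w.\<close>

lemma isomorphic_if_transport:
  assumes g: "g \<in> G" and k: "k \<in> G" and \<chi>: "\<chi> \<in> Irr g" and \<psi>: "\<psi> \<in> Irr (cj k g)"
    and tr: "\<And>z. z \<in> Cent g \<Longrightarrow> \<chi> (basis_elt z) = \<psi> (conj_elt V M \<phi> g k z)"
  shows "isomorphic_modules FV (Wmod g \<chi>) (Wmod (cj k g) \<psi>)"
proof -
  let ?h = "cj k g" and ?d = "dimg g \<chi>" and ?d' = "dimg (cj k g) \<psi>"
  have h: "?h \<in> G" by (rule cj_in[OF k g])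
  interpret A: proj_action "HC g" "al g" "sc g" "sp g" "\<phi> g" by (rule proj_action[OF g])
  interpret B: proj_action "HC ?h" "al ?h" "sc ?h" "sp ?h" "\<phi> ?h" by (rule proj_action[OF h])
  let ?\<rho> = "basisrep g \<chi>" and ?\<rho>' = "pullback g k (basisrep ?h \<psi>)"
  have s: "A.simple_proj_rep ?d ?\<rho>" by (rule simple_basisrep[OF g \<chi>])
  have s': "A.simple_proj_rep ?d' ?\<rho>'" by (rule simple_pullback[OF g k simple_basisrep[OF h \<psi>]])
  have dp: "?d > 0" "?d' > 0" by (rule dimg_pos[OF g \<chi>], rule dimg_pos[OF h \<psi>])
  have "\<exists>S T. S \<in> carrier_mat ?d ?d' \<and> T \<in> carrier_mat ?d' ?d \<and> S * T = 1\<^sub>m ?d \<and> T * S = 1\<^sub>m ?d' \<and> (\<forall>a\<in>carrier (HC g). ?\<rho> a * S = S * ?\<rho>' a)"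
  proof (rule A.same_trace_intertwiner[OF s s'])
    fix a assume "a \<in> carrier (HC g)"
    then show "mtrace ?d (?\<rho> a) = mtrace ?d' (?\<rho>' a)"
      using tr[of a] character_basis[OF g \<chi>, of a] character_conj_elt[OF g k \<psi>, of a] by simp
  qed
  then obtain S T where S: "S \<in> carrier_mat ?d ?d'" and T: "T \<in> carrier_mat ?d' ?d"
    and TS: "T * S = 1\<^sub>m ?d'" and int: "\<forall>a\<in>carrier (HC g). ?\<rho> a * S = S * ?\<rho>' a" by (elim exE conjE)
  have c: "?\<rho> a \<in> carrier_mat ?d ?d" "?\<rho>' a \<in> carrier_mat ?d' ?d'" if "a \<in> Cent g" for a
    using s s' that by (auto simp: A.simple_proj_rep_def A.proj_rep_def)
  \<comment> \<open>The columns of S are the change of basis: \<rho>(a) S = S \<rho>'(a) turns a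
    family of type \<rho> into one of type \<rho>'.\<close>
  define u where "u w i = (\<Sum>l<?d. sc g (S $$ (l, i)) (uop g \<chi> l 0 w))" for w i
  have ul_in: "uop g \<chi> l 0 w \<in> sp g" if "w \<in> sp g" for w l by (rule uop_in[OF g that])
  have u_in: "u w i \<in> sp g" if "w \<in> sp g" for w i
    unfolding u_def by (intro A.subspace_sum[OF A.subW] A.subspace_scale[OF A.subW] ul_in that)
  have tu: "A.transforms ?d' ?\<rho>' (u w)" if w: "w \<in> sp g" for w
    unfolding A.transforms_def
  proof (intro conjI allI impI ballI)
    show "u w i \<in> sp g" for i by (rule u_in[OF w])
    fix a i assume a: "a \<in> carrier (HC g)" and i: "i < ?d'"
    have aC: "a \<in> Cent g" using a by simp
    have t0: "\<phi> g a (uop g \<chi> l 0 w) = (\<Sum>j<?d. sc g (?\<rho> a $$ (j, l)) (uop g \<chi> j 0 w))" if "l < ?d" for l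
      using uop_transforms[OF g \<chi> w] a that unfolding A.transforms_def by blast
    have "\<phi> g a (u w i) = (\<Sum>l<?d. \<Sum>j<?d. sc g (?\<rho> a $$ (j, l) * S $$ (l, i)) (uop g \<chi> j 0 w))"
      unfolding u_def using a
      by (subst A.\<pi>_sum[OF a]) (simp_all add: A.subspace_scale[OF A.subW] ul_in[OF w] A.\<pi>_scale t0 A.scale_sum_right mult.commute)
    also have "\<dots> = (\<Sum>j<?d. \<Sum>l<?d. sc g (?\<rho> a $$ (j, l) * S $$ (l, i)) (uop g \<chi> j 0 w))" by (rule sum.swap)
    also have "\<dots> = (\<Sum>j<?d. sc g ((?\<rho> a * S) $$ (j, i)) (uop g \<chi> j 0 w))"
      using index_mult_mat_sum[OF c(1)[OF aC] S] i by (simp add: A.scale_sum_left del: index_mult_mat)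
    also have "\<dots> = (\<Sum>j<?d. \<Sum>m<?d'. sc g (S $$ (j, m) * ?\<rho>' a $$ (m, i)) (uop g \<chi> j 0 w))"
      using index_mult_mat_sum[OF S c(2)[OF aC]] i int a by (simp add: A.scale_sum_left del: index_mult_mat)
    also have "\<dots> = (\<Sum>m<?d'. \<Sum>j<?d. sc g (S $$ (j, m) * ?\<rho>' a $$ (m, i)) (uop g \<chi> j 0 w))" by (rule sum.swap)
    also have "\<dots> = (\<Sum>m<?d'. sc g (?\<rho>' a $$ (m, i)) (u w m))"
      unfolding u_def by (simp add: A.scale_sum_right mult.commute)
    finally show "\<phi> g a (u w i) = (\<Sum>m<?d'. sc g (?\<rho>' a $$ (m, i)) (u w m))" .
  qed
  define \<theta> where "\<theta> w = \<phi> g k (u w 0)" for w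
  have \<theta>_in: "\<theta> w \<in> Wsp ?h \<psi>" if w: "w \<in> sp g" for w
  proof -
    have "B.transforms ?d' (basisrep ?h \<psi>) (\<lambda>i. \<phi> g k (u w i))"
      using transport_family[OF g k proj_basisrep[OF h \<psi>], of "u w"] u_in[OF w] tu[OF w] by simp
    from B.unit_op_same[OF simple_basisrep[OF h \<psi>] this dp(2) dp(2) dp(2)]
    show ?thesis using phi_in[OF g k u_in[OF w]] by (simp add: Wsp_def \<theta>_def)
  qed
  have u_add: "u (x + y) 0 = u x 0 + u y 0" if "x \<in> sp g" "y \<in> sp g" for x y
    using that by (simp add: u_def linear_on_add[OF uop_linear[OF g]] A.scale_right_distrib sum.distrib)
  have u_scale: "u (sc g b x) 0 = sc g b (u x 0)" if "x \<in> sp g" for b x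
    using that by (simp add: u_def linear_on_scale[OF uop_linear[OF g]] A.scale_sum_right mult.commute)
  have lin: "linear_on (sc g) (sc ?h) (Wsp g \<chi>) \<theta>"
    unfolding linear_on_def \<theta>_def
    using u_add u_scale u_in Wsp_sub linear_on_add[OF phi_linear[OF g k]] phi_scale[OF g k] by auto
  have mode: "\<theta> (mo g v n w) = mo ?h v n (\<theta> w)" if v: "v \<in> fixedV" and w: "w \<in> sp g" for v n w
  proof -
    have vV: "v \<in> vspace V" by (rule fixedV_sub[OF v])
    have "u (mo g v n w) 0 = (\<Sum>l<?d. mo g v n (sc g (S $$ (l, 0)) (uop g \<chi> l 0 w)))"
      using w by (simp add: u_def uop_fixed_mode[OF g v] linear_on_scale[OF mo_linear[OF g vV]] ul_in)
    also have "\<dots> = mo g v n (u w 0)"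
      unfolding u_def by (rule linear_on_sum[OF mo_linear[OF g vV] vsp[OF g] sub_sp[OF g], symmetric])
        (intro A.subspace_scale[OF A.subW] ul_in[OF w])
    finally show ?thesis using phi_mode[OF g k vV u_in[OF w]] fixedV_fix[OF v k] by (simp add: \<theta>_def)
  qed
  \<comment> \<open>Applying E_0l to \<open>u w 0\<close> isolates the entry of S at (l, 0) times w.
    If w were nonzero, column 0 of an invertible matrix would vanish.\<close>
  have ker: "w = 0" if w: "w \<in> Wsp g \<chi>" and z: "\<theta> w = 0" for w
  proof (rule ccontr)
    assume w0: "w \<noteq> 0"
    have wg: "w \<in> sp g" by (rule Wsp_sub[OF w])
    have u0: "u w 0 = 0" using phi_eq_0[OF g k u_in[OF wg]] z by (simp add: \<theta>_def)
    have "S $$ (l, 0) = 0" if l: "l < ?d" for l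
    proof -
      have "uop g \<chi> 0 l (u w 0) = (\<Sum>j<?d. sc g (S $$ (j, 0)) (uop g \<chi> 0 l (uop g \<chi> j 0 w)))"
        unfolding u_def
        by (subst uop_sum[OF g]) (simp_all add: A.subspace_scale[OF A.subW] ul_in[OF wg] linear_on_scale[OF uop_linear[OF g]])
      also have "\<dots> = (\<Sum>j<?d. if j = l then sc g (S $$ (j, 0)) w else 0)"
        using uop_uop[OF g \<chi> \<chi> _ dp(1) dp(1) l wg] Wsp_fix[OF w] by (intro sum.cong refl) auto
      finally have "sc g (S $$ (l, 0)) w = 0" using l u0 uop_0[OF g] by simp
      then show ?thesis using w0 by simp
    qed
    then have "(T * S) $$ (0, 0) = 0" using index_mult_mat_sum[OF T S dp(2) dp(2)] by (simp del: index_mult_mat)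
    then show False using TS dp(2) by simp
  qed
  have inj: "inj_on \<theta> (Wsp g \<chi>)"
  proof (rule inj_onI)
    fix x y assume xy: "x \<in> Wsp g \<chi>" "y \<in> Wsp g \<chi>" "\<theta> x = \<theta> y"
    have "\<theta> (x - y) = 0" using linear_on_diff[OF lin vsp[OF g] vsp[OF h] subspace_Wsp[OF g] xy(1,2)] xy(3) by simp
    then have "x - y = 0" by (rule ker[OF A.subspace_diff[OF subspace_Wsp[OF g] xy(1,2)]])
    then show "x = y" by simp
  qed
  \<comment> \<open>Surjectivity comes from simplicity of the target: the image is a nonzero
    submodule.\<close>
  have "B.subspace (\<theta> ` Wsp g \<chi>)"
  proof (rule B.subspaceI)
    show "0 \<in> \<theta> ` Wsp g \<chi>"
      using linear_on_0[OF lin vsp[OF g] subspace_Wsp[OF g]] A.subspace_0[OF subspace_Wsp[OF g]] by (intro image_eqI[of _ _ 0]) simp_all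
    fix x y assume "x \<in> \<theta> ` Wsp g \<chi>" "y \<in> \<theta> ` Wsp g \<chi>"
    then obtain a b where ab: "a \<in> Wsp g \<chi>" "b \<in> Wsp g \<chi>" "x = \<theta> a" "y = \<theta> b" by blast
    have "x + y = \<theta> (a + b)" using linear_on_add[OF lin ab(1,2)] ab by simp
    then show "x + y \<in> \<theta> ` Wsp g \<chi>" using A.subspace_add[OF subspace_Wsp[OF g] ab(1,2)] by (rule image_eqI)
  next
    fix b x assume "x \<in> \<theta> ` Wsp g \<chi>"
    then obtain a where a: "a \<in> Wsp g \<chi>" "x = \<theta> a" by blast
    have "sc ?h b x = \<theta> (sc g b a)" using linear_on_scale[OF lin a(1)] a by simp
    then show "sc ?h b x \<in> \<theta> ` Wsp g \<chi>" using A.subspace_scale[OF subspace_Wsp[OF g] a(1)] by (rule image_eqI)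
  qed
  moreover have "\<theta> ` Wsp g \<chi> \<subseteq> Wsp ?h \<psi>" using \<theta>_in Wsp_sub by blast
  moreover have "mo ?h v n x \<in> \<theta> ` Wsp g \<chi>" if v: "v \<in> fixedV" and x: "x \<in> \<theta> ` Wsp g \<chi>" for v n x
  proof -
    obtain a where a: "a \<in> Wsp g \<chi>" "x = \<theta> a" using x by blast
    have "mo ?h v n x = \<theta> (mo g v n a)" using mode[OF v Wsp_sub[OF a(1)]] a by simp
    then show ?thesis using Wsp_mode[OF g v a(1)] by (rule image_eqI)
  qed
  ultimately have "\<theta> ` Wsp g \<chi> = {0} \<or> \<theta> ` Wsp g \<chi> = Wsp ?h \<psi>" by (rule Wsp_simple[OF h \<psi>])
  moreover obtain w where w: "w \<in> Wsp g \<chi>" "w \<noteq> 0" using Wsp_ne[OF g \<chi>] by blast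
  then have "\<theta> w \<noteq> 0" "\<theta> w \<in> \<theta> ` Wsp g \<chi>" using ker by auto
  ultimately have "\<theta> ` Wsp g \<chi> = Wsp ?h \<psi>" by auto
  then have bij: "bij_betw \<theta> (Wsp g \<chi>) (Wsp ?h \<psi>)" using inj by (simp add: bij_betw_def)
  have "module_iso FV (Wmod g \<chi>) (Wmod ?h \<psi>) \<theta>"
    unfolding module_iso_def vspace_FV Wmod_simps
    by (intro conjI bij lin ballI allI mode Wsp_sub)
  then show ?thesis unfolding isomorphic_modules_def by (rule exI[of _ \<theta>])
qed

lemma act_intertwine:
  assumes "fixed_modes xs" and g: "g \<in> G"
    and lin: "linear_on (sc g) (sc h) (Wsp g \<chi>) \<theta>"
    and mode: "\<And>v n w. v \<in> fixedV \<Longrightarrow> w \<in> Wsp g \<chi> \<Longrightarrow> \<theta> (mo g v n w) = mo h v n (\<theta> w)"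
    and w: "w \<in> Wsp g \<chi>"
  shows "act xs g w \<in> Wsp g \<chi> \<and> \<theta> (act xs g w) = act xs h (\<theta> w)"
  using assms(1)
proof (induction xs)
  case Nil
  interpret cvector_space "sc g" by (rule vs[OF g])
  show ?case using linear_on_0[OF lin vsp[OF g] subspace_Wsp[OF g]] subspace_0[OF subspace_Wsp[OF g]] by simp
next
  case (Cons p xs)
  interpret cvector_space "sc g" by (rule vs[OF g])
  obtain v n where p: "p = (v, n)" by (cases p)
  have v: "v \<in> fixedV" and xs: "fixed_modes xs" using Cons.prems p by (auto simp: fixed_modes_def)
  have m: "mo g v n w \<in> Wsp g \<chi>" by (rule Wsp_mode[OF g v w])
  show ?case using Cons.IH[OF xs] m linear_on_add[OF lin m] mode[OF v w] subspace_add[OF subspace_Wsp[OF g] m] by (simp add: p)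
qed

text \<open>If no k transports \<chi> to \<psi>, density separates w from its image x: some list of
  fixed modes fixes w and kills x, which no isomorphism allows.\<close>

lemma transport_if_isomorphic:
  assumes g: "g \<in> G" and h: "h \<in> G" and \<chi>: "\<chi> \<in> Irr g" and \<psi>: "\<psi> \<in> Irr h"
    and iso: "isomorphic_modules FV (Wmod g \<chi>) (Wmod h \<psi>)"
  shows "\<exists>k\<in>G. char_transport V G M \<phi> k g \<chi> h \<psi>"
proof (rule ccontr)
  assume no: "\<not> ?thesis"
  obtain \<theta> where "module_iso FV (Wmod g \<chi>) (Wmod h \<psi>) \<theta>" using iso unfolding isomorphic_modules_def by (rule exE)
  then have bij: "bij_betw \<theta> (Wsp g \<chi>) (Wsp h \<psi>)" and lin: "linear_on (sc g) (sc h) (Wsp g \<chi>) \<theta>"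
    and mode: "\<And>v n w. v \<in> fixedV \<Longrightarrow> w \<in> Wsp g \<chi> \<Longrightarrow> \<theta> (mo g v n w) = mo h v n (\<theta> w)"
    unfolding module_iso_def vspace_FV Wmod_simps by simp_all
  interpret A: proj_action "HC g" "al g" "sc g" "sp g" "\<phi> g" by (rule proj_action[OF g])
  obtain w where w: "w \<in> Wsp g \<chi>" "w \<noteq> 0" using Wsp_ne[OF g \<chi>] by blast
  have wg: "w \<in> sp g" "uop g \<chi> 0 0 w = w" using w by (auto simp: Wsp_def)
  define x where "x = \<theta> w"
  have xW: "x \<in> Wsp h \<psi>" using bij w(1) unfolding x_def by (rule bij_betwE[rule_format])
  have xh: "x \<in> sp h" by (rule Wsp_sub[OF xW])
  \<comment> \<open>A transport of x into the sector g belongs to a family of pullback type. Its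
    character differs from \<chi>, so the idempotent of \<chi> kills it by orthogonality.\<close>
  have kill: "uop g \<chi> 0 0 (phi_inverse k h x) = 0" if k: "k \<in> G" and e: "cj (iG k) h = g" for k
  proof -
    have hk: "h = cj k g" using cj_inv(1)[OF k h] e by simp
    have \<psi>': "\<psi> \<in> Irr (cj k g)" using \<psi> hk by simp
    let ?\<rho>' = "pullback g k (basisrep h \<psi>)" and ?d' = "dimg h \<psi>"
    have "\<not> char_transport V G M \<phi> k g \<chi> h \<psi>" using no k by blast
    then obtain z where z: "z \<in> Cent g" "\<chi> (basis_elt z) \<noteq> \<psi> (conj_elt V M \<phi> g k z)"
      unfolding char_transport_def using hk by blast
    have ne: "mtrace ?d' (?\<rho>' z) \<noteq> mtrace (dimg g \<chi>) (basisrep g \<chi> z)"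
      using z character_basis[OF g \<chi> z(1)] character_conj_elt[OF g k \<psi>' z(1)] hk by simp
    have zc: "z \<in> carrier (HC g)" using z by simp
    have s': "A.simple_proj_rep ?d' ?\<rho>'" using simple_pullback[OF g k] simple_basisrep[OF h \<psi>] hk by simp
    define u where "u i = phi_inverse k h (uop h \<psi> i 0 x)" for i
    have u_in: "u i \<in> sp g" for i using phi_inverse_in[OF k h uop_in[OF h xh]] e by (simp add: u_def)
    have pu: "\<phi> g k (u i) = uop h \<psi> i 0 x" for i using phi_phi_inverse[OF k h uop_in[OF h xh]] e by (simp add: u_def)
    have tu: "A.transforms ?d' ?\<rho>' u"
      using transport_family[OF g k proj_basisrep[OF cj_in[OF k g] \<psi>'], of u] u_in uop_transforms[OF h \<psi> xh] pu hk by simp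
    have d0: "0 < ?d'" "0 < dimg g \<chi>" by (rule dimg_pos[OF h \<psi>], rule dimg_pos[OF g \<chi>])
    have "uop g \<chi> 0 0 (u 0) = 0"
    proof (rule A.unit_op_diff[where ?a0.0 = z])
      show "A.simple_proj_rep ?d' ?\<rho>'" by (rule s')
      show "A.simple_proj_rep (dimg g \<chi>) (basisrep g \<chi>)" by (rule simple_basisrep[OF g \<chi>])
    qed (rule tu d0 zc ne)+
    then show ?thesis using Wsp_fix[OF xW] by (simp add: u_def)
  qed
  have "finite_points {(h, x)}" using h xh by (simp add: finite_points_def)
  from fixed_density[OF g simple_basisrep[OF g \<chi>] wg(1) w(2) wg(2) wg this]
  obtain xs where xs: "fixed_modes xs" "act xs g w = w" "act xs h x = 0" using kill by auto
  have "\<theta> w = 0"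
    using act_intertwine[OF xs(1) g lin mode w(1)] xs(2,3) by (simp add: x_def)
  moreover have "\<theta> 0 = 0" by (rule linear_on_0[OF lin vsp[OF g] subspace_Wsp[OF g]])
  moreover have "0 \<in> Wsp g \<chi>" by (rule A.subspace_0[OF subspace_Wsp[OF g]])
  ultimately show False using bij w unfolding bij_betw_def inj_on_def by metis
qed

lemma isomorphic_iff_transport:
  assumes g: "g \<in> G" and h: "h \<in> G" and \<chi>: "\<chi> \<in> Irr g" and \<psi>: "\<psi> \<in> Irr h"
  shows "isomorphic_modules FV (Wmod g \<chi>) (Wmod h \<psi>) \<longleftrightarrow> (\<exists>k\<in>G. char_transport V G M \<phi> k g \<chi> h \<psi>)"
proof
  assume "\<exists>k\<in>G. char_transport V G M \<phi> k g \<chi> h \<psi>"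
  then obtain k where k: "k \<in> G" and h': "h = cj k g"
    and tr: "\<And>z. z \<in> Cent g \<Longrightarrow> \<chi> (basis_elt z) = \<psi> (conj_elt V M \<phi> g k z)"
    unfolding char_transport_def by blast
  show "isomorphic_modules FV (Wmod g \<chi>) (Wmod h \<psi>)"
    using isomorphic_if_transport[OF g k \<chi> _ tr] \<psi> h' by simp
qed (rule transport_if_isomorphic[OF g h \<chi> \<psi>])

end

section \<open>Normalised intertwiners\<close>

context module_family
begin

text \<open>The hypothesis is applied to the inverse of h, which lands in the sector of h g h^(-1);
  substituting h v for v then gives the required rule.\<close>

lemma intertwiners_exist:
  assumes iso: "\<And>g h. g \<in> G \<Longrightarrow> h \<in> G \<Longrightarrow> isomorphic_modules V (twist (M g) h) (M (conjg AutV (inv\<^bsub>AutV\<^esub> h) g))"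
  shows "\<exists>\<phi>. intertwiners V G M \<phi>"
proof -
  have "\<exists>f. g \<in> G \<longrightarrow> h \<in> G \<longrightarrow> bij_betw f (sp g) (sp (conjg AutV h g)) \<and>
      linear_on (sc g) (sc (conjg AutV h g)) (sp g) f \<and>
      (\<forall>v\<in>vspace V. \<forall>n. \<forall>w\<in>sp g. f (mo g v n w) = mo (conjg AutV h g) (h v) n (f w))" (is "\<exists>f. ?P g h f") for g h
  proof (cases "g \<in> G \<and> h \<in> G")
    case True
    then have h: "h \<in> G" "inv\<^bsub>AutV\<^esub> h \<in> G" and hc: "h \<in> carrier AutV"
      using subgroup.m_inv_closed[OF subG] G_in by auto
    obtain f where f: "module_iso V (twist (M g) (inv\<^bsub>AutV\<^esub> h)) (M (conjg AutV h g)) f"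
      using iso[OF conjunct1[OF True] h(2)] hc unfolding isomorphic_modules_def by auto
    have "f (mo g v n w) = mo (conjg AutV h g) (h v) n (f w)" if v: "v \<in> vspace V" and w: "w \<in> sp g" for v n w
    proof -
      have "(inv\<^bsub>AutV\<^esub> h) (h v) = v"
        using aut_mult[OF Aut.inv_closed[OF hc] hc v] hc aut_one[OF v] by simp
      then show ?thesis using f aut_in[OF hc v] w unfolding module_iso_def twist_def by force
    qed
    then show ?thesis using f by (intro exI[of _ f]) (simp add: module_iso_def twist_def)
  qed simp
  then have "\<exists>\<phi>. \<forall>p. ?P (fst p) (snd p) (\<phi> p)" by (intro choice) simp
  then obtain \<phi> where \<phi>: "\<And>p. ?P (fst p) (snd p) (\<phi> p)" by (elim exE) (rule that, erule spec)
  have "intertwiners V G M (\<lambda>g h. \<phi> (g, h))"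
    unfolding intertwiners_def Let_def
  proof (intro ballI)
    fix g h assume gh: "g \<in> G" "h \<in> G"
    from \<phi>[of "(g, h)", unfolded fst_conv snd_conv, rule_format, OF gh]
    show "bij_betw (\<phi> (g, h)) (sp g) (sp (conjg AutV h g)) \<and>
       linear_on (sc g) (sc (conjg AutV h g)) (sp g) (\<phi> (g, h)) \<and>
       (\<forall>v\<in>vspace V. \<forall>n. \<forall>w\<in>sp g. \<phi> (g, h) (mo g v n w) = mo (conjg AutV h g) (h v) n (\<phi> (g, h) w))"
      by blast
  qed
  then show ?thesis by blast
qed

end

section \<open>The conjugation factors and their removal by rescaling\<close>

context equivariant_family
begin

lemma conj_factor_unique:
  assumes g: "g \<in> G" and k: "k \<in> G" and z: "z \<in> Cent g" and w: "w \<in> sp g" "w \<noteq> 0"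
    and e: "\<phi> g k (\<phi> g z w) = sc (cj k g) c (\<phi> (cj k g) (cj k z) (\<phi> g k w))"
  shows "conj_factor g k z = c"
proof -
  interpret cvector_space "sc (cj k g)" by (rule vs[OF cj_in[OF k g]])
  have kw: "\<phi> g k w \<in> sp (cj k g)" by (rule phi_in[OF g k w(1)])
  have "\<phi> (cj k g) (cj k z) (\<phi> g k w) \<noteq> 0"
    using phi_eq_0[OF cj_in[OF k g] cj_in[OF k Cent_sub[OF z]] kw] phi_eq_0[OF g k w(1)] w(2) by blast
  then show ?thesis using phi_conj[OF g k z w(1)] e by simp
qed

text \<open>Conjugating \<phi>_g(z) by \<phi>_g(k l) or successively by the maps for l and k is the
  same, since the two differ by the scalar \<alpha>_g(k,l), which cancels.\<close>

lemma conj_factor_mult: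
  assumes g: "g \<in> G" and k: "k \<in> G" and l: "l \<in> G" and z: "z \<in> Cent g"
  shows "conj_factor g (k \<odot> l) z = conj_factor (cj l g) k (cj l z) * conj_factor g l z"
proof -
  have zG: "z \<in> G" by (rule Cent_sub[OF z])
  have kl: "k \<odot> l \<in> G" and lg: "cj l g \<in> G" and h: "cj (k \<odot> l) g \<in> G" using g k l mul_in cj_in by auto
  have e: "cj (k \<odot> l) g = cj k (cj l g)" "cj (k \<odot> l) z = cj k (cj l z)" using cj_mul k l g zG by auto
  interpret A: cvector_space "sc (cj l g)" by (rule vs[OF lg])
  interpret B: cvector_space "sc (cj (k \<odot> l) g)" by (rule vs[OF h])
  obtain w where w: "w \<in> sp g" "w \<noteq> 0" using ex_nonzero[OF g] by blast
  have zw: "\<phi> g z w \<in> sp g" using phi_in[OF g zG w(1)] cj_Cent[OF z g] by simp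
  have lw: "\<phi> g l w \<in> sp (cj l g)" by (rule phi_in[OF g l w(1)])
  have lz: "cj l z \<in> Cent (cj l g)" by (rule cj_Cent_in[OF g l z])
  have lzw: "\<phi> (cj l g) (cj l z) (\<phi> g l w) \<in> sp (cj l g)"
    using phi_in[OF lg Cent_sub[OF lz] lw] cj_Cent[OF lz lg] by simp
  have klw: "\<phi> g (k \<odot> l) w \<in> sp (cj (k \<odot> l) g)" by (rule phi_in[OF g kl w(1)])
  have klz: "cj (k \<odot> l) z \<in> Cent (cj (k \<odot> l) g)" by (rule cj_Cent_in[OF g kl z])
  let ?s = "sc (cj (k \<odot> l) g)"
  let ?y = "\<phi> (cj (k \<odot> l) g) (cj (k \<odot> l) z) (\<phi> g (k \<odot> l) w)"
  let ?c = "conj_factor (cj l g) k (cj l z) * conj_factor g l z"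
  have "?s (al g k l) (\<phi> g (k \<odot> l) (\<phi> g z w)) = \<phi> (cj l g) k (\<phi> g l (\<phi> g z w))"
    by (rule al_eq[OF g k l zw, symmetric])
  also have "\<dots> = \<phi> (cj l g) k (sc (cj l g) (conj_factor g l z) (\<phi> (cj l g) (cj l z) (\<phi> g l w)))"
    by (simp only: phi_conj[OF g l z w(1)])
  also have "\<dots> = ?s (conj_factor g l z) (\<phi> (cj l g) k (\<phi> (cj l g) (cj l z) (\<phi> g l w)))"
    by (simp only: phi_scale[OF lg k lzw] e)
  also have "\<dots> = ?s ?c (\<phi> (cj (k \<odot> l) g) (cj (k \<odot> l) z) (\<phi> (cj l g) k (\<phi> g l w)))"
    unfolding phi_conj[OF lg k lz lw] e[symmetric] by (simp add: mult.commute)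
  also have "\<phi> (cj l g) k (\<phi> g l w) = ?s (al g k l) (\<phi> g (k \<odot> l) w)" by (rule al_eq[OF g k l w(1)])
  also have "\<phi> (cj (k \<odot> l) g) (cj (k \<odot> l) z) (?s (al g k l) (\<phi> g (k \<odot> l) w)) = ?s (al g k l) ?y"
    using phi_scale[OF h Cent_sub[OF klz] klw] cj_Cent[OF klz h] by simp
  also have "?s ?c (?s (al g k l) ?y) = ?s (al g k l) (?s ?c ?y)" by (simp add: mult.commute)
  finally have "\<phi> g (k \<odot> l) (\<phi> g z w) = ?s ?c ?y" using al_nz[OF g k l] by (simp del: B.scale_scale)
  then show ?thesis by (rule conj_factor_unique[OF g kl z w])
qed

text \<open>As c commutes with z, conjugation by \<rho>(c) multiplies \<rho>(z) by the factor. The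
  trace is unchanged by conjugation, so it must vanish if the factor is not 1.\<close>

lemma character_zero:
  assumes g: "g \<in> G" and c: "c \<in> Cent g" and z: "z \<in> Cent g" and cz: "cj c z = z"
    and f: "conj_factor g c z \<noteq> 1" and \<chi>: "\<chi> \<in> Irr g"
  shows "\<chi> (basis_elt z) = 0"
proof -
  interpret A: proj_action "HC g" "al g" "sc g" "sp g" "\<phi> g" by (rule proj_action[OF g])
  let ?\<rho> = "basisrep g \<chi>" and ?d = "dimg g \<chi>" and ?f = "conj_factor g c z"
  have pr: "A.proj_rep ?d ?\<rho>" by (rule proj_basisrep[OF g \<chi>])
  have cG: "c \<in> G" and zG: "z \<in> G" using c z Cent_sub by auto
  have com: "c \<odot> z = z \<odot> c" using cj_fix_iff[OF cG zG] cz by (simp add: centralizer_def)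
  let ?r = "A.rinv ?\<rho> c"
  have m: "?\<rho> c \<in> carrier_mat ?d ?d" "?\<rho> z \<in> carrier_mat ?d ?d" "?r \<in> carrier_mat ?d ?d"
    using pr c z A.rinv_carrier[OF pr, of c] by (auto simp: A.proj_rep_def)
  have inv: "?\<rho> c * ?r = 1\<^sub>m ?d" "?r * ?\<rho> c = 1\<^sub>m ?d" using A.rep_rinv[OF pr, of c] c by auto
  have "?\<rho> c * ?\<rho> z = al g c z \<cdot>\<^sub>m ?\<rho> (c \<odot> z)" "?\<rho> z * ?\<rho> c = al g z c \<cdot>\<^sub>m ?\<rho> (c \<odot> z)"
    using pr c z com by (simp_all add: A.proj_rep_def)
  then have e: "?\<rho> c * ?\<rho> z = ?f \<cdot>\<^sub>m (?\<rho> z * ?\<rho> c)"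
    using al_nz[OF g zG cG] cz by (auto simp: conj_factor_def intro!: eq_matI)
  have "?\<rho> z = ?r * (?\<rho> c * ?\<rho> z)"
    using m inv by (simp add: assoc_mult_mat[of _ ?d ?d _ ?d _ ?d, symmetric])
  also have "\<dots> = ?f \<cdot>\<^sub>m (?r * (?\<rho> z * ?\<rho> c))"
    unfolding e by (rule mult_smult_distrib[of _ ?d ?d _ ?d]) (use m in simp_all)
  finally have "mtrace ?d (?\<rho> z) = mtrace ?d (?f \<cdot>\<^sub>m (?r * (?\<rho> z * ?\<rho> c)))" by simp
  also have "\<dots> = ?f * mtrace ?d (?r * (?\<rho> z * ?\<rho> c))"
    using m by (simp add: mtrace_def sum_distrib_left del: index_mult_mat(1))
  also have "mtrace ?d (?r * (?\<rho> z * ?\<rho> c)) = mtrace ?d (?\<rho> z * ?\<rho> c * ?r)"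
    by (rule mtrace_comm) (use m in simp_all)
  also have "?\<rho> z * ?\<rho> c * ?r = ?\<rho> z" using m inv by (simp add: assoc_mult_mat[of _ ?d ?d _ ?d _ ?d])
  finally show ?thesis using f character_basis[OF g \<chi> z] by simp
qed

lemma character_conj:
  assumes g: "g \<in> G" and k: "k \<in> G" and \<psi>: "\<psi> \<in> Irr (cj k g)" and z: "z \<in> Cent g"
  shows "\<psi> (conj_elt V M \<phi> g k z) = conj_factor g k z * \<psi> (basis_elt (cj k z))"
proof -
  have "twisted_group.proj_rep (HC (cj k g)) (al (cj k g)) (dimg (cj k g) \<psi>) (basisrep (cj k g) \<psi>)"
    by (rule proj_basisrep[OF cj_in[OF k g] \<psi>])
  then have "basisrep (cj k g) \<psi> (cj k z) \<in> carrier_mat (dimg (cj k g) \<psi>) (dimg (cj k g) \<psi>)"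
    using cj_Cent_in[OF g k z] by (simp add: twisted_group.proj_rep_def[OF twisted_group[OF cj_in[OF k g]]])
  then show ?thesis
    unfolding character_conj_elt[OF assms] character_basis[OF cj_in[OF k g] \<psi> cj_Cent_in[OF g k z]] pullback_def
    by (simp add: mtrace_def sum_distrib_left)
qed

definition pair_conj :: "('v \<Rightarrow> 'v) \<Rightarrow> ('v \<Rightarrow> 'v) \<times> ('v \<Rightarrow> 'v) \<Rightarrow> ('v \<Rightarrow> 'v) \<times> ('v \<Rightarrow> 'v)" where
  "pair_conj k x = (cj k (fst x), cj k (snd x))"

definition pair_factor :: "('v \<Rightarrow> 'v) \<Rightarrow> ('v \<Rightarrow> 'v) \<times> ('v \<Rightarrow> 'v) \<Rightarrow> complex" where
  "pair_factor k x = conj_factor (fst x) k (snd x)"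

definition commuting_pairs :: "(('v \<Rightarrow> 'v) \<times> ('v \<Rightarrow> 'v)) set" where
  "commuting_pairs = {x. fst x \<in> G \<and> snd x \<in> Cent (fst x)}"

text \<open>For singular pairs \<open>(g, z)\<close> all characters vanish at \<open>z\<close>.\<close>

definition singular_pair :: "('v \<Rightarrow> 'v) \<times> ('v \<Rightarrow> 'v) \<Rightarrow> bool" where
  "singular_pair x \<longleftrightarrow> (\<exists>c\<in>G. pair_conj c x = x \<and> pair_factor c x \<noteq> 1)"

lemma commuting_pairsD: "x \<in> commuting_pairs \<Longrightarrow> fst x \<in> G" "x \<in> commuting_pairs \<Longrightarrow> snd x \<in> Cent (fst x)"
    "x \<in> commuting_pairs \<Longrightarrow> snd x \<in> G"
  by (auto simp: commuting_pairs_def dest: Cent_sub)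

lemma pair_conj_in: "k \<in> G \<Longrightarrow> x \<in> commuting_pairs \<Longrightarrow> pair_conj k x \<in> commuting_pairs"
  by (simp add: commuting_pairs_def pair_conj_def cj_in cj_Cent_in)

lemma pair_conj_mult: "k \<in> G \<Longrightarrow> l \<in> G \<Longrightarrow> x \<in> commuting_pairs \<Longrightarrow> pair_conj (k \<odot> l) x = pair_conj k (pair_conj l x)"
  by (simp add: commuting_pairsD pair_conj_def cj_mul)

lemma pair_conj_one: "x \<in> commuting_pairs \<Longrightarrow> pair_conj oneG x = x"
  by (simp add: commuting_pairsD pair_conj_def cj_one)

lemma pair_conj_inv: "k \<in> G \<Longrightarrow> x \<in> commuting_pairs \<Longrightarrow> pair_conj (iG k) (pair_conj k x) = x"
  using pair_conj_mult[of "iG k" k x] by (simp add: iG_in G_in pair_conj_one)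

lemma pair_factor_mult: "k \<in> G \<Longrightarrow> l \<in> G \<Longrightarrow> x \<in> commuting_pairs \<Longrightarrow>
   pair_factor (k \<odot> l) x = pair_factor k (pair_conj l x) * pair_factor l x"
  by (simp add: commuting_pairs_def pair_conj_def pair_factor_def conj_factor_mult)

lemma pair_factor_nz: "k \<in> G \<Longrightarrow> x \<in> commuting_pairs \<Longrightarrow> pair_factor k x \<noteq> 0"
  by (simp add: commuting_pairsD pair_factor_def conj_factor_nz)

text \<open>Conjugate the stabilising element by k. By multiplicativity its factor at the moved pair
  is the old one, the contributions of k cancelling.\<close>

lemma singular_pair_conj:
  assumes k: "k \<in> G" and x: "x \<in> commuting_pairs" and s: "singular_pair x"
  shows "singular_pair (pair_conj k x)"
proof -
  obtain c where c: "c \<in> G" "pair_conj c x = x" "pair_factor c x \<noteq> 1" using s by (auto simp: singular_pair_def)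
  define b where "b = k \<odot> c \<odot> iG k"
  have b: "b \<in> G" using k c by (simp add: b_def mul_in iG_in)
  have bk: "b \<odot> k = k \<odot> c" using k c by (simp add: b_def G_in Aut.m_assoc)
  have "pair_conj b (pair_conj k x) = pair_conj k x"
    using pair_conj_mult[OF b k x] pair_conj_mult[OF k c(1) x] bk c(2) by simp
  moreover have "pair_factor b (pair_conj k x) * pair_factor k x = pair_factor k x * pair_factor c x"
    using pair_factor_mult[OF b k x] pair_factor_mult[OF k c(1) x] bk c(2) by auto
  then have "pair_factor b (pair_conj k x) = pair_factor c x"
    using pair_factor_nz[OF k x] by (metis mult.commute mult_cancel_left)
  then have "pair_factor b (pair_conj k x) \<noteq> 1" using c(3) by simp
  ultimately show ?thesis using b by (auto simp: singular_pair_def)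
qed

text \<open>\<open>t x\<close> is the factor by which a chosen group element moves the representative of the orbit
  of \<open>x\<close> to \<open>x\<close>; by the multiplicativity of the factors only stabilisers contribute to the
  corrected factor.\<close>

lemma normalizing_scalars:
  "\<exists>t. (\<forall>x. t x \<noteq> 0) \<and> (\<forall>x\<in>commuting_pairs. \<forall>k\<in>G.
     pair_factor k x * t x = t (pair_conj k x) \<or> singular_pair x)"
proof -
  \<comment> \<open>The representative is chosen from the orbit as a set and is therefore the same
    for all pairs in it.\<close>
  define orb where "orb x = (\<lambda>k. pair_conj k x) ` G" for x
  define rp where "rp x = (SOME y. y \<in> orb x)" for x
  define mv where "mv x = (SOME k. k \<in> G \<and> pair_conj k (rp x) = x)" for x
  define t where "t x = (if x \<in> commuting_pairs then pair_factor (mv x) (rp x) else 1)" for x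
  have rp: "rp x \<in> commuting_pairs" and mv: "mv x \<in> G" "pair_conj (mv x) (rp x) = x" if x: "x \<in> commuting_pairs" for x
  proof -
    have "orb x \<noteq> {}" using one_in by (auto simp: orb_def)
    then have "rp x \<in> orb x" unfolding rp_def by (simp add: some_in_eq)
    then obtain k where k: "k \<in> G" "rp x = pair_conj k x" by (auto simp: orb_def)
    show "rp x \<in> commuting_pairs" using k pair_conj_in[OF k(1) x] by simp
    have "iG k \<in> G \<and> pair_conj (iG k) (rp x) = x" using k pair_conj_inv[OF k(1) x] iG_in by simp
    then have "mv x \<in> G \<and> pair_conj (mv x) (rp x) = x" unfolding mv_def by (rule someI[of _ "iG k"])
    then show "mv x \<in> G" "pair_conj (mv x) (rp x) = x" by auto
  qed
  have rp_conj: "rp (pair_conj k x) = rp x" if x: "x \<in> commuting_pairs" and k: "k \<in> G" for k x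
  proof -
    have "orb (pair_conj k x) = orb x"
    proof
      show "orb (pair_conj k x) \<subseteq> orb x"
        using pair_conj_mult[OF _ k x] mul_in[OF _ k] by (auto simp: orb_def simp flip: pair_conj_mult[OF _ k x])
      show "orb x \<subseteq> orb (pair_conj k x)"
      proof
        fix y assume "y \<in> orb x"
        then obtain l where l: "l \<in> G" "y = pair_conj l x" by (auto simp: orb_def)
        have "pair_conj (l \<odot> iG k) (pair_conj k x) = y"
          using pair_conj_mult[OF l(1) iG_in[OF k] pair_conj_in[OF k x]] pair_conj_inv[OF k x] l(2) by simp
        then show "y \<in> orb (pair_conj k x)" using mul_in[OF l(1) iG_in[OF k]] by (auto simp: orb_def)
      qed
    qed
    then show ?thesis by (simp add: rp_def)
  qed
  have "pair_factor k x * t x = t (pair_conj k x) \<or> singular_pair x" if x: "x \<in> commuting_pairs" and k: "k \<in> G" for k x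
  proof (cases "singular_pair x")
    case False
    have kx: "pair_conj k x \<in> commuting_pairs" by (rule pair_conj_in[OF k x])
    let ?r = "rp x" and ?m = "mv x" and ?n = "mv (pair_conj k x)"
    \<comment> \<open>Moving the representative first to x and then by k, or directly to the moved
      pair, differs by this stabiliser element, whose factor is 1 off the singular pairs.\<close>
    define c where "c = iG ?n \<odot> (k \<odot> ?m)"
    have n: "?n \<in> G" "pair_conj ?n ?r = pair_conj k x" using mv[OF kx] rp_conj[OF x k] by auto
    have c: "c \<in> G" using n(1) k mv(1)[OF x] by (simp add: c_def mul_in iG_in)
    have nc: "?n \<odot> c = k \<odot> ?m" using n(1) k mv(1)[OF x] by (simp add: c_def G_in Aut.m_assoc[symmetric])
    have "pair_conj (k \<odot> ?m) ?r = pair_conj k x" using pair_conj_mult[OF k mv(1)[OF x] rp[OF x]] mv(2)[OF x] by simp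
    then have cr: "pair_conj c ?r = ?r"
      unfolding c_def using pair_conj_mult[OF iG_in[OF n(1)] mul_in[OF k mv(1)[OF x]] rp[OF x]] pair_conj_inv[OF n(1) rp[OF x]] n(2)
      by simp
    have "\<not> singular_pair ?r" using singular_pair_conj[OF mv(1)[OF x] rp[OF x]] mv(2)[OF x] False by auto
    then have "pair_factor c ?r = 1" using cr c unfolding singular_pair_def by blast
    then have "pair_factor k x * pair_factor ?m ?r = pair_factor ?n ?r"
      using pair_factor_mult[OF n(1) c rp[OF x]] pair_factor_mult[OF k mv(1)[OF x] rp[OF x]] nc cr mv(2)[OF x] by simp
    then show ?thesis using x kx rp_conj[OF x k] by (simp add: t_def)
  qed simp
  moreover have "t x \<noteq> 0" for x using pair_factor_nz mv(1) rp by (simp add: t_def)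
  ultimately show ?thesis by blast
qed

lemma intertwiners_scale:
  assumes t: "\<And>g h. t g h \<noteq> 0"
  shows "intertwiners V G M (\<lambda>g h w. sc (cj h g) (t g h) (\<phi> g h w))"
  unfolding intertwiners_def Let_def
proof (intro ballI conjI allI)
  fix g h assume g: "g \<in> G" and h: "h \<in> G"
  have hg: "cj h g \<in> G" by (rule cj_in[OF h g])
  interpret B: cvector_space "sc (cj h g)" by (rule vs[OF hg])
  let ?t = "t g h" and ?s = "sc (cj h g)"
  have "bij_betw (?s ?t) (sp (cj h g)) (sp (cj h g))"
    by (rule bij_betw_byWitness[where f' = "?s (inverse ?t)"])
      (use t[of g h] B.subspace_scale[OF sub_sp[OF hg]] in auto)
  from bij_betw_trans[OF phi_bij[OF g h] this]
  show "bij_betw (\<lambda>w. ?s ?t (\<phi> g h w)) (sp g) (sp (cj h g))" by (simp add: comp_def)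
  show "linear_on (sc g) ?s (sp g) (\<lambda>w. ?s ?t (\<phi> g h w))"
    using phi_linear[OF g h] by (simp add: linear_on_def B.scale_right_distrib mult.commute)
  fix v n w assume v: "v \<in> vspace V" and w: "w \<in> sp g"
  show "?s ?t (\<phi> g h (mo g v n w)) = mo (cj h g) (h v) n (?s ?t (\<phi> g h w))"
    using phi_mode[OF g h v w] linear_on_scale[OF mo_linear[OF hg aut_in[OF G_in[OF h] v]] phi_in[OF g h w]] by simp
qed

text \<open>Scaling \<phi>_g(z) by t(g,z) multiplies the factor of (g, z) by t(g,z) and divides it
  by t at the conjugated pair, which makes it 1 off the singular pairs. At singular pairs the value
  of \<psi> vanishes in either criterion. The algebras and characters compared here are those
  belonging to \<phi>'.\<close>

lemma normalized_intertwiners: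
  "\<exists>\<phi>'. intertwiners V G M \<phi>' \<and> (\<forall>g\<in>G. \<forall>k\<in>G. \<forall>h. \<forall>\<chi>\<in>irr V G M \<phi>' g. \<forall>\<psi>\<in>irr V G M \<phi>' h.
     char_transport V G M \<phi>' k g \<chi> h \<psi> \<longleftrightarrow> char_transport_basis V G k g \<chi> h \<psi>)"
proof -
  obtain t where t: "\<And>x. t x \<noteq> 0"
    and nt: "\<And>x k. x \<in> commuting_pairs \<Longrightarrow> k \<in> G \<Longrightarrow> pair_factor k x * t x = t (pair_conj k x) \<or> singular_pair x"
    using normalizing_scalars by blast
  define \<phi>' where "\<phi>' = (\<lambda>g h w. sc (cj h g) (t (g, h)) (\<phi> g h w))"
  have int': "intertwiners V G M \<phi>'" unfolding \<phi>'_def by (rule intertwiners_scale) (rule t)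
  interpret E: equivariant_family V G M \<phi>'
    by (intro equivariant_family.intro module_family_axioms equivariant_family_axioms.intro int')
  \<comment> \<open>The scale t(g,k) of the conjugating map occurs on both sides and drops out, so
    only commuting pairs matter.\<close>
  have factor: "E.conj_factor g k z = conj_factor g k z * t (g, z) / t (cj k g, cj k z)"
    if g: "g \<in> G" and k: "k \<in> G" and z: "z \<in> Cent g" for g k z
  proof -
    interpret A: cvector_space "sc g" by (rule vs[OF g])
    interpret B: cvector_space "sc (cj k g)" by (rule vs[OF cj_in[OF k g]])
    obtain w where w: "w \<in> sp g" "w \<noteq> 0" using ex_nonzero[OF g] by blast
    have zw: "\<phi> g z w \<in> sp g" using phi_in[OF g Cent_sub[OF z] w(1)] cj_Cent[OF z g] by simp
    have kz: "cj k z \<in> Cent (cj k g)" by (rule cj_Cent_in[OF g k z])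
    have "\<phi>' g k (\<phi>' g z w) = sc (cj k g) (t (g, k) * (t (g, z) * conj_factor g k z)) (\<phi> (cj k g) (cj k z) (\<phi> g k w))"
      using phi_scale[OF g k zw] phi_conj[OF g k z w(1)] cj_Cent[OF z g] by (simp add: \<phi>'_def)
    moreover have "\<phi>' (cj k g) (cj k z) (\<phi>' g k w) = sc (cj k g) (t (cj k g, cj k z) * t (g, k)) (\<phi> (cj k g) (cj k z) (\<phi> g k w))"
      using phi_scale[OF cj_in[OF k g] Cent_sub[OF kz] phi_in[OF g k w(1)]] cj_Cent[OF kz cj_in[OF k g]] by (simp add: \<phi>'_def)
    ultimately show ?thesis
      by (intro E.conj_factor_unique[OF g k z w]) (simp add: t field_simps)
  qed
  have zero: "\<chi> (basis_elt (snd x)) = 0"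
    if x: "x \<in> commuting_pairs" and s: "singular_pair x" and \<chi>: "\<chi> \<in> E.Irr (fst x)" for x \<chi>
  proof -
    obtain c where c: "c \<in> G" "pair_conj c x = x" "pair_factor c x \<noteq> 1" using s by (auto simp: singular_pair_def)
    have cx: "cj c (fst x) = fst x" "cj c (snd x) = snd x" using c(2) by (auto simp: pair_conj_def prod_eq_iff)
    have "E.conj_factor (fst x) c (snd x) \<noteq> 1"
      using factor[OF commuting_pairsD(1)[OF x] c(1) commuting_pairsD(2)[OF x]] cx c(3) t by (simp add: pair_factor_def)
    moreover have "c \<in> Cent (fst x)" using cj_fix_iff[OF c(1) commuting_pairsD(1)[OF x]] cx by simp
    ultimately show ?thesis
      using E.character_zero[OF commuting_pairsD(1)[OF x] _ commuting_pairsD(2)[OF x] cx(2) _ \<chi>] by blast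
  qed
  have eq: "\<chi> (basis_elt z) = \<psi> (conj_elt V M \<phi>' g k z) \<longleftrightarrow> \<chi> (basis_elt z) = \<psi> (basis_elt (cj k z))"
    if g: "g \<in> G" and k: "k \<in> G" and z: "z \<in> Cent g" and \<chi>: "\<chi> \<in> E.Irr g" and \<psi>: "\<psi> \<in> E.Irr (cj k g)" for g k z \<chi> \<psi>
  proof (cases "singular_pair (g, z)")
    case True
    have x: "(g, z) \<in> commuting_pairs" using g z by (simp add: commuting_pairs_def)
    show ?thesis
      \<comment> \<open>The conjugated pair is singular too, so \<psi> vanishes at k z k^(-1) and
        the scalar in front has no effect.\<close>
      using zero[OF pair_conj_in[OF k x] singular_pair_conj[OF k x True], of \<psi>] \<psi> E.character_conj[OF g k \<psi> z]
      by (simp add: pair_conj_def)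
  next
    case False
    have x: "(g, z) \<in> commuting_pairs" using g z by (simp add: commuting_pairs_def)
    have "E.conj_factor g k z = 1"
      using factor[OF g k z] nt[OF x k] False t by (simp add: pair_factor_def pair_conj_def)
    then show ?thesis using E.character_conj[OF g k \<psi> z] by simp
  qed
  have "char_transport V G M \<phi>' k g \<chi> h \<psi> \<longleftrightarrow> char_transport_basis V G k g \<chi> h \<psi>"
    if g: "g \<in> G" and k: "k \<in> G" and \<chi>: "\<chi> \<in> E.Irr g" and \<psi>: "\<psi> \<in> E.Irr h" for g k h \<chi> \<psi>
    using eq[OF g k _ \<chi>, of _ \<psi>] \<psi> unfolding char_transport_def char_transport_basis_def by blast
  with int' show ?thesis by blast
qed

end

text \<open>An arbitrary choice of intertwiners brings a scalar into the conjugation of basis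
  elements, so the first half uses \<open>char_transport\<close> for every choice. The second half
  supplies intertwiners for which the criterion holds literally, with the basis element of k z
  k^(-1).\<close>

theorem theorem6p1:
  fixes V :: "('v::ab_group_add) voa"
    and G :: "('v \<Rightarrow> 'v) set"
    and M :: "('v \<Rightarrow> 'v) \<Rightarrow> ('v, 'm::ab_group_add) twmod"
  assumes "simple_voa V"
    and "subgroup G (voa_aut V)" and "finite G"
    and "\<And>g. g \<in> G \<Longrightarrow> simple_twisted_module V g (M g)"
    and "\<And>g h. g \<in> G \<Longrightarrow> h \<in> G \<Longrightarrow>
           isomorphic_modules V (twist (M g) h) (M (conjg (voa_aut V) (inv\<^bsub>voa_aut V\<^esub> h) g))"
    and "nilpotent_group ((voa_aut V)\<lparr>carrier := G\<rparr>)"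
  shows "(\<forall>\<phi>. intertwiners V G M \<phi> \<longrightarrow>
           (\<exists>d R W. (\<forall>g\<in>G. simple_decomposition V G M \<phi> g (d g) (R g) (W g)) \<and>
             (\<forall>g\<in>G. \<forall>h\<in>G. \<forall>\<chi>\<in>irr V G M \<phi> g. \<forall>\<psi>\<in>irr V G M \<phi> h.
                isomorphic_modules (fixed_voa V G) (W g \<chi>) (W h \<psi>) \<longleftrightarrow>
                (\<exists>k\<in>G. char_transport V G M \<phi> k g \<chi> h \<psi>)))) \<and>
         (\<exists>\<phi>. intertwiners V G M \<phi> \<and>
           (\<exists>d R W. (\<forall>g\<in>G. simple_decomposition V G M \<phi> g (d g) (R g) (W g)) \<and>
             (\<forall>g\<in>G. \<forall>h\<in>G. \<forall>\<chi>\<in>irr V G M \<phi> g. \<forall>\<psi>\<in>irr V G M \<phi> h.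
                isomorphic_modules (fixed_voa V G) (W g \<chi>) (W h \<psi>) \<longleftrightarrow>
                (\<exists>k\<in>G. char_transport_basis V G k g \<chi> h \<psi>))))"
proof -
  interpret module_family V G M
    using assms(1-4)
    by (auto intro!: module_family.intro voa_on.intro module_family_axioms.intro simp: simple_voa_def)
  have main: "\<exists>d R W. (\<forall>g\<in>G. simple_decomposition V G M \<phi> g (d g) (R g) (W g)) \<and>
      (\<forall>g\<in>G. \<forall>h\<in>G. \<forall>\<chi>\<in>irr V G M \<phi> g. \<forall>\<psi>\<in>irr V G M \<phi> h.
        isomorphic_modules (fixed_voa V G) (W g \<chi>) (W h \<psi>) \<longleftrightarrow> (\<exists>k\<in>G. char_transport V G M \<phi> k g \<chi> h \<psi>))"
    if \<phi>: "intertwiners V G M \<phi>" for \<phi>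
  proof -
    interpret E: equivariant_family V G M \<phi>
      by (intro equivariant_family.intro module_family_axioms equivariant_family_axioms.intro \<phi>)
    show ?thesis
      by (rule exI[of _ E.dimg], rule exI[of _ E.repg], rule exI[of _ E.Wmod])
        (simp add: E.decomposition E.isomorphic_iff_transport)
  qed
  \<comment> \<open>Any family serves as the starting point for the rescaling.\<close>
  obtain \<phi>\<^sub>0 where "intertwiners V G M \<phi>\<^sub>0" using intertwiners_exist assms(5) by blast
  then interpret E: equivariant_family V G M \<phi>\<^sub>0
    by (intro equivariant_family.intro module_family_axioms equivariant_family_axioms.intro)
  obtain \<phi> where \<phi>: "intertwiners V G M \<phi>"
    and transport: "\<forall>g\<in>G. \<forall>k\<in>G. \<forall>h. \<forall>\<chi>\<in>irr V G M \<phi> g. \<forall>\<psi>\<in>irr V G M \<phi> h.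
      char_transport V G M \<phi> k g \<chi> h \<psi> \<longleftrightarrow> char_transport_basis V G k g \<chi> h \<psi>"
    using E.normalized_intertwiners by (elim exE conjE)
  \<comment> \<open>The modules are those of the first half for the rescaled family; only the
    formulation of the criterion changes.\<close>
  have "\<exists>d R W. (\<forall>g\<in>G. simple_decomposition V G M \<phi> g (d g) (R g) (W g)) \<and>
      (\<forall>g\<in>G. \<forall>h\<in>G. \<forall>\<chi>\<in>irr V G M \<phi> g. \<forall>\<psi>\<in>irr V G M \<phi> h.
        isomorphic_modules (fixed_voa V G) (W g \<chi>) (W h \<psi>) \<longleftrightarrow> (\<exists>k\<in>G. char_transport_basis V G k g \<chi> h \<psi>))"
    using main[OF \<phi>] by (simp add: transport cong: bex_cong ball_cong)
  then show ?thesis using main \<phi> by (intro conjI allI impI) (assumption | rule exI conjI | blast)+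
qed

end
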